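(* Let $\underline v>0$, $q_0\in L^\infty(\mathbb R)$, $\gamma\in BV(\mathbb R;\mathbb R_{\ge0})$, $V\in W^{1,\infty}_{\mathrm{loc}}(\mathbb R)$ and $v\in L^\infty(\mathbb R;\mathbb R_{\ge\underline v})$. There exists a time horizon $T>0$ such that the nonlocal, discontinuous conservation law $$\partial_t q(t,x)+\partial_x\Big(v(x)\,V\big((\gamma*q(t,\cdot))(x)\big)\,q(t,x)\Big)=0,\quad (t,x)\in(0,T)\times\mathbb R,\qquad q(0,x)=q_0(x),\quad x\in\mathbb R,$$ admits a unique weak solution $$q\in C\big([0,T];L^1_{\mathrm{loc}}(\mathbb R)\big)\cap L^\infty\big((0,T);L^\infty(\mathbb R)\big).$$ The solution can be stated as $$q(t,x)=q_0(\xi_w(t,x;0))\,\partial_2\xi_w(t,x;0),\qquad (t,x)\in(0,T)\times\mathbb R,$$ where $\xi_w:(0,T)\times\mathbb R\times[0,T]\to\mathbb R$ is the unique solution (in the integral sense given in the context) of the initial value problem, for $(t,x)\in(0,T)\times\mathbb R$, $$\partial_3\xi_w(t,x;\tau)=v\big(\xi_w(t,x;\tau)\big)\,V\big(w(\tau,\xi_w(t,x;\tau))\big),\quad \tau\in(0,T),\qquad \xi_w(t,x;t)=x,$$ and $w$ is the solution of the fixed-point equation in $L^\infty((0,T);L^\infty(\mathbb R))$ $$w(t,x)=\int_{\mathbb R}\gamma\big(x-\xi_w(0,y;t)\big)q_0(y)\,dy,\qquad (t,x)\in(0,T)\times\mathbb R.$$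
   Context: $L^\infty(\mathbb R;\mathbb R_{\ge\underline v})$ is the set of essentially bounded measurable functions on $\mathbb R$ with values in $[\underline v,\infty)$. $BV(\mathbb R;\mathbb R_{\ge0})$ carries the norm $\|\cdot\|_{L^1(\mathbb R)}+|\cdot|_{TV(\mathbb R)}$ (in particular $\gamma\in L^1(\mathbb R)$). Convolution: $(\gamma*q(t,\cdot))(x)=\int_{\mathbb R}\gamma(x-y)q(t,y)\,dy$. Weak solution: $q\in C([0,T];L^1_{\mathrm{loc}}(\mathbb R))\cap L^\infty((0,T);L^\infty(\mathbb R))$ is a weak solution if for all $\phi\in C^1_c((-42,T)\times\mathbb R)$ $$\iint_{(0,T)\times\mathbb R}q(t,x)\Big(\phi_t(t,x)+v(x)V\big((\gamma*q(t,\cdot))(x)\big)\phi_x(t,x)\Big)\,dx\,dt+\int_{\mathbb R}\phi(0,x)q_0(x)\,dx=0.$$ Characteristics: for $w\in L^\infty((0,T);W^{1,\infty}(\mathbb R))$, and initial time $t\in[0,T]$ (including $t=0$) and $x\in\mathbb R$, the solution $\tau\mapsto\xi_w(t,x;\tau)$ of the initial value problem $$\partial_3\xi_w(t,x;\tau)=v\big(\xi_w(t,x;\tau)\big)\,V\big(w(\tau,\xi_w(t,x;\tau))\big),\quad \tau\in(0,T),\qquad \xi_w(t,x;t)=x,$$ is understood as the continuous function on $[0,T]$ satisfying $$\int_x^{\xi_w(t,x;\tau)}\frac1{v(y)}\,dy=\int_t^\tau V\big(w(s,\xi_w(t,x;s))\big)\,ds\qquad\forall\tau\in[0,T].$$ $\partial_2\xi_w$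 denotes the derivative with respect to $x$, $\partial_3\xi_w$ the derivative with respect to $\tau$. *)

theory Defs
  imports "HOL-Analysis.Analysis"
begin

text \<open>Elements of Lebesgue and Sobolev spaces are represented by functions; all conditions on them
  are invariant under modification on Lebesgue null sets, except that members of Sobolev spaces
  \<open>W\<^sup>1\<^sup>,\<^sup>\<infinity>\<close> are always their continuous representatives, as they are evaluated pointwise. Integrals
  are taken over \<^const>\<open>lebesgue\<close>, since representatives need not be Borel measurable.\<close>

definition Linfty :: "'a::euclidean_space set \<Rightarrow> ('a \<Rightarrow> real) set" where
  "Linfty S = {f. f \<in> borel_measurable (lebesgue_on S) \<and>
                  (\<exists>C. AE x in lebesgue_on S. \<bar>f x\<bar> \<le> C)}"

definition Linfty_loc :: "(real \<Rightarrow> real) set" where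
  "Linfty_loc = {f. \<forall>K. compact K \<longrightarrow> f \<in> Linfty K}"

definition L1_loc :: "(real \<Rightarrow> real) set" where
  "L1_loc = {f. \<forall>K. compact K \<longrightarrow> set_integrable lebesgue K f}"

text \<open>A test function on \<open>S\<close> is represented by its extension by zero to the whole space.\<close>

definition C1_compact_support :: "'a::euclidean_space set \<Rightarrow> ('a \<Rightarrow> real) set" where
  "C1_compact_support S = {\<phi>.
     (\<exists>\<phi>'. (\<forall>z. (\<phi> has_derivative blinfun_apply (\<phi>' z)) (at z)) \<and> continuous_on UNIV \<phi>') \<and>
     compact (closure {z. \<phi> z \<noteq> 0}) \<and> closure {z. \<phi> z \<noteq> 0} \<subseteq> S}"

text \<open>The distributional (essential) total variation, which depends only on the class of \<open>f\<close>.\<close>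

definition total_variation :: "(real \<Rightarrow> real) \<Rightarrow> ereal" where
  "total_variation f =
     (SUP \<phi>\<in>{\<phi> \<in> C1_compact_support UNIV. \<forall>x. \<bar>\<phi> x\<bar> \<le> 1}.
        ereal (LINT x|lebesgue. f x * deriv \<phi> x))"

definition BV_nonneg :: "(real \<Rightarrow> real) set" where
  "BV_nonneg = {f. integrable lebesgue f \<and> total_variation f < \<infinity> \<and> (AE x in lebesgue. 0 \<le> f x)}"

definition is_weak_derivative :: "(real \<Rightarrow> real) \<Rightarrow> (real \<Rightarrow> real) \<Rightarrow> bool" where
  "is_weak_derivative f g \<longleftrightarrow> f \<in> L1_loc \<and> g \<in> L1_loc \<and>
     (\<forall>\<phi>\<in>C1_compact_support UNIV.
        (LINT x|lebesgue. f x * deriv \<phi> x) = - (LINT x|lebesgue. g x * \<phi> x))"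

definition W1infty_loc :: "(real \<Rightarrow> real) set" where
  "W1infty_loc = {f. continuous_on UNIV f \<and> f \<in> Linfty_loc \<and>
                     (\<exists>g\<in>Linfty_loc. is_weak_derivative f g)}"

text \<open>\<open>Linfty_Linfty T\<close> is \<open>L\<^sup>\<infinity>((0,T); L\<^sup>\<infinity>(\<real>))\<close>, read as \<open>L\<^sup>\<infinity>((0,T) \<times> \<real>)\<close>; strong (Bochner) measurability
  with values in the nonseparable space \<open>L\<^sup>\<infinity>(\<real>)\<close> is not meant. Likewise \<open>Linfty_W1infty T\<close> is
  \<open>L\<^sup>\<infinity>((0,T); W\<^sup>1\<^sup>,\<^sup>\<infinity>(\<real>))\<close>, where \<open>C\<close> bounds \<open>w(t,\<cdot>)\<close> and its weak derivative uniformly in \<open>t\<close>.\<close>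

definition Linfty_Linfty :: "real \<Rightarrow> (real \<Rightarrow> real \<Rightarrow> real) set" where
  "Linfty_Linfty T = {q. case_prod q \<in> Linfty ({0<..<T} \<times> UNIV)}"

definition Linfty_W1infty :: "real \<Rightarrow> (real \<Rightarrow> real \<Rightarrow> real) set" where
  "Linfty_W1infty T = {w \<in> Linfty_Linfty T.
     \<exists>C. AE t in lebesgue_on {0<..<T}.
       continuous_on UNIV (w t) \<and> (\<forall>x. \<bar>w t x\<bar> \<le> C) \<and>
       (\<exists>g. is_weak_derivative (w t) g \<and> (AE x in lebesgue. \<bar>g x\<bar> \<le> C))}"

definition C_L1_loc :: "real \<Rightarrow> (real \<Rightarrow> real \<Rightarrow> real) set" where
  "C_L1_loc T = {q. (\<forall>t\<in>{0..T}. q t \<in> L1_loc) \<and>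
     (\<forall>K. compact K \<longrightarrow> (\<forall>t\<in>{0..T}.
        ((\<lambda>s. LINT x:K|lebesgue. \<bar>q s x - q t x\<bar>) \<longlongrightarrow> 0) (at t within {0..T})))}"

definition convolution :: "(real \<Rightarrow> real) \<Rightarrow> (real \<Rightarrow> real) \<Rightarrow> real \<Rightarrow> real" where
  "convolution f g x = (LINT y|lebesgue. f (x - y) * g y)"

text \<open>The lower time bound \<open>-42\<close> is an arbitrary negative number: test functions need not vanish at
  time \<open>0\<close>.\<close>

definition is_weak_solution ::
  "(real \<Rightarrow> real) \<Rightarrow> (real \<Rightarrow> real) \<Rightarrow> (real \<Rightarrow> real) \<Rightarrow> (real \<Rightarrow> real) \<Rightarrow> real \<Rightarrow>
   (real \<Rightarrow> real \<Rightarrow> real) \<Rightarrow> bool" where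
  "is_weak_solution q\<^sub>0 \<gamma> V v T q \<longleftrightarrow>
     q \<in> C_L1_loc T \<and> q \<in> Linfty_Linfty T \<and>
     (\<forall>\<phi>\<in>C1_compact_support ({-42<..<T} \<times> UNIV).
        (LINT z:{0<..<T} \<times> UNIV|lebesgue.
           (case z of (t, x) \<Rightarrow>
              q t x * (deriv (\<lambda>s. \<phi> (s, x)) t
                       + v x * V (convolution \<gamma> (q t) x) * deriv (\<lambda>y. \<phi> (t, y)) x)))
        + (LINT x|lebesgue. \<phi> (0, x) * q\<^sub>0 x) = 0)"

text \<open>\<open>\<eta>\<close> is \<open>\<tau> \<mapsto> \<xi>\<^sub>w(t,x;\<tau>)\<close>, the characteristic through \<open>x\<close> at time \<open>t\<close>. The integrals are oriented;
  the initial condition \<open>\<eta> t = x\<close> is the case \<open>\<tau> = t\<close> of the equation.\<close>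

definition is_characteristic ::
  "(real \<Rightarrow> real) \<Rightarrow> (real \<Rightarrow> real) \<Rightarrow> real \<Rightarrow> (real \<Rightarrow> real \<Rightarrow> real) \<Rightarrow> real \<Rightarrow> real \<Rightarrow>
   (real \<Rightarrow> real) \<Rightarrow> bool" where
  "is_characteristic V v T w t x \<eta> \<longleftrightarrow>
     continuous_on {0..T} \<eta> \<and>
     (\<forall>\<tau>\<in>{0..T}. (LINT y=x..\<eta> \<tau>|lebesgue. (1 / v y)) = (LINT s=t..\<tau>|lebesgue. V (w s (\<eta> s))))"

definition is_characteristics ::
  "(real \<Rightarrow> real) \<Rightarrow> (real \<Rightarrow> real) \<Rightarrow> real \<Rightarrow> (real \<Rightarrow> real \<Rightarrow> real) \<Rightarrow>
   (real \<Rightarrow> real \<Rightarrow> real \<Rightarrow> real) \<Rightarrow> bool" where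
  "is_characteristics V v T w \<xi> \<longleftrightarrow>
     (\<forall>t\<in>{0..T}. \<forall>x. is_characteristic V v T w t x (\<xi> t x))"

text \<open>The equation is one in \<open>L\<^sup>\<infinity>((0,T); L\<^sup>\<infinity>(\<real>))\<close>, but \<open>w\<close> has to lie in \<open>L\<^sup>\<infinity>((0,T); W\<^sup>1\<^sup>,\<^sup>\<infinity>(\<real>))\<close> for its
  characteristics \<open>\<xi>\<close> to be defined.\<close>

definition is_fixed_point ::
  "(real \<Rightarrow> real) \<Rightarrow> (real \<Rightarrow> real) \<Rightarrow> (real \<Rightarrow> real) \<Rightarrow> (real \<Rightarrow> real) \<Rightarrow> real \<Rightarrow>
   (real \<Rightarrow> real \<Rightarrow> real) \<Rightarrow> (real \<Rightarrow> real \<Rightarrow> real \<Rightarrow> real) \<Rightarrow> bool" where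
  "is_fixed_point q\<^sub>0 \<gamma> V v T w \<xi> \<longleftrightarrow>
     w \<in> Linfty_W1infty T \<and> is_characteristics V v T w \<xi> \<and>
     (AE (t, x) in lebesgue_on ({0<..<T} \<times> UNIV).
        w t x = (LINT y|lebesgue. \<gamma> (x - \<xi> 0 y t) * q\<^sub>0 y))"

end

theory Submission
  imports Defs
begin

text \<open>In the coordinate \<open>F(x) = \<integral>\<^sub>0\<^sup>x dy / v(y)\<close>, a bi-Lipschitz change of variables, characteristics obey
  \<open>(F \<circ> \<xi>)' = V(w(\<tau>, \<xi>))\<close>, with a velocity that is Lipschitz in \<open>\<xi>\<close>: a kernel of bounded variation satisfies
  \<open>\<parallel>\<gamma>(\<cdot> + h) - \<gamma>\<parallel>\<^sub>1 \<le> K h\<close>, so that \<open>w(t,x) = \<integral> \<gamma>(x - a(t,y)) q\<^sub>0(y) dy\<close> depends in a Lipschitz manner on \<open>x\<close> and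
  on the flow \<open>a\<close>, measured in the supremum norm, as long as \<open>a(t,\<cdot>)\<close> is bi-Lipschitz. Banach's theorem on a short
  time interval yields a flow driven by its own \<open>w\<close>, and pushing \<open>q\<^sub>0\<close> forward along it gives a solution.

  Conversely, let \<open>q\<close> be any weak solution and \<open>b\<close> the flow of its velocity field. Testing with smoothed
  indicators of the region between two characteristics shows that the mass of \<open>q\<close> between them is
  conserved, hence \<open>q(t,\<cdot>)\<close> is the push-forward of \<open>q\<^sub>0\<close> along \<open>b\<close>, and so \<open>b\<close> is driven by its own \<open>w\<close>. Gronwall's
  inequality shows that there is only one such flow.\<close>

section \<open>Oriented integrals and their almost everywhere derivatives\<close>

text \<open>Two obstacles shape the argument. \<open>v\<close> is merely bounded and measurable, so
  every differential identity along characteristics holds only almost everywhere and null sets have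
  to be moved through the flow; hence all flow maps are kept in a class \<open>bilip c L\<close>,
  and their image densities are built explicitly. The second obstacle is circular: the bound on
  \<open>w\<close>, the range on which \<open>V\<close> is Lipschitz and the modulus of
  \<open>w\<close> all depend on the lower constant \<open>c\<close> of the flow. Existence
  therefore fixes \<open>c\<close> beforehand, as a constraint on the displacement in the coordinate
  \<open>F\<close>, and shortens the time until the constraint reproduces itself. Uniqueness does
  not rest on a short time: a competing flow is bi-Lipschitz by its own comparison estimate, and an
  exponential weight absorbs the length of the interval. In the conservation of mass two limits are
  taken in a fixed order: \<open>F\<close> is averaged to obtain admissible test functions, and this
  average is removed while the transition layer still has positive width, so that \<open>v\<close>
  cancels against the derivative \<open>1 / v\<close> of \<open>F\<close>; only afterwards does the
  layer shrink.\<close>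

definition loc_int :: "(real \<Rightarrow> real) \<Rightarrow> bool" where
  "loc_int f \<longleftrightarrow> (\<forall>a b. set_integrable lborel {a..b} f)"

text \<open>Orientation gives increments \<open>H b - H a\<close> one formula for both orders of the
  endpoints, so that backward and forward characteristics are treated together.\<close>

definition oint :: "(real \<Rightarrow> real) \<Rightarrow> real \<Rightarrow> real \<Rightarrow> real" where
  "oint f a b = (LBINT s=ereal a..ereal b. f s)"

lemma loc_intD: "loc_int f \<Longrightarrow> set_integrable lborel {a..b} f" by (simp add: loc_int_def)

lemma loc_int_bounded:
  assumes "f \<in> borel_measurable borel" "\<And>x. \<bar>f x\<bar> \<le> C"
  shows "loc_int f"
  unfolding loc_int_def set_integrable_def
proof (intro allI)
  fix a b :: real
  show "integrable lborel (\<lambda>x. indicator {a..b} x *\<^sub>R f x)"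
    by (rule integrableI_bounded_set[where A="{a..b}" and B=C])
      (use assms in \<open>auto simp: indicator_def emeasure_lborel_Icc_eq\<close>)
qed

lemma loc_int_continuous: "continuous_on UNIV f \<Longrightarrow> loc_int f"
  unfolding loc_int_def by (metis borel_integrable_atLeastAtMost' continuous_on_subset subset_UNIV)

lemma loc_int_integrable: "integrable lborel f \<Longrightarrow> loc_int f"
  unfolding loc_int_def set_integrable_def using integrable_mult_indicator[of _ lborel f] by auto

lemma loc_int_add: "loc_int f \<Longrightarrow> loc_int g \<Longrightarrow> loc_int (\<lambda>x. f x + g x)"
  unfolding loc_int_def by (auto intro: set_integral_add)
lemma loc_int_diff: "loc_int f \<Longrightarrow> loc_int g \<Longrightarrow> loc_int (\<lambda>x. f x - g x)"
  unfolding loc_int_def by (auto intro: set_integral_diff)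
lemma loc_int_cmult: "loc_int f \<Longrightarrow> loc_int (\<lambda>x. c * f x)"
  unfolding loc_int_def by auto
lemma loc_int_abs: "loc_int f \<Longrightarrow> loc_int (\<lambda>x. \<bar>f x\<bar>)"
  unfolding loc_int_def by (auto intro: set_integrable_abs)

lemma loc_int_ili: "loc_int f \<Longrightarrow> interval_lebesgue_integrable lborel (ereal a) (ereal b) f"
proof -
  assume "loc_int f"
  have "set_integrable lborel {min a b..max a b} f" using \<open>loc_int f\<close> by (rule loc_intD)
  then have "set_integrable lborel {min a b<..<max a b} f" by (rule set_integrable_subset) auto
  then show ?thesis unfolding interval_lebesgue_integrable_def by (auto simp: min_def max_def split: if_splits)
qed

lemma oint_add: "loc_int f \<Longrightarrow> oint f a b + oint f b c = oint f a c"
  unfolding oint_def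
  by (rule interval_integral_sum) (simp flip: ereal_min ereal_max add: loc_int_ili)

lemma oint_refl[simp]: "oint f a a = 0" by (simp add: oint_def)
lemma oint_swap: "oint f a b = - oint f b a"
  unfolding oint_def by (rule interval_integral_endpoints_reverse)

lemma oint_le: "a \<le> b \<Longrightarrow> oint f a b = (LBINT x:{a..b}. f x)"
  unfolding oint_def by (rule interval_integral_Icc)

lemma oint_minus: "loc_int f \<Longrightarrow> oint f a b - oint f a c = oint f c b"
  using oint_add[of f a c b] by simp

lemma oint_diff: "loc_int f \<Longrightarrow> loc_int g \<Longrightarrow> oint (\<lambda>x. f x - g x) a b = oint f a b - oint g a b"
  unfolding oint_def by (rule interval_lebesgue_integral_diff) (auto intro: loc_int_ili)
lemma oint_sum: "loc_int f \<Longrightarrow> loc_int g \<Longrightarrow> oint (\<lambda>x. f x + g x) a b = oint f a b + oint g a b"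
  unfolding oint_def by (rule interval_lebesgue_integral_add) (auto intro: loc_int_ili)
lemma oint_cmult: "oint (\<lambda>x. c * f x) a b = c * oint f a b"
  unfolding oint_def by simp

lemma oint_mono:
  assumes "loc_int f" "loc_int g" "a \<le> b" "AE x in lborel. a < x \<and> x < b \<longrightarrow> f x \<le> g x"
  shows "oint f a b \<le> oint g a b"
proof -
  have i: "set_integrable lborel {a<..<b} f" "set_integrable lborel {a<..<b} g"
    using assms(1,2)[THEN loc_intD, of a b] by (auto intro: set_integrable_subset)
  have "(LBINT x:{a<..<b}. f x) \<le> (LBINT x:{a<..<b}. g x)"
    unfolding set_lebesgue_integral_def
    by (rule integral_mono_AE) (use i assms(4) in \<open>auto simp: set_integrable_def indicator_def\<close>)
  then show ?thesis using \<open>a \<le> b\<close> by (simp add: oint_def interval_lebesgue_integral_def einterval_eq)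
qed

lemma oint_const[simp]: "oint (\<lambda>x. c) a b = c * (b - a)"
proof -
  have *: "oint (\<lambda>x. c) a b = c * (b - a)" if "a \<le> b" for a b
    using that by (simp add: oint_le set_lebesgue_integral_def)
  show ?thesis
    using *[of a b] *[of b a] oint_swap[of "\<lambda>x. c" a b] by (cases "a \<le> b") (auto simp: algebra_simps)
qed

lemma oint_abs_mono:
  assumes "loc_int f" "loc_int g" "a \<le> b" "AE x in lborel. a < x \<and> x < b \<longrightarrow> \<bar>f x\<bar> \<le> g x"
  shows "\<bar>oint f a b\<bar> \<le> oint g a b"
proof -
  have "oint f a b \<le> oint g a b" by (rule oint_mono) (use assms in auto)
  moreover have "oint (\<lambda>x. (-1) * f x) a b \<le> oint g a b"
    by (rule oint_mono) (use assms loc_int_cmult[OF assms(1), of "-1"] in auto)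
  ultimately show ?thesis unfolding oint_cmult by simp
qed

lemma oint_bound:
  assumes "loc_int f" "AE x in lborel. min a b < x \<and> x < max a b \<longrightarrow> \<bar>f x\<bar> \<le> C"
  shows "\<bar>oint f a b\<bar> \<le> C * \<bar>b - a\<bar>"
proof (cases "a \<le> b")
  case True
  have "\<bar>oint f a b\<bar> \<le> oint (\<lambda>_. C) a b"
    by (rule oint_abs_mono) (use assms True in \<open>auto intro!: loc_int_continuous\<close>)
  then show ?thesis using True by simp
next
  case False
  have "\<bar>oint f b a\<bar> \<le> oint (\<lambda>_. C) b a"
    by (rule oint_abs_mono) (use assms False in \<open>auto intro!: loc_int_continuous\<close>)
  then show ?thesis using False by (simp add: oint_swap[of f a b])
qed

lemma oint_cong_AE:
  assumes "loc_int f" "loc_int g" "AE x in lborel. min a b < x \<and> x < max a b \<longrightarrow> f x = g x"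
  shows "oint f a b = oint g a b"
proof -
  have "\<bar>oint (\<lambda>x. f x - g x) a b\<bar> \<le> 0 * \<bar>b - a\<bar>"
    by (rule oint_bound) (use assms in \<open>auto intro: loc_int_diff\<close>)
  then show ?thesis using assms by (simp add: oint_diff)
qed

lemma oint_deriv:
  assumes "continuous_on UNIV f"
  shows "((\<lambda>x. oint f a x) has_real_derivative f x) (at x)"
proof -
  define c where "c = min a x - 1"
  define d where "d = max a x + 1"
  have cd: "c \<le> a" "a \<le> d" "c < x" "x < d" by (auto simp: c_def d_def)
  have "((\<lambda>u. LBINT y=ereal a..ereal u. f y) has_vector_derivative f x) (at x within {c..d})"
    by (rule interval_integral_FTC2) (use cd assms in \<open>auto intro: continuous_on_subset\<close>)
  then have "((\<lambda>u. LBINT y=ereal a..ereal u. f y) has_vector_derivative f x) (at x)"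
    using cd at_within_interior[of x "{c..d}"] by simp
  then show ?thesis by (simp add: oint_def has_real_derivative_iff_has_vector_derivative)
qed

section \<open>Null sets and Lebesgue differentiation of primitives\<close>

lemma AE_lebesgue_lborel: "(AE x in lebesgue. P x) \<longleftrightarrow> (AE x in lborel. P x)"
  by (rule AE_completion_iff)

lemma negligible_AE: "negligible {x. \<not> P x} \<longleftrightarrow> (AE x in lborel. P x)"
proof -
  have "(AE x in lebesgue. P x) \<longleftrightarrow> {x. \<not> P x} \<in> null_sets lebesgue"
    by (subst eventually_ae_filter)
      (auto intro: completion.complete2)
  then show ?thesis by (simp add: negligible_iff_null_sets AE_lebesgue_lborel)
qed

text \<open>Vitali covering argument. A point with \<open>h x > \<beta>\<close> at which the
  conclusion fails is an endpoint of arbitrarily short intervals over which the mean of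
  \<open>h\<close> is below \<open>\<alpha>\<close>. Disjoint intervals of this kind that cover
  almost all such points have their union \<open>W\<close> inside an open set barely larger than
  \<open>{h > \<beta>}\<close>, and comparing the two bounds on the mass of \<open>W\<close> forces
  \<open>W\<close> to be small. The bad set is not known to be measurable, hence the outer criterion
  for negligibility.\<close>

lemma lower_derivative_density:
  fixes h H :: "real \<Rightarrow> real"
  assumes [measurable]: "h \<in> borel_measurable borel" and h0: "\<And>x. 0 \<le> h x"
    and loc_int: "loc_int h" and H: "\<And>a b. H b - H a = oint h a b"
    and ab: "0 \<le> \<alpha>" "\<alpha> < \<beta>"
  shows "AE x in lborel. h x > \<beta> \<longrightarrow> (\<exists>\<delta>>0. \<forall>y. 0 < \<bar>y - x\<bar> \<and> \<bar>y - x\<bar> < \<delta> \<longrightarrow> (H y - H x) / (y - x) \<ge> \<alpha>)"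
proof -
  define Q where "Q x = (\<exists>\<delta>>0. \<forall>y. 0 < \<bar>y - x\<bar> \<and> \<bar>y - x\<bar> < \<delta> \<longrightarrow> (H y - H x) / (y - x) \<ge> \<alpha>)" for x
  define N :: "real measure" where "N = density lborel (\<lambda>x. ennreal (h x))"
  have Nint: "emeasure N {a..b} = ennreal (H b - H a)" if "a \<le> b" for a b
  proof -
    have i: "integrable lborel (\<lambda>x. indicator {a..b} x * h x)"
      using loc_intD[OF loc_int, of a b] by (simp add: set_integrable_def)
    have "emeasure N {a..b} = (\<integral>\<^sup>+x. ennreal (indicator {a..b} x * h x) \<partial>lborel)"
      unfolding N_def by (subst emeasure_density) (auto intro!: nn_integral_cong simp: indicator_def)
    also have "\<dots> = ennreal (LINT x|lborel. indicator {a..b} x * h x)"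
      by (rule nn_integral_eq_integral[OF i]) (use h0 in auto)
    finally show ?thesis using that by (simp add: H oint_le set_lebesgue_integral_def)
  qed
  have neg: "negligible {x. \<bar>x\<bar> < real R \<and> h x > \<beta> \<and> \<not> Q x}" for R :: nat
    unfolding negligible_outer_le
  proof (intro allI impI)
    fix e :: real assume "e > 0"
    define E' where "E' = {x. \<bar>x\<bar> < real R \<and> h x > \<beta>}"
    define E where "E = {x. \<bar>x\<bar> < real R \<and> h x > \<beta> \<and> \<not> Q x}"
    have E'[measurable]: "E' \<in> sets borel" unfolding E'_def by measurable
    \<comment> \<open>The final inequality bounds the measure of \<open>W\<close> by
      \<open>\<beta> / (\<beta> - \<alpha>)\<close> times that of \<open>W - E'\<close>; with this
      excess the result is at most \<open>e\<close>.\<close>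
    define e' where "e' = e * (\<beta> - \<alpha>) / \<beta>"
    have e': "e' > 0" using \<open>e > 0\<close> ab by (simp add: e'_def)
    obtain U where U: "open U" "E' \<subseteq> U" "(U - E') \<in> lmeasurable" "emeasure lebesgue (U - E') < ennreal e'"
      by (rule sets_lebesgue_outer_open[of E' e']) (use E' e' in auto)
    \<comment> \<open>Intervals are indexed by the bad point \<open>x\<close> and a witness
      \<open>y\<close>; \<open>a\<close> and \<open>r\<close> present the interval between them as a
      ball, the form in which the covering theorem speaks.\<close>
    define K where "K = {(x, y). x \<in> E \<and> x \<noteq> y \<and> {min x y..max x y} \<subseteq> U \<and> (H y - H x) / (y - x) < \<alpha>}"
    define a where "a = (\<lambda>(x::real, y). (x + y) / 2)"
    define r where "r = (\<lambda>(x::real, y). \<bar>y - x\<bar> / 2)"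
    have cb: "cball (a i) (r i) = {min (fst i) (snd i)..max (fst i) (snd i)}" for i
      by (cases i) (auto simp: a_def r_def cball_def dist_real_def abs_if min_def max_def field_simps split: if_splits)
    obtain C where C: "countable C" "C \<subseteq> K"
      "pairwise (\<lambda>i j. disjnt (cball (a i) (r i)) (cball (a j) (r j))) C"
      "negligible (E - (\<Union>i\<in>C. cball (a i) (r i)))"
    proof (rule Vitali_covering_theorem_cballs[of K r E a])
      show "0 < r i" if "i \<in> K" for i using that by (auto simp: K_def r_def)
      show "\<exists>i. i \<in> K \<and> x \<in> cball (a i) (r i) \<and> r i < d" if "x \<in> E" "0 < d" for x d
      proof -
        have "x \<in> U" using that U(2) by (auto simp: E_def E'_def)
        then obtain d1 where d1: "d1 > 0" "ball x d1 \<subseteq> U" using U(1) open_contains_ball by blast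
        have "min d d1 > 0" using d1 that by simp
        moreover have "\<not> Q x" using that by (simp add: E_def)
        ultimately obtain y where y: "0 < \<bar>y - x\<bar>" "\<bar>y - x\<bar> < min d d1" "(H y - H x) / (y - x) < \<alpha>"
          unfolding Q_def by (meson not_le)
        have "{min x y..max x y} \<subseteq> ball x d1" using y(1,2) by (auto simp: dist_real_def)
        then have "(x, y) \<in> K" using y d1 that by (auto simp: K_def)
        moreover have "x \<in> cball (a (x, y)) (r (x, y))" unfolding cb by auto
        moreover have "r (x, y) < d" using y by (auto simp: r_def)
        ultimately show ?thesis by blast
      qed
    qed blast
    define B where "B i = cball (a i) (r i)" for i
    define W where "W = (\<Union>i\<in>C. B i)"
    have B[measurable]: "B i \<in> sets borel" for i by (simp add: B_def)
    have W[measurable]: "W \<in> sets borel" unfolding W_def using C(1) by (intro sets.countable_UN') auto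
    have WU: "W \<subseteq> U" using C(2) unfolding W_def B_def cb by (fastforce simp: K_def)
    have disj: "disjoint_family_on B C"
      using C(3) by (auto simp: disjoint_family_on_def pairwise_def disjnt_def B_def)
    have le: "emeasure N (B i) \<le> ennreal \<alpha> * emeasure lborel (B i)" if "i \<in> C" for i
    proof -
      obtain x y where i: "i = (x, y)" by (cases i)
      have K: "x \<noteq> y" "(H y - H x) / (y - x) < \<alpha>" using C(2) that by (auto simp: K_def i)
      have "H (max x y) - H (min x y) \<le> \<alpha> * (max x y - min x y)"
        using K by (auto simp: max_def min_def field_simps split: if_splits)
      then have "ennreal (H (max x y) - H (min x y)) \<le> ennreal (\<alpha> * (max x y - min x y))" by (rule ennreal_leI)
      also have "\<dots> = ennreal \<alpha> * ennreal (max x y - min x y)" using ab by (simp add: ennreal_mult)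
      finally show ?thesis unfolding B_def cb i by (simp add: Nint)
    qed
    have "emeasure N W = (\<integral>\<^sup>+i. emeasure N (B i) \<partial>count_space C)"
      unfolding W_def by (rule emeasure_UN_countable) (use C(1) disj in \<open>auto simp: N_def\<close>)
    also have "\<dots> \<le> (\<integral>\<^sup>+i. ennreal \<alpha> * emeasure lborel (B i) \<partial>count_space C)"
      by (rule nn_integral_mono) (use le in auto)
    also have "\<dots> = ennreal \<alpha> * (\<integral>\<^sup>+i. emeasure lborel (B i) \<partial>count_space C)"
      by (rule nn_integral_cmult) auto
    also have "(\<integral>\<^sup>+i. emeasure lborel (B i) \<partial>count_space C) = emeasure lborel W"
      unfolding W_def by (rule emeasure_UN_countable[symmetric]) (use C(1) disj in auto)
    finally have 1: "emeasure N W \<le> ennreal \<alpha> * emeasure lborel W" .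
    have fE: "emeasure lborel (W \<inter> E') < \<infinity>"
    proof -
      have "emeasure lborel (W \<inter> E') \<le> emeasure lborel {-real R..real R}"
        by (rule emeasure_mono) (auto simp: E'_def)
      then show ?thesis by (simp add: le_less_trans ennreal_less_top less_top[symmetric])
        (metis ennreal_less_top leD linorder_not_less)
    qed
    have fD: "emeasure lborel (W - E') \<le> ennreal e'"
    proof -
      have "emeasure lborel (W - E') = emeasure lebesgue (W - E')" by simp
      also have "\<dots> \<le> emeasure lebesgue (U - E')"
        by (rule emeasure_mono) (use WU U(1) in auto)
      finally show ?thesis using U(4) by simp
    qed
    define m1 where "m1 = measure lborel (W \<inter> E')"
    define m2 where "m2 = measure lborel (W - E')"
    have m1: "emeasure lborel (W \<inter> E') = ennreal m1" unfolding m1_def using fE by (simp add: emeasure_eq_ennreal_measure less_top)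
    have fD': "emeasure lborel (W - E') < \<infinity>" using fD by (simp add: le_less_trans ennreal_less_top)
    have m2: "emeasure lborel (W - E') = ennreal m2" unfolding m2_def using fD' by (simp add: emeasure_eq_ennreal_measure less_top)
    have m0: "m1 \<ge> 0" "m2 \<ge> 0" by (simp_all add: m1_def m2_def)
    have m2e: "m2 \<le> e'" using fD e' m0 unfolding m2 by (simp add: ennreal_le_iff)
    have W12: "emeasure lborel W = ennreal (m1 + m2)"
    proof -
      have "emeasure lborel W = emeasure lborel ((W \<inter> E') \<union> (W - E'))" by (rule arg_cong[where f="emeasure lborel"]) auto
      also have "\<dots> = emeasure lborel (W \<inter> E') + emeasure lborel (W - E')"
        by (rule plus_emeasure[symmetric]) auto
      finally show ?thesis using m0 by (simp add: m1 m2)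
    qed
    \<comment> \<open>The density exceeds \<open>\<beta>\<close> on \<open>W \<inter> E'\<close>,
      while its mean over each interval of \<open>W\<close> is at most
      \<open>\<alpha>\<close>.\<close>
    have "ennreal (\<beta> * m1) = ennreal \<beta> * emeasure lborel (W \<inter> E')" using ab m0 by (simp add: m1 ennreal_mult)
    also have "\<dots> = (\<integral>\<^sup>+x. ennreal \<beta> * indicator (W \<inter> E') x \<partial>lborel)" by (subst nn_integral_cmult_indicator) auto
    also have "\<dots> \<le> (\<integral>\<^sup>+x. ennreal (h x) * indicator (W \<inter> E') x \<partial>lborel)"
      by (rule nn_integral_mono) (auto simp: indicator_def E'_def intro!: ennreal_leI)
    also have "\<dots> = emeasure N (W \<inter> E')" unfolding N_def by (subst emeasure_density) auto
    also have "\<dots> \<le> emeasure N W" by (rule emeasure_mono) (auto simp: N_def)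
    also have "\<dots> \<le> ennreal (\<alpha> * (m1 + m2))" using 1 ab m0 by (simp add: W12 ennreal_mult)
    finally have "\<beta> * m1 \<le> \<alpha> * (m1 + m2)" using ab m0 by (simp add: ennreal_le_iff)
    then have "m1 + m2 \<le> \<beta> / (\<beta> - \<alpha>) * m2" using ab by (simp add: field_simps)
    also have "\<dots> \<le> \<beta> / (\<beta> - \<alpha>) * e'" by (rule mult_left_mono) (use m2e ab in auto)
    also have "\<dots> = e" using ab by (simp add: e'_def)
    finally have me: "m1 + m2 \<le> e" .
    have nW: "negligible (E - W)" using C(4) by (simp add: W_def B_def)
    show "\<exists>T. {x. \<bar>x\<bar> < real R \<and> \<beta> < h x \<and> \<not> Q x} \<subseteq> T \<and> T \<in> lmeasurable \<and> measure lebesgue T \<le> e"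
    proof (intro exI conjI)
      show "{x. \<bar>x\<bar> < real R \<and> \<beta> < h x \<and> \<not> Q x} \<subseteq> (E - W) \<union> W" by (auto simp: E_def)
      have Wl: "W \<in> lmeasurable" by (rule fmeasurableI) (use W12 in auto)
      show "(E - W) \<union> W \<in> lmeasurable" using fmeasurable.Un[OF negligible_imp_measurable[OF nW] Wl] .
      have "measure lebesgue ((E - W) \<union> W) \<le> measure lebesgue (E - W) + measure lebesgue W"
        by (rule measure_Un_le) (use nW Wl negligible_imp_measurable in \<open>auto intro!: negligible_imp_sets\<close>)
      also have "\<dots> = measure lborel W" using nW by (simp add: negligible_imp_measure0)
      also have "\<dots> = m1 + m2" using W12 m0 by (simp add: measure_def del: ennreal_plus)
      finally show "measure lebesgue ((E - W) \<union> W) \<le> e" using me by simp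
    qed
  qed
  have "negligible (\<Union>R. {x. \<bar>x\<bar> < real R \<and> h x > \<beta> \<and> \<not> Q x})"
    by (rule negligible_Union_nat) (rule neg)
  moreover have "(\<Union>R. {x. \<bar>x\<bar> < real R \<and> h x > \<beta> \<and> \<not> Q x}) = {x. \<not> (h x > \<beta> \<longrightarrow> Q x)}"
    using reals_Archimedean2 by fastforce
  ultimately have "negligible {x. \<not> (h x > \<beta> \<longrightarrow> Q x)}" by simp
  then show ?thesis unfolding negligible_AE Q_def .
qed

text \<open>Rational pairs \<open>\<alpha> < \<beta>\<close> between \<open>h x - e\<close> and
  \<open>h x\<close> give one null set for all \<open>e\<close>. The bound
  \<open>1 \<le> h x\<close> leaves room for a nonnegative \<open>\<alpha>\<close> below
  \<open>h x\<close>.\<close>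

lemma lower_derivative_density_all:
  fixes h H :: "real \<Rightarrow> real"
  assumes h[measurable]: "h \<in> borel_measurable borel" and h0: "\<And>x. 1 \<le> h x"
    and loc_int: "loc_int h" and H: "\<And>a b. H b - H a = oint h a b"
  shows "AE x in lborel. \<forall>e>0. \<exists>\<delta>>0. \<forall>y. 0 < \<bar>y - x\<bar> \<and> \<bar>y - x\<bar> < \<delta> \<longrightarrow> (H y - H x) / (y - x) \<ge> h x - e"
proof -
  have h00: "0 \<le> h x" for x using h0[of x] by simp
  have "AE x in lborel. \<forall>\<alpha>::rat. \<forall>\<beta>::rat. 0 \<le> \<alpha> \<and> \<alpha> < \<beta> \<longrightarrow> h x > of_rat \<beta> \<longrightarrow>
    (\<exists>\<delta>>0. \<forall>y. 0 < \<bar>y - x\<bar> \<and> \<bar>y - x\<bar> < \<delta> \<longrightarrow> (H y - H x) / (y - x) \<ge> of_rat \<alpha>)"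
    unfolding AE_all_countable
  proof (intro allI)
    fix \<alpha> \<beta> :: rat
    show "AE x in lborel. 0 \<le> \<alpha> \<and> \<alpha> < \<beta> \<longrightarrow> h x > of_rat \<beta> \<longrightarrow>
    (\<exists>\<delta>>0. \<forall>y. 0 < \<bar>y - x\<bar> \<and> \<bar>y - x\<bar> < \<delta> \<longrightarrow> (H y - H x) / (y - x) \<ge> of_rat \<alpha>)"
    proof (cases "0 \<le> \<alpha> \<and> \<alpha> < \<beta>")
      case True
      then show ?thesis
        using lower_derivative_density[OF h h00 loc_int H, of "of_rat \<alpha>" "of_rat \<beta>"]
        by (simp add: of_rat_less)
    qed auto
  qed
  then show ?thesis
  proof eventually_elim
    case (elim x)
    show ?case
    proof (intro allI impI)
      fix e :: real assume "e > 0"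
      have "max 0 (h x - e) < h x" using \<open>e > 0\<close> h0[of x] by auto
      then obtain \<beta> where b: "max 0 (h x - e) < of_rat \<beta>" "of_rat \<beta> < h x" using of_rat_dense by blast
      obtain \<alpha> where a: "max 0 (h x - e) < of_rat \<alpha>" "(of_rat \<alpha> :: real) < of_rat \<beta>" using of_rat_dense b(1) by blast
      have "0 \<le> \<alpha> \<and> \<alpha> < \<beta>" using a by (auto simp: of_rat_less)
      then obtain \<delta> where "\<delta>>0" "\<forall>y. 0 < \<bar>y - x\<bar> \<and> \<bar>y - x\<bar> < \<delta> \<longrightarrow> (H y - H x) / (y - x) \<ge> of_rat \<alpha>"
        using elim b(2) by blast
      moreover have "h x - e \<le> of_rat \<alpha>" using a by simp
      ultimately show "\<exists>\<delta>>0. \<forall>y. 0 < \<bar>y - x\<bar> \<and> \<bar>y - x\<bar> < \<delta> \<longrightarrow> (H y - H x) / (y - x) \<ge> h x - e"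
        by (meson order_trans)
    qed
  qed
qed

text \<open>Both \<open>h + (C + 1)\<close> and \<open>(C + 1) - h\<close> are at least 1; the lower
  estimate for the second is the upper estimate for the difference quotients of
  \<open>H\<close>.\<close>

lemma oint_AE_deriv:
  fixes h H :: "real \<Rightarrow> real"
  assumes h[measurable]: "h \<in> borel_measurable borel" and C: "\<And>x. \<bar>h x\<bar> \<le> C"
    and H: "\<And>a b. H b - H a = oint h a b"
  shows "AE x in lborel. (H has_real_derivative h x) (at x)"
proof -
  have loc_int: "loc_int h" using C by (rule loc_int_bounded[rotated]) simp
  have lic: "loc_int (\<lambda>x. C + 1)" by (rule loc_int_continuous) auto
  have "AE x in lborel. \<forall>e>0. \<exists>\<delta>>0. \<forall>y. 0 < \<bar>y - x\<bar> \<and> \<bar>y - x\<bar> < \<delta> \<longrightarrow>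
     ((H y + (C + 1) * y) - (H x + (C + 1) * x)) / (y - x) \<ge> (h x + (C + 1)) - e"
  proof (rule lower_derivative_density_all)
    show "1 \<le> h x + (C + 1)" for x using C[of x] by auto
    show "loc_int (\<lambda>x. h x + (C + 1))" by (rule loc_int_add[OF loc_int lic])
    show "H b + (C + 1) * b - (H a + (C + 1) * a) = oint (\<lambda>x. h x + (C + 1)) a b" for a b
      unfolding oint_sum[OF loc_int lic] H[symmetric] oint_const by (simp add: algebra_simps)
  qed simp
  moreover have "AE x in lborel. \<forall>e>0. \<exists>\<delta>>0. \<forall>y. 0 < \<bar>y - x\<bar> \<and> \<bar>y - x\<bar> < \<delta> \<longrightarrow>
     (((C + 1) * y - H y) - ((C + 1) * x - H x)) / (y - x) \<ge> ((C + 1) - h x) - e"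
  proof (rule lower_derivative_density_all)
    show "1 \<le> (C + 1) - h x" for x using C[of x] by auto
    show "loc_int (\<lambda>x. (C + 1) - h x)" by (rule loc_int_diff[OF lic loc_int])
    show "(C + 1) * b - H b - ((C + 1) * a - H a) = oint (\<lambda>x. (C + 1) - h x) a b" for a b
      unfolding oint_diff[OF lic loc_int] H[symmetric] oint_const by (simp add: algebra_simps)
  qed simp
  ultimately show ?thesis
  proof eventually_elim
    case (elim x)
    have "((\<lambda>y. (H y - H x) / (y - x)) \<longlongrightarrow> h x) (at x)"
      unfolding LIM_def
    proof (intro allI impI)
      fix r :: real assume "r > 0"
      then have "r / 2 > 0" by simp
      obtain d1 where d1: "d1 > 0" "\<And>y. 0 < \<bar>y - x\<bar> \<and> \<bar>y - x\<bar> < d1 \<Longrightarrow>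
        ((H y + (C + 1) * y) - (H x + (C + 1) * x)) / (y - x) \<ge> (h x + (C + 1)) - r / 2"
        using elim(1) \<open>r / 2 > 0\<close> by blast
      obtain d2 where d2: "d2 > 0" "\<And>y. 0 < \<bar>y - x\<bar> \<and> \<bar>y - x\<bar> < d2 \<Longrightarrow>
        (((C + 1) * y - H y) - ((C + 1) * x - H x)) / (y - x) \<ge> ((C + 1) - h x) - r / 2"
        using elim(2) \<open>r / 2 > 0\<close> by blast
      show "\<exists>s>0. \<forall>y. y \<noteq> x \<and> dist y x < s \<longrightarrow> dist ((H y - H x) / (y - x)) (h x) < r"
      proof (intro exI[of _ "min d1 d2"] conjI allI impI)
        show "0 < min d1 d2" using d1 d2 by simp
        fix y assume y: "y \<noteq> x \<and> dist y x < min d1 d2"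
        then have y': "0 < \<bar>y - x\<bar> \<and> \<bar>y - x\<bar> < d1" "0 < \<bar>y - x\<bar> \<and> \<bar>y - x\<bar> < d2" by (auto simp: dist_real_def)
        have n: "y - x \<noteq> 0" using y by simp
        have "((H y + (C + 1) * y) - (H x + (C + 1) * x)) / (y - x) = (H y - H x) / (y - x) + (C + 1)"
          using n by (simp add: field_simps)
        then have A: "(H y - H x) / (y - x) \<ge> h x - r / 2" using d1(2)[OF y'(1)] by simp
        have "(((C + 1) * y - H y) - ((C + 1) * x - H x)) / (y - x) = (C + 1) - (H y - H x) / (y - x)"
          using n by (simp add: field_simps)
        then have B: "(H y - H x) / (y - x) \<le> h x + r / 2" using d2(2)[OF y'(2)] by simp
        show "dist ((H y - H x) / (y - x)) (h x) < r" using A B \<open>r > 0\<close> by (auto simp: dist_real_def)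
      qed
    qed
    then show ?case by (simp add: has_field_derivative_iff)
  qed
qed

section \<open>Bi-Lipschitz maps and Lipschitz functions\<close>

text \<open>Asking for a lower slope \<open>c > 0\<close> on ordered pairs encodes monotonicity as
  well: flow maps are increasing, and one notion serves both order and measure arguments.\<close>

definition bilip :: "real \<Rightarrow> real \<Rightarrow> (real \<Rightarrow> real) \<Rightarrow> bool" where
  "bilip c L X \<longleftrightarrow> 0 < c \<and> (\<forall>x y. x \<le> y \<longrightarrow> c * (y - x) \<le> X y - X x \<and> X y - X x \<le> L * (y - x))"

lemma bilip_pos: assumes "bilip c L X" shows "0 < c" "c \<le> L" "0 < L"
proof -
  show "0 < c" using assms by (simp add: bilip_def)
  have *: "\<forall>x y. x \<le> y \<longrightarrow> c * (y - x) \<le> X y - X x \<and> X y - X x \<le> L * (y - x)"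
    using assms by (simp add: bilip_def)
  show "c \<le> L" using *[rule_format, of 0 1] by simp
  then show "0 < L" using \<open>0 < c\<close> by simp
qed

lemma bilip_abs: assumes "bilip c L X" shows "c * \<bar>y - x\<bar> \<le> \<bar>X y - X x\<bar>" "\<bar>X y - X x\<bar> \<le> L * \<bar>y - x\<bar>"
proof -
  have *: "x \<le> y \<Longrightarrow> c * (y - x) \<le> X y - X x \<and> X y - X x \<le> L * (y - x)" for x y
    using assms unfolding bilip_def by blast
  have "0 < c" using assms by (rule bilip_pos)
  have 1: "x \<le> y \<Longrightarrow> 0 \<le> X y - X x" for x y using *[of x y] \<open>0 < c\<close> by (smt (verit) mult_nonneg_nonneg)
  show "c * \<bar>y - x\<bar> \<le> \<bar>X y - X x\<bar>" "\<bar>X y - X x\<bar> \<le> L * \<bar>y - x\<bar>"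
    using *[of x y] 1[of x y] *[of y x] 1[of y x] by (cases "x \<le> y"; simp)+
qed

lemma lipschitz_real_continuous:
  fixes f :: "real \<Rightarrow> real"
  assumes "\<And>x y. \<bar>f y - f x\<bar> \<le> L * \<bar>y - x\<bar>"
  shows "continuous_on UNIV f"
proof (rule lipschitz_on_continuous_on[of "\<bar>L\<bar>"], rule lipschitz_onI)
  fix x y
  show "dist (f x) (f y) \<le> \<bar>L\<bar> * dist x y"
    using assms[of x y] by (smt (verit) dist_real_def mult_right_mono)
qed simp

lemma bilip_continuous: "bilip c L X \<Longrightarrow> continuous_on UNIV X"
  by (rule lipschitz_real_continuous) (rule bilip_abs)

lemma bilip_borel: "bilip c L X \<Longrightarrow> X \<in> borel_measurable borel"
  by (rule borel_measurable_continuous_onI) (rule bilip_continuous)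

lemma bilip_less: "bilip c L X \<Longrightarrow> X x < X y \<longleftrightarrow> x < y"
proof -
  assume b: "bilip c L X"
  have *: "X x < X y" if "x < y" for x y
  proof -
    have "0 < c * (y - x)" using that bilip_pos[OF b] by simp
    then show ?thesis using b that unfolding bilip_def by (smt (verit))
  qed
  show ?thesis using *[of x y] *[of y x] by (metis not_less_iff_gr_or_eq)
qed

lemma bilip_leq: "bilip c L X \<Longrightarrow> X x \<le> X y \<longleftrightarrow> x \<le> y"
  using bilip_less[of c L X y x] by linarith

lemma bilip_bij: assumes b: "bilip c L X" shows "bij X"
proof -
  have c: "c > 0" by (rule bilip_pos[OF b])
  have "inj X" unfolding inj_def using bilip_leq[OF b] by (metis order.antisym order_refl)
  moreover have "\<exists>x. X x = y" for y
  proof -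
    define R where "R = \<bar>y - X 0\<bar> / c"
    have R: "R \<ge> 0" using c by (simp add: R_def)
    have cR: "c * R = \<bar>y - X 0\<bar>" using c by (simp add: R_def)
    have "c * (R - 0) \<le> X R - X 0" using b R unfolding bilip_def by blast
    moreover have "c * (0 - (-R)) \<le> X 0 - X (-R)" using b R unfolding bilip_def by (metis neg_le_0_iff_le)
    ultimately have "X (-R) \<le> y" "y \<le> X R" using cR by auto
    then show ?thesis using IVT'[of X "-R" y R] R bilip_continuous[OF b] continuous_on_subset by fastforce
  qed
  ultimately show ?thesis by (metis bij_def surj_def)
qed

lemma bilip_inv: assumes b: "bilip c L X" shows "bilip (1 / L) (1 / c) (inv X)"
  unfolding bilip_def
proof (intro conjI allI impI)
  have p: "0 < c" "0 < L" by (rule bilip_pos[OF b])+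
  show "0 < 1 / L" using p by simp
  have bij: "bij X" by (rule bilip_bij[OF b])
  fix x y :: real assume "x \<le> y"
  define u w where "u = inv X x" and "w = inv X y"
  have xy: "x = X u" "y = X w" using bij by (simp_all only: u_def w_def surj_f_inv_f bij_is_surj)
  have "u \<le> w" using \<open>x \<le> y\<close> bilip_leq[OF b] xy by simp
  then have "c * (w - u) \<le> y - x" "y - x \<le> L * (w - u)" using b unfolding bilip_def xy by blast+
  then show "1 / L * (y - x) \<le> inv X y - inv X x" "inv X y - inv X x \<le> 1 / c * (y - x)"
    using p by (auto simp: u_def[symmetric] w_def[symmetric] field_simps)
qed

lemma bilip_inv_simps: assumes b: "bilip c L X" shows "inv X (X x) = x" "X (inv X x) = x"
  using inv_f_f[OF bij_is_inj[OF bilip_bij[OF b]]] surj_f_inv_f[OF bij_is_surj[OF bilip_bij[OF b]]] by metis+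

text \<open>On its range an expanding map has a Lipschitz inverse, and Lipschitz images of null sets
  are null. This form also serves the decreasing maps \<open>y \<mapsto> x - a y\<close> that occur
  in convolutions.\<close>

lemma AE_expanding:
  fixes a :: "real \<Rightarrow> real"
  assumes e: "\<And>x y. c * \<bar>y - x\<bar> \<le> \<bar>a y - a x\<bar>" and c: "c > 0" and P: "AE x in lborel. P x"
  shows "AE y in lborel. P (a y)"
proof -
  define S where "S = {x. \<not> P x} \<inter> range a"
  have "negligible {x. \<not> P x}" using P negligible_AE by blast
  then have "negligible S" unfolding S_def by (rule negligible_subset) auto
  have "inj a"
  proof (rule injI)
    fix x y assume *: "a x = a y"
    have "c * \<bar>y - x\<bar> \<le> 0" using e[of y x] unfolding * by simp
    then show "x = y" using c by (simp add: mult_le_0_iff)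
  qed
  have "negligible (inv a ` S)"
  proof (rule negligible_locally_Lipschitz_image)
    fix x assume "x \<in> S"
    then obtain u where u: "x = a u" by (auto simp: S_def)
    show "\<exists>T B. open T \<and> x \<in> T \<and> (\<forall>y\<in>S \<inter> T. norm (inv a y - inv a x) \<le> B * norm (y - x))"
    proof (intro exI[of _ UNIV] exI[of _ "1 / c"] conjI ballI)
      fix y assume "y \<in> S \<inter> UNIV"
      then obtain w where w: "y = a w" by (auto simp: S_def)
      show "norm (inv a y - inv a x) \<le> 1 / c * norm (y - x)"
        using e[of w u] c by (simp add: u w inv_f_f[OF \<open>inj a\<close>] field_simps)
    qed auto
  qed (use \<open>negligible S\<close> in auto)
  moreover have "{y. \<not> P (a y)} \<subseteq> inv a ` S"
  proof
    fix y assume "y \<in> {y. \<not> P (a y)}"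
    then have "a y \<in> S" by (simp add: S_def)
    then show "y \<in> inv a ` S" using inv_f_f[OF \<open>inj a\<close>, of y] by (metis image_eqI)
  qed
  ultimately have "negligible {y. \<not> P (a y)}" by (rule negligible_subset)
  then show ?thesis using negligible_AE by blast
qed

lemma AE_bilip: "bilip c L X \<Longrightarrow> AE x in lborel. P x \<Longrightarrow> AE y in lborel. P (X y)"
  by (rule AE_expanding[of c X]) (auto simp: bilip_abs bilip_pos)

text \<open>The image of Lebesgue measure is absolutely continuous because \<open>X\<close> pulls
  null sets back to null sets. Its Radon-Nikodym density integrates over an interval to the
  increment of \<open>inv X\<close>, hence is the almost everywhere derivative of
  \<open>inv X\<close>. Clipping to \<open>[1 / L, 1 / c]\<close> makes the bounds hold
  everywhere.\<close>

lemma bilip_density: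
  assumes b: "bilip c L X"
  shows "\<exists>h. h \<in> borel_measurable borel \<and> (\<forall>x. 1 / L \<le> h x \<and> h x \<le> 1 / c) \<and>
    distr lborel borel X = density lborel (\<lambda>x. ennreal (h x)) \<and>
    (\<forall>a b. inv X b - inv X a = oint h a b) \<and>
    (AE x in lborel. (inv X has_real_derivative h x) (at x))"
proof -
  have p: "0 < c" "0 < L" by (rule bilip_pos[OF b])+
  have X[measurable]: "X \<in> borel_measurable borel" by (rule bilip_borel[OF b])
  note bi = bilip_inv[OF b]
  define N where "N = distr lborel borel X"
  have ac: "absolutely_continuous lborel N"
    unfolding absolutely_continuous_def
  proof
    fix A :: "real set" assume A: "A \<in> null_sets lborel"
    then have "AE x in lborel. x \<notin> A" by (rule AE_not_in)
    then have "AE y in lborel. X y \<notin> A" by (rule AE_bilip[OF b])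
    then have "X -` A \<in> null_sets lborel"
      using A by (subst AE_iff_null_sets) (auto intro!: measurable_sets_borel[OF X])
    then show "A \<in> null_sets N" using A by (auto simp: N_def null_sets_def emeasure_distr)
  qed
  obtain f where f[measurable]: "f \<in> borel_measurable lborel" and fN: "density lborel f = N"
    using sigma_finite_measure.Radon_Nikodym[OF lborel.sigma_finite_measure_axioms ac] by (auto simp: N_def)
  define k where "k = inv X"
  have Nint: "emeasure N {u..w} = ennreal (k w - k u)" if "u \<le> w" for u w
  proof -
    have "X -` {u..w} = {k u..k w}"
    proof -
      have "u \<le> X x \<longleftrightarrow> k u \<le> x" "X x \<le> w \<longleftrightarrow> x \<le> k w" for x
        using bilip_leq[OF b, of "k u" x] bilip_leq[OF b, of x "k w"] by (simp_all add: k_def bilip_inv_simps[OF b])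
      then show ?thesis by auto
    qed
    moreover have "k u \<le> k w" using that bilip_leq[OF bi] by (simp add: k_def)
    ultimately show ?thesis by (simp add: N_def emeasure_distr)
  qed
  have fin: "AE x in lborel. f x < \<infinity>"
  proof -
    have "AE x in lborel. \<forall>n::nat. x \<in> {-real n..real n} \<longrightarrow> f x < \<infinity>"
      unfolding AE_all_countable
    proof
      fix n :: nat
      have "(\<integral>\<^sup>+x. f x * indicator {-real n..real n} x \<partial>lborel) = emeasure N {-real n..real n}"
        unfolding fN[symmetric] by (simp add: emeasure_density)
      then have "(\<integral>\<^sup>+x. f x * indicator {-real n..real n} x \<partial>lborel) \<noteq> \<infinity>" by (simp add: Nint)
      then have "AE x in lborel. f x * indicator {-real n..real n} x \<noteq> \<infinity>"
        by (intro nn_integral_PInf_AE) auto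
      then show "AE x in lborel. x \<in> {-real n..real n} \<longrightarrow> f x < \<infinity>"
        by eventually_elim (auto simp: less_top)
    qed
    then show ?thesis
    proof eventually_elim
      case (elim x)
      obtain n :: nat where "\<bar>x\<bar> \<le> real n" using real_arch_simple by blast
      then show ?case using elim by (auto simp: abs_le_iff)
    qed
  qed
  define h1 where "h1 x = enn2real (f x)" for x
  have h1[measurable]: "h1 \<in> borel_measurable borel" unfolding h1_def by measurable
  have h10: "0 \<le> h1 x" for x by (simp add: h1_def)
  have h1N: "density lborel (\<lambda>x. ennreal (h1 x)) = N"
    unfolding fN[symmetric]
    by (rule density_cong) (use fin in \<open>auto simp: h1_def less_top\<close>)
  have h1i: "set_integrable lborel {u..w} h1 \<and> (LBINT x:{u..w}. h1 x) = k w - k u" if "u \<le> w" for u w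
  proof -
    have kk: "0 \<le> k w - k u" using that bilip_leq[OF bi] by (simp add: k_def)
    have "(\<integral>\<^sup>+x. ennreal (indicator {u..w} x * h1 x) \<partial>lborel) = emeasure N {u..w}"
      unfolding h1N[symmetric]
      by (subst emeasure_density) (auto intro!: nn_integral_cong simp: indicator_def)
    then have "(\<integral>\<^sup>+x. ennreal (indicator {u..w} x * h1 x) \<partial>lborel) = ennreal (k w - k u)" using that by (simp add: Nint)
    then show ?thesis unfolding set_integrable_def set_lebesgue_integral_def
      by (subst (asm) nn_integral_eq_integrable) (use h10 kk in auto)
  qed
  have li1: "loc_int h1" unfolding loc_int_def
  proof (intro allI)
    fix u w show "set_integrable lborel {u..w} h1"
      using h1i[of u w] by (cases "u \<le> w") (auto simp: set_integrable_def)
  qed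
  have k1: "k w - k u = oint h1 u w" for u w
    using h1i[of u w] h1i[of w u] oint_swap[of h1 u w] by (cases "u \<le> w") (auto simp: oint_le)
  \<comment> \<open>\<open>oint_AE_deriv\<close> asks for a bounded density. If \<open>h1\<close>
    exceeded \<open>1 / c\<close> on a set that is not null, \<open>lower_derivative_density\<close>
    would produce difference quotients of \<open>k\<close> above its Lipschitz constant
    \<open>1 / c\<close>.\<close>
  have "AE x in lborel. \<not> (h1 x > 1 / c)"
  proof -
    have "AE x in lborel. \<forall>n::nat. \<not> h1 x > 1 / c + 2 / (real n + 1)"
      unfolding AE_all_countable
    proof
      fix n :: nat
      have "AE x in lborel. h1 x > 1 / c + 2 / (real n + 1) \<longrightarrow> (\<exists>\<delta>>0. \<forall>y. 0 < \<bar>y - x\<bar> \<and> \<bar>y - x\<bar> < \<delta> \<longrightarrow> (k y - k x) / (y - x) \<ge> 1 / c + 1 / (real n + 1))"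
        by (rule lower_derivative_density[OF h1 h10 li1 k1]) (use p in \<open>auto intro!: divide_strict_right_mono\<close>)
      then show "AE x in lborel. \<not> h1 x > 1 / c + 2 / (real n + 1)"
      proof eventually_elim
        case (elim x)
        show ?case
        proof
          assume "h1 x > 1 / c + 2 / (real n + 1)"
          then obtain d where d: "d > 0" "\<And>y. 0 < \<bar>y - x\<bar> \<and> \<bar>y - x\<bar> < d \<Longrightarrow> (k y - k x) / (y - x) \<ge> 1 / c + 1 / (real n + 1)"
            using elim by blast
          have "(k (x + d/2) - k x) / ((x + d/2) - x) \<ge> 1 / c + 1 / (real n + 1)" by (rule d(2)) (use d(1) in auto)
          moreover have "k (x + d/2) - k x \<le> 1 / c * ((x + d/2) - x)" using bi d(1) unfolding bilip_def k_def by (metis less_add_same_cancel1 half_gt_zero less_imp_le)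
          then have "(k (x + d/2) - k x) / ((x + d/2) - x) \<le> 1 / c" using d(1) p by (simp add: field_simps)
          moreover have "1 / (real n + 1) > 0" by simp
          ultimately show False by linarith
        qed
      qed
    qed
    then show ?thesis
    proof eventually_elim
      case (elim x)
      show ?case
      proof
        assume "1 / c < h1 x"
        then obtain n :: nat where "inverse (real (Suc n)) < (h1 x - 1 / c) / 2" using reals_Archimedean[of "(h1 x - 1 / c) / 2"] by auto
        then have "1 / c + 2 / (real n + 1) < h1 x" by (simp add: field_simps inverse_eq_divide)
        then show False using elim by blast
      qed
    qed
  qed
  define h2 where "h2 x = min (1 / c) (h1 x)" for x
  have h2[measurable]: "h2 \<in> borel_measurable borel" unfolding h2_def by measurable
  have h12: "AE x in lborel. h1 x = h2 x" using \<open>AE x in lborel. \<not> (h1 x > 1 / c)\<close> by eventually_elim (auto simp: h2_def)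
  have bd2: "\<bar>h2 x\<bar> \<le> 1 / c" for x using h10[of x] p by (auto simp: h2_def)
  have li2: "loc_int h2" by (rule loc_int_bounded[OF h2 bd2])
  have k2: "k w - k u = oint h2 u w" for u w
    unfolding k1 by (rule oint_cong_AE[OF li1 li2]) (use h12 in auto)
  have d2: "AE x in lborel. (k has_real_derivative h2 x) (at x)"
    by (rule oint_AE_deriv[OF h2 bd2 k2])
  define h where "h x = max (1 / L) (h2 x)" for x
  have hm[measurable]: "h \<in> borel_measurable borel" unfolding h_def by measurable
  \<comment> \<open>The lower bound is read off from the difference quotients of \<open>k\<close>,
    whose slope is at least \<open>1 / L\<close>; so the second clipping, too, acts on a null set
    only.\<close>
  have h2h: "AE x in lborel. h2 x = h x"
    using d2
  proof eventually_elim
    case (elim x)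
    then have "((\<lambda>y. (k y - k x) / (y - x)) \<longlongrightarrow> h2 x) (at x)" by (simp add: has_field_derivative_iff)
    then have "1 / L \<le> h2 x"
    proof (rule tendsto_lowerbound)
      have "1 / L \<le> (k y - k x) / (y - x)" if "y \<noteq> x" for y
      proof (cases "x < y")
        case True then show ?thesis using bi unfolding bilip_def k_def[symmetric] by (simp add: pos_le_divide_eq)
      next
        case False
        then have "1 / L * (x - y) \<le> k x - k y" using bi unfolding bilip_def k_def[symmetric] by simp
        moreover have "(k y - k x) / (y - x) = (k x - k y) / (x - y)" by (metis minus_diff_eq minus_divide_divide)
        ultimately show ?thesis using False that by (simp add: pos_le_divide_eq)
      qed
      then show "\<forall>\<^sub>F y in at x. 1 / L \<le> (k y - k x) / (y - x)" by (simp add: eventually_at_filter)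
    qed simp
    then show ?case by (simp add: h_def)
  qed
  have bd: "1 / L \<le> h x \<and> h x \<le> 1 / c" for x
    using bilip_pos[OF b] by (auto simp: h_def h2_def field_simps)
  have "\<bar>h x\<bar> \<le> 1 / c" for x using bd[of x] p by (smt (verit) divide_pos_pos)
  then have lih: "loc_int h" by (rule loc_int_bounded[OF hm])
  show ?thesis
  proof (intro exI[of _ h] conjI)
    show "\<forall>x. 1 / L \<le> h x \<and> h x \<le> 1 / c" using bd by blast
    show "distr lborel borel X = density lborel (\<lambda>x. ennreal (h x))"
      unfolding N_def[symmetric] h1N[symmetric]
      by (rule density_cong) (use h12 h2h in auto)
    show "\<forall>a b. inv X b - inv X a = oint h a b"
      unfolding k_def[symmetric] k2 by (intro allI oint_cong_AE[OF li2 lih]) (use h2h in auto)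
    show "AE x in lborel. (inv X has_real_derivative h x) (at x)"
      using d2 h2h by eventually_elim (auto simp: k_def)
  qed fact
qed

text \<open>Rademacher's theorem on the line. Adding \<open>(L + 1) * x\<close> makes
  \<open>f\<close> increasing with slopes between 1 and \<open>2 * L + 1\<close>, so
  \<open>bilip_density\<close>, applied to the inverse of the sum, supplies the derivative.\<close>

lemma lipschitz_density:
  assumes lip: "\<And>x y. \<bar>f y - f x\<bar> \<le> L * \<bar>y - x\<bar>"
  obtains h where "h \<in> borel_measurable borel" "\<And>x. \<bar>h x\<bar> \<le> L" "\<And>a b. f b - f a = oint h a b"
    "AE x in lborel. (f has_real_derivative h x) (at x)"
proof -
  have L: "L \<ge> 0" using lip[of 1 0] by auto
  define k where "k x = f x + (L + 1) * x" for x
  have "1 * (y - x) \<le> k y - k x \<and> k y - k x \<le> (2 * L + 1) * (y - x)" if "x \<le> y" for x y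
    using lip[of y x] that by (auto simp: k_def algebra_simps abs_if split: if_splits)
  then have bk: "bilip 1 (2 * L + 1) k" unfolding bilip_def by auto
  have ik: "inv (inv k) = k" by (rule inv_inv_eq[OF bilip_bij[OF bk]])
  obtain h where h: "h \<in> borel_measurable borel" "\<And>x. 1 / (1/1) \<le> h x \<and> h x \<le> 1 / (1 / (2 * L + 1))"
    "\<And>a b. k b - k a = oint h a b" "AE x in lborel. (k has_real_derivative h x) (at x)"
    using bilip_density[OF bilip_inv[OF bk], unfolded ik] by blast
  have "\<bar>h x\<bar> \<le> 2 * L + 1" for x using h(2)[of x] by simp
  then have lih: "loc_int h" by (rule loc_int_bounded[OF h(1)])
  have lic: "loc_int (\<lambda>x. L + 1)" by (rule loc_int_continuous) auto
  show ?thesis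
  proof (rule that[of "\<lambda>x. h x - (L + 1)"])
    show "(\<lambda>x. h x - (L + 1)) \<in> borel_measurable borel" using h(1) by measurable
    show "\<bar>h x - (L + 1)\<bar> \<le> L" for x using h(2)[of x] by (auto simp: abs_if)
    show "f b - f a = oint (\<lambda>x. h x - (L + 1)) a b" for a b
      using h(3)[of b a] unfolding oint_diff[OF lih lic] k_def oint_const by (simp add: algebra_simps)
    show "AE x in lborel. (f has_real_derivative (h x - (L + 1))) (at x)"
      using h(4)
    proof eventually_elim
      case (elim x)
      have "((\<lambda>x. k x - (L + 1) * x) has_real_derivative (h x - (L + 1))) (at x)"
        by (rule derivative_eq_intros elim refl | simp)+
      then show ?case by (simp add: k_def)
    qed
  qed
qed

text \<open>The image of Lebesgue measure under \<open>X\<close> has a density of at most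
  \<open>1 / c\<close>.\<close>

lemma bilip_nn_integral_le:
  assumes b: "bilip c L X" and [measurable]: "f \<in> borel_measurable borel"
  shows "(\<integral>\<^sup>+y. f (X y) \<partial>lborel) \<le> ennreal (1 / c) * (\<integral>\<^sup>+x. f x \<partial>lborel)"
proof -
  have [measurable]: "X \<in> borel_measurable borel" by (rule bilip_borel[OF b])
  obtain h where h[measurable]: "h \<in> borel_measurable borel" and hb: "\<And>x. 1 / L \<le> h x \<and> h x \<le> 1 / c"
    and d: "distr lborel borel X = density lborel (\<lambda>x. ennreal (h x))"
    using bilip_density[OF b] by blast
  have "(\<integral>\<^sup>+y. f (X y) \<partial>lborel) = (\<integral>\<^sup>+x. f x \<partial>distr lborel borel X)" by (simp add: nn_integral_distr)
  also have "\<dots> = (\<integral>\<^sup>+x. ennreal (h x) * f x \<partial>lborel)" unfolding d by (simp add: nn_integral_density)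
  also have "\<dots> \<le> (\<integral>\<^sup>+x. ennreal (1 / c) * f x \<partial>lborel)"
    by (intro nn_integral_mono mult_right_mono ennreal_leI) (use hb in auto)
  also have "\<dots> = ennreal (1 / c) * (\<integral>\<^sup>+x. f x \<partial>lborel)" by (rule nn_integral_cmult) simp
  finally show ?thesis .
qed

lemma bilip_integrable:
  fixes f :: "real \<Rightarrow> real"
  assumes b: "bilip c L X" and f: "integrable lborel f"
  shows "integrable lborel (\<lambda>y. f (X y))" "(LINT y|lborel. \<bar>f (X y)\<bar>) \<le> (LINT x|lborel. \<bar>f x\<bar>) / c"
proof -
  have [measurable]: "f \<in> borel_measurable borel" using f by simp
  have [measurable]: "X \<in> borel_measurable borel" by (rule bilip_borel[OF b])
  have c: "c > 0" by (rule bilip_pos[OF b])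
  have "(\<integral>\<^sup>+y. ennreal \<bar>f (X y)\<bar> \<partial>lborel) \<le> ennreal (1 / c) * (\<integral>\<^sup>+x. ennreal \<bar>f x\<bar> \<partial>lborel)"
    by (rule bilip_nn_integral_le[OF b]) simp
  also have "(\<integral>\<^sup>+x. ennreal \<bar>f x\<bar> \<partial>lborel) = ennreal (LINT x|lborel. \<bar>f x\<bar>)"
    by (rule nn_integral_eq_integral) (use f in auto)
  also have "ennreal (1 / c) * ennreal (LINT x|lborel. \<bar>f x\<bar>) = ennreal ((LINT x|lborel. \<bar>f x\<bar>) / c)"
    using c by (simp add: ennreal_mult[symmetric])
  finally have *: "(\<integral>\<^sup>+y. ennreal \<bar>f (X y)\<bar> \<partial>lborel) \<le> ennreal ((LINT x|lborel. \<bar>f x\<bar>) / c)" .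
  show i: "integrable lborel (\<lambda>y. f (X y))"
    by (rule integrableI_bounded) (use * in \<open>auto intro: le_less_trans\<close>)
  have "(\<integral>\<^sup>+y. ennreal \<bar>f (X y)\<bar> \<partial>lborel) = ennreal (LINT y|lborel. \<bar>f (X y)\<bar>)"
    by (rule nn_integral_eq_integral) (use i in auto)
  then show "(LINT y|lborel. \<bar>f (X y)\<bar>) \<le> (LINT x|lborel. \<bar>f x\<bar>) / c"
    using * c by (simp add: ennreal_le_iff)
qed

lemma bilip_cov:
  fixes f :: "real \<Rightarrow> real"
  assumes b: "bilip c L X" and h[measurable]: "h \<in> borel_measurable borel" and hb: "\<And>x. 0 \<le> h x"
    and d: "distr lborel borel X = density lborel (\<lambda>x. ennreal (h x))"
    and [measurable]: "f \<in> borel_measurable borel"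
  shows "(LINT y|lborel. f (X y)) = (LINT x|lborel. h x * f x)"
proof -
  have [measurable]: "X \<in> borel_measurable borel" by (rule bilip_borel[OF b])
  have "(LINT y|lborel. f (X y)) = integral\<^sup>L (distr lborel borel X) f" by (simp add: integral_distr)
  also have "\<dots> = (LINT x|lborel. h x * f x)" unfolding d by (subst integral_density) (use hb in auto)
  finally show ?thesis .
qed

lemma oint_shift: "oint f (a + h) (b + h) = oint (\<lambda>x. f (x + h)) a b"
proof -
  have *: "oint f (a + h) (b + h) = oint (\<lambda>x. f (x + h)) a b" if "a \<le> b" for a b
  proof -
    have "(LINT x|lborel. indicator {a + h..b + h} x *\<^sub>R f x) = (LINT x|lborel. indicator {a + h..b + h} (h + 1 * x) *\<^sub>R f (h + 1 * x))"
      using lborel_integral_real_affine[of 1 "\<lambda>x. indicator {a + h..b + h} x *\<^sub>R f x" h] by simp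
    also have "\<dots> = (LINT x|lborel. indicator {a..b} x *\<^sub>R f (x + h))"
      by (rule Bochner_Integration.integral_cong) (auto simp: indicator_def algebra_simps)
    finally show ?thesis using that by (simp add: oint_le set_lebesgue_integral_def)
  qed
  show ?thesis using *[of a b] *[of b a] oint_swap[of _ a b] oint_swap[of _ "a+h" "b+h"] by (cases "a \<le> b") auto
qed

lemma loc_int_shift: assumes "loc_int f" shows "loc_int (\<lambda>x. f (x + h))"
  unfolding loc_int_def set_integrable_def
proof (intro allI)
  fix a b
  have "integrable lborel (\<lambda>x. indicator {a + h..b + h} x *\<^sub>R f x)" using loc_intD[OF assms] by (simp add: set_integrable_def)
  then have "integrable lborel (\<lambda>x. indicator {a + h..b + h} (h + 1 * x) *\<^sub>R f (h + 1 * x))"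
    by (rule lborel_integrable_real_affine) simp
  then show "integrable lborel (\<lambda>x. indicator {a..b} x *\<^sub>R f (x + h))"
    by (rule Bochner_Integration.integrable_cong[THEN iffD1, rotated -1]) (auto simp: indicator_def algebra_simps)
qed

section \<open>Translation estimates for functions of bounded variation\<close>

lemma C1_compact_support_realI:
  fixes \<phi> :: "real \<Rightarrow> real"
  assumes d: "\<And>x. (\<phi> has_real_derivative \<phi>' x) (at x)" and c: "continuous_on UNIV \<phi>'"
    and s: "\<And>x. \<phi> x \<noteq> 0 \<Longrightarrow> a \<le> x \<and> x \<le> b"
  shows "\<phi> \<in> C1_compact_support UNIV"
proof -
  have sub: "closure {z. \<phi> z \<noteq> 0} \<subseteq> {a..b}" by (rule closure_minimal) (use s in auto)
  have "compact (closure {z. \<phi> z \<noteq> 0})"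
    using sub by (metis closed_closure compact_Icc compact_Int_closed inf.absorb_iff2 Int_commute)
  moreover have "(\<phi> has_derivative blinfun_apply (\<phi>' z *\<^sub>R id_blinfun)) (at z)" for z
    using d[of z] by (simp add: has_field_derivative_def scaleR_blinfun.rep_eq) 
  moreover have "continuous_on UNIV (\<lambda>z. \<phi>' z *\<^sub>R (id_blinfun :: real \<Rightarrow>\<^sub>L real))"
    by (intro continuous_intros c)
  ultimately show ?thesis unfolding C1_compact_support_def
    by (intro CollectI conjI exI[of _ "\<lambda>z. \<phi>' z *\<^sub>R id_blinfun"] allI) auto
qed

text \<open>Measurable functions are almost everywhere limits of continuous ones. The cut-off factor
  \<open>k n\<close> adds compact support and clipping keeps the bound, so that the approximants are
  dominated and can serve as test functions.\<close>

lemma continuous_approx_AE: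
  fixes f :: "real \<Rightarrow> real"
  assumes [measurable]: "f \<in> borel_measurable borel" and f1: "\<And>x. \<bar>f x\<bar> \<le> B"
  obtains g :: "nat \<Rightarrow> real \<Rightarrow> real" where "\<And>n. continuous_on UNIV (g n)" "\<And>n x. \<bar>g n x\<bar> \<le> B"
    "\<And>n x. g n x \<noteq> 0 \<Longrightarrow> \<bar>x\<bar> \<le> real n" "AE x in lborel. (\<lambda>n. g n x) \<longlonglongrightarrow> f x"
proof -
  have B: "B \<ge> 0" using f1[of 0] by linarith
  have "f measurable_on UNIV" by (rule lebesgue_measurable_imp_measurable_on) (auto intro: measurable_completion)
  then obtain N g where N: "negligible N" and g: "\<And>n. continuous_on UNIV (g n)"
    "\<And>x. x \<notin> N \<Longrightarrow> (\<lambda>n. g n x) \<longlonglongrightarrow> f x" unfolding measurable_on_def by auto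
  define k where "k n x = max 0 (min 1 (real n - \<bar>x\<bar>))" for n x
  define u where "u n x = k n x * max (-B) (min B (g n x))" for n x
  show ?thesis
  proof (rule that[of u])
    show "continuous_on UNIV (u n)" for n unfolding u_def k_def by (intro continuous_intros g)
    show "\<bar>u n x\<bar> \<le> B" for n x
    proof -
      have "\<bar>u n x\<bar> = \<bar>k n x\<bar> * \<bar>max (-B) (min B (g n x))\<bar>" by (simp add: u_def abs_mult)
      also have "\<dots> \<le> 1 * B" by (rule mult_mono) (use B in \<open>auto simp: k_def\<close>)
      finally show ?thesis by simp
    qed
    show "\<bar>x\<bar> \<le> real n" if "u n x \<noteq> 0" for n x using that by (auto simp: u_def k_def max_def min_def split: if_splits)
    have *: "(\<lambda>n. u n x) \<longlonglongrightarrow> f x" if "x \<notin> N" for x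
    proof -
      have "(\<lambda>n. k n x) \<longlonglongrightarrow> 1"
      proof (rule tendsto_eventually)
        obtain n0 :: nat where n0: "\<bar>x\<bar> + 1 \<le> real n0" using real_arch_simple by blast
        show "\<forall>\<^sub>F n in sequentially. k n x = 1"
          using eventually_ge_at_top[of n0] by eventually_elim (use n0 in \<open>auto simp: k_def\<close>)
      qed
      then have "(\<lambda>n. u n x) \<longlonglongrightarrow> 1 * max (-B) (min B (f x))" unfolding u_def
        by (intro tendsto_intros g(2) that)
      moreover have "max (-B) (min B (f x)) = f x" using f1[of x] by (auto simp: abs_le_iff)
      ultimately show ?thesis by simp
    qed
    have "AE x in lborel. x \<notin> N" using N negligible_AE[of "\<lambda>x. x \<notin> N"] by simp
    then show "AE x in lborel. (\<lambda>n. u n x) \<longlonglongrightarrow> f x" by eventually_elim (rule *)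
  qed
qed

text \<open>Duality. Testing the variation with a moving average of \<open>- \<phi>\<close> makes
  the derivative of the test function a difference quotient of \<open>\<phi>\<close>; shifting it
  onto \<open>g\<close> bounds the pairing of \<open>g (x + h) - g x\<close> with
  \<open>\<phi>\<close>, and letting \<open>\<phi>\<close> approach the sign of this difference
  gives its L1 norm.\<close>

lemma translation_estimate:
  fixes g :: "real \<Rightarrow> real"
  assumes g: "integrable lborel g" and h: "h > 0"
    and K: "\<And>\<phi>. \<phi> \<in> C1_compact_support UNIV \<Longrightarrow> (\<And>x. \<bar>\<phi> x\<bar> \<le> 1) \<Longrightarrow> (LINT x|lborel. g x * deriv \<phi> x) \<le> K"
  shows "(LINT x|lborel. \<bar>g (x + h) - g x\<bar>) \<le> K * h"
proof -
  have [measurable]: "g \<in> borel_measurable borel" using g by simp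
  have gh: "integrable lborel (\<lambda>x. g (x + h))"
    using lborel_integrable_real_affine[OF g, of 1 h] by (simp add: add.commute)
  define f where "f x = g (x + h) - g x" for x
  have f: "integrable lborel f" unfolding f_def using g gh by simp
  have [measurable]: "f \<in> borel_measurable borel" using f by simp
  have 1: "(LINT x|lborel. f x * \<phi> x) \<le> K * h"
    if c: "continuous_on UNIV \<phi>" and b: "\<And>x. \<bar>\<phi> x\<bar> \<le> 1" and s: "\<And>x. \<phi> x \<noteq> 0 \<Longrightarrow> \<bar>x\<bar> \<le> R" for \<phi> R
  proof -
    have [measurable]: "\<phi> \<in> borel_measurable borel" by (rule borel_measurable_continuous_onI[OF c])
    have loc_int: "loc_int \<phi>" by (rule loc_int_continuous[OF c])
    \<comment> \<open>\<open>\<psi> x\<close> is minus the mean of \<open>\<phi>\<close> over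
      \<open>[x - h, x]\<close>: it inherits the bound 1 and is continuously differentiable although
      \<open>\<phi>\<close> is only continuous.\<close>
    define \<psi> where "\<psi> x = (oint \<phi> 0 (x - h) - oint \<phi> 0 x) / h" for x
    have der: "(\<psi> has_real_derivative (\<phi> (x - h) - \<phi> x) / h) (at x)" for x
      unfolding \<psi>_def
      by (rule derivative_eq_intros DERIV_chain2[OF oint_deriv[OF c]] oint_deriv[OF c] refl | use h in simp)+
    have eq: "\<psi> x = oint \<phi> x (x - h) / h" for x unfolding \<psi>_def by (simp add: oint_minus[OF loc_int])
    have b1: "\<bar>\<psi> x\<bar> \<le> 1" for x
    proof -
      have "\<bar>oint \<phi> x (x - h)\<bar> \<le> 1 * \<bar>(x - h) - x\<bar>" by (rule oint_bound[OF loc_int]) (use b in auto)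
      then show ?thesis using h by (simp add: eq)
    qed
    have s1: "- \<bar>R\<bar> \<le> x \<and> x \<le> \<bar>R\<bar> + h" if "\<psi> x \<noteq> 0" for x
    proof (rule ccontr)
      assume n: "\<not> (- \<bar>R\<bar> \<le> x \<and> x \<le> \<bar>R\<bar> + h)"
      have "oint \<phi> x (x - h) = oint (\<lambda>x. 0) x (x - h)"
      proof (rule oint_cong_AE[OF loc_int loc_int_continuous], goal_cases)
        case 2
        have "\<phi> y = 0" if "min x (x - h) < y \<and> y < max x (x - h)" for y
        proof (rule ccontr)
          assume "\<phi> y \<noteq> 0"
          then have "\<bar>y\<bar> \<le> R" by (rule s)
          then show False using that n h by (auto simp: min_def max_def abs_if split: if_splits)
        qed
        then show ?case by auto
      qed auto
      then show False using that by (simp add: eq)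
    qed
    have "\<psi> \<in> C1_compact_support UNIV"
      by (rule C1_compact_support_realI[OF der _ s1]) (use h in \<open>auto intro!: continuous_intros continuous_on_compose2[OF c]\<close>)
    then have "(LINT x|lborel. g x * deriv \<psi> x) \<le> K" using b1 by (rule K)
    moreover have "deriv \<psi> x = (\<phi> (x - h) - \<phi> x) / h" for x by (rule DERIV_imp_deriv[OF der])
    ultimately have "(LINT x|lborel. (g x * \<phi> (x - h) - g x * \<phi> x) / h) \<le> K" by (simp add: right_diff_distrib)
    moreover have i1: "integrable lborel (\<lambda>x. g x * \<phi> (x - h))"
      by (rule Bochner_Integration.integrable_bound[OF g]) (use b in \<open>auto simp: abs_mult intro!: AE_I2 mult_left_le\<close>)
    moreover have i2: "integrable lborel (\<lambda>x. g x * \<phi> x)"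
      by (rule Bochner_Integration.integrable_bound[OF g]) (use b in \<open>auto simp: abs_mult intro!: AE_I2 mult_left_le\<close>)
    moreover have i3: "integrable lborel (\<lambda>x. g (x + h) * \<phi> x)"
      by (rule Bochner_Integration.integrable_bound[OF gh]) (use b in \<open>auto simp: abs_mult intro!: AE_I2 mult_left_le\<close>)
    moreover have "(LINT x|lborel. g x * \<phi> (x - h)) = (LINT x|lborel. g (x + h) * \<phi> x)"
      using lborel_integral_real_affine[of 1 "\<lambda>x. g x * \<phi> (x - h)" h] by (simp add: add.commute)
    ultimately have "((LINT x|lborel. g (x + h) * \<phi> x) - (LINT x|lborel. g x * \<phi> x)) / h \<le> K" by simp
    then show ?thesis using h i2 i3 by (simp add: f_def left_diff_distrib field_simps)
  qed
  obtain \<phi> where ph: "\<And>n. continuous_on UNIV (\<phi> n)" "\<And>n x. \<bar>\<phi> n x\<bar> \<le> (1::real)"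
    "\<And>n x. \<phi> n x \<noteq> 0 \<Longrightarrow> \<bar>x\<bar> \<le> real n" "AE x in lborel. (\<lambda>n. \<phi> n x) \<longlonglongrightarrow> sgn (f x)"
    by (rule continuous_approx_AE[of "\<lambda>x. sgn (f x)" 1]) (auto simp: sgn_if)
  have [measurable]: "\<phi> n \<in> borel_measurable borel" for n by (rule borel_measurable_continuous_onI[OF ph(1)])
  have "(\<lambda>n. LINT x|lborel. f x * \<phi> n x) \<longlonglongrightarrow> (LINT x|lborel. f x * sgn (f x))"
  proof (rule integral_dominated_convergence[where w="\<lambda>x. \<bar>f x\<bar>"])
    show "AE x in lborel. (\<lambda>n. f x * \<phi> n x) \<longlonglongrightarrow> f x * sgn (f x)"
      using ph(4) by eventually_elim (intro tendsto_intros)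
    show "AE x in lborel. norm (f x * \<phi> n x) \<le> \<bar>f x\<bar>" for n
      using ph(2) by (auto simp: abs_mult intro!: AE_I2 mult_left_le)
  qed (use f in auto)
  then have "(LINT x|lborel. f x * sgn (f x)) \<le> K * h"
    by (rule LIMSEQ_le_const2) (use 1[OF ph(1) ph(2) ph(3)] in blast)
  then show ?thesis by (simp add: f_def abs_sgn)
qed

text \<open>For absolutely continuous \<open>g\<close> one bounds the difference by the integral of
  the modulus of its derivative between \<open>a y\<close> and \<open>b y\<close> and applies
  Fubini: for fixed \<open>x\<close> the parameters \<open>y\<close> with
  \<open>\<bar>a y - x\<bar> \<le> d\<close> lie in an interval of length at most
  \<open>2 * d / c\<close>. Here \<open>g\<close> is replaced by its forward average
  \<open>G\<close> of width \<open>\<epsilon>\<close>, whose derivative has L1 norm at most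
  \<open>K\<close>; the error, carried through the changes of variables \<open>a\<close> and
  \<open>b\<close>, vanishes with \<open>\<epsilon>\<close>.\<close>

lemma bv_composition:
  fixes g :: "real \<Rightarrow> real"
  assumes g: "integrable lborel g" and K: "\<And>h. h > 0 \<Longrightarrow> (LINT x|lborel. \<bar>g (x + h) - g x\<bar>) \<le> K * h"
    and a: "bilip c L a" and b: "bilip c L b" and d: "\<And>y. \<bar>a y - b y\<bar> \<le> d"
  shows "(LINT y|lborel. \<bar>g (a y) - g (b y)\<bar>) \<le> 2 * K / c * d"
proof -
  have [measurable]: "g \<in> borel_measurable borel" using g by simp
  have [measurable]: "a \<in> borel_measurable borel" "b \<in> borel_measurable borel" using a b by (auto intro: bilip_borel)
  have c: "c > 0" by (rule bilip_pos[OF a])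
  have K0: "K \<ge> 0"
  proof -
    have "0 \<le> (LINT x|lborel. \<bar>g (x + 1) - g x\<bar>)" by simp
    also have "\<dots> \<le> K * 1" by (rule K) simp
    finally show ?thesis by simp
  qed
  have d0: "d \<ge> 0" using d[of 0] by linarith
  have loc_int: "loc_int g" by (rule loc_int_integrable[OF g])
  have gs: "integrable lborel (\<lambda>x. g (x + s))" for s
    using lborel_integrable_real_affine[OF g, of 1 s] by (simp add: add.commute)
  have Kn: "(\<integral>\<^sup>+x. ennreal \<bar>g (x + h) - g x\<bar> \<partial>lborel) \<le> ennreal (K * h)" if "h \<ge> 0" for h
  proof (cases "h = 0")
    case False
    have "(\<integral>\<^sup>+x. ennreal \<bar>g (x + h) - g x\<bar> \<partial>lborel) = ennreal (LINT x|lborel. \<bar>g (x + h) - g x\<bar>)"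
      by (rule nn_integral_eq_integral) (use g gs[of h] in auto)
    then show ?thesis using K[of h] False that by (simp add: ennreal_leI)
  qed simp
  have main: "(\<integral>\<^sup>+y. ennreal \<bar>g (a y) - g (b y)\<bar> \<partial>lborel) \<le> ennreal (2 * K / c * d + 2 * K / c * \<epsilon>)" if e: "\<epsilon> > 0" for \<epsilon>
  proof -
    \<comment> \<open>The average is written over the fixed interval \<open>{0..\<epsilon>}\<close>,
      which makes measurability in \<open>x\<close> evident; \<open>Go\<close> gives the form that
      can be differenced in \<open>x\<close>.\<close>
    define G where "G x = (LINT s|lborel. indicator {0..\<epsilon>} s * g (x + s)) / \<epsilon>" for x
    have G[measurable]: "G \<in> borel_measurable borel" unfolding G_def by measurable
    have Go: "G x = oint g x (x + \<epsilon>) / \<epsilon>" for x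
      using oint_shift[of g 0 x \<epsilon>] e by (simp add: G_def oint_le set_lebesgue_integral_def add.commute)
    have 1: "(\<integral>\<^sup>+x. ennreal \<bar>G x - g x\<bar> \<partial>lborel) \<le> ennreal (K * \<epsilon>)"
    proof -
      have le: "ennreal \<bar>G x - g x\<bar> \<le> (\<integral>\<^sup>+s. ennreal (1 / \<epsilon>) * (indicator {0..\<epsilon>} s * ennreal \<bar>g (x + s) - g x\<bar>) \<partial>lborel)" for x
      proof -
        have i1: "integrable lborel (\<lambda>s. indicator {0..\<epsilon>} s * g (x + s))"
          using loc_intD[OF loc_int_shift[OF loc_int, of x], of 0 \<epsilon>] by (simp add: set_integrable_def add.commute)
        have i2: "integrable lborel (\<lambda>s. indicator {0..\<epsilon>} s * g x)"
          by (intro integrable_mult_left) (auto simp: integrable_indicator_iff emeasure_lborel_Icc_eq)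
        have i3: "integrable lborel (\<lambda>s. indicator {0..\<epsilon>} s * (g (x + s) - g x))"
          using Bochner_Integration.integrable_diff[OF i1 i2] by (simp add: right_diff_distrib)
        have "(LINT s|lborel. indicator {0..\<epsilon>} s * g x) = \<epsilon> * g x" using e by simp
        then have "G x - g x = (LINT s|lborel. indicator {0..\<epsilon>} s * (g (x + s) - g x)) / \<epsilon>"
          using e Bochner_Integration.integral_diff[OF i1 i2] by (simp add: G_def right_diff_distrib field_simps)
        then have "\<bar>G x - g x\<bar> = \<bar>LINT s|lborel. indicator {0..\<epsilon>} s * (g (x + s) - g x)\<bar> / \<epsilon>" using e by simp
        also have "\<dots> \<le> (LINT s|lborel. \<bar>indicator {0..\<epsilon>} s * (g (x + s) - g x)\<bar>) / \<epsilon>"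
          using e integral_abs_bound by (intro divide_right_mono) auto
        finally have "ennreal \<bar>G x - g x\<bar> \<le> ennreal (1 / \<epsilon>) * ennreal (LINT s|lborel. \<bar>indicator {0..\<epsilon>} s * (g (x + s) - g x)\<bar>)"
          using e by (subst ennreal_mult[symmetric]) (auto intro!: ennreal_leI)
        also have "ennreal (LINT s|lborel. \<bar>indicator {0..\<epsilon>} s * (g (x + s) - g x)\<bar>) = (\<integral>\<^sup>+s. ennreal \<bar>indicator {0..\<epsilon>} s * (g (x + s) - g x)\<bar> \<partial>lborel)"
          by (rule nn_integral_eq_integral[symmetric]) (use i3 in auto)
        also have "\<dots> = (\<integral>\<^sup>+s. indicator {0..\<epsilon>} s * ennreal \<bar>g (x + s) - g x\<bar> \<partial>lborel)"
          by (rule nn_integral_cong) (auto simp: indicator_def)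
        finally show ?thesis by (simp add: nn_integral_cmult)
      qed
      have "(\<integral>\<^sup>+x. ennreal \<bar>G x - g x\<bar> \<partial>lborel) \<le>
        (\<integral>\<^sup>+x. \<integral>\<^sup>+s. ennreal (1 / \<epsilon>) * (indicator {0..\<epsilon>} s * ennreal \<bar>g (x + s) - g x\<bar>) \<partial>lborel \<partial>lborel)"
        by (rule nn_integral_mono) (rule le)
      also have "\<dots> = (\<integral>\<^sup>+s. \<integral>\<^sup>+x. ennreal (1 / \<epsilon>) * (indicator {0..\<epsilon>} s * ennreal \<bar>g (x + s) - g x\<bar>) \<partial>lborel \<partial>lborel)"
        by (rule lborel_pair.Fubini') measurable
      also have "\<dots> = (\<integral>\<^sup>+s. ennreal (1 / \<epsilon>) * (indicator {0..\<epsilon>} s * (\<integral>\<^sup>+x. ennreal \<bar>g (x + s) - g x\<bar> \<partial>lborel)) \<partial>lborel)"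
        by (simp add: nn_integral_cmult)
      also have "\<dots> \<le> (\<integral>\<^sup>+s. ennreal K * indicator {0..\<epsilon>} s \<partial>lborel)"
      proof (rule nn_integral_mono)
        fix s
        show "ennreal (1 / \<epsilon>) * (indicator {0..\<epsilon>} s * (\<integral>\<^sup>+x. ennreal \<bar>g (x + s) - g x\<bar> \<partial>lborel)) \<le> ennreal K * indicator {0..\<epsilon>} s"
        proof (cases "s \<in> {0..\<epsilon>}")
          case True
          have "ennreal (1 / \<epsilon>) * (\<integral>\<^sup>+x. ennreal \<bar>g (x + s) - g x\<bar> \<partial>lborel) \<le> ennreal (1 / \<epsilon>) * ennreal (K * s)"
            by (rule mult_left_mono) (use Kn True in auto)
          also have "\<dots> \<le> ennreal K" using True e K0 by (simp add: ennreal_mult[symmetric] divide_le_eq mult_left_mono)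
          finally show ?thesis using True by simp
        qed simp
      qed
      also have "\<dots> = ennreal (K * \<epsilon>)" using e K0 by (simp add: nn_integral_cmult_indicator ennreal_mult)
      finally show ?thesis .
    qed
    \<comment> \<open>The modulus of the derivative of \<open>G\<close>; the translation estimate
      divided by \<open>\<epsilon>\<close> bounds its L1 norm by \<open>K\<close>.\<close>
    define k where "k x = \<bar>g (x + \<epsilon>) - g x\<bar> / \<epsilon>" for x
    have [measurable]: "k \<in> borel_measurable borel" unfolding k_def by measurable
    have k0: "k x \<ge> 0" for x using e by (simp add: k_def)
    have lik: "loc_int k" unfolding k_def using loc_int_cmult[OF loc_int_abs[OF loc_int_diff[OF loc_int_shift[OF loc_int, of \<epsilon>] loc_int]], of "1/\<epsilon>"] by simp
    have kK: "(\<integral>\<^sup>+x. ennreal (k x) \<partial>lborel) \<le> ennreal K"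
    proof -
      have "(\<integral>\<^sup>+x. ennreal (k x) \<partial>lborel) = (\<integral>\<^sup>+x. ennreal (1 / \<epsilon>) * ennreal \<bar>g (x + \<epsilon>) - g x\<bar> \<partial>lborel)"
        using e by (intro nn_integral_cong) (simp add: k_def ennreal_mult[symmetric])
      also have "\<dots> = ennreal (1 / \<epsilon>) * (\<integral>\<^sup>+x. ennreal \<bar>g (x + \<epsilon>) - g x\<bar> \<partial>lborel)" by (rule nn_integral_cmult) simp
      also have "\<dots> \<le> ennreal (1 / \<epsilon>) * ennreal (K * \<epsilon>)" by (rule mult_left_mono[OF Kn]) (use e in auto)
      also have "\<dots> = ennreal K" using e K0 by (simp add: ennreal_mult[symmetric])
      finally show ?thesis .
    qed
    have Gd: "ennreal \<bar>G p - G q\<bar> \<le> (\<integral>\<^sup>+x. indicator {min p q..max p q} x * ennreal (k x) \<partial>lborel)" for p q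
    proof -
      have pq: "oint g p (p + \<epsilon>) - oint g q (q + \<epsilon>) = oint (\<lambda>x. g (x + \<epsilon>) - g x) q p"
        using oint_add[OF loc_int, of p q "q + \<epsilon>"] oint_add[OF loc_int, of p "q + \<epsilon>" "p + \<epsilon>"] oint_shift[of g q \<epsilon> p] oint_swap[of g p q]
        by (simp add: oint_diff[OF loc_int_shift[OF loc_int] loc_int])
      have "G p - G q = oint (\<lambda>x. (1 / \<epsilon>) * (g (x + \<epsilon>) - g x)) q p"
        unfolding oint_cmult pq[symmetric] Go using e by (simp add: field_simps)
      then have "\<bar>G p - G q\<bar> = \<bar>oint (\<lambda>x. (1 / \<epsilon>) * (g (x + \<epsilon>) - g x)) (min p q) (max p q)\<bar>"
        using oint_swap[of "\<lambda>x. (1 / \<epsilon>) * (g (x + \<epsilon>) - g x)" p q] by (cases "p \<le> q") (auto simp: min_def max_def)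
      also have "\<dots> \<le> oint k (min p q) (max p q)"
        by (rule oint_abs_mono[OF loc_int_cmult[OF loc_int_diff[OF loc_int_shift[OF loc_int] loc_int]] lik]) (use e in \<open>auto simp: k_def abs_mult\<close>)
      also have "\<dots> = (LINT x|lborel. indicator {min p q..max p q} x * k x)" by (simp add: oint_le set_lebesgue_integral_def)
      finally have "ennreal \<bar>G p - G q\<bar> \<le> ennreal (LINT x|lborel. indicator {min p q..max p q} x * k x)" by (rule ennreal_leI)
      also have "\<dots> = (\<integral>\<^sup>+x. ennreal (indicator {min p q..max p q} x * k x) \<partial>lborel)"
        by (rule nn_integral_eq_integral[symmetric]) (use loc_intD[OF lik] k0 in \<open>auto simp: set_integrable_def\<close>)
      also have "\<dots> = (\<integral>\<^sup>+x. indicator {min p q..max p q} x * ennreal (k x) \<partial>lborel)"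
        by (rule nn_integral_cong) (auto simp: indicator_def)
      finally show ?thesis .
    qed
    have 2: "(\<integral>\<^sup>+y. ennreal \<bar>G (a y) - G (b y)\<bar> \<partial>lborel) \<le> ennreal (2 * K / c * d)"
    proof -
      have "(\<integral>\<^sup>+y. ennreal \<bar>G (a y) - G (b y)\<bar> \<partial>lborel) \<le>
        (\<integral>\<^sup>+y. \<integral>\<^sup>+x. indicator {min (a y) (b y)..max (a y) (b y)} x * ennreal (k x) \<partial>lborel \<partial>lborel)"
        by (rule nn_integral_mono) (rule Gd)
      \<comment> \<open>Replacing the interval between \<open>a y\<close> and \<open>b y\<close> by
        the ball of radius \<open>d\<close> around \<open>a y\<close> leaves only one of the two
        maps to invert, at the price of the factor 2 in the bound.\<close>
      also have "\<dots> \<le> (\<integral>\<^sup>+y. \<integral>\<^sup>+x. indicator {(x, y). \<bar>a y - x\<bar> \<le> d} (x, y) * ennreal (k x) \<partial>lborel \<partial>lborel)"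
      proof (intro nn_integral_mono mult_right_mono)
        fix x y :: real
        show "(indicator {min (a y) (b y)..max (a y) (b y)} x :: ennreal) \<le> indicator {(x, y). \<bar>a y - x\<bar> \<le> d} (x, y)"
          using d[of y] by (auto simp: indicator_def)
      qed simp
      also have "\<dots> = (\<integral>\<^sup>+x. \<integral>\<^sup>+y. indicator {(x, y). \<bar>a y - x\<bar> \<le> d} (x, y) * ennreal (k x) \<partial>lborel \<partial>lborel)"
        by (rule lborel_pair.Fubini'[symmetric]) measurable
      also have "\<dots> \<le> (\<integral>\<^sup>+x. ennreal (2 * d / c) * ennreal (k x) \<partial>lborel)"
      proof (rule nn_integral_mono)
        fix x
        have "(\<integral>\<^sup>+y. indicator {(x, y). \<bar>a y - x\<bar> \<le> d} (x, y) * ennreal (k x) \<partial>lborel)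
          \<le> (\<integral>\<^sup>+y. ennreal (k x) * indicator {inv a (x - d)..inv a (x + d)} y \<partial>lborel)"
        proof (rule nn_integral_mono)
          fix y
          have "inv a (x - d) \<le> y \<and> y \<le> inv a (x + d)" if "\<bar>a y - x\<bar> \<le> d"
            using bilip_leq[OF a, of "inv a (x - d)" y] bilip_leq[OF a, of y "inv a (x + d)"] that
            by (simp add: bilip_inv_simps[OF a] abs_le_iff)
          then show "indicator {(x, y). \<bar>a y - x\<bar> \<le> d} (x, y) * ennreal (k x) \<le> ennreal (k x) * indicator {inv a (x - d)..inv a (x + d)} y"
            by (auto simp: indicator_def)
        qed
        also have "\<dots> = ennreal (k x) * emeasure lborel {inv a (x - d)..inv a (x + d)}"
          by (rule nn_integral_cmult_indicator) simp
        also have "\<dots> \<le> ennreal (k x) * ennreal (2 * d / c)"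
        proof (rule mult_left_mono)
          have "x - d \<le> x + d" using d0 by simp
          then have "inv a (x - d) \<le> inv a (x + d)" "inv a (x + d) - inv a (x - d) \<le> 1 / c * ((x + d) - (x - d))"
            using bilip_inv[OF a] bilip_leq[OF bilip_inv[OF a]] unfolding bilip_def by blast+
          then show "emeasure lborel {inv a (x - d)..inv a (x + d)} \<le> ennreal (2 * d / c)"
            by (simp add: ennreal_leI)
        qed simp
        finally show "(\<integral>\<^sup>+y. indicator {(x, y). \<bar>a y - x\<bar> \<le> d} (x, y) * ennreal (k x) \<partial>lborel) \<le> ennreal (2 * d / c) * ennreal (k x)"
          by (simp add: mult.commute)
      qed
      also have "\<dots> = ennreal (2 * d / c) * (\<integral>\<^sup>+x. ennreal (k x) \<partial>lborel)" by (rule nn_integral_cmult) simp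
      also have "\<dots> \<le> ennreal (2 * d / c) * ennreal K" by (rule mult_left_mono[OF kK]) simp
      also have "\<dots> = ennreal (2 * K / c * d)" using d0 c K0 by (simp add: ennreal_mult[symmetric] mult.commute)
      finally show ?thesis .
    qed
    have 3: "(\<integral>\<^sup>+y. ennreal \<bar>G (u y) - g (u y)\<bar> \<partial>lborel) \<le> ennreal (K / c * \<epsilon>)" if u: "bilip c L u" for u
    proof -
      have "(\<integral>\<^sup>+y. ennreal \<bar>G (u y) - g (u y)\<bar> \<partial>lborel) \<le> ennreal (1 / c) * (\<integral>\<^sup>+x. ennreal \<bar>G x - g x\<bar> \<partial>lborel)"
        by (rule bilip_nn_integral_le[OF u]) simp
      also have "\<dots> \<le> ennreal (1 / c) * ennreal (K * \<epsilon>)" by (rule mult_left_mono[OF 1]) simp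
      also have "\<dots> = ennreal (K / c * \<epsilon>)" using c e K0 by (simp add: ennreal_mult[symmetric])
      finally show ?thesis .
    qed
    have "(\<integral>\<^sup>+y. ennreal \<bar>g (a y) - g (b y)\<bar> \<partial>lborel) \<le>
      (\<integral>\<^sup>+y. ennreal \<bar>G (a y) - g (a y)\<bar> + ennreal \<bar>G (b y) - g (b y)\<bar> + ennreal \<bar>G (a y) - G (b y)\<bar> \<partial>lborel)"
      by (rule nn_integral_mono) (simp add: ennreal_plus[symmetric] ennreal_leI del: ennreal_plus)
    also have "\<dots> = (\<integral>\<^sup>+y. ennreal \<bar>G (a y) - g (a y)\<bar> \<partial>lborel) + (\<integral>\<^sup>+y. ennreal \<bar>G (b y) - g (b y)\<bar> \<partial>lborel)
      + (\<integral>\<^sup>+y. ennreal \<bar>G (a y) - G (b y)\<bar> \<partial>lborel)"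
      by (simp add: nn_integral_add)
    also have "\<dots> \<le> ennreal (K / c * \<epsilon>) + ennreal (K / c * \<epsilon>) + ennreal (2 * K / c * d)"
      by (intro add_mono 2 3 a b)
    also have "\<dots> = ennreal (2 * K / c * d + 2 * K / c * \<epsilon>)"
      using e c K0 d0 by (simp add: ennreal_plus[symmetric] del: ennreal_plus)
    finally show ?thesis .
  qed
  have i: "integrable lborel (\<lambda>y. g (a y) - g (b y))"
    using bilip_integrable(1)[OF a g] bilip_integrable(1)[OF b g] by simp
  have eq: "(\<integral>\<^sup>+y. ennreal \<bar>g (a y) - g (b y)\<bar> \<partial>lborel) = ennreal (LINT y|lborel. \<bar>g (a y) - g (b y)\<bar>)"
    by (rule nn_integral_eq_integral) (use i in auto)
  have mm: "(LINT y|lborel. \<bar>g (a y) - g (b y)\<bar>) \<le> 2 * K / c * d + 2 * K / c * \<epsilon>" if "\<epsilon> > 0" for \<epsilon>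
    using main[OF that] that c K0 d0 unfolding eq by (subst (asm) ennreal_le_iff) auto
  then have *: "(LINT y|lborel. \<bar>g (a y) - g (b y)\<bar>) - 2 * K / c * d \<le> 2 * K / c * \<epsilon>" if "\<epsilon> > 0" for \<epsilon> using mm[OF that] by linarith
  show ?thesis
  proof (rule field_le_epsilon)
    fix e :: real assume "e > 0"
    \<comment> \<open>The summand 1 keeps the quotient defined when \<open>K = 0\<close>.\<close>
    define \<epsilon> where "\<epsilon> = e / (2 * K / c + 1)"
    have p: "2 * K / c \<ge> 0" using K0 c by simp
    have "\<epsilon> > 0" using \<open>e > 0\<close> p by (simp add: \<epsilon>_def add_nonneg_pos)
    moreover have "2 * K / c * \<epsilon> \<le> e" 
    proof -
      have "q * (e / (q + 1)) \<le> e" if "q \<ge> 0" for q :: real using that \<open>e > 0\<close> by (simp add: field_simps)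
      then show ?thesis using p unfolding \<epsilon>_def by blast
    qed
    ultimately show "(LINT y|lborel. \<bar>g (a y) - g (b y)\<bar>) \<le> 2 * K / c * d + e" using *[of \<epsilon>] by linarith
  qed
qed

lemma oint_FTC:
  assumes d: "\<And>x. (F has_real_derivative f x) (at x)" and c: "continuous_on UNIV f"
  shows "oint f a b = F b - F a"
proof -
  have "((\<lambda>x. oint f a x - F x) has_real_derivative 0) (at x)" for x
    by (rule derivative_eq_intros oint_deriv[OF c] d refl | simp)+
  then have "oint f a b - F b = oint f a a - F a" by (intro DERIV_isconst_all) auto
  then show ?thesis by simp
qed

lemma continuous_interval_bounded:
  fixes f :: "real \<Rightarrow> real"
  assumes "continuous_on UNIV f"
  obtains M where "0 \<le> M" "\<And>x. a \<le> x \<Longrightarrow> x \<le> b \<Longrightarrow> \<bar>f x\<bar> \<le> M"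
proof -
  have "bounded (f ` {a..b})"
    by (intro compact_imp_bounded compact_continuous_image continuous_on_subset[OF assms]) auto
  then obtain M where M: "\<forall>y\<in>f ` {a..b}. norm y \<le> M" unfolding bounded_iff by blast
  show ?thesis
  proof (rule that[of "max 0 M"])
    fix x assume "a \<le> x" "x \<le> b"
    then have "norm (f x) \<le> M" using M by auto
    then show "\<bar>f x\<bar> \<le> max 0 M" by simp
  qed simp
qed

section \<open>Weak derivatives\<close>

text \<open>The factor 6 normalises the integral over \<open>[0, 1]\<close> to 1. On this interval
  \<open>smoothstep\<close> is the cubic \<open>3 * x ^ 2 - 2 * x ^ 3\<close>, a step from 0 to 1
  that is continuously differentiable, as test functions have to be.\<close>

definition bump :: "real \<Rightarrow> real" where "bump x = max 0 (6 * x * (1 - x))"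
definition smoothstep :: "real \<Rightarrow> real" where "smoothstep x = oint bump 0 x"

lemma bump_continuous: "continuous_on UNIV bump"
  unfolding bump_def by (intro continuous_intros)

lemma bump_zero: "x \<le> 0 \<or> 1 \<le> x \<Longrightarrow> bump x = 0"
proof -
  assume "x \<le> 0 \<or> 1 \<le> x"
  then have "6 * x * (1 - x) \<le> 0" by (auto simp: mult_le_0_iff)
  then show ?thesis by (simp add: bump_def)
qed

lemma bump_bounds: "0 \<le> bump x" "bump x \<le> 3/2"
proof -
  show "0 \<le> bump x" by (simp add: bump_def)
  have "0 \<le> (x - 1/2)^2" by simp
  then have "6 * x * (1 - x) \<le> 3/2" by (simp add: power2_eq_square algebra_simps)
  then show "bump x \<le> 3/2" by (simp add: bump_def)
qed

lemma bump_measurable[measurable]: "bump \<in> borel_measurable borel"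
  by (rule borel_measurable_continuous_onI[OF bump_continuous])

lemma loc_int_bump: "loc_int bump" by (rule loc_int_continuous[OF bump_continuous])

lemma smoothstep_deriv: "(smoothstep has_real_derivative bump x) (at x)"
  unfolding smoothstep_def by (rule oint_deriv[OF bump_continuous])

lemma smoothstep_continuous: "continuous_on UNIV smoothstep"
  using smoothstep_deriv by (meson DERIV_continuous_on has_field_derivative_at_within)

lemma smoothstep_measurable[measurable]: "smoothstep \<in> borel_measurable borel"
  by (rule borel_measurable_continuous_onI[OF smoothstep_continuous])

lemma smoothstep_mono: assumes "x \<le> y" shows "smoothstep x \<le> smoothstep y"
proof (rule DERIV_nonneg_imp_nondecreasing[OF assms])
  show "\<And>z. x \<le> z \<Longrightarrow> z \<le> y \<Longrightarrow> \<exists>d. (smoothstep has_real_derivative d) (at z) \<and> 0 \<le> d"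
    using smoothstep_deriv bump_bounds(1) by blast
qed

lemma smoothstep_0: "x \<le> 0 \<Longrightarrow> smoothstep x = 0"
proof -
  assume "x \<le> 0"
  have "smoothstep x = oint (\<lambda>x. 0) 0 x" unfolding smoothstep_def
    by (rule oint_cong_AE[OF loc_int_bump]) (use \<open>x \<le> 0\<close> bump_zero in \<open>auto intro!: loc_int_continuous AE_I2\<close>)
  then show ?thesis by simp
qed

lemma smoothstep_1: "1 \<le> x \<Longrightarrow> smoothstep x = 1"
proof -
  assume "1 \<le> x"
  have "oint bump 0 1 = oint (\<lambda>x. 6 * x * (1 - x)) 0 1"
    by (rule oint_cong_AE[OF loc_int_bump]) (auto intro!: loc_int_continuous continuous_intros AE_I2 simp: bump_def)
  also have "\<dots> = (3 * 1 ^ 2 - 2 * 1 ^ 3) - (3 * 0 ^ 2 - 2 * 0 ^ 3)"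
    by (rule oint_FTC) (auto intro!: derivative_eq_intros continuous_intros simp: algebra_simps power2_eq_square power3_eq_cube)
  finally have 1: "oint bump 0 1 = 1" by simp
  have "oint bump 1 x = oint (\<lambda>x. 0) 1 x"
    by (rule oint_cong_AE[OF loc_int_bump]) (use \<open>1 \<le> x\<close> bump_zero in \<open>auto intro!: loc_int_continuous AE_I2\<close>)
  then show ?thesis using oint_add[OF loc_int_bump, of 0 1 x] 1 by (simp add: smoothstep_def)
qed

lemma smoothstep_bounds: "0 \<le> smoothstep x" "smoothstep x \<le> 1"
  using smoothstep_mono[of "min 0 x" x] smoothstep_0[of "min 0 x"]
    smoothstep_mono[of x "max 1 x"] smoothstep_1[of "max 1 x"] by auto

lemma smoothstep_scaled_deriv:
  assumes "\<epsilon> \<noteq> 0"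
  shows "((\<lambda>x. smoothstep ((x - a) / \<epsilon>)) has_real_derivative bump ((x - a) / \<epsilon>) / \<epsilon>) (at x)"
proof -
  have "((\<lambda>x. (x - a) / \<epsilon>) has_real_derivative 1 / \<epsilon>) (at x)"
    by (rule derivative_eq_intros refl | use assms in simp)+
  from DERIV_chain2[OF smoothstep_deriv this] show ?thesis by simp
qed

text \<open>The rescaled bumps have unit mass and lie to the right of \<open>a\<close>, so the right
  limit of \<open>f\<close> decides; after the substitution \<open>x = a + \<epsilon> * s\<close>
  they become one fixed weight on \<open>[0, 1]\<close>.\<close>

lemma bump_average_limit:
  fixes f :: "real \<Rightarrow> real"
  assumes [measurable]: "f \<in> borel_measurable borel" and c: "(f \<longlongrightarrow> f a) (at_right a)"
    and B: "\<And>x. a \<le> x \<Longrightarrow> x \<le> a + 1 \<Longrightarrow> \<bar>f x\<bar> \<le> B"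
  shows "(\<lambda>n. LINT x|lborel. f x * (bump ((x - a) / inverse (real (Suc n))) / inverse (real (Suc n)))) \<longlonglongrightarrow> f a"
proof -
  have eq: "(LINT x|lborel. f x * (bump ((x - a) / \<epsilon>) / \<epsilon>)) = (LINT s|lborel. f (a + \<epsilon> * s) * bump s)" if "\<epsilon> > 0" for \<epsilon>
    using lborel_integral_real_affine[of \<epsilon> "\<lambda>x. f x * (bump ((x - a) / \<epsilon>) / \<epsilon>)" a] that
    by simp
  have B0: "0 \<le> B" using B[of a] by simp
  have "(\<lambda>n. LINT s|lborel. f (a + inverse (real (Suc n)) * s) * bump s) \<longlonglongrightarrow> (LINT s|lborel. f a * bump s)"
  proof (rule integral_dominated_convergence[where w="\<lambda>s::real. indicator {0..1} s * (2 * B)"])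
    show "integrable lborel (\<lambda>s::real. indicator {0..1} s * (2 * B) :: real)"
      by (intro integrable_mult_left) (auto simp: integrable_indicator_iff)
    show "AE s in lborel. (\<lambda>n. f (a + inverse (real (Suc n)) * s) * bump s) \<longlonglongrightarrow> f a * bump s"
    proof (rule AE_I2)
      fix s
      show "(\<lambda>n. f (a + inverse (real (Suc n)) * s) * bump s) \<longlonglongrightarrow> f a * bump s"
      proof (cases "0 < s")
        case True
        have "(\<lambda>n. a + inverse (real (Suc n)) * s) \<longlonglongrightarrow> a + 0 * s"
          by (intro tendsto_intros LIMSEQ_inverse_real_of_nat)
        then have "filterlim (\<lambda>n. a + inverse (real (Suc n)) * s) (at_right a) sequentially"
          unfolding filterlim_at using True by auto
        then have "(\<lambda>n. f (a + inverse (real (Suc n)) * s)) \<longlonglongrightarrow> f a" by (rule filterlim_compose[OF c])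
        then show ?thesis by (intro tendsto_intros)
      qed (simp add: bump_zero)
    qed
    show "AE s in lborel. norm (f (a + inverse (real (Suc n)) * s) * bump s) \<le> indicator {0..1} s * (2 * B)" for n
    proof (rule AE_I2)
      fix s
      show "norm (f (a + inverse (real (Suc n)) * s) * bump s) \<le> indicator {0..1} s * (2 * B)"
      proof (cases "0 < s \<and> s < 1")
        case True
        have "inverse (real (Suc n)) * s \<le> 1 * 1" by (rule mult_mono) (use True in \<open>auto simp: inverse_le_1_iff\<close>)
        then have "\<bar>f (a + inverse (real (Suc n)) * s)\<bar> \<le> B" using True by (intro B) auto
        then have "\<bar>f (a + inverse (real (Suc n)) * s)\<bar> * bump s \<le> B * 2"
          by (rule mult_mono) (use bump_bounds[of s] B0 in auto)
        then show ?thesis using True bump_bounds[of s] by (simp add: abs_mult)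
      next
        case False
        then show ?thesis using B0 bump_zero[of s] by (auto simp: indicator_def)
      qed
    qed
  qed measurable
  moreover have "(LINT s|lborel. f a * bump s) = f a"
  proof -
    have "(LINT s|lborel. bump s) = (LINT s|lborel. indicator {0..1} s * bump s)"
    proof (rule Bochner_Integration.integral_cong)
      show "bump s = indicator {0..1} s * bump s" for s
        using bump_zero[of s] by (cases "s \<in> {0..1}") auto
    qed simp
    also have "\<dots> = oint bump 0 1" by (simp add: oint_le set_lebesgue_integral_def)
    also have "\<dots> = 1" using smoothstep_1[of 1] by (simp add: smoothstep_def)
    finally show ?thesis by simp
  qed
  ultimately show ?thesis by (subst eq) (auto simp del: of_nat_Suc)
qed

text \<open>Test with the difference of two smoothed steps starting at \<open>a\<close> and at
  \<open>b\<close>: its derivative is a difference of unit bumps, which converge to point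
  evaluations. The bound on \<open>g\<close> is asked up to \<open>b + 1\<close> because the second
  layer lies to the right of \<open>b\<close>.\<close>

lemma weak_derivative_lipschitz:
  assumes cf: "continuous_on UNIV f" and wd: "is_weak_derivative f g" and ab: "a < b"
    and C: "AE x in lborel. a \<le> x \<and> x \<le> b + 1 \<longrightarrow> \<bar>g x\<bar> \<le> C" and C0: "0 \<le> C"
  shows "\<bar>f b - f a\<bar> \<le> C * (b - a)"
proof -
  have [measurable]: "f \<in> borel_measurable borel" by (rule borel_measurable_continuous_onI[OF cf])
  define e where "e n = inverse (real (Suc n))" for n
  have e: "0 < e n" "e n \<le> 1" for n by (auto simp: e_def inverse_le_1_iff)
  define B where "B u n x = bump ((x - u) / e n) / e n" for u n x
  have Bc: "continuous_on UNIV (B u n)" for u n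
    unfolding B_def using e[of n] by (intro continuous_intros continuous_on_compose2[OF bump_continuous]) auto
  have [measurable]: "B u n \<in> borel_measurable borel" for u n by (rule borel_measurable_continuous_onI[OF Bc])
  obtain M where M: "\<And>x. a \<le> x \<Longrightarrow> x \<le> b + 1 \<Longrightarrow> \<bar>f x\<bar> \<le> M"
    using continuous_interval_bounded[OF cf, of a "b + 1"] by blast
  have cr: "(f \<longlongrightarrow> f u) (at_right u)" for u
    using cf by (meson continuous_on_def UNIV_I tendsto_within_subset subset_UNIV)
  have lim: "(\<lambda>n. (LINT x|lborel. f x * B a n x) - (LINT x|lborel. f x * B b n x)) \<longlonglongrightarrow> f a - f b"
    unfolding B_def e_def
    by (intro tendsto_diff bump_average_limit[where B=M] cr) (use M ab in auto)
  have bound: "\<bar>(LINT x|lborel. f x * B a n x) - (LINT x|lborel. f x * B b n x)\<bar> \<le> C * (b - a + e n)" for n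
  proof -
    define \<phi> where "\<phi> x = smoothstep ((x - a) / e n) - smoothstep ((x - b) / e n)" for x
    have der: "(\<phi> has_real_derivative B a n x - B b n x) (at x)" for x
      unfolding \<phi>_def B_def using e[of n] by (intro DERIV_diff smoothstep_scaled_deriv) auto
    have supp: "a \<le> x \<and> x \<le> b + e n" if "\<phi> x \<noteq> 0" for x
    proof (rule ccontr)
      assume n: "\<not> (a \<le> x \<and> x \<le> b + e n)"
      have "\<phi> x = 0"
      proof (cases "a \<le> x")
        case True
        then have "1 \<le> (x - a) / e n" "1 \<le> (x - b) / e n" using n ab e[of n] by (auto simp: field_simps)
        then show ?thesis by (simp add: \<phi>_def smoothstep_1)
      next
        case False
        then have "(x - a) / e n \<le> 0" "(x - b) / e n \<le> 0" using ab e[of n] by (auto simp: divide_le_0_iff)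
        then show ?thesis by (simp add: \<phi>_def smoothstep_0)
      qed
      then show False using that by simp
    qed
    have pb: "0 \<le> \<phi> x" "\<phi> x \<le> 1" for x
    proof -
      have "(x - b) / e n \<le> (x - a) / e n" using ab e[of n] by (intro divide_right_mono) auto
      then show "0 \<le> \<phi> x" using smoothstep_mono by (simp add: \<phi>_def)
      show "\<phi> x \<le> 1" using smoothstep_bounds[of "(x - a) / e n"] smoothstep_bounds[of "(x - b) / e n"] by (simp add: \<phi>_def)
    qed
    have C1: "\<phi> \<in> C1_compact_support UNIV"
      by (rule C1_compact_support_realI[OF der _ supp]) (intro continuous_intros Bc)
    have "(LINT x|lebesgue. f x * deriv \<phi> x) = - (LINT x|lebesgue. g x * \<phi> x)"
      using wd C1 by (simp add: is_weak_derivative_def)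
    moreover have "deriv \<phi> x = B a n x - B b n x" for x by (rule DERIV_imp_deriv[OF der])
    moreover have "\<bar>LINT x|lebesgue. g x * \<phi> x\<bar> \<le> C * (b - a + e n)"
    proof -
      have "\<bar>LINT x|lebesgue. g x * \<phi> x\<bar> \<le> (LINT x|lebesgue. \<bar>g x * \<phi> x\<bar>)" by (rule integral_abs_bound)
      also have "\<dots> \<le> (LINT x|lebesgue. C * indicator {a..b + e n} x)"
      proof (rule integral_mono_AE')
        show "integrable lebesgue (\<lambda>x. C * indicator {a..b + e n} x :: real)"
          by (intro integrable_mult_right) (auto simp: integrable_indicator_iff emeasure_lborel_Icc_eq)
        show "AE x in lebesgue. \<bar>g x * \<phi> x\<bar> \<le> C * indicator {a..b + e n} x"
          unfolding AE_lebesgue_lborel using C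
        proof eventually_elim
          case (elim x)
          show ?case
          proof (cases "\<phi> x = 0")
            case True then show ?thesis using C0 by simp
          next
            case False
            then have x: "a \<le> x" "x \<le> b + e n" using supp by auto
            then have "\<bar>g x\<bar> \<le> C" using elim e[of n] by auto
            then have "\<bar>g x\<bar> * \<phi> x \<le> C * 1" by (rule mult_mono) (use pb[of x] C0 in auto)
            then show ?thesis using x pb(1)[of x] by (simp add: abs_mult)
          qed
        qed
      qed (use C0 in auto)
      also have "\<dots> = C * (b - a + e n)" using ab e[of n] by (simp add: algebra_simps)
      finally show ?thesis .
    qed
    moreover have "(LINT x|lebesgue. f x * (B a n x - B b n x)) = (LINT x|lborel. f x * B a n x) - (LINT x|lborel. f x * B b n x)"
    proof -
      have i: "integrable lborel (\<lambda>x. f x * B u n x)" if "a \<le> u" "u \<le> b" for u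
      proof -
        have "loc_int (\<lambda>x. f x * B u n x)" by (intro loc_int_continuous continuous_intros cf Bc)
        then have "integrable lborel (\<lambda>x. indicator {u..u + e n} x * (f x * B u n x))"
          by (auto dest: loc_intD simp: set_integrable_def)
        moreover have "indicator {u..u + e n} x * (f x * B u n x) = f x * B u n x" for x
        proof (cases "x \<in> {u..u + e n}")
          case False
          then have "(x - u) / e n \<le> 0 \<or> 1 \<le> (x - u) / e n" using e[of n] by (auto simp: field_simps divide_le_0_iff)
          then show ?thesis by (simp add: B_def bump_zero)
        qed simp
        ultimately show ?thesis by simp
      qed
      have "(LINT x|lebesgue. f x * (B a n x - B b n x)) = (LINT x|lborel. f x * (B a n x - B b n x))"
        by (rule integral_completion) measurable
      then show ?thesis using i[of a] i[of b] ab by (simp add: right_diff_distrib)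
    qed
    ultimately show ?thesis by simp
  qed
  have "\<bar>f a - f b\<bar> \<le> C * (b - a + 0)"
  proof (rule LIMSEQ_le)
    show "(\<lambda>n. \<bar>(LINT x|lborel. f x * B a n x) - (LINT x|lborel. f x * B b n x)\<bar>) \<longlonglongrightarrow> \<bar>f a - f b\<bar>"
      by (rule tendsto_rabs[OF lim])
    show "(\<lambda>n. C * (b - a + e n)) \<longlonglongrightarrow> C * (b - a + 0)"
      unfolding e_def by (intro tendsto_intros LIMSEQ_inverse_real_of_nat)
  qed (use bound in \<open>auto intro: exI[of _ 0]\<close>)
  then show ?thesis by (simp add: abs_minus_commute)
qed

text \<open>The weak derivative of \<open>V\<close> is bounded only locally, so the constant is
  attached to a range \<open>[-R, R]\<close>, later the range of the nonlocal term.\<close>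

lemma W1infty_loc_lipschitz:
  assumes "V \<in> W1infty_loc"
  shows "continuous_on UNIV V" "\<exists>L\<ge>0. \<forall>a\<in>{-R..R}. \<forall>b\<in>{-R..R}. \<bar>V b - V a\<bar> \<le> L * \<bar>b - a\<bar>"
proof -
  show c: "continuous_on UNIV V" using assms by (simp add: W1infty_loc_def)
  obtain g where g: "g \<in> Linfty_loc" "is_weak_derivative V g" using assms by (auto simp: W1infty_loc_def)
  have "g \<in> Linfty {-R..R+1}" using g(1) by (auto simp: Linfty_loc_def)
  then obtain C where "AE x in lebesgue_on {-R..R+1}. \<bar>g x\<bar> \<le> C" by (auto simp: Linfty_def)
  then have C: "AE x in lborel. x \<in> {-R..R+1} \<longrightarrow> \<bar>g x\<bar> \<le> C"
    by (subst (asm) AE_restrict_space_iff) (auto simp: AE_lebesgue_lborel)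
  have *: "\<bar>V b - V a\<bar> \<le> \<bar>C\<bar> * (b - a)" if "-R \<le> a" "a < b" "b \<le> R" for a b
    by (rule weak_derivative_lipschitz[OF c g(2) that(2)])
      (use C in eventually_elim, use that in auto)
  have "\<bar>V b - V a\<bar> \<le> \<bar>C\<bar> * \<bar>b - a\<bar>" if "a \<in> {-R..R}" "b \<in> {-R..R}" for a b
    using *[of a b] *[of b a] that by (cases a b rule: linorder_cases) (auto simp: abs_minus_commute)
  then show "\<exists>L\<ge>0. \<forall>a\<in>{-R..R}. \<forall>b\<in>{-R..R}. \<bar>V b - V a\<bar> \<le> L * \<bar>b - a\<bar>"
    by (intro exI[of _ "\<bar>C\<bar>"]) auto
qed

lemma C1_compact_support_realE:
  fixes \<phi> :: "real \<Rightarrow> real"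
  assumes "\<phi> \<in> C1_compact_support UNIV"
  obtains \<phi>' R C where "\<And>x. (\<phi> has_real_derivative \<phi>' x) (at x)" "continuous_on UNIV \<phi>'" "0 < R"
    "\<And>x. R \<le> \<bar>x\<bar> \<Longrightarrow> \<phi> x = 0 \<and> \<phi>' x = 0" "\<And>x. \<bar>\<phi> x\<bar> \<le> C \<and> \<bar>\<phi>' x\<bar> \<le> C"
proof -
  obtain D where D: "\<And>z. (\<phi> has_derivative blinfun_apply (D z)) (at z)" "continuous_on UNIV D"
    and K: "compact (closure {z. \<phi> z \<noteq> 0})" using assms by (auto simp: C1_compact_support_def)
  define \<phi>' where "\<phi>' x = blinfun_apply (D x) 1" for x
  have der: "(\<phi> has_real_derivative \<phi>' x) (at x)" for x
  proof -
    have "blinfun_apply (D x) = (*) (\<phi>' x)"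
    proof
      fix y
      have "blinfun_apply (D x) (y *\<^sub>R 1) = y *\<^sub>R blinfun_apply (D x) 1" by (rule blinfun.scaleR_right)
      then show "blinfun_apply (D x) y = \<phi>' x * y" by (simp add: \<phi>'_def mult.commute)
    qed
    then show ?thesis using D(1)[of x] by (simp add: has_field_derivative_def)
  qed
  have c': "continuous_on UNIV \<phi>'" unfolding \<phi>'_def by (intro continuous_intros D(2))
  have c: "continuous_on UNIV \<phi>" using der by (meson DERIV_continuous_on has_field_derivative_at_within)
  obtain R0 where R0: "\<And>x. x \<in> closure {z. \<phi> z \<noteq> 0} \<Longrightarrow> \<bar>x\<bar> \<le> R0"
    using compact_imp_bounded[OF K] by (auto simp: bounded_iff)
  \<comment> \<open>The summand 1 places all points with \<open>\<bar>x\<bar> \<ge> R\<close> in the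
    open complement of the support, so that the derivative vanishes there too.\<close>
  define R where "R = \<bar>R0\<bar> + 1"
  have nz: "\<phi> y = 0" if "y \<notin> closure {z. \<phi> z \<noteq> 0}" for y
  proof (rule ccontr)
    assume "\<phi> y \<noteq> 0"
    then have "y \<in> {z. \<phi> z \<noteq> 0}" by simp
    then have "y \<in> closure {z. \<phi> z \<noteq> 0}" by (rule subsetD[OF closure_subset])
    then show False using that by simp
  qed
  have z: "\<phi> x = 0 \<and> \<phi>' x = 0" if "R \<le> \<bar>x\<bar>" for x
  proof -
    have x: "x \<notin> closure {z. \<phi> z \<noteq> 0}" using R0[of x] that by (auto simp: R_def)
    then have "\<phi> x = 0" by (rule nz)
    moreover have "(\<phi> has_real_derivative 0) (at x)"
    proof (rule has_field_derivative_transform_within_open[of "\<lambda>_. 0" 0 x "- closure {z. \<phi> z \<noteq> 0}" \<phi>])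
      show "0 = \<phi> y" if "y \<in> - closure {z. \<phi> z \<noteq> 0}" for y using nz[of y] that by simp
    qed (use x in \<open>auto simp: closed_closure\<close>)
    then have "\<phi>' x = 0" using der DERIV_unique by blast
    ultimately show ?thesis by simp
  qed
  obtain C1 where C1: "0 \<le> C1" "\<And>x. - R \<le> x \<Longrightarrow> x \<le> R \<Longrightarrow> \<bar>\<phi> x\<bar> \<le> C1"
    using continuous_interval_bounded[OF c, of "-R" R] by blast
  obtain C2 where C2: "0 \<le> C2" "\<And>x. - R \<le> x \<Longrightarrow> x \<le> R \<Longrightarrow> \<bar>\<phi>' x\<bar> \<le> C2"
    using continuous_interval_bounded[OF c', of "-R" R] by blast
  show ?thesis
  proof (rule that[of \<phi>' R "max C1 C2"])
    fix x
    show "\<bar>\<phi> x\<bar> \<le> max C1 C2 \<and> \<bar>\<phi>' x\<bar> \<le> max C1 C2"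
    proof (cases "R \<le> \<bar>x\<bar>")
      case True then show ?thesis using z[of x] C1(1) by simp
    next
      case False
      then have "- R \<le> x" "x \<le> R" by auto
      then show ?thesis using C1(2)[of x] C2(2)[of x] by (simp add: le_max_iff_disj)
    qed
  qed (use der c' z in \<open>auto simp: R_def\<close>)
qed

lemma lipschitz_from_deriv:
  assumes d: "\<And>x. (f has_real_derivative f' x) (at x)" and C: "\<And>x. \<bar>f' x\<bar> \<le> C"
  shows "\<bar>f y - f x\<bar> \<le> C * \<bar>y - x\<bar>"
  using field_differentiable_bound[of UNIV f f' C y x] d C by auto

text \<open>The almost everywhere derivative serves as \<open>g\<close>: the product of
  \<open>f\<close> with a test function is Lipschitz, hence the integral of its own derivative, and
  its boundary values vanish.\<close>

lemma lipschitz_weak_derivative: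
  assumes lip: "\<And>x y. \<bar>f y - f x\<bar> \<le> L * \<bar>y - x\<bar>" and bd: "\<And>x. \<bar>f x\<bar> \<le> B"
  shows "\<exists>g. is_weak_derivative f g \<and> (\<forall>x. \<bar>g x\<bar> \<le> L)"
proof -
  obtain h where h[measurable]: "h \<in> borel_measurable borel" and hL: "\<And>x. \<bar>h x\<bar> \<le> L"
    and fh: "\<And>a b. f b - f a = oint h a b" and dh: "AE x in lborel. (f has_real_derivative h x) (at x)"
    by (rule lipschitz_density[OF lip]) (rule that)
  have cf: "continuous_on UNIV f" by (rule lipschitz_real_continuous[OF lip])
  have [measurable]: "f \<in> borel_measurable borel" by (rule borel_measurable_continuous_onI[OF cf])
  have B0: "B \<ge> 0" using bd[of 0] by linarith
  have loc: "u \<in> L1_loc" if "u \<in> borel_measurable borel" "\<And>x. \<bar>u x\<bar> \<le> C" for u C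
    unfolding L1_loc_def set_integrable_def
  proof (intro CollectI allI impI)
    fix K :: "real set" assume "compact K"
    then have K: "emeasure lborel K < \<infinity>" "K \<in> sets borel"
      using emeasure_compact_finite[OF \<open>compact K\<close>] borel_compact[OF \<open>compact K\<close>] by auto
    have "integrable lborel (\<lambda>x. indicator K x *\<^sub>R u x)"
      by (rule integrableI_bounded_set[where A=K and B=C]) (use K that in \<open>auto simp: indicator_def\<close>)
    then show "integrable lebesgue (\<lambda>x. indicator K x *\<^sub>R u x)"
      by (subst integrable_completion) auto
  qed
  have "(LINT x|lebesgue. f x * deriv \<phi> x) = - (LINT x|lebesgue. h x * \<phi> x)" if ph: "\<phi> \<in> C1_compact_support UNIV" for \<phi>
  proof -
    obtain \<phi>' R C where p: "\<And>x. (\<phi> has_real_derivative \<phi>' x) (at x)" "continuous_on UNIV \<phi>'" "0 < R"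
      "\<And>x. R \<le> \<bar>x\<bar> \<Longrightarrow> \<phi> x = 0 \<and> \<phi>' x = 0" "\<And>x. \<bar>\<phi> x\<bar> \<le> C \<and> \<bar>\<phi>' x\<bar> \<le> C"
      by (rule C1_compact_support_realE[OF ph]) (rule that)
    have cp: "continuous_on UNIV \<phi>" using p(1) by (meson DERIV_continuous_on has_field_derivative_at_within)
    have [measurable]: "\<phi> \<in> borel_measurable borel" "\<phi>' \<in> borel_measurable borel"
      by (auto intro!: borel_measurable_continuous_onI cp p(2))
    have pC: "\<bar>\<phi> x\<bar> \<le> C" "\<bar>\<phi>' x\<bar> \<le> C" for x using p(5)[of x] by auto
    have C0: "C \<ge> 0" using pC[of 0] by linarith
    have L0: "L \<ge> 0" using hL[of 0] by linarith
    have lipp: "\<bar>f y * \<phi> y - f x * \<phi> x\<bar> \<le> (B * C + C * L) * \<bar>y - x\<bar>" for x y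
    proof -
      have "f y * \<phi> y - f x * \<phi> x = f y * (\<phi> y - \<phi> x) + \<phi> x * (f y - f x)" by (simp add: algebra_simps)
      then have "\<bar>f y * \<phi> y - f x * \<phi> x\<bar> \<le> \<bar>f y\<bar> * \<bar>\<phi> y - \<phi> x\<bar> + \<bar>\<phi> x\<bar> * \<bar>f y - f x\<bar>"
        by (metis abs_mult abs_triangle_ineq)
      also have "\<dots> \<le> B * (C * \<bar>y - x\<bar>) + C * (L * \<bar>y - x\<bar>)"
        by (intro add_mono mult_mono bd lip lipschitz_from_deriv[OF p(1)]) (use pC B0 C0 in auto)
      finally show ?thesis by (simp add: algebra_simps)
    qed
    obtain k where k[measurable]: "k \<in> borel_measurable borel" and kL: "\<And>x. \<bar>k x\<bar> \<le> B * C + C * L"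
      and fk: "\<And>a b. f b * \<phi> b - f a * \<phi> a = oint k a b"
      and dk: "AE x in lborel. ((\<lambda>x. f x * \<phi> x) has_real_derivative k x) (at x)"
      by (rule lipschitz_density[OF lipp]) (rule that)
    have bb: "loc_int (\<lambda>x. f x * \<phi>' x)" "loc_int (\<lambda>x. h x * \<phi> x)"
    proof -
      show "loc_int (\<lambda>x. f x * \<phi>' x)"
        by (rule loc_int_bounded[of _ "B * C"]) (auto simp: abs_mult intro!: mult_mono bd B0 pC)
      show "loc_int (\<lambda>x. h x * \<phi> x)"
        by (rule loc_int_bounded[of _ "L * C"]) (auto simp: abs_mult intro!: mult_mono hL L0 pC)
    qed
    have "0 = oint k (-R) R" unfolding fk[symmetric] using p(4)[of R] p(4)[of "-R"] p(3) by simp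
    also have "\<dots> = oint (\<lambda>x. f x * \<phi>' x + h x * \<phi> x) (-R) R"
    proof (rule oint_cong_AE[OF loc_int_bounded[OF k kL] loc_int_add[OF bb]])
      show "AE x in lborel. min (-R) R < x \<and> x < max (-R) R \<longrightarrow> k x = f x * \<phi>' x + h x * \<phi> x"
        using dk dh
      proof eventually_elim
        case (elim x)
        have "((\<lambda>x. f x * \<phi> x) has_real_derivative h x * \<phi> x + \<phi>' x * f x) (at x)" by (rule DERIV_mult[OF elim(2) p(1)])
        with elim(1) have "k x = h x * \<phi> x + \<phi>' x * f x" by (rule DERIV_unique)
        then show ?case by simp
      qed
    qed
    also have "\<dots> = oint (\<lambda>x. f x * \<phi>' x) (-R) R + oint (\<lambda>x. h x * \<phi> x) (-R) R" by (rule oint_sum[OF bb])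
    finally have 0: "oint (\<lambda>x. f x * \<phi>' x) (-R) R + oint (\<lambda>x. h x * \<phi> x) (-R) R = 0" by simp
    have full: "oint u (-R) R = (LINT x|lebesgue. u x)" if "u \<in> borel_measurable borel" "\<And>x. R \<le> \<bar>x\<bar> \<Longrightarrow> u x = 0" for u
    proof -
      have "oint u (-R) R = (LINT x|lborel. indicator {-R..R} x *\<^sub>R u x)" using p(3) by (simp add: oint_le set_lebesgue_integral_def)
      also have "\<dots> = (LINT x|lborel. u x)"
      proof (rule Bochner_Integration.integral_cong)
        show "indicator {-R..R} x *\<^sub>R u x = u x" for x
          using that(2)[of x] by (cases "R \<le> \<bar>x\<bar>") (auto simp: indicator_def)
      qed simp
      also have "\<dots> = (LINT x|lebesgue. u x)" by (rule integral_completion[symmetric]) (use that in simp)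
      finally show ?thesis .
    qed
    have "deriv \<phi> x = \<phi>' x" for x by (rule DERIV_imp_deriv[OF p(1)])
    then show ?thesis using 0 full[of "\<lambda>x. f x * \<phi>' x"] full[of "\<lambda>x. h x * \<phi> x"] p(4) by simp
  qed
  then have "is_weak_derivative f h" unfolding is_weak_derivative_def
    using loc[of f B] loc[of h L] bd hL by auto
  then show ?thesis using hL by blast
qed

section \<open>Borel representatives and null sets in the plane\<close>

lemma lebesgue_rep:
  fixes f :: "'a::euclidean_space \<Rightarrow> real"
  assumes "f \<in> borel_measurable lebesgue"
  obtains g where "g \<in> borel_measurable borel" "AE x in lborel. f x = g x"
  using completion_ex_borel_measurable_real[OF assms] by auto

lemma lebesgue_on_rep:
  fixes f :: "'a::euclidean_space \<Rightarrow> real"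
  assumes f: "f \<in> borel_measurable (lebesgue_on S)" and S: "S \<in> sets borel"
  obtains g where "g \<in> borel_measurable borel" "AE x in lborel. x \<in> S \<longrightarrow> f x = g x"
proof -
  have "(\<lambda>x. indicator S x *\<^sub>R f x) \<in> borel_measurable lebesgue"
    using f S by (subst (asm) borel_measurable_restrict_space_iff) auto
  then obtain g where g: "g \<in> borel_measurable borel" "AE x in lborel. indicator S x *\<^sub>R f x = g x"
    by (rule lebesgue_rep)
  show ?thesis
  proof (rule that[OF g(1)])
    show "AE x in lborel. x \<in> S \<longrightarrow> f x = g x" using g(2) by eventually_elim auto
  qed
qed

text \<open>Measurability of \<open>f\<close> comes from the completeness of Lebesgue measure, so
  that the given representatives enter only through an almost everywhere equality.\<close>

lemma LINT_lebesgue_rep: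
  fixes f g :: "'a::euclidean_space \<Rightarrow> real"
  assumes g[measurable]: "g \<in> borel_measurable borel" and fg: "AE x in lborel. f x = g x"
  shows "(LINT x|lebesgue. f x) = (LINT x|lborel. g x)" "integrable lebesgue f \<longleftrightarrow> integrable lborel g"
    "f \<in> borel_measurable lebesgue"
proof -
  have gl: "g \<in> borel_measurable lebesgue" by (rule measurable_completion) simp
  have fg': "AE x in lebesgue. f x = g x" using fg by (simp add: AE_completion_iff)
  show fl: "f \<in> borel_measurable lebesgue"
  proof (rule measurableI)
    fix A :: "real set" assume A: "A \<in> sets borel"
    have gA: "g -` A \<in> sets lebesgue" using measurable_sets[OF gl A] by simp
    have n: "{x. f x \<noteq> g x} \<in> null_sets lebesgue"
      using fg' by (subst (asm) eventually_ae_filter) (auto intro: completion.complete2)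
    have m: "N \<in> sets lebesgue" if "N \<subseteq> {x. f x \<noteq> g x}" for N
      using completion.complete2[OF that n] by auto
    have "f -` A = (g -` A - {x. f x \<noteq> g x}) \<union> (f -` A \<inter> {x. f x \<noteq> g x})" by auto
    also have "\<dots> \<in> sets lebesgue" by (intro sets.Un sets.Diff gA m) auto
    finally show "f -` A \<inter> space lebesgue \<in> sets lebesgue" by simp
  qed simp
  have "(LINT x|lebesgue. f x) = (LINT x|lebesgue. g x)" by (rule integral_cong_AE[OF fl gl fg'])
  then show "(LINT x|lebesgue. f x) = (LINT x|lborel. g x)" by (simp add: integral_completion)
  have "integrable lebesgue f \<longleftrightarrow> integrable lebesgue g" by (rule integrable_cong_AE[OF fl gl fg'])
  then show "integrable lebesgue f \<longleftrightarrow> integrable lborel g" by (simp add: integrable_completion)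
qed

text \<open>Exchanging the order of the variables needs a measurable exceptional set, hence the
  passage to a measurable null set \<open>N\<close> that contains it.\<close>

lemma AE_prodD:
  fixes P :: "real \<times> real \<Rightarrow> bool"
  assumes "AE z in lborel. P z"
  shows "AE t in lborel. AE x in lborel. P (t, x)" "AE x in lborel. AE t in lborel. P (t, x)"
proof -
  have *: "AE z in lborel \<Otimes>\<^sub>M lborel. P z" unfolding lborel_prod by (rule assms)
  then show "AE t in lborel. AE x in lborel. P (t, x)" by (rule lborel_pair.AE_pair)
  obtain N where N': "{z \<in> space (lborel \<Otimes>\<^sub>M lborel). \<not> P z} \<subseteq> N"
    "emeasure (lborel \<Otimes>\<^sub>M lborel) N = 0" "N \<in> sets (lborel \<Otimes>\<^sub>M lborel)"
    by (rule AE_E[OF *]) (rule that)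
  have N: "N \<in> sets (lborel \<Otimes>\<^sub>M lborel)" "emeasure (lborel \<Otimes>\<^sub>M lborel) N = 0" "{z. \<not> P z} \<subseteq> N"
    using N' by (auto simp: space_pair_measure)
  have "AE z in lborel \<Otimes>\<^sub>M lborel. (fst z, snd z) \<notin> N" using N by (intro AE_I[of _ _ N]) auto
  moreover have "{x \<in> space (lborel \<Otimes>\<^sub>M lborel). (fst x, snd x) \<notin> N} \<in> sets (lborel \<Otimes>\<^sub>M lborel)"
    using N(1) by measurable
  ultimately have "AE x in lborel. AE t in lborel. (t, x) \<notin> N"
    using lborel_pair.AE_commute[of "\<lambda>t x. (t, x) \<notin> N"] lborel_pair.AE_pair[of "\<lambda>z. (fst z, snd z) \<notin> N"] by simp
  then show "AE x in lborel. AE t in lborel. P (t, x)"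
  proof eventually_elim
    case (elim x)
    then show ?case by eventually_elim (use N(3) in blast)
  qed
qed

lemma AE_prodI:
  fixes P :: "real \<times> real \<Rightarrow> bool"
  assumes "{z. P z} \<in> sets borel" "AE t in lborel. AE x in lborel. P (t, x)"
  shows "AE z in lborel. P z"
  by (rule lborel_pair.AE_pair_measure[unfolded lborel_prod]) (use assms in auto)

lemma fubini_lborel:
  fixes f :: "real \<times> real \<Rightarrow> real"
  assumes "integrable lborel f"
  shows "(LINT z|lborel. f z) = (LINT t|lborel. LINT x|lborel. f (t, x))"
    "(LINT z|lborel. f z) = (LINT x|lborel. LINT t|lborel. f (t, x))"
    "AE t in lborel. integrable lborel (\<lambda>x. f (t, x))" "AE x in lborel. integrable lborel (\<lambda>t. f (t, x))"
proof -
  have i: "integrable (lborel \<Otimes>\<^sub>M lborel) f" using assms by (simp add: lborel_prod)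
  have i': "integrable (lborel \<Otimes>\<^sub>M lborel) (\<lambda>(t, x). f (t, x))" using i by simp
  show "(LINT z|lborel. f z) = (LINT t|lborel. LINT x|lborel. f (t, x))"
    using lborel_pair.integral_fst'[OF i] by (simp add: lborel_prod)
  show "(LINT z|lborel. f z) = (LINT x|lborel. LINT t|lborel. f (t, x))"
    using lborel_pair.integral_snd[OF i'] by (simp add: lborel_prod)
  show "AE t in lborel. integrable lborel (\<lambda>x. f (t, x))" by (rule lborel_pair.AE_integrable_fst'[OF i])
  show "AE x in lborel. integrable lborel (\<lambda>t. f (t, x))" using lborel_pair.AE_integrable_snd[OF i'] .
qed

text \<open>A curve is a null set of the plane, so joint measurability up to null sets says nothing
  about the values of \<open>w\<close> on it. Continuity in space does: for almost every
  \<open>s\<close> the averages over \<open>[\<eta> s, \<eta> s + e n]\<close> can be computed from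
  a Borel representative, and they converge to \<open>w s (\<eta> s)\<close>.\<close>

lemma caratheodory_measurable:
  fixes w :: "real \<Rightarrow> real \<Rightarrow> real"
  assumes w: "case_prod w \<in> borel_measurable (lebesgue_on ({0<..<T} \<times> UNIV))"
    and cw: "AE t in lebesgue_on {0<..<T}. continuous_on UNIV (w t)"
    and c\<eta>: "continuous_on {0..T} \<eta>" and T: "T > 0"
  obtains \<beta> where "\<beta> \<in> borel_measurable borel" "AE s in lborel. 0 < s \<and> s < T \<longrightarrow> w s (\<eta> s) = \<beta> s"
proof -
  obtain g where g: "g \<in> borel_measurable borel" "AE z in lborel. z \<in> {0<..<T} \<times> UNIV \<longrightarrow> case_prod w z = g z"
  proof (rule lebesgue_on_rep[OF w])
    show "{0<..<T} \<times> UNIV \<in> sets (borel :: (real \<times> real) measure)"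
      by (intro borel_open open_Times) auto
  qed (rule that)
  have [measurable]: "g \<in> borel_measurable (borel \<Otimes>\<^sub>M borel)" using g(1) by (simp add: borel_prod)
  have wg: "AE t in lborel. AE x in lborel. 0 < t \<and> t < T \<longrightarrow> w t x = g (t, x)"
    using AE_prodD(1)[OF g(2)] by simp
  have cw': "AE t in lborel. 0 < t \<and> t < T \<longrightarrow> continuous_on UNIV (w t)"
    using cw by (subst (asm) AE_restrict_space_iff) (auto simp: AE_completion_iff)
  \<comment> \<open>Clamping the time extends the curve continuously to the whole line.\<close>
  define a where "a s = \<eta> (max 0 (min T s))" for s
  have "continuous_on UNIV a" unfolding a_def
    by (rule continuous_on_compose2[OF c\<eta>]) (use T in \<open>auto intro!: continuous_intros\<close>)
  then have [measurable]: "a \<in> borel_measurable borel" by (rule borel_measurable_continuous_onI)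
  define e where "e n = inverse (real (Suc n))" for n
  define A where "A n s = (LINT x|lborel. (if a s \<le> x \<and> x \<le> a s + e n then g (s, x) else 0)) / e n" for n s
  have [measurable]: "A n \<in> borel_measurable borel" for n unfolding A_def by measurable
  define \<beta> where "\<beta> s = lim (\<lambda>n. A n s)" for s
  show ?thesis
  proof (rule that[of \<beta>])
    show "\<beta> \<in> borel_measurable borel" unfolding \<beta>_def by measurable
    show "AE s in lborel. 0 < s \<and> s < T \<longrightarrow> w s (\<eta> s) = \<beta> s"
      using wg cw'
    proof eventually_elim
      case (elim s)
      show ?case
      proof
        assume s: "0 < s \<and> s < T"
        have c: "continuous_on UNIV (w s)" using elim(2) s by blast
        have [measurable]: "w s \<in> borel_measurable borel" by (rule borel_measurable_continuous_onI[OF c])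
        have as: "a s = \<eta> s" using s by (simp add: a_def)
        have An: "A n s = (oint (w s) 0 (\<eta> s + e n) - oint (w s) 0 (\<eta> s)) / e n" for n
        proof -
          have "(LINT x|lborel. (if a s \<le> x \<and> x \<le> a s + e n then g (s, x) else 0)) = (LINT x|lborel. indicator {\<eta> s..\<eta> s + e n} x *\<^sub>R w s x)"
          proof (rule integral_cong_AE)
            show "AE x in lborel. (if a s \<le> x \<and> x \<le> a s + e n then g (s, x) else 0) = indicator {\<eta> s..\<eta> s + e n} x *\<^sub>R w s x"
              using elim(1) by eventually_elim (use s in \<open>auto simp: as\<close>)
          qed measurable
          then show ?thesis by (simp add: A_def oint_minus[OF loc_int_continuous[OF c]] oint_le set_lebesgue_integral_def e_def)
        qed
        have "((\<lambda>h. (oint (w s) 0 (\<eta> s + h) - oint (w s) 0 (\<eta> s)) / h) \<longlongrightarrow> w s (\<eta> s)) (at 0)"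
          using oint_deriv[OF c, of 0 "\<eta> s"] by (simp add: DERIV_def)
        moreover have "filterlim e (at 0) sequentially"
          unfolding filterlim_at e_def using LIMSEQ_inverse_real_of_nat by auto
        ultimately have "(\<lambda>n. A n s) \<longlonglongrightarrow> w s (\<eta> s)" unfolding An by (rule filterlim_compose)
        then show "w s (\<eta> s) = \<beta> s" unfolding \<beta>_def by (rule limI[symmetric])
      qed
    qed
  qed
qed

text \<open>Gronwall in the form of a contraction: \<open>step\<close> halves the weighted supremum norm
  of \<open>f\<close>, up to \<open>A\<close>.\<close>

lemma gronwall_sup:
  fixes f :: "real \<Rightarrow> 'y \<Rightarrow> real"
  assumes T: "0 \<le> T" and L: "0 < L" and A: "0 \<le> A"
    and f: "\<And>t y. t \<in> {0..T} \<Longrightarrow> 0 \<le> f t y \<and> f t y \<le> B"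
    and step: "\<And>m t y. 0 \<le> m \<Longrightarrow> (\<And>s y. s \<in> {0..T} \<Longrightarrow> f s y \<le> m * exp (2 * L * s)) \<Longrightarrow> t \<in> {0..T} \<Longrightarrow>
      f t y \<le> A + m / 2 * exp (2 * L * t)"
    and t: "t \<in> {0..T}"
  shows "f t y \<le> 2 * A * exp (2 * L * t)"
proof -
  define S where "S = (\<lambda>(s, y). f s y * exp (- (2 * L * s))) ` ({0..T} \<times> UNIV)"
  have ex: "exp (- (2 * L * s)) \<le> 1" if "s \<in> {0..T}" for s using that L by simp
  have bdd: "bdd_above S"
  proof (rule bdd_aboveI[of _ B])
    fix z assume "z \<in> S"
    then obtain s y where s: "s \<in> {0..T}" and z: "z = f s y * exp (- (2 * L * s))" by (auto simp: S_def)
    have "z \<le> f s y * 1" unfolding z by (rule mult_left_mono) (use ex[OF s] f[OF s] in auto)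
    then show "z \<le> B" using f[OF s, of y] by simp
  qed
  define m where "m = Sup S"
  have up: "f s y * exp (- (2 * L * s)) \<le> m" if "s \<in> {0..T}" for s y
    unfolding m_def by (rule cSup_upper[OF _ bdd]) (use that in \<open>auto simp: S_def\<close>)
  have conv: "f s y \<le> m * exp (2 * L * s)" if "s \<in> {0..T}" for s y
  proof -
    have "f s y * exp (- (2 * L * s)) * exp (2 * L * s) \<le> m * exp (2 * L * s)"
      by (rule mult_right_mono[OF up[OF that]]) simp
    then show ?thesis by (simp add: exp_minus field_simps)
  qed
  have m0: "0 \<le> m" using up[of 0] f[of 0] T by (metis atLeastAtMost_iff exp_ge_zero mult_nonneg_nonneg order_trans order_refl)
  have "m \<le> A + m / 2"
    unfolding m_def
  proof (rule cSup_least)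
    show "S \<noteq> {}" using T by (auto simp: S_def)
    fix z assume "z \<in> S"
    then obtain s y where s: "s \<in> {0..T}" and z: "z = f s y * exp (- (2 * L * s))" by (auto simp: S_def)
    have "f s y \<le> A + m / 2 * exp (2 * L * s)" by (rule step[OF m0 conv s])
    then have "z \<le> (A + m / 2 * exp (2 * L * s)) * exp (- (2 * L * s))" unfolding z by (rule mult_right_mono) simp
    also have "\<dots> = A * exp (- (2 * L * s)) + m / 2" by (simp add: algebra_simps exp_minus)
    also have "\<dots> \<le> A * 1 + m / 2" using ex[OF s] A by (intro add_right_mono mult_left_mono) auto
    finally show "z \<le> A + Sup S / 2" by (simp add: m_def)
  qed
  then have "m \<le> 2 * A" by simp
  then have "m * exp (2 * L * t) \<le> 2 * A * exp (2 * L * t)" by (intro mult_right_mono) auto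
  then show ?thesis using conv[OF t] by (meson order_trans)
qed

text \<open>Integrating the weight gains the factor \<open>1 / K\<close>. With
  \<open>K = 2 * L\<close> this produces the 1/2 that \<open>gronwall_sup\<close> asks for; the
  modulus in the exponent covers both directions of time.\<close>

lemma oint_exp:
  assumes K: "K > 0"
  shows "\<bar>oint (\<lambda>s. exp (K * \<bar>s - \<sigma>\<bar>)) \<sigma> \<tau>\<bar> \<le> exp (K * \<bar>\<tau> - \<sigma>\<bar>) / K"
proof -
  have loc_int: "loc_int (\<lambda>s. exp (K * \<bar>s - \<sigma>\<bar>))" by (intro loc_int_continuous continuous_intros)
  have "\<bar>oint (\<lambda>s. exp (K * \<bar>s - \<sigma>\<bar>)) \<sigma> \<tau>\<bar> = (exp (K * \<bar>\<tau> - \<sigma>\<bar>) - 1) / K"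
  proof (cases "\<sigma> \<le> \<tau>")
    case True
    have "oint (\<lambda>s. exp (K * \<bar>s - \<sigma>\<bar>)) \<sigma> \<tau> = oint (\<lambda>s. exp (K * (s - \<sigma>))) \<sigma> \<tau>"
      by (rule oint_cong_AE[OF loc_int]) (use True in \<open>auto intro!: loc_int_continuous continuous_intros AE_I2\<close>)
    also have "\<dots> = exp (K * (\<tau> - \<sigma>)) / K - exp (K * (\<sigma> - \<sigma>)) / K"
      by (rule oint_FTC) (use K in \<open>auto intro!: derivative_eq_intros continuous_intros\<close>)
    finally have "oint (\<lambda>s. exp (K * \<bar>s - \<sigma>\<bar>)) \<sigma> \<tau> = (exp (K * (\<tau> - \<sigma>)) - 1) / K" by (simp add: diff_divide_distrib)
    moreover have "0 \<le> (exp (K * (\<tau> - \<sigma>)) - 1) / K" using True K by simp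
    ultimately have "\<bar>oint (\<lambda>s. exp (K * \<bar>s - \<sigma>\<bar>)) \<sigma> \<tau>\<bar> = (exp (K * (\<tau> - \<sigma>)) - 1) / K"
      by (simp only: abs_of_nonneg)
    then show ?thesis using True by simp
  next
    case False
    have "oint (\<lambda>s. exp (K * \<bar>s - \<sigma>\<bar>)) \<sigma> \<tau> = oint (\<lambda>s. exp (K * (\<sigma> - s))) \<sigma> \<tau>"
      by (rule oint_cong_AE[OF loc_int]) (use False in \<open>auto intro!: loc_int_continuous continuous_intros AE_I2\<close>)
    also have "\<dots> = - exp (K * (\<sigma> - \<tau>)) / K - (- exp (K * (\<sigma> - \<sigma>)) / K)"
      by (rule oint_FTC) (use K in \<open>auto intro!: derivative_eq_intros continuous_intros\<close>)
    finally have "oint (\<lambda>s. exp (K * \<bar>s - \<sigma>\<bar>)) \<sigma> \<tau> = - ((exp (K * (\<sigma> - \<tau>)) - 1) / K)" by (simp add: diff_divide_distrib)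
    moreover have "0 \<le> (exp (K * (\<sigma> - \<tau>)) - 1) / K" using False K by simp
    ultimately have "\<bar>oint (\<lambda>s. exp (K * \<bar>s - \<sigma>\<bar>)) \<sigma> \<tau>\<bar> = (exp (K * (\<sigma> - \<tau>)) - 1) / K"
      by (simp only: abs_of_nonneg abs_minus_cancel)
    then show ?thesis using False by simp
  qed
  also have "\<dots> \<le> exp (K * \<bar>\<tau> - \<sigma>\<bar>) / K" using K by (intro divide_right_mono) auto
  finally show ?thesis .
qed

text \<open>Forward and backward stability at once: the Gronwall argument runs over the distance in
  time from \<open>\<sigma>\<close>, with the direction as the second parameter.\<close>

lemma char_compare:
  fixes e1 e2 \<beta>1 \<beta>2 :: "real \<Rightarrow> real"
  assumes L: "0 < L" and loc_int: "loc_int \<beta>1" "loc_int \<beta>2"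
    and e1: "\<And>s t. s \<in> {0..T} \<Longrightarrow> t \<in> {0..T} \<Longrightarrow> e1 t - e1 s = oint \<beta>1 s t"
    and e2: "\<And>s t. s \<in> {0..T} \<Longrightarrow> t \<in> {0..T} \<Longrightarrow> e2 t - e2 s = oint \<beta>2 s t"
    and lip: "AE s in lborel. 0 < s \<and> s < T \<longrightarrow> \<bar>\<beta>1 s - \<beta>2 s\<bar> \<le> L * \<bar>e1 s - e2 s\<bar>"
    and st: "\<sigma> \<in> {0..T}" "\<tau> \<in> {0..T}"
  shows "\<bar>e1 \<tau> - e2 \<tau>\<bar> \<le> 2 * exp (2 * L * T) * \<bar>e1 \<sigma> - e2 \<sigma>\<bar>"
proof -
  have T: "0 \<le> T" using st by simp
  define d where "d t = e1 t - e2 t" for t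
  define \<beta> where "\<beta> = (\<lambda>s. \<beta>1 s - \<beta>2 s)"
  have loc_int\<beta>: "loc_int \<beta>" unfolding \<beta>_def by (intro loc_int_diff loc_int)
  have d: "d t - d s = oint \<beta> s t" if "s \<in> {0..T}" "t \<in> {0..T}" for s t
    using e1[OF that] e2[OF that] by (simp add: d_def \<beta>_def oint_diff loc_int)
  \<comment> \<open>The velocities are only locally integrable, so the a priori bound required by
    \<open>gronwall_sup\<close> comes from the integral of the modulus of
    \<open>\<beta>\<close>.\<close>
  define B where "B = \<bar>d 0\<bar> + oint (\<lambda>s. \<bar>\<beta> s\<bar>) 0 T"
  have dB: "\<bar>d t\<bar> \<le> B" if "t \<in> {0..T}" for t
  proof -
    have "\<bar>oint \<beta> 0 t\<bar> \<le> oint (\<lambda>s. \<bar>\<beta> s\<bar>) 0 t" by (rule oint_abs_mono) (use that loc_int\<beta> in \<open>auto intro: loc_int_abs\<close>)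
    moreover have "0 \<le> oint (\<lambda>s. \<bar>\<beta> s\<bar>) t T" using that by (auto simp: oint_le set_lebesgue_integral_def)
    moreover have "oint (\<lambda>s. \<bar>\<beta> s\<bar>) 0 t + oint (\<lambda>s. \<bar>\<beta> s\<bar>) t T = oint (\<lambda>s. \<bar>\<beta> s\<bar>) 0 T" by (rule oint_add[OF loc_int_abs[OF loc_int\<beta>]])
    ultimately show ?thesis using d[of 0 t] that T by (auto simp: B_def)
  qed
  \<comment> \<open>The time at distance \<open>r\<close> from \<open>\<sigma>\<close>, later if
    \<open>y\<close> holds and earlier otherwise, clipped to \<open>{0..T}\<close>.\<close>
  define p where "p r y = max 0 (min T (\<sigma> + (if y then r else - r)))" for r :: real and y :: bool
  have p: "p r y \<in> {0..T}" for r y using T by (auto simp: p_def)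
  have pr: "\<bar>p r y - \<sigma>\<bar> \<le> r" if "0 \<le> r" for r y using that st by (auto simp: p_def)
  have main: "\<bar>d (p r y)\<bar> \<le> 2 * \<bar>d \<sigma>\<bar> * exp (2 * L * r)" if "r \<in> {0..T}" for r y
  proof (rule gronwall_sup[where B=B and f="\<lambda>r y. \<bar>d (p r y)\<bar>" and t=r and y=y, OF T L])
    show "0 \<le> \<bar>d (p t y)\<bar> \<and> \<bar>d (p t y)\<bar> \<le> B" for t y using dB[OF p] by simp
    fix m t y assume m: "0 \<le> m" and h: "\<And>s y. s \<in> {0..T} \<Longrightarrow> \<bar>d (p s y)\<bar> \<le> m * exp (2 * L * s)" and t: "t \<in> {0..T}"
    have h': "\<bar>d s\<bar> \<le> m * exp (2 * L * \<bar>s - \<sigma>\<bar>)" if "s \<in> {0..T}" for s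
    proof -
      have "p \<bar>s - \<sigma>\<bar> (\<sigma> \<le> s) = s" using that by (auto simp: p_def)
      then show ?thesis using h[of "\<bar>s - \<sigma>\<bar>" "\<sigma> \<le> s"] that st by auto
    qed
    define q where "q = p t y"
    have q: "q \<in> {0..T}" unfolding q_def by (rule p)
    define E where "E s = L * m * exp (2 * L * \<bar>s - \<sigma>\<bar>)" for s
    have liE: "loc_int E" unfolding E_def by (intro loc_int_continuous continuous_intros)
    have "AE s in lborel. min \<sigma> q < s \<and> s < max \<sigma> q \<longrightarrow> \<bar>\<beta> s\<bar> \<le> E s"
      using lip
    proof eventually_elim
      case (elim s)
      show ?case
      proof
        assume "min \<sigma> q < s \<and> s < max \<sigma> q"
        then have s: "0 < s" "s < T" using st q by auto
        then have "\<bar>\<beta> s\<bar> \<le> L * \<bar>d s\<bar>" using elim by (simp add: \<beta>_def d_def)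
        also have "\<dots> \<le> L * (m * exp (2 * L * \<bar>s - \<sigma>\<bar>))" using h'[of s] s L by (intro mult_left_mono) auto
        finally show "\<bar>\<beta> s\<bar> \<le> E s" by (simp add: E_def mult.assoc)
      qed
    qed
    then have "\<bar>oint \<beta> (min \<sigma> q) (max \<sigma> q)\<bar> \<le> oint E (min \<sigma> q) (max \<sigma> q)"
      by (intro oint_abs_mono[OF loc_int\<beta> liE]) auto
    then have "\<bar>oint \<beta> \<sigma> q\<bar> \<le> \<bar>oint E \<sigma> q\<bar>"
      using oint_swap[of \<beta> \<sigma> q] oint_swap[of E \<sigma> q] by (cases "\<sigma> \<le> q") (auto simp: min_def max_def)
    also have "\<dots> = L * m * \<bar>oint (\<lambda>s. exp (2 * L * \<bar>s - \<sigma>\<bar>)) \<sigma> q\<bar>"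
      unfolding E_def oint_cmult using L m by (simp add: abs_mult)
    also have "\<dots> \<le> L * m * (exp (2 * L * \<bar>q - \<sigma>\<bar>) / (2 * L))"
      by (intro mult_left_mono oint_exp) (use L m in auto)
    also have "\<dots> = m / 2 * exp (2 * L * \<bar>q - \<sigma>\<bar>)" using L by simp
    also have "\<dots> \<le> m / 2 * exp (2 * L * t)"
      using pr[of t y] t L m by (intro mult_left_mono) (auto simp: q_def)
    finally show "\<bar>d (p t y)\<bar> \<le> \<bar>d \<sigma>\<bar> + m / 2 * exp (2 * L * t)"
      using d[OF st(1) q] by (simp add: q_def)
  qed (use that in auto)
  have "p \<bar>\<tau> - \<sigma>\<bar> (\<sigma> \<le> \<tau>) = \<tau>" using st by (auto simp: p_def)
  moreover have "\<bar>\<tau> - \<sigma>\<bar> \<in> {0..T}" using st by auto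
  ultimately have "\<bar>d \<tau>\<bar> \<le> 2 * \<bar>d \<sigma>\<bar> * exp (2 * L * \<bar>\<tau> - \<sigma>\<bar>)" using main by metis
  also have "\<dots> \<le> 2 * \<bar>d \<sigma>\<bar> * exp (2 * L * T)" using \<open>\<bar>\<tau> - \<sigma>\<bar> \<in> {0..T}\<close> L by (intro mult_left_mono) auto
  finally show ?thesis by (simp add: d_def mult.commute mult.left_commute)
qed

section \<open>Test functions in space and time\<close>

lemma prod_partial_derivs:
  fixes \<phi> :: "real \<times> real \<Rightarrow> real"
  assumes "(\<phi> has_derivative (\<lambda>(s, y). a * s + b * y)) (at (t, x))"
  shows "((\<lambda>s. \<phi> (s, x)) has_real_derivative a) (at t)" "((\<lambda>y. \<phi> (t, y)) has_real_derivative b) (at x)"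
proof -
  have "((\<lambda>s. (s, x)) has_derivative (\<lambda>h. (h, 0))) (at t)" by (auto intro!: derivative_eq_intros)
  from has_derivative_compose[OF this, of \<phi> "\<lambda>(s, y). a * s + b * y"] assms
  have "((\<lambda>s. \<phi> (s, x)) has_derivative (\<lambda>h. a * h)) (at t)" by simp
  then show "((\<lambda>s. \<phi> (s, x)) has_real_derivative a) (at t)" by (simp add: has_field_derivative_def)
  have "((\<lambda>y. (t, y)) has_derivative (\<lambda>h. (0, h))) (at x)" by (auto intro!: derivative_eq_intros)
  from has_derivative_compose[OF this, of \<phi> "\<lambda>(s, y). a * s + b * y"] assms
  have "((\<lambda>y. \<phi> (t, y)) has_derivative (\<lambda>h. b * h)) (at x)" by simp
  then show "((\<lambda>y. \<phi> (t, y)) has_real_derivative b) (at x)" by (simp add: has_field_derivative_def)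
qed

lemma C1_compact_support_prodI:
  fixes \<phi> a b :: "real \<times> real \<Rightarrow> real"
  assumes d: "\<And>t x. (\<phi> has_derivative (\<lambda>(s, y). a (t, x) * s + b (t, x) * y)) (at (t, x))"
    and c: "continuous_on UNIV a" "continuous_on UNIV b"
    and s: "\<And>t x. \<phi> (t, x) \<noteq> 0 \<Longrightarrow> t1 \<le> t \<and> t \<le> t2 \<and> x1 \<le> x \<and> x \<le> x2" and t: "-42 < t1" "t2 < T"
  shows "\<phi> \<in> C1_compact_support ({-42<..<T} \<times> UNIV)"
proof -
  have sub: "closure {z. \<phi> z \<noteq> 0} \<subseteq> {t1..t2} \<times> {x1..x2}"
    by (rule closure_minimal) (use s in \<open>auto intro!: closed_Times\<close>)
  have K: "compact ({t1..t2} \<times> {x1..x2})" by (intro compact_Times) auto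
  have "compact (closure {z. \<phi> z \<noteq> 0})"
    using compact_Int_closed[OF K closed_closure[of "{z. \<phi> z \<noteq> 0}"]] sub by (simp add: Int_absorb1)
  moreover have "closure {z. \<phi> z \<noteq> 0} \<subseteq> {-42<..<T} \<times> UNIV" using sub t by fastforce
  moreover have "(\<phi> has_derivative blinfun_apply (a z *\<^sub>R fst_blinfun + b z *\<^sub>R snd_blinfun)) (at z)" for z
  proof -
    have "blinfun_apply (a z *\<^sub>R fst_blinfun + b z *\<^sub>R snd_blinfun) = (\<lambda>(s, y). a z * s + b z * y)"
      by (auto simp: fun_eq_iff blinfun.add_left blinfun.scaleR_left)
    then show ?thesis using d[of "fst z" "snd z"] by simp
  qed
  moreover have "continuous_on UNIV (\<lambda>z. a z *\<^sub>R fst_blinfun + b z *\<^sub>R (snd_blinfun :: (real \<times> real) \<Rightarrow>\<^sub>L real))"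
    by (intro continuous_intros c)
  ultimately show ?thesis unfolding C1_compact_support_def
    by (intro CollectI conjI exI[of _ "\<lambda>z. a z *\<^sub>R fst_blinfun + b z *\<^sub>R snd_blinfun"] allI)
qed

lemma C1_compact_support_prodE:
  fixes \<phi> :: "real \<times> real \<Rightarrow> real"
  assumes "\<phi> \<in> C1_compact_support ({-42<..<T} \<times> UNIV)"
  obtains a b R C where "\<And>t x. (\<phi> has_derivative (\<lambda>(s, y). a (t, x) * s + b (t, x) * y)) (at (t, x))"
    "continuous_on UNIV a" "continuous_on UNIV b"
    "\<And>t x. \<not> (t < T \<and> \<bar>x\<bar> \<le> R) \<Longrightarrow> \<phi> (t, x) = 0 \<and> a (t, x) = 0 \<and> b (t, x) = 0"
    "\<And>z. \<bar>\<phi> z\<bar> \<le> C \<and> \<bar>a z\<bar> \<le> C \<and> \<bar>b z\<bar> \<le> C"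
proof -
  obtain D where D: "\<And>z. (\<phi> has_derivative blinfun_apply (D z)) (at z)" "continuous_on UNIV D"
    and K: "compact (closure {z. \<phi> z \<noteq> 0})" and sub: "closure {z. \<phi> z \<noteq> 0} \<subseteq> {-42<..<T} \<times> UNIV"
    using assms by (auto simp: C1_compact_support_def)
  define a where "a z = blinfun_apply (D z) (1, 0)" for z
  define b where "b z = blinfun_apply (D z) (0, 1)" for z
  have bl: "blinfun_apply (D z) = (\<lambda>(s, y). a z * s + b z * y)" for z
  proof (rule ext, clarify)
    fix s y :: real
    have "blinfun_apply (D z) (s, y) = blinfun_apply (D z) (s *\<^sub>R (1, 0) + y *\<^sub>R (0, 1))" by simp
    also have "\<dots> = s * a z + y * b z" by (simp only: blinfun.add_right blinfun.scaleR_right a_def b_def real_scaleR_def)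
    finally show "blinfun_apply (D z) (s, y) = a z * s + b z * y" by (simp add: mult.commute)
  qed
  have der: "(\<phi> has_derivative (\<lambda>(s, y). a (t, x) * s + b (t, x) * y)) (at (t, x))" for t x
    using D(1)[of "(t, x)"] by (simp add: bl)
  have ca: "continuous_on UNIV a" "continuous_on UNIV b" unfolding a_def b_def by (intro continuous_intros D(2))+
  have c: "continuous_on UNIV \<phi>" by (intro continuous_at_imp_continuous_on ballI has_derivative_continuous[OF D(1)])
  have nz: "\<phi> y = 0" if "y \<notin> closure {z. \<phi> z \<noteq> 0}" for y
  proof (rule ccontr)
    assume "\<phi> y \<noteq> 0"
    then have "y \<in> {z. \<phi> z \<noteq> 0}" by simp
    then have "y \<in> closure {z. \<phi> z \<noteq> 0}" by (rule subsetD[OF closure_subset])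
    then show False using that by simp
  qed
  have z: "\<phi> z = 0 \<and> a z = 0 \<and> b z = 0" if x: "z \<notin> closure {z. \<phi> z \<noteq> 0}" for z
  proof -
    have "(\<phi> has_derivative (\<lambda>_. 0)) (at z)"
    proof (rule has_derivative_transform_within_open[of "\<lambda>_. 0" "\<lambda>_. 0" z UNIV "- closure {z. \<phi> z \<noteq> 0}" \<phi>])
      show "0 = \<phi> y" if "y \<in> - closure {z. \<phi> z \<noteq> 0}" for y using nz[of y] that by simp
    qed (use x in \<open>auto simp: closed_closure\<close>)
    then have "blinfun_apply (D z) = (\<lambda>_. 0)" by (rule has_derivative_unique[OF D(1)[of z], symmetric, THEN sym])
    then show ?thesis using nz[OF x] by (simp add: a_def b_def)
  qed
  have bd: "\<exists>C\<ge>0. \<forall>z. \<bar>u z\<bar> \<le> C" if cu: "continuous_on UNIV u" and uz: "\<And>z. z \<notin> closure {z. \<phi> z \<noteq> 0} \<Longrightarrow> u z = 0" for u :: "real \<times> real \<Rightarrow> real"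
  proof -
    have "bounded (u ` closure {z. \<phi> z \<noteq> 0})"
      by (intro compact_imp_bounded compact_continuous_image K continuous_on_subset[OF cu]) auto
    then obtain M where M: "\<forall>y\<in>u ` closure {z. \<phi> z \<noteq> 0}. norm y \<le> M" unfolding bounded_iff by blast
    show ?thesis
    proof (intro exI[of _ "max 0 M"] conjI allI)
      fix z show "\<bar>u z\<bar> \<le> max 0 M" using M uz[of z] by (cases "z \<in> closure {z. \<phi> z \<noteq> 0}") (auto simp: le_max_iff_disj)
    qed simp
  qed
  obtain C1 C2 C3 where C: "0 \<le> C1" "0 \<le> C2" "0 \<le> C3" "\<forall>z. \<bar>\<phi> z\<bar> \<le> C1" "\<forall>z. \<bar>a z\<bar> \<le> C2" "\<forall>z. \<bar>b z\<bar> \<le> C3"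
    using bd[OF c nz] bd[OF ca(1)] bd[OF ca(2)] z by metis
  obtain R where R: "\<forall>z\<in>closure {z. \<phi> z \<noteq> 0}. norm z \<le> R"
    using compact_imp_bounded[OF K] unfolding bounded_iff by blast
  show ?thesis
  proof (rule that[of a b R "C1 + C2 + C3", OF der ca])
    fix t x assume n: "\<not> (t < T \<and> \<bar>x\<bar> \<le> R)"
    have "(t, x) \<notin> closure {z. \<phi> z \<noteq> 0}"
    proof
      assume i: "(t, x) \<in> closure {z. \<phi> z \<noteq> 0}"
      then have "t < T" using sub by auto
      moreover have "norm x \<le> norm (t, x)" using norm_snd_le[of x t] by simp
      then have "\<bar>x\<bar> \<le> R" using R i by fastforce
      ultimately show False using n by simp
    qed
    then show "\<phi> (t, x) = 0 \<and> a (t, x) = 0 \<and> b (t, x) = 0" by (rule z)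
  next
    fix z show "\<bar>\<phi> z\<bar> \<le> C1 + C2 + C3 \<and> \<bar>a z\<bar> \<le> C1 + C2 + C3 \<and> \<bar>b z\<bar> \<le> C1 + C2 + C3"
      using C(1-3) C(4)[rule_format, of z] C(5)[rule_format, of z] C(6)[rule_format, of z] by linarith
  qed
qed

section \<open>Composition of bi-Lipschitz maps and their image densities\<close>

lemma bilip_diff_const: "bilip c L a \<Longrightarrow> bilip c L (\<lambda>y. a y - x)"
  unfolding bilip_def by auto

lemma bilip_id: "bilip 1 1 (\<lambda>x. x)" unfolding bilip_def by auto

lemma bilip_comp:
  assumes X: "bilip c L X" and Y: "bilip c' L' Y"
  shows "bilip (c * c') (L * L') (\<lambda>x. X (Y x))"
  unfolding bilip_def
proof (intro conjI allI impI)
  show "0 < c * c'" using bilip_pos[OF X] bilip_pos[OF Y] by simp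
  fix x y :: real assume xy: "x \<le> y"
  have 1: "c' * (y - x) \<le> Y y - Y x" "Y y - Y x \<le> L' * (y - x)" "Y x \<le> Y y"
    using Y xy bilip_leq[OF Y] unfolding bilip_def by blast+
  have 2: "c * (Y y - Y x) \<le> X (Y y) - X (Y x)" "X (Y y) - X (Y x) \<le> L * (Y y - Y x)"
    using X 1(3) unfolding bilip_def by blast+
  have "c * (c' * (y - x)) \<le> c * (Y y - Y x)" using 1 bilip_pos[OF X] by (intro mult_left_mono) auto
  then show "c * c' * (y - x) \<le> X (Y y) - X (Y x)" using 2 by (simp add: mult.assoc)
  have "L * (Y y - Y x) \<le> L * (L' * (y - x))" using 1 bilip_pos[OF X] by (intro mult_left_mono) auto
  then show "X (Y y) - X (Y x) \<le> L * L' * (y - x)" using 2 by (simp add: mult.assoc)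
qed

text \<open>\<open>dens X\<close> is the density of the image of Lebesgue measure under \<open>X\<close>, i.e. the derivative of
  \<open>inv X\<close>, with the almost everywhere ambiguity resolved so that it is bounded everywhere.\<close>

definition is_dens :: "(real \<Rightarrow> real) \<Rightarrow> (real \<Rightarrow> real) \<Rightarrow> bool" where
  "is_dens X h \<longleftrightarrow> h \<in> borel_measurable borel \<and> (\<exists>C. \<forall>x. 0 \<le> h x \<and> h x \<le> C) \<and>
    distr lborel borel X = density lborel (\<lambda>x. ennreal (h x)) \<and>
    (\<forall>a b. inv X b - inv X a = oint h a b) \<and>
    (AE x in lborel. (inv X has_real_derivative h x) (at x))"

definition dens :: "(real \<Rightarrow> real) \<Rightarrow> real \<Rightarrow> real" where
  "dens X = (SOME h. is_dens X h)"

lemma is_dens_dens: assumes "bilip c L X" shows "is_dens X (dens X)"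
proof -
  have L: "0 < 1 / L" using bilip_pos[OF assms] by simp
  obtain h where "h \<in> borel_measurable borel" "\<forall>x. 1 / L \<le> h x \<and> h x \<le> 1 / c"
    "distr lborel borel X = density lborel (\<lambda>x. ennreal (h x))"
    "\<forall>a b. inv X b - inv X a = oint h a b"
    "AE x in lborel. (inv X has_real_derivative h x) (at x)"
    using bilip_density[OF assms] by blast
  moreover from this(2) L have "\<forall>x. 0 \<le> h x \<and> h x \<le> 1 / c" by (meson less_imp_le order_trans)
  ultimately have "is_dens X h" unfolding is_dens_def by blast
  then show ?thesis unfolding dens_def by (rule someI[of "is_dens X"])
qed

lemma dens_measurable: "bilip c L X \<Longrightarrow> dens X \<in> borel_measurable borel"
  using is_dens_dens unfolding is_dens_def by blast
lemma dens_bounded: "bilip c L X \<Longrightarrow> \<exists>C. \<forall>x. 0 \<le> dens X x \<and> dens X x \<le> C"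
  using is_dens_dens unfolding is_dens_def by blast
lemma dens_deriv: "bilip c L X \<Longrightarrow> AE x in lborel. (inv X has_real_derivative dens X x) (at x)"
  using is_dens_dens unfolding is_dens_def by blast
lemma dens_cov:
  assumes X: "bilip c L X" and f: "f \<in> borel_measurable borel"
  shows "(LINT y|lborel. f (X y)) = (LINT x|lborel. dens X x * f x)"
  using is_dens_dens[OF X] unfolding is_dens_def
  by (intro bilip_cov[OF X _ _ _ f]) blast+

text \<open>Both functions are almost everywhere the derivative of one common primitive.\<close>

lemma oint_eq_AE_eq:
  assumes f: "f \<in> borel_measurable borel" "\<And>x. \<bar>f x\<bar> \<le> B" and g: "g \<in> borel_measurable borel" "\<And>x. \<bar>g x\<bar> \<le> C"
    and eq: "\<And>a b. a \<le> b \<Longrightarrow> oint f a b = oint g a b"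
  shows "AE x in lborel. f x = g x"
proof -
  have loc_int: "loc_int f" "loc_int g" by (auto intro: loc_int_bounded[OF f] loc_int_bounded[OF g])
  have eq': "oint f a b = oint g a b" for a b
    using eq[of a b] eq[of b a] oint_swap[of f a b] oint_swap[of g a b] by (cases "a \<le> b") auto
  have "AE x in lborel. ((\<lambda>x. oint f 0 x) has_real_derivative f x) (at x)"
    by (rule oint_AE_deriv[OF f]) (simp add: oint_minus loc_int)
  moreover have "AE x in lborel. ((\<lambda>x. oint f 0 x) has_real_derivative g x) (at x)"
    by (rule oint_AE_deriv[OF g]) (simp add: eq' oint_minus loc_int)
  ultimately show ?thesis by eventually_elim (rule DERIV_unique)
qed

lemma continuous_AE_eq:
  fixes f g :: "real \<Rightarrow> real"
  assumes f: "continuous_on UNIV f" and g: "continuous_on UNIV g" and eq: "AE x in lborel. f x = g x"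
  shows "f x = g x"
proof (rule ccontr)
  assume "f x \<noteq> g x"
  moreover have "open {x. f x \<noteq> g x}" using f g by (intro open_Collect_neq)
  ultimately have "\<not> negligible {x. f x \<noteq> g x}" by (intro open_not_negligible) auto
  then show False using eq negligible_AE[of "\<lambda>x. f x = g x"] by simp
qed

lemma LINT_interval_rep:
  assumes g[measurable]: "g \<in> borel_measurable borel" and fg: "AE s in lborel. min a b < s \<and> s < max a b \<longrightarrow> f s = g s"
  shows "(LINT s=ereal a..ereal b|lebesgue. f s) = oint g a b"
proof -
  have *: "(LINT s:{c<..<d}|lebesgue. f s) = (LBINT s:{c<..<d}. g s)" if "AE s in lborel. c < s \<and> s < d \<longrightarrow> f s = g s" for c d
    unfolding set_lebesgue_integral_def
    by (rule LINT_lebesgue_rep(1)) (use that in \<open>auto simp: indicator_def\<close>)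
  show ?thesis
  proof (cases "a \<le> b")
    case True
    then show ?thesis using *[of a b] fg
      by (simp add: oint_def interval_lebesgue_integral_def einterval_eq)
  next
    case False
    then show ?thesis using *[of b a] fg
      by (simp add: oint_def interval_lebesgue_integral_def einterval_eq)
  qed
qed

section \<open>Velocity coordinates and uniqueness of the flow\<close>

text \<open>\<open>qo\<close>, \<open>go\<close>, \<open>vo\<close> are the given representatives of initial datum, kernel and velocity; \<open>q0\<close>, \<open>\<gamma>\<close>, \<open>v\<close>
  are Borel versions for which all bounds hold everywhere.\<close>

locale nonlocal_data =
  fixes vl vu N K :: real and q0 \<gamma> V v qo go vo :: "real \<Rightarrow> real"
  assumes vl: "0 < vl"
    and v_meas[measurable]: "v \<in> borel_measurable borel" and v_lower: "\<And>x. vl \<le> v x" and v_upper: "\<And>x. v x \<le> vu"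
    and q0_meas[measurable]: "q0 \<in> borel_measurable borel" and q0_bound: "\<And>x. \<bar>q0 x\<bar> \<le> N"
    and gamma_int: "integrable lborel \<gamma>"
    and gamma_bv: "\<And>h. h > 0 \<Longrightarrow> (LINT x|lborel. \<bar>\<gamma> (x + h) - \<gamma> x\<bar>) \<le> K * h"
    and V_cont: "continuous_on UNIV V"
    and V_lip: "\<And>R. \<exists>L\<ge>0. \<forall>a\<in>{-R..R}. \<forall>b\<in>{-R..R}. \<bar>V b - V a\<bar> \<le> L * \<bar>b - a\<bar>"
    and qo: "AE x in lborel. qo x = q0 x" and go: "AE x in lborel. go x = \<gamma> x" and vo: "AE x in lborel. vo x = v x"
begin

lemma vu: "0 < vu" using vl v_lower[of 0] v_upper[of 0] by simp
lemma N0: "0 \<le> N" using q0_bound[of 0] by simp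
lemma gamma_meas[measurable]: "\<gamma> \<in> borel_measurable borel" using gamma_int by simp

lemma K0: "0 \<le> K"
proof -
  have "0 \<le> (LINT x|lborel. \<bar>\<gamma> (x + 1) - \<gamma> x\<bar>)" by simp
  also have "\<dots> \<le> K * 1" by (rule gamma_bv) simp
  finally show ?thesis by simp
qed

lemma V_meas[measurable]: "V \<in> borel_measurable borel" by (rule borel_measurable_continuous_onI[OF V_cont])

lemma V_bounded: "\<exists>M\<ge>0. \<forall>a\<in>{-R..R}. \<bar>V a\<bar> \<le> M"
  using continuous_interval_bounded[OF V_cont, of "-R" R] by (metis atLeastAtMost_iff)

text \<open>In the coordinate \<open>F\<close> the characteristic equation has the velocity \<open>V(w)\<close>: the discontinuous factor
  \<open>v\<close> has disappeared.\<close>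

definition F :: "real \<Rightarrow> real" where "F x = oint (\<lambda>y. 1 / v y) 0 x"
definition G :: "real \<Rightarrow> real" where "G = inv F"

lemma loc_int_rv: "loc_int (\<lambda>y. 1 / v y)"
proof (rule loc_int_bounded)
  show "\<bar>1 / v x\<bar> \<le> 1 / vl" for x using v_lower[of x] vl by (simp add: frac_le)
qed measurable

lemma F_diff: "F b - F a = oint (\<lambda>y. 1 / v y) a b"
  unfolding F_def by (rule oint_minus[OF loc_int_rv])

lemma F_bilip: "bilip (1 / vu) (1 / vl) F"
  unfolding bilip_def
proof (intro conjI allI impI)
  show "0 < 1 / vu" using vu by simp
  fix x y :: real assume xy: "x \<le> y"
  have b: "1 / vu \<le> 1 / v z" "1 / v z \<le> 1 / vl" for z
    using v_lower[of z] v_upper[of z] vl by (auto intro!: frac_le)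
  have "oint (\<lambda>_. 1 / vu) x y \<le> oint (\<lambda>y. 1 / v y) x y" "oint (\<lambda>y. 1 / v y) x y \<le> oint (\<lambda>_. 1 / vl) x y"
    by (rule oint_mono; use xy b loc_int_rv in \<open>auto intro: loc_int_continuous\<close>)+
  then show "1 / vu * (y - x) \<le> F y - F x" "F y - F x \<le> 1 / vl * (y - x)" by (simp_all add: F_diff)
qed

lemma F_meas[measurable]: "F \<in> borel_measurable borel" by (rule bilip_borel[OF F_bilip])

lemma G_bilip: "bilip vl vu G"
  using bilip_inv[OF F_bilip] by (simp add: G_def)

lemma FG[simp]: "F (G z) = z" and GF[simp]: "G (F x) = x"
  unfolding G_def using bilip_inv_simps[OF F_bilip] by auto

lemma F_diff_abs: "\<bar>y - x\<bar> / vu \<le> \<bar>F y - F x\<bar>" "\<bar>F y - F x\<bar> \<le> \<bar>y - x\<bar> / vl"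
  using bilip_abs[OF F_bilip, of y x] by auto

lemma le_F_diff: "\<bar>y - x\<bar> \<le> vu * \<bar>F y - F x\<bar>"
  using F_diff_abs(1)[of y x] vu by (simp add: field_simps)

lemma G_diff_abs: "\<bar>G y - G x\<bar> \<le> vu * \<bar>y - x\<bar>" "vl * \<bar>y - x\<bar> \<le> \<bar>G y - G x\<bar>"
  using bilip_abs[OF G_bilip] by auto

lemma F_deriv: "AE x in lborel. (F has_real_derivative 1 / v x) (at x)"
proof (rule oint_AE_deriv)
  show "\<bar>1 / v x\<bar> \<le> 1 / vl" for x using v_lower[of x] vl by (simp add: frac_le)
qed (simp_all add: F_diff)

text \<open>\<open>F\<close> is differentiable at \<open>G z\<close> for almost every
  \<open>z\<close>, because \<open>G\<close> pulls null sets back to null sets; at such points the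
  inverse function rule applies.\<close>

lemma G_deriv: "AE z in lborel. (G has_real_derivative v (G z)) (at z)"
proof -
  have "AE z in lborel. (F has_real_derivative 1 / v (G z)) (at (G z))"
    by (rule AE_bilip[OF G_bilip F_deriv])
  then show ?thesis
  proof eventually_elim
    case (elim z)
    have "v (G z) \<noteq> 0" using v_lower[of "G z"] vl by simp
    have "DERIV G (F (G z)) :> inverse (1 / v (G z))"
    proof (rule DERIV_inverse_function[where f=F and g=G and a="z - 1" and b="z + 1"])
      show "DERIV F (G (F (G z))) :> 1 / v (G z)" using elim by simp
      show "isCont G (F (G z))" using bilip_continuous[OF G_bilip] by (simp add: continuous_on_eq_continuous_at)
    qed (use \<open>v (G z) \<noteq> 0\<close> in auto)
    then show ?case by simp
  qed
qed

text \<open>\<open>W q a\<close> is the convolution of \<open>\<gamma>\<close> with the image of \<open>q\<close> under the flow map \<open>a\<close>.\<close>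

definition W :: "(real \<Rightarrow> real) \<Rightarrow> (real \<Rightarrow> real) \<Rightarrow> real \<Rightarrow> real" where
  "W q a x = (LINT y|lborel. \<gamma> (x - a y) * q y)"

definition \<Gamma> :: real where "\<Gamma> = (LINT x|lborel. \<bar>\<gamma> x\<bar>)"

text \<open>In \<open>W\<close> the kernel is evaluated at \<open>x - a y\<close>, that is, its
  reflection at \<open>a y - x\<close>; reflection keeps the norm and the translation bound.\<close>

lemma gamma_refl: "integrable lborel (\<lambda>z. \<gamma> (- z))" "(LINT z|lborel. \<bar>\<gamma> (- z)\<bar>) = \<Gamma>"
  "\<And>h. h > 0 \<Longrightarrow> (LINT x|lborel. \<bar>\<gamma> (- (x + h)) - \<gamma> (- x)\<bar>) \<le> K * h"
proof -
  show "integrable lborel (\<lambda>z. \<gamma> (- z))"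
    using lborel_integrable_real_affine[OF gamma_int, of "-1" 0] by simp
  show "(LINT z|lborel. \<bar>\<gamma> (- z)\<bar>) = \<Gamma>"
    using lborel_integral_real_affine[of "-1" "\<lambda>z. \<bar>\<gamma> z\<bar>" 0] by (simp add: \<Gamma>_def)
  fix h :: real assume h: "h > 0"
  have "(LINT x|lborel. \<bar>\<gamma> (x + h) - \<gamma> x\<bar>) = (LINT x|lborel. \<bar>\<gamma> (- x) - \<gamma> (- (x + h))\<bar>)"
    using lborel_integral_real_affine[of "-1" "\<lambda>x. \<bar>\<gamma> (x + h) - \<gamma> x\<bar>" "- h"] by (simp add: algebra_simps)
  then show "(LINT x|lborel. \<bar>\<gamma> (- (x + h)) - \<gamma> (- x)\<bar>) \<le> K * h"
    using gamma_bv[OF h] by (simp add: abs_minus_commute)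
qed

lemma gamma_comp_integrable:
  assumes a: "bilip c L a"
  shows "integrable lborel (\<lambda>y. \<gamma> (x - a y))" "(LINT y|lborel. \<bar>\<gamma> (x - a y)\<bar>) \<le> \<Gamma> / c"
  using bilip_integrable[OF bilip_diff_const[OF a, of x] gamma_refl(1)] by (simp_all add: gamma_refl(2))

lemma W_integrable:
  assumes a: "bilip c L a" and [measurable]: "q \<in> borel_measurable borel" and q: "\<And>y. \<bar>q y\<bar> \<le> B"
  shows "integrable lborel (\<lambda>y. \<gamma> (x - a y) * q y)" "\<bar>W q a x\<bar> \<le> B * \<Gamma> / c"
proof -
  have B: "0 \<le> B" using q[of 0] by linarith
  have [measurable]: "a \<in> borel_measurable borel" by (rule bilip_borel[OF a])
  have i: "integrable lborel (\<lambda>y. B * \<bar>\<gamma> (x - a y)\<bar>)" using gamma_comp_integrable(1)[OF a] by simp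
  have le: "\<bar>\<gamma> (x - a y) * q y\<bar> \<le> B * \<bar>\<gamma> (x - a y)\<bar>" for y
    using mult_right_mono[OF q[of y], of "\<bar>\<gamma> (x - a y)\<bar>"] by (simp add: abs_mult mult.commute)
  show i2: "integrable lborel (\<lambda>y. \<gamma> (x - a y) * q y)"
    by (rule Bochner_Integration.integrable_bound[OF i]) (use le B in auto)
  have "\<bar>W q a x\<bar> \<le> (LINT y|lborel. \<bar>\<gamma> (x - a y) * q y\<bar>)" unfolding W_def by (rule integral_abs_bound)
  also have "\<dots> \<le> (LINT y|lborel. B * \<bar>\<gamma> (x - a y)\<bar>)" by (rule integral_mono) (use i i2 le in auto)
  also have "\<dots> = B * (LINT y|lborel. \<bar>\<gamma> (x - a y)\<bar>)" by simp
  also have "\<dots> \<le> B * (\<Gamma> / c)" by (rule mult_left_mono[OF gamma_comp_integrable(2)[OF a] B])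
  finally show "\<bar>W q a x\<bar> \<le> B * \<Gamma> / c" by simp
qed

text \<open>Moving the point from \<open>x\<close> to \<open>x'\<close> amounts to shifting the flow
  map by a constant, so \<open>bv_composition\<close> for \<open>a - x\<close> and
  \<open>b - x'\<close> handles both perturbations at once.\<close>

lemma W_diff:
  assumes a: "bilip c L a" and b: "bilip c L b" and [measurable]: "q \<in> borel_measurable borel" and q: "\<And>y. \<bar>q y\<bar> \<le> B"
    and d: "\<And>y. \<bar>a y - b y\<bar> \<le> d"
  shows "\<bar>W q a x - W q b x'\<bar> \<le> B * (2 * K / c) * (d + \<bar>x - x'\<bar>)"
proof -
  have B: "0 \<le> B" using q[of 0] by linarith
  have [measurable]: "a \<in> borel_measurable borel" "b \<in> borel_measurable borel" using a b by (auto intro: bilip_borel)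
  note i = W_integrable(1)[OF a \<open>q \<in> _\<close> q, of x] W_integrable(1)[OF b \<open>q \<in> _\<close> q, of x']
  have i': "integrable lborel (\<lambda>y. \<gamma> (x - a y) - \<gamma> (x' - b y))"
    using gamma_comp_integrable(1)[OF a] gamma_comp_integrable(1)[OF b] by simp
  have "W q a x - W q b x' = (LINT y|lborel. \<gamma> (x - a y) * q y - \<gamma> (x' - b y) * q y)" unfolding W_def using i by simp
  also have "\<bar>\<dots>\<bar> \<le> (LINT y|lborel. \<bar>\<gamma> (x - a y) * q y - \<gamma> (x' - b y) * q y\<bar>)" by (rule integral_abs_bound)
  also have "\<dots> \<le> (LINT y|lborel. B * \<bar>\<gamma> (x - a y) - \<gamma> (x' - b y)\<bar>)"
  proof (rule integral_mono)
    show "\<bar>\<gamma> (x - a y) * q y - \<gamma> (x' - b y) * q y\<bar> \<le> B * \<bar>\<gamma> (x - a y) - \<gamma> (x' - b y)\<bar>" for y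
    proof -
      have "\<gamma> (x - a y) * q y - \<gamma> (x' - b y) * q y = q y * (\<gamma> (x - a y) - \<gamma> (x' - b y))" by (simp add: algebra_simps)
      then show ?thesis using mult_right_mono[OF q[of y], of "\<bar>\<gamma> (x - a y) - \<gamma> (x' - b y)\<bar>"] by (simp add: abs_mult)
    qed
  qed (use i i' in auto)
  also have "\<dots> = B * (LINT y|lborel. \<bar>\<gamma> (- (a y - x)) - \<gamma> (- (b y - x'))\<bar>)" by simp
  also have "\<dots> \<le> B * (2 * K / c * (d + \<bar>x - x'\<bar>))"
  proof (rule mult_left_mono[OF bv_composition[where L=L and g="\<lambda>z. \<gamma> (- z)" and a="\<lambda>y. a y - x" and b="\<lambda>y. b y - x'"] B])
    show "integrable lborel (\<lambda>z. \<gamma> (- z))" by (rule gamma_refl)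
    show "\<And>h. 0 < h \<Longrightarrow> (LINT x|lborel. \<bar>\<gamma> (- (x + h)) - \<gamma> (- x)\<bar>) \<le> K * h" by (rule gamma_refl)
    show "bilip c L (\<lambda>y. a y - x)" "bilip c L (\<lambda>y. b y - x')" using a b by (auto intro: bilip_diff_const)
    show "\<bar>a y - x - (b y - x')\<bar> \<le> d + \<bar>x - x'\<bar>" for y using d[of y] by linarith
  qed
  finally show ?thesis by simp
qed

lemma W_lip:
  assumes a: "bilip c L a" and q: "q \<in> borel_measurable borel" "\<And>y. \<bar>q y\<bar> \<le> B"
  shows "\<bar>W q a x - W q a x'\<bar> \<le> B * (2 * K / c) * \<bar>x - x'\<bar>"
  using W_diff[OF a a q, of 0 x x'] by simp

text \<open>The velocity of one characteristic depends on the whole flow through \<open>W\<close>,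
  so the Gronwall argument takes the supremum over all starting points \<open>y\<close>. Since it
  works for any \<open>T\<close>, uniqueness is not tied to the interval produced by
  existence.\<close>

lemma flow_unique:
  assumes T: "0 \<le> T"
    and a: "\<And>t. t \<in> {0..T} \<Longrightarrow> bilip c L (a t)" and b: "\<And>t. t \<in> {0..T} \<Longrightarrow> bilip c L (b t)"
    and loc_int: "\<And>y. loc_int (\<alpha> y)" "\<And>y. loc_int (\<beta> y)"
    and ea: "\<And>t y. t \<in> {0..T} \<Longrightarrow> F (a t y) = F y + oint (\<alpha> y) 0 t"
    and eb: "\<And>t y. t \<in> {0..T} \<Longrightarrow> F (b t y) = F y + oint (\<beta> y) 0 t"
    and fa: "\<And>y. AE s in lborel. 0 < s \<and> s < T \<longrightarrow> \<alpha> y s = V (W q0 (a s) (a s y))"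
    and fb: "\<And>y. AE s in lborel. 0 < s \<and> s < T \<longrightarrow> \<beta> y s = V (W q0 (b s) (b s y))"
    and t: "t \<in> {0..T}"
  shows "a t y = b t y"
proof -
  have c: "0 < c" using a[of 0] T by (auto dest: bilip_pos(1))
  define R where "R = N * \<Gamma> / c"
  obtain LV where LV: "LV \<ge> 0" "\<And>p q. p \<in> {-R..R} \<Longrightarrow> q \<in> {-R..R} \<Longrightarrow> \<bar>V q - V p\<bar> \<le> LV * \<bar>q - p\<bar>"
    using V_lip[of R] by blast
  obtain MV where MV: "MV \<ge> 0" "\<And>p. p \<in> {-R..R} \<Longrightarrow> \<bar>V p\<bar> \<le> MV" using V_bounded[of R] by blast
  have Wa: "W q0 (a s) x \<in> {-R..R}" and Wb: "W q0 (b s) x \<in> {-R..R}" if "s \<in> {0..T}" for s x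
    using W_integrable(2)[OF a[OF that] q0_meas q0_bound, of x] W_integrable(2)[OF b[OF that] q0_meas q0_bound, of x]
    by (auto simp: R_def abs_le_iff)
  define \<kappa> where "\<kappa> = N * (2 * K / c)"
  have \<kappa>: "\<kappa> \<ge> 0" using N0 K0 c by (simp add: \<kappa>_def)
  \<comment> \<open>The distance of the flows enters twice, through the image of \<open>q0\<close>
    and through the evaluation point, and \<open>vu\<close> converts it from the coordinate
    \<open>F\<close>; the summand 1 keeps \<open>\<Lambda>\<close> positive.\<close>
  define \<Lambda> where "\<Lambda> = LV * (\<kappa> * (2 * vu)) + 1"
  have Lam: "\<Lambda> > 0" using LV \<kappa> vu by (simp add: \<Lambda>_def add_nonneg_pos)
  have "\<bar>F (a t y) - F (b t y)\<bar> \<le> 2 * 0 * exp (2 * \<Lambda> * t)"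
  proof (rule gronwall_sup[where B="2 * MV * T" and f="\<lambda>t y. \<bar>F (a t y) - F (b t y)\<bar>" and t=t and y=y, OF T Lam])
    fix t y assume t: "t \<in> {0..T}"
    have "\<bar>oint (\<alpha> y) 0 t\<bar> \<le> MV * \<bar>t - 0\<bar>"
      by (rule oint_bound[OF loc_int(1)]) (use fa[of y] in eventually_elim, use MV(2)[OF Wa] t in auto)
    moreover have "\<bar>oint (\<beta> y) 0 t\<bar> \<le> MV * \<bar>t - 0\<bar>"
      by (rule oint_bound[OF loc_int(2)]) (use fb[of y] in eventually_elim, use MV(2)[OF Wb] t in auto)
    moreover have "MV * t \<le> MV * T" using t MV by (intro mult_left_mono) auto
    ultimately show "0 \<le> \<bar>F (a t y) - F (b t y)\<bar> \<and> \<bar>F (a t y) - F (b t y)\<bar> \<le> 2 * MV * T"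
      using ea[OF t, of y] eb[OF t, of y] t by auto
  next
    fix m t y assume m: "0 \<le> m" and h: "\<And>s y. s \<in> {0..T} \<Longrightarrow> \<bar>F (a s y) - F (b s y)\<bar> \<le> m * exp (2 * \<Lambda> * s)"
      and t: "t \<in> {0..T}"
    define E where "E s = \<Lambda> * m * exp (2 * \<Lambda> * \<bar>s - 0\<bar>)" for s
    have liE: "loc_int E" unfolding E_def by (intro loc_int_continuous continuous_intros)
    have bd: "\<bar>V (W q0 (a s) (a s y)) - V (W q0 (b s) (b s y))\<bar> \<le> E s" if s: "s \<in> {0..T}" for s
    proof -
      define d where "d = vu * (m * exp (2 * \<Lambda> * s))"
      have d: "\<bar>a s y - b s y\<bar> \<le> d" for y
      proof -
        have "\<bar>a s y - b s y\<bar> \<le> vu * \<bar>F (a s y) - F (b s y)\<bar>" by (rule le_F_diff)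
        also have "\<dots> \<le> d" unfolding d_def using vu by (intro mult_left_mono[OF h[OF s]]) auto
        finally show ?thesis .
      qed
      have "\<bar>V (W q0 (a s) (a s y)) - V (W q0 (b s) (b s y))\<bar> \<le> LV * \<bar>W q0 (a s) (a s y) - W q0 (b s) (b s y)\<bar>"
        by (rule LV(2)[OF Wb[OF s] Wa[OF s]])
      also have "\<dots> \<le> LV * (\<kappa> * (d + \<bar>a s y - b s y\<bar>))"
        unfolding \<kappa>_def by (rule mult_left_mono[OF W_diff[OF a[OF s] b[OF s] q0_meas q0_bound d] LV(1)])
      also have "\<dots> \<le> LV * (\<kappa> * (d + d))" using LV \<kappa> d[of y] by (intro mult_left_mono) auto
      also have "\<dots> = (LV * (\<kappa> * (2 * vu))) * (m * exp (2 * \<Lambda> * s))" by (simp add: d_def)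
      also have "\<dots> \<le> \<Lambda> * (m * exp (2 * \<Lambda> * s))" using m by (intro mult_right_mono) (auto simp: \<Lambda>_def)
      finally show ?thesis using s by (simp add: E_def mult.assoc)
    qed
    have "F (a t y) - F (b t y) = oint (\<lambda>s. \<alpha> y s - \<beta> y s) 0 t"
      by (simp add: ea[OF t] eb[OF t] oint_diff loc_int)
    also have "\<bar>\<dots>\<bar> \<le> oint E 0 t"
    proof (rule oint_abs_mono[OF loc_int_diff[OF loc_int] liE])
      show "AE s in lborel. 0 < s \<and> s < t \<longrightarrow> \<bar>\<alpha> y s - \<beta> y s\<bar> \<le> E s"
        using fa[of y] fb[of y] by eventually_elim (use bd t in auto)
    qed (use t in auto)
    also have "\<dots> = \<Lambda> * m * oint (\<lambda>s. exp (2 * \<Lambda> * \<bar>s - 0\<bar>)) 0 t" unfolding E_def by (rule oint_cmult)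
    also have "\<dots> \<le> \<Lambda> * m * (exp (2 * \<Lambda> * \<bar>t - 0\<bar>) / (2 * \<Lambda>))"
      using Lam m oint_exp[of "2 * \<Lambda>" 0 t] by (intro mult_left_mono) auto
    also have "\<dots> = 0 + m / 2 * exp (2 * \<Lambda> * t)" using Lam t by simp
    finally show "\<bar>F (a t y) - F (b t y)\<bar> \<le> 0 + m / 2 * exp (2 * \<Lambda> * t)" .
  qed (use t in auto)
  then have "F (a t y) = F (b t y)" by simp
  then show ?thesis by (metis GF)
qed

text \<open>\<open>char_compare\<close> between the times 0 and \<open>t\<close>, used in both
  directions, bounds the distance of two characteristics in the coordinate \<open>F\<close> from
  above and below by the factor \<open>2 * exp (2 * \<Lambda> * T)\<close>; the quotient of
  \<open>vu\<close> and \<open>vl\<close> comes from the change of coordinate. Order is preserved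
  because characteristics cannot meet.\<close>

lemma flow_bilip:
  assumes Lam: "0 < \<Lambda>" and loc_int: "\<And>y. loc_int (\<beta> y)" and B: "\<And>y s. \<bar>\<beta> y s\<bar> \<le> B"
    and e: "\<And>s t y. s \<in> {0..T} \<Longrightarrow> t \<in> {0..T} \<Longrightarrow> F (a t y) - F (a s y) = oint (\<beta> y) s t"
    and a0: "\<And>y. a 0 y = y"
    and lip: "\<And>y z. AE s in lborel. 0 < s \<and> s < T \<longrightarrow> \<bar>\<beta> y s - \<beta> z s\<bar> \<le> \<Lambda> * \<bar>F (a s y) - F (a s z)\<bar>"
    and t: "t \<in> {0..T}"
  shows "bilip (vl / (2 * exp (2 * \<Lambda> * T) * vu)) (2 * exp (2 * \<Lambda> * T) * vu / vl) (a t)"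
proof -
  define \<kappa> where "\<kappa> = 2 * exp (2 * \<Lambda> * T)"
  have \<kappa>: "\<kappa> > 0" by (simp add: \<kappa>_def)
  have T: "0 \<in> {0..T}" using t by simp
  have up: "\<bar>F (a \<tau> y) - F (a \<tau> z)\<bar> \<le> \<kappa> * \<bar>F (a \<sigma> y) - F (a \<sigma> z)\<bar>" if "\<sigma> \<in> {0..T}" "\<tau> \<in> {0..T}" for \<sigma> \<tau> y z
    unfolding \<kappa>_def by (rule char_compare[OF Lam loc_int loc_int e e lip that])
  have lt: "F (a t y) < F (a t z)" if "y < z" for y z
  proof (rule ccontr)
    assume n: "\<not> F (a t y) < F (a t z)"
    define D where "D s = F (a s z) - F (a s y)" for s
    have "continuous_on {0..T} D"
    proof (rule lipschitz_on_continuous_on[of "2 * \<bar>B\<bar>"], rule lipschitz_onI)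
      fix s r assume sr: "s \<in> {0..T}" "r \<in> {0..T}"
      have "\<bar>oint (\<beta> u) r s\<bar> \<le> \<bar>B\<bar> * \<bar>s - r\<bar>" for u
        by (rule oint_bound[OF loc_int]) (use B[of u] in \<open>auto intro!: AE_I2 intro: order_trans[OF _ abs_ge_self]\<close>)
      from this[of z] this[of y] show "dist (D s) (D r) \<le> 2 * \<bar>B\<bar> * dist s r"
        using e[OF sr(2,1), of z] e[OF sr(2,1), of y] by (simp add: D_def dist_real_def) 
    qed simp
    then have cD: "continuous_on {0..t} D" by (rule continuous_on_subset) (use t in auto)
    have D0: "D 0 > 0" using that bilip_less[OF F_bilip] by (simp add: D_def a0)
    moreover have "D t \<le> 0" using n by (simp add: D_def)
    ultimately obtain s where s: "0 \<le> s" "s \<le> t" "D s = 0" using IVT2'[of D t 0 0] cD t by auto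
    \<comment> \<open>At a zero of \<open>D\<close> the backward estimate would force the two
      starting points to coincide.\<close>
    have "\<bar>F (a 0 z) - F (a 0 y)\<bar> \<le> \<kappa> * \<bar>F (a s z) - F (a s y)\<bar>" by (rule up) (use s t in auto)
    then show False using s D0 by (simp add: D_def)
  qed
  have inc: "1 / \<kappa> * (F z - F y) \<le> F (a t z) - F (a t y) \<and> F (a t z) - F (a t y) \<le> \<kappa> * (F z - F y)" if "y \<le> z" for y z
  proof (cases "y = z")
    case False
    then have yz: "y < z" using that by simp
    have p: "0 < F (a t z) - F (a t y)" "0 < F z - F y" using lt[OF yz] yz bilip_less[OF F_bilip] by auto
    show ?thesis using up[OF T t, of z y] up[OF t T, of z y] p \<kappa> by (simp add: a0 field_simps)
  qed simp
  show ?thesis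
    unfolding \<kappa>_def[symmetric] bilip_def
  proof (intro conjI allI impI)
    show "0 < vl / (\<kappa> * vu)" using vl vu \<kappa> by simp
    fix y z :: real assume yz: "y \<le> z"
    have Fyz: "1 / vu * (z - y) \<le> F z - F y" "F z - F y \<le> 1 / vl * (z - y)" using F_bilip yz unfolding bilip_def by blast+
    have aa: "F (a t y) \<le> F (a t z)" using lt[of y z] yz by (cases "y = z") auto
    have Gd: "vl * (F (a t z) - F (a t y)) \<le> G (F (a t z)) - G (F (a t y))" "G (F (a t z)) - G (F (a t y)) \<le> vu * (F (a t z) - F (a t y))"
      using G_bilip aa unfolding bilip_def by blast+
    have "vl / (\<kappa> * vu) * (z - y) = vl * (1 / \<kappa> * (1 / vu * (z - y)))" by simp
    also have "\<dots> \<le> vl * (1 / \<kappa> * (F z - F y))" using Fyz vl \<kappa> by (intro mult_left_mono) auto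
    also have "\<dots> \<le> vl * (F (a t z) - F (a t y))" using inc[OF yz] vl by (intro mult_left_mono) auto
    finally show "vl / (\<kappa> * vu) * (z - y) \<le> a t z - a t y" using Gd by simp
    have "vu * (F (a t z) - F (a t y)) \<le> vu * (\<kappa> * (F z - F y))" using inc[OF yz] vu by (intro mult_left_mono) auto
    also have "\<dots> \<le> vu * (\<kappa> * (1 / vl * (z - y)))" using Fyz vu \<kappa> by (intro mult_left_mono) auto
    finally show "a t z - a t y \<le> \<kappa> * vu / vl * (z - y)" using Gd by (simp add: ac_simps)
  qed
qed

text \<open>The left-hand integral of the defining equation is an increment of \<open>F\<close>. The
  integrand in time may be any Borel function that agrees almost everywhere on \<open>(0, T)\<close>
  with the velocity along \<open>\<eta>\<close>, which makes the oriented integral calculus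
  applicable.\<close>

lemma characteristic_iff:
  assumes \<beta>[measurable]: "\<beta> \<in> borel_measurable borel"
    and eq: "AE s in lborel. 0 < s \<and> s < T \<longrightarrow> V (w s (\<eta> s)) = \<beta> s" and t: "t \<in> {0..T}"
  shows "is_characteristic V vo T w t x \<eta> \<longleftrightarrow>
    continuous_on {0..T} \<eta> \<and> (\<forall>\<tau>\<in>{0..T}. F (\<eta> \<tau>) - F x = oint \<beta> t \<tau>)"
proof -
  have 1: "(LINT y=ereal x..ereal (\<eta> \<tau>)|lebesgue. (1 / vo y)) = F (\<eta> \<tau>) - F x" for \<tau>
    unfolding F_diff by (rule LINT_interval_rep) (use vo in auto)
  have 2: "(LINT s=ereal t..ereal \<tau>|lebesgue. V (w s (\<eta> s))) = oint \<beta> t \<tau>" if "\<tau> \<in> {0..T}" for \<tau>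
    by (rule LINT_interval_rep) (use eq in \<open>simp, eventually_elim, use that t in auto\<close>)
  show ?thesis unfolding is_characteristic_def using 1 2 by auto
qed

end

section \<open>Existence of the flow\<close>

lemma bilip_weaken: "bilip c L X \<Longrightarrow> 0 < c' \<Longrightarrow> c' \<le> c \<Longrightarrow> L \<le> L' \<Longrightarrow> bilip c' L' X"
  unfolding bilip_def
proof (intro conjI allI impI, goal_cases)
  case (2 x y)
  then have "c' * (y - x) \<le> c * (y - x)" by (intro mult_right_mono) auto
  then show ?case using 2 by fastforce
next
  case (3 x y)
  then have "L * (y - x) \<le> L' * (y - x)" by (intro mult_right_mono) auto
  then show ?case using 3 by fastforce
qed auto

context nonlocal_data
begin

text \<open>The fixed-point theorem is applied to the displacement
  \<open>u (s, y) = F (a s y) - F y\<close>, which stays bounded although the flow does not. The set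
  \<open>S\<close> limits the slopes of \<open>u\<close> in space and in time, so that all flows
  built from it share \<open>c\<close> and \<open>L\<close>, and with them the range of
  \<open>W\<close> and the Lipschitz constants entering the contraction.\<close>

lemma flow_exists:
  obtains T c L B a where "0 < T" "\<And>t. bilip c L (a t)"
    "\<And>s t y. \<bar>a t y - a s y\<bar> \<le> B * \<bar>t - s\<bar>"
    "\<And>t y. t \<in> {0..T} \<Longrightarrow> F (a t y) = F y + oint (\<lambda>s. V (W q0 (a s) (a s y))) 0 t"
proof -
  \<comment> \<open>In the coordinate \<open>F\<close> the maps are the identity plus a displacement
    of slope at most 1/2, so their slopes lie between 1/2 and 3/2; \<open>vl\<close> and
    \<open>vu\<close> convert to the original coordinate.\<close>
  define c where "c = vl / (2 * vu)"
  define L where "L = 3 / 2 * vu / vl"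
  have c: "0 < c" using vl vu by (simp add: c_def)
  \<comment> \<open>Bounds \<open>W q0 a\<close> for every map \<open>a\<close> with lower constant
    \<open>c\<close>; all constants of \<open>V\<close> refer to \<open>[-R, R]\<close>.\<close>
  define R where "R = N * \<Gamma> / c"
  obtain LV where LV: "LV \<ge> 0" "\<And>p q. p \<in> {-R..R} \<Longrightarrow> q \<in> {-R..R} \<Longrightarrow> \<bar>V q - V p\<bar> \<le> LV * \<bar>q - p\<bar>"
    using V_lip[of R] by blast
  obtain M where M: "M \<ge> 0" "\<And>p. p \<in> {-R..R} \<Longrightarrow> \<bar>V p\<bar> \<le> M" using V_bounded[of R] by blast
  define \<kappa> where "\<kappa> = N * (2 * K / c)"
  have \<kappa>: "\<kappa> \<ge> 0" using N0 K0 c by (simp add: \<kappa>_def)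
  define \<Lambda> where "\<Lambda> = LV * \<kappa> * vu"
  have Lam: "\<Lambda> \<ge> 0" using LV \<kappa> vu by (simp add: \<Lambda>_def)
  \<comment> \<open>Chosen for \<open>T * \<Lambda> \<le> 1 / 4\<close>: the image of a displacement
    in \<open>S\<close> then has slope at most \<open>3 / 8\<close> in space, and the map contracts
    by \<open>1 / 2\<close>.\<close>
  define T where "T = 1 / (4 * (\<Lambda> + 1))"
  have T: "0 < T" using Lam by (simp add: T_def)
  have TL: "T * \<Lambda> \<le> 1 / 4" using Lam by (simp add: T_def field_simps)
  \<comment> \<open>Clamping time in the fixed-point map keeps displacements bounded and continuous
    on the whole plane, the domain of the function space used.\<close>
  define cl where "cl t = max 0 (min T t)" for t
  have cl: "cl t \<in> {0..T}" for t using T by (auto simp: cl_def)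
  have clid: "t \<in> {0..T} \<Longrightarrow> cl t = t" for t by (auto simp: cl_def)
  have cll: "\<bar>cl t - cl s\<bar> \<le> \<bar>t - s\<bar>" for s t by (auto simp: cl_def)
  define A where "A u s y = G (F y + u (s, y))" for u :: "real \<times> real \<Rightarrow> real" and s y
  define S where "S = {u :: (real \<times> real) \<Rightarrow>\<^sub>C real.
    (\<forall>t y z. \<bar>u (t, y) - u (t, z)\<bar> \<le> 1 / 2 * \<bar>F y - F z\<bar>) \<and> (\<forall>s t y. \<bar>u (t, y) - u (s, y)\<bar> \<le> M * \<bar>t - s\<bar>)}"
  define f where "f u y s = V (W q0 (A u s) (A u s y))" for u y s
  have FA: "F (A u s y) = F y + u (s, y)" for u s y by (simp add: A_def)
  have Ab: "bilip c L (A (apply_bcontfun u) s)" if "u \<in> S" for u s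
    unfolding bilip_def
  proof (intro conjI allI impI c)
    fix y z :: real assume yz: "y \<le> z"
    have us: "\<bar>u (s, z) - u (s, y)\<bar> \<le> 1 / 2 * \<bar>F z - F y\<bar>" using that by (simp add: S_def)
    have Fyz: "1 / vu * (z - y) \<le> F z - F y" "F z - F y \<le> 1 / vl * (z - y)" using F_bilip yz unfolding bilip_def by blast+
    have F0: "0 \<le> F z - F y" using yz bilip_leq[OF F_bilip] by simp
    have d1: "1 / 2 * (F z - F y) \<le> (F z + u (s, z)) - (F y + u (s, y))"
      using abs_le_D2[OF us] unfolding abs_of_nonneg[OF F0] by simp
    have d2: "(F z + u (s, z)) - (F y + u (s, y)) \<le> 3 / 2 * (F z - F y)"
      using abs_le_D1[OF us] unfolding abs_of_nonneg[OF F0] by simp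
    have "F y + u (s, y) \<le> F z + u (s, z)" using d1 F0 by simp
    then have Gd: "vl * ((F z + u (s, z)) - (F y + u (s, y))) \<le> A u s z - A u s y" "A u s z - A u s y \<le> vu * ((F z + u (s, z)) - (F y + u (s, y)))"
      using G_bilip unfolding bilip_def A_def by blast+
    have "c * (z - y) = vl * (1 / 2 * (1 / vu * (z - y)))" by (simp add: c_def)
    also have "\<dots> \<le> vl * ((F z + u (s, z)) - (F y + u (s, y)))"
      by (rule mult_left_mono[OF order_trans[OF mult_left_mono[OF Fyz(1)] d1]]) (use vl in auto)
    finally show "c * (z - y) \<le> A u s z - A u s y" using Gd by simp
    have "vu * ((F z + u (s, z)) - (F y + u (s, y))) \<le> vu * (3 / 2 * (1 / vl * (z - y)))"
      by (rule mult_left_mono[OF order_trans[OF d2 mult_left_mono[OF Fyz(2)]]]) (use vu in auto)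
    from order_trans[OF Gd(2) this] have "A u s z - A u s y \<le> vu * (3 / 2 * (1 / vl * (z - y)))" .
    also have "\<dots> = L * (z - y)" by (simp add: L_def)
    finally show "A u s z - A u s y \<le> L * (z - y)" .
  qed
  have At: "\<bar>A (apply_bcontfun u) t y - A (apply_bcontfun u) s y\<bar> \<le> vu * M * \<bar>t - s\<bar>" if "u \<in> S" for u s t y
  proof -
    have "\<bar>A u t y - A u s y\<bar> \<le> vu * \<bar>(F y + u (t, y)) - (F y + u (s, y))\<bar>" unfolding A_def by (rule G_diff_abs)
    also have "\<dots> \<le> vu * (M * \<bar>t - s\<bar>)" using that vu by (intro mult_left_mono) (auto simp: S_def)
    finally show ?thesis by simp
  qed
  have WR: "W q0 (A (apply_bcontfun u) s) x \<in> {-R..R}" if "u \<in> S" for u s x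
    using W_integrable(2)[OF Ab[OF that] q0_meas q0_bound, of s x] by (auto simp: R_def abs_le_iff)
  have fM: "\<bar>f (apply_bcontfun u) y s\<bar> \<le> M" if "u \<in> S" for u y s
    unfolding f_def by (rule M(2)[OF WR[OF that]])
  have fd: "\<bar>f (apply_bcontfun u) y s - f (apply_bcontfun u') z r\<bar> \<le> LV * (\<kappa> * (d + \<bar>A u s y - A u' r z\<bar>))"
    if u: "u \<in> S" "u' \<in> S" and d: "\<And>y. \<bar>A u s y - A u' r y\<bar> \<le> d" for u u' y z s r d
  proof -
    have "\<bar>f u y s - f u' z r\<bar> \<le> LV * \<bar>W q0 (A u s) (A u s y) - W q0 (A u' r) (A u' r z)\<bar>"
      unfolding f_def by (rule LV(2)[OF WR[OF u(2)] WR[OF u(1)]])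
    also have "\<dots> \<le> LV * (\<kappa> * (d + \<bar>A u s y - A u' r z\<bar>))"
      unfolding \<kappa>_def by (rule mult_left_mono[OF W_diff[OF Ab[OF u(1)] Ab[OF u(2)] q0_meas q0_bound d] LV(1)])
    finally show ?thesis .
  qed
  have fcont: "continuous_on UNIV (f (apply_bcontfun u) y)" if u: "u \<in> S" for u y
  proof (rule lipschitz_real_continuous)
    fix s r
    have "\<bar>f u y s - f u y r\<bar> \<le> LV * (\<kappa> * (vu * M * \<bar>s - r\<bar> + \<bar>A u s y - A u r y\<bar>))"
      by (rule fd[OF u u At[OF u]])
    also have "\<dots> \<le> LV * (\<kappa> * (vu * M * \<bar>s - r\<bar> + vu * M * \<bar>s - r\<bar>))"
      using LV \<kappa> by (intro mult_left_mono add_left_mono At[OF u]) auto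
    finally show "\<bar>f u y s - f u y r\<bar> \<le> (LV * \<kappa> * 2 * vu * M) * \<bar>s - r\<bar>" by (simp add: algebra_simps)
  qed
  have fli: "loc_int (f (apply_bcontfun u) y)" if "u \<in> S" for u y by (rule loc_int_continuous[OF fcont[OF that]])
  define P0 where "P0 u = (\<lambda>(t, y). oint (f (apply_bcontfun u) y) 0 (cl t))" for u
  have P0t: "\<bar>P0 u (t, y) - P0 u (s, y)\<bar> \<le> M * \<bar>t - s\<bar>" if u: "u \<in> S" for u s t y
  proof -
    have "P0 u (t, y) - P0 u (s, y) = oint (f u y) (cl s) (cl t)" by (simp add: P0_def oint_minus[OF fli[OF u]])
    also have "\<bar>\<dots>\<bar> \<le> M * \<bar>cl t - cl s\<bar>" by (rule oint_bound[OF fli[OF u]]) (use fM[OF u] in auto)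
    also have "\<dots> \<le> M * \<bar>t - s\<bar>" using M cll by (intro mult_left_mono) auto
    finally show ?thesis .
  qed
  have P0d: "\<bar>P0 u (t, y) - P0 u' (t, z)\<bar> \<le> T * D" if u: "u \<in> S" "u' \<in> S" and D: "\<And>s. \<bar>f u y s - f u' z s\<bar> \<le> D" for u u' y z t D
  proof -
    have D0: "0 \<le> D" using D[of 0] by linarith
    have "P0 u (t, y) - P0 u' (t, z) = oint (\<lambda>s. f u y s - f u' z s) 0 (cl t)" by (simp add: P0_def oint_diff fli u)
    also have "\<bar>\<dots>\<bar> \<le> D * \<bar>cl t - 0\<bar>" by (rule oint_bound[OF loc_int_diff[OF fli[OF u(1)] fli[OF u(2)]]]) (use D in auto)
    also have "\<dots> \<le> D * T" using cl[of t] D0 by (intro mult_left_mono) auto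
    finally show ?thesis by (simp add: mult.commute)
  qed
  have P0y: "\<bar>P0 u (t, y) - P0 u (t, z)\<bar> \<le> 1 / 2 * \<bar>F y - F z\<bar>" if u: "u \<in> S" for u t y z
  proof -
    have "\<bar>f u y s - f u z s\<bar> \<le> \<Lambda> * (3 / 2 * \<bar>F y - F z\<bar>)" for s
    proof -
      \<comment> \<open>Both characteristics belong to the same flow, so the kernel term contributes
        0 and only the evaluation point differs.\<close>
      have "\<bar>f u y s - f u z s\<bar> \<le> LV * (\<kappa> * (0 + \<bar>A u s y - A u s z\<bar>))" by (rule fd[OF u u]) simp
      also have "\<dots> \<le> LV * (\<kappa> * (0 + vu * (3 / 2 * \<bar>F y - F z\<bar>)))"
      proof -
        have us: "\<bar>u (s, y) - u (s, z)\<bar> \<le> 1 / 2 * \<bar>F y - F z\<bar>" using u by (simp add: S_def)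
        have "\<bar>(F y + u (s, y)) - (F z + u (s, z))\<bar> = \<bar>(F y - F z) + (u (s, y) - u (s, z))\<bar>" by (simp add: algebra_simps)
        also have "\<dots> \<le> \<bar>F y - F z\<bar> + \<bar>u (s, y) - u (s, z)\<bar>" by (rule abs_triangle_ineq)
        also have "\<dots> \<le> \<bar>F y - F z\<bar> + 1 / 2 * \<bar>F y - F z\<bar>" by (rule add_left_mono[OF us])
        also have "\<dots> = 3 / 2 * \<bar>F y - F z\<bar>" by simp
        finally have "\<bar>(F y + u (s, y)) - (F z + u (s, z))\<bar> \<le> 3 / 2 * \<bar>F y - F z\<bar>" .
        then have "vu * \<bar>(F y + u (s, y)) - (F z + u (s, z))\<bar> \<le> vu * (3 / 2 * \<bar>F y - F z\<bar>)" using vu by (intro mult_left_mono) auto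
        moreover have "\<bar>A u s y - A u s z\<bar> \<le> vu * \<bar>(F y + u (s, y)) - (F z + u (s, z))\<bar>" unfolding A_def by (rule G_diff_abs)
        ultimately show ?thesis using LV \<kappa> by (intro mult_left_mono add_left_mono) auto
      qed
      finally show ?thesis by (simp add: \<Lambda>_def mult.assoc)
    qed
    then have "\<bar>P0 u (t, y) - P0 u (t, z)\<bar> \<le> T * (\<Lambda> * (3 / 2 * \<bar>F y - F z\<bar>))" by (rule P0d[OF u u])
    also have "\<dots> = (T * \<Lambda>) * (3 / 2 * \<bar>F y - F z\<bar>)" by simp
    also have "\<dots> \<le> 1 / 4 * (3 / 2 * \<bar>F y - F z\<bar>)" by (rule mult_right_mono[OF TL]) simp
    also have "\<dots> = 3 / 8 * \<bar>F y - F z\<bar>" by simp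
    also have "\<dots> \<le> 1 / 2 * \<bar>F y - F z\<bar>" by (rule mult_right_mono) auto
    finally show ?thesis .
  qed
  have P0b: "P0 u \<in> bcontfun" if u: "u \<in> S" for u
  proof -
    have "continuous_on UNIV (P0 u)"
    proof (rule lipschitz_on_continuous_on[of "M + 1 / 2 * (1 / vl)"], rule lipschitz_onI)
      fix p q :: "real \<times> real"
      obtain t y s z where p: "p = (t, y)" and q: "q = (s, z)" by (cases p, cases q)
      have "dist (P0 u p) (P0 u q) \<le> \<bar>P0 u (t, y) - P0 u (s, y)\<bar> + \<bar>P0 u (s, y) - P0 u (s, z)\<bar>" by (simp add: p q dist_real_def)
      also have "\<dots> \<le> M * \<bar>t - s\<bar> + 1 / 2 * \<bar>F y - F z\<bar>" by (intro add_mono P0t P0y u)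
      also have "\<dots> \<le> M * dist p q + 1 / 2 * (1 / vl * dist p q)"
      proof (intro add_mono mult_left_mono)
        show "\<bar>t - s\<bar> \<le> dist p q" using dist_fst_le[of p q] by (simp add: p q dist_real_def)
        have "\<bar>y - z\<bar> \<le> dist p q" using dist_snd_le[of p q] by (simp add: p q dist_real_def)
        then have "\<bar>y - z\<bar> / vl \<le> dist p q / vl" using vl by (intro divide_right_mono) auto
        then show "\<bar>F y - F z\<bar> \<le> 1 / vl * dist p q" using F_diff_abs(2)[of y z] by simp
      qed (use M in auto)
      finally show "dist (P0 u p) (P0 u q) \<le> (M + 1 / 2 * (1 / vl)) * dist p q" by (simp add: algebra_simps)
    qed (use M vl in auto)
    moreover have "bounded (range (P0 u))"
      unfolding bounded_iff
    proof (intro exI[of _ "M * T"] ballI)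
      fix x assume "x \<in> range (P0 u)"
      then obtain t y where x: "x = oint (f u y) 0 (cl t)" by (auto simp: P0_def)
      have "\<bar>oint (f u y) 0 (cl t)\<bar> \<le> M * \<bar>cl t - 0\<bar>" by (rule oint_bound[OF fli[OF u]]) (use fM[OF u] in auto)
      also have "\<dots> \<le> M * T" using cl[of t] M by (intro mult_left_mono) auto
      finally show "norm x \<le> M * T" by (simp add: x)
    qed
    ultimately show ?thesis by (simp add: bcontfun_def)
  qed
  define P where "P u = Bcontfun (P0 u)" for u
  have Pa: "apply_bcontfun (P u) = P0 u" if "u \<in> S" for u
    unfolding P_def by (rule Bcontfun_inverse[OF P0b[OF that]])
  have evc: "continuous_on UNIV (\<lambda>u :: (real \<times> real) \<Rightarrow>\<^sub>C real. u x)" for x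
    by (rule lipschitz_on_continuous_on[of 1], rule lipschitz_onI) (auto intro: dist_bounded)
  have "closed S"
    unfolding S_def by (intro closed_Collect_conj closed_Collect_all closed_Collect_le continuous_intros evc)
  then have "complete S" by (simp add: complete_eq_closed)
  moreover have "S \<noteq> {}"
  proof -
    have "(0 :: (real \<times> real) \<Rightarrow>\<^sub>C real) \<in> S" using M by (simp add: S_def)
    then show ?thesis by blast
  qed
  moreover have "P ` S \<subseteq> S"
  proof
    fix p assume "p \<in> P ` S"
    then obtain u where u: "u \<in> S" "p = P u" by blast
    show "p \<in> S" unfolding S_def u(2) using P0y[OF u(1)] P0t[OF u(1)] by (simp add: Pa[OF u(1)])
  qed
  moreover have "dist (P u) (P u') \<le> 1 / 2 * dist u u'" if u: "u \<in> S" "u' \<in> S" for u u'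
  proof (rule dist_bound)
    fix p :: "real \<times> real"
    obtain t y where p: "p = (t, y)" by (cases p)
    have "\<bar>f u y s - f u' y s\<bar> \<le> \<Lambda> * (2 * dist u u')" for s
    proof -
      have d: "\<bar>A u s z - A u' s z\<bar> \<le> vu * dist u u'" for z
      proof -
        have "\<bar>A u s z - A u' s z\<bar> \<le> vu * \<bar>(F z + u (s, z)) - (F z + u' (s, z))\<bar>" unfolding A_def by (rule G_diff_abs)
        also have "\<dots> \<le> vu * dist u u'" using dist_bounded[of u "(s, z)" u'] vu by (intro mult_left_mono) (auto simp: dist_real_def)
        finally show ?thesis .
      qed
      have "\<bar>f u y s - f u' y s\<bar> \<le> LV * (\<kappa> * (vu * dist u u' + \<bar>A u s y - A u' s y\<bar>))" by (rule fd[OF u d])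
      also have "\<dots> \<le> LV * (\<kappa> * (vu * dist u u' + vu * dist u u'))" using LV \<kappa> by (intro mult_left_mono add_left_mono d) auto
      finally show ?thesis by (simp add: \<Lambda>_def algebra_simps)
    qed
    then have "\<bar>P0 u (t, y) - P0 u' (t, y)\<bar> \<le> T * (\<Lambda> * (2 * dist u u'))" by (rule P0d[OF u])
    also have "\<dots> = (T * \<Lambda>) * (2 * dist u u')" by simp
    also have "\<dots> \<le> 1 / 4 * (2 * dist u u')" by (rule mult_right_mono[OF TL]) simp
    finally show "dist (P u p) (P u' p) \<le> 1 / 2 * dist u u'" by (simp add: Pa u p dist_real_def)
  qed
  ultimately have "\<exists>!u\<in>S. P u = u" by (intro Banach_fix[of S "1 / 2"]) auto
  then obtain u where u: "u \<in> S" "P u = u" by blast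
  define a where "a = A (apply_bcontfun u)"
  show ?thesis
  proof (rule that[of T c L a "vu * M", OF T])
    show "bilip c L (a t)" for t unfolding a_def by (rule Ab[OF u(1)])
    show "\<bar>a t y - a s y\<bar> \<le> vu * M * \<bar>t - s\<bar>" for s t y unfolding a_def by (rule At[OF u(1)])
    fix t y assume t: "t \<in> {0..T}"
    have "u (t, y) = P0 u (t, y)" using u Pa[OF u(1)] by simp
    also have "\<dots> = oint (f u y) 0 t" by (simp add: P0_def clid[OF t])
    also have "\<dots> = oint (\<lambda>s. V (W q0 (a s) (a s y))) 0 t" by (simp add: f_def[abs_def] a_def)
    finally show "F (a t y) = F y + oint (\<lambda>s. V (W q0 (a s) (a s y))) 0 t" by (simp add: a_def FA)
  qed
qed

end

lemma borel_pair_lebesgue_on: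
  fixes f :: "real \<times> real \<Rightarrow> real"
  assumes "f \<in> borel_measurable borel"
  shows "f \<in> borel_measurable (lebesgue_on S)"
  by (rule measurable_restrict_space1) (rule measurable_completion, use assms in simp)

lemma AE_lebesgue_on_iff:
  fixes S :: "'a::euclidean_space set"
  assumes "S \<in> sets borel"
  shows "(AE x in lebesgue_on S. P x) \<longleftrightarrow> (AE x in lborel. x \<in> S \<longrightarrow> P x)"
  using assms by (subst AE_restrict_space_iff) (auto simp: AE_completion_iff)

lemma strip_borel: "{0<..<T} \<times> UNIV \<in> sets (borel :: (real \<times> real) measure)"
  by (intro borel_open open_Times) auto

context nonlocal_data
begin

text \<open>The map \<open>y \<mapsto> x - a y\<close> pulls the null set
  \<open>{go \<noteq> \<gamma>}\<close> back to a null set, so given and Borel representatives yield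
  the same value at every \<open>x\<close>, not just at almost every one.\<close>

lemma lebesgue_W:
  assumes a: "bilip c L a"
  shows "(LINT y|lebesgue. go (x - a y) * qo y) = W q0 a x"
  unfolding W_def
proof (rule LINT_lebesgue_rep(1))
  have [measurable]: "a \<in> borel_measurable borel" by (rule bilip_borel[OF a])
  show "(\<lambda>y. \<gamma> (x - a y) * q0 y) \<in> borel_measurable borel" by measurable
  have "AE y in lborel. go (x - a y) = \<gamma> (x - a y)"
    by (rule AE_expanding[where c=c and a="\<lambda>y. x - a y" and P="\<lambda>z. go z = \<gamma> z", OF _ bilip_pos(1)[OF a] go])
      (use bilip_abs(1)[OF a] in \<open>auto simp: abs_minus_commute\<close>)
  then show "AE y in lborel. go (x - a y) * qo y = \<gamma> (x - a y) * q0 y"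
    using qo by eventually_elim simp
qed

end

section \<open>Characteristics and the fixed-point equation\<close>

locale nonlocal_flow = nonlocal_data +
  fixes T c L B :: real and a :: "real \<Rightarrow> real \<Rightarrow> real"
  assumes T: "0 < T" and a_bilip: "\<And>t. bilip c L (a t)"
    and a_time: "\<And>s t y. \<bar>a t y - a s y\<bar> \<le> B * \<bar>t - s\<bar>"
    and a_flow: "\<And>t y. t \<in> {0..T} \<Longrightarrow> F (a t y) = F y + oint (\<lambda>s. V (W q0 (a s) (a s y))) 0 t"
begin

definition w :: "real \<Rightarrow> real \<Rightarrow> real" where "w t x = W q0 (a t) x"
definition vel :: "real \<Rightarrow> real \<Rightarrow> real" where "vel y s = V (w s (a s y))"
definition k :: "real \<Rightarrow> real \<Rightarrow> real" where "k t = inv (a t)"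
text \<open>\<open>k t x\<close> is the starting point at time 0 of the characteristic through
  \<open>x\<close> at time \<open>t\<close>; in particular \<open>xi t x 0 = k t x\<close>.\<close>

definition xi :: "real \<Rightarrow> real \<Rightarrow> real \<Rightarrow> real" where "xi t x \<tau> = a \<tau> (k t x)"
definition R where "R = N * \<Gamma> / c"
definition \<kappa> where "\<kappa> = N * (2 * K / c)"

lemma c0: "0 < c" by (rule bilip_pos[OF a_bilip])
lemma kappa0: "0 \<le> \<kappa>" using N0 K0 c0 by (simp add: \<kappa>_def)
lemma B0: "0 \<le> B"
proof -
  have "0 \<le> \<bar>a 1 0 - a 0 0\<bar>" by simp
  also have "\<dots> \<le> B * \<bar>1 - 0\<bar>" by (rule a_time)
  finally show ?thesis by simp
qed

lemma w_bound: "\<bar>w t x\<bar> \<le> R"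
  unfolding w_def R_def by (rule W_integrable(2)[OF a_bilip q0_meas q0_bound])

lemma w_bound': "w t x \<in> {-R..R}" using w_bound[of t x] by auto

lemma w_lip: "\<bar>w t x - w s z\<bar> \<le> \<kappa> * (B * \<bar>t - s\<bar> + \<bar>x - z\<bar>)"
  unfolding w_def \<kappa>_def by (rule W_diff[OF a_bilip a_bilip q0_meas q0_bound a_time])

lemma w_lip_space: "\<bar>w t x - w t z\<bar> \<le> \<kappa> * \<bar>x - z\<bar>" using w_lip[of t x t z] by simp

lemma w_continuous: "continuous_on UNIV (\<lambda>(t, x). w t x)"
proof (rule lipschitz_on_continuous_on[of "\<kappa> * (B + 1)"], rule lipschitz_onI)
  fix p q :: "real \<times> real"
  obtain t x s z where p: "p = (t, x)" and q: "q = (s, z)" by (cases p, cases q)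
  have "dist (case p of (t, x) \<Rightarrow> w t x) (case q of (t, x) \<Rightarrow> w t x) \<le> \<kappa> * (B * \<bar>t - s\<bar> + \<bar>x - z\<bar>)"
    using w_lip[of t x s z] by (simp add: p q dist_real_def)
  also have "\<dots> \<le> \<kappa> * (B * dist p q + dist p q)"
    using dist_fst_le[of p q] dist_snd_le[of p q] kappa0 B0
    by (intro mult_left_mono add_mono) (auto simp: p q dist_real_def)
  finally show "dist (case p of (t, x) \<Rightarrow> w t x) (case q of (t, x) \<Rightarrow> w t x) \<le> \<kappa> * (B + 1) * dist p q"
    by (simp add: algebra_simps)
qed (use kappa0 B0 in auto)

lemma w_compose_continuous:
  assumes "continuous_on S f" "continuous_on S g"
  shows "continuous_on S (\<lambda>s. w (f s) (g s))"
  using continuous_on_compose2[OF w_continuous, of S "\<lambda>s. (f s, g s)"] assms by (auto intro!: continuous_intros)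

lemma a_time_continuous: "continuous_on UNIV (\<lambda>t. a t y)"
  by (rule lipschitz_real_continuous[of _ B]) (rule a_time)

lemma vel_continuous: "continuous_on UNIV (vel y)"
  unfolding vel_def
  by (rule continuous_on_compose2[OF V_cont]) (auto intro: w_compose_continuous a_time_continuous)

lemma vel_loc_int: "loc_int (vel y)" by (rule loc_int_continuous[OF vel_continuous])
lemma vel_meas[measurable]: "vel y \<in> borel_measurable borel"
  by (rule borel_measurable_continuous_onI[OF vel_continuous])

lemma a_flow_vel: "t \<in> {0..T} \<Longrightarrow> F (a t y) = F y + oint (vel y) 0 t"
  using a_flow[of t y] by (simp add: vel_def[abs_def] w_def)

lemma a_flow_diff: "s \<in> {0..T} \<Longrightarrow> t \<in> {0..T} \<Longrightarrow> F (a t y) - F (a s y) = oint (vel y) s t"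
  by (simp add: a_flow_vel oint_minus[OF vel_loc_int])

lemma a_0[simp]: "a 0 y = y"
proof -
  have "F (a 0 y) = F y" using a_flow_vel[of 0 y] T by simp
  then show ?thesis by (metis GF)
qed

lemma ak[simp]: "a t (k t x) = x" and ka[simp]: "k t (a t y) = y"
  unfolding k_def using bilip_inv_simps[OF a_bilip] by auto

lemma k_0[simp]: "k 0 x = x" using ka[of 0 x] by simp

lemma k_bilip: "bilip (1 / L) (1 / c) (k t)" unfolding k_def by (rule bilip_inv[OF a_bilip])

lemma xi_characteristics: "is_characteristics V vo T w xi"
  unfolding is_characteristics_def
proof (intro ballI allI)
  fix t x assume t: "t \<in> {0..T}"
  have "is_characteristic V vo T w t x (xi t x) \<longleftrightarrow>
    continuous_on {0..T} (xi t x) \<and> (\<forall>\<tau>\<in>{0..T}. F (xi t x \<tau>) - F x = oint (vel (k t x)) t \<tau>)"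
    by (rule characteristic_iff[OF vel_meas _ t]) (simp add: vel_def xi_def)
  moreover have "continuous_on {0..T} (xi t x)"
    unfolding xi_def using a_time_continuous by (rule continuous_on_subset) simp
  moreover have "F (xi t x \<tau>) - F x = oint (vel (k t x)) t \<tau>" if "\<tau> \<in> {0..T}" for \<tau>
    using a_flow_diff[OF t that, of "k t x"] by (simp add: xi_def)
  ultimately show "is_characteristic V vo T w t x (xi t x)" by blast
qed

lemma F_eq_0: "F x - F y = 0 \<Longrightarrow> x = y" by (metis GF eq_iff_diff_eq_0)

text \<open>In the coordinate \<open>F\<close> a competing solution and the flow line through the
  same point have velocities that differ by at most a multiple of their distance;
  \<open>char_compare\<close> started at time \<open>t\<close> then gives equality on all of
  \<open>[0, T]\<close>.\<close>

lemma xi_unique: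
  assumes t: "t \<in> {0..T}" and \<eta>: "is_characteristic V vo T w t x \<eta>" and \<tau>: "\<tau> \<in> {0..T}"
  shows "\<eta> \<tau> = xi t x \<tau>"
proof -
  define cl where "cl s = max 0 (min T s)" for s
  have cl: "s \<in> {0..T} \<Longrightarrow> cl s = s" "cl s \<in> {0..T}" for s using T by (auto simp: cl_def)
  have c\<eta>: "continuous_on {0..T} \<eta>" using \<eta> by (simp add: is_characteristic_def)
  \<comment> \<open>\<open>\<eta>\<close> is continuous on \<open>{0..T}\<close> only; clamping
    gives a velocity that is continuous on the line.\<close>
  define b where "b s = V (w (cl s) (\<eta> (cl s)))" for s
  have ccl: "continuous_on UNIV cl" unfolding cl_def by (intro continuous_intros)
  have cb: "continuous_on UNIV b"
    unfolding b_def
    by (rule continuous_on_compose2[OF V_cont]) (auto intro!: w_compose_continuous ccl continuous_on_compose2[OF c\<eta> ccl] cl)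
  have bm: "b \<in> borel_measurable borel" by (rule borel_measurable_continuous_onI[OF cb])
  have lib: "loc_int b" by (rule loc_int_continuous[OF cb])
  have "AE s in lborel. 0 < s \<and> s < T \<longrightarrow> V (w s (\<eta> s)) = b s" by (rule AE_I2) (simp add: b_def cl)
  then have F\<eta>: "F (\<eta> \<tau>) - F x = oint b t \<tau>" if "\<tau> \<in> {0..T}" for \<tau>
    using \<eta> characteristic_iff[OF bm _ t] that by blast
  obtain LV where LV: "LV \<ge> 0" "\<And>p q. p \<in> {-R..R} \<Longrightarrow> q \<in> {-R..R} \<Longrightarrow> \<bar>V q - V p\<bar> \<le> LV * \<bar>q - p\<bar>"
    using V_lip[of R] by blast
  define y where "y = k t x"
  have "\<bar>F (\<eta> \<tau>) - F (a \<tau> y)\<bar> \<le> 2 * exp (2 * (LV * \<kappa> * vu + 1) * T) * \<bar>F (\<eta> t) - F (a t y)\<bar>"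
  proof (rule char_compare[OF _ lib vel_loc_int[of y] _ _ _ t \<tau>])
    show "0 < LV * \<kappa> * vu + 1" using LV kappa0 vu by (simp add: add_nonneg_pos)
    show "F (\<eta> r) - F (\<eta> s) = oint b s r" if "s \<in> {0..T}" "r \<in> {0..T}" for s r
      using F\<eta>[OF that(1)] F\<eta>[OF that(2)] oint_minus[OF lib, of t r s] by simp
    show "F (a r y) - F (a s y) = oint (vel y) s r" if "s \<in> {0..T}" "r \<in> {0..T}" for s r by (rule a_flow_diff[OF that])
    have "\<bar>b s - vel y s\<bar> \<le> (LV * \<kappa> * vu + 1) * \<bar>F (\<eta> s) - F (a s y)\<bar>" if s: "0 < s" "s < T" for s
    proof -
      have "\<bar>b s - vel y s\<bar> \<le> LV * \<bar>w s (\<eta> s) - w s (a s y)\<bar>"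
        using LV(2)[OF w_bound' w_bound', of s "\<eta> s" s "a s y"] s by (simp add: b_def vel_def cl abs_minus_commute)
      also have "\<dots> \<le> LV * (\<kappa> * \<bar>\<eta> s - a s y\<bar>)" by (rule mult_left_mono[OF w_lip_space LV(1)])
      also have "\<dots> \<le> LV * (\<kappa> * (vu * \<bar>F (\<eta> s) - F (a s y)\<bar>))"
        using LV kappa0 le_F_diff by (intro mult_left_mono) auto
      also have "\<dots> \<le> (LV * \<kappa> * vu + 1) * \<bar>F (\<eta> s) - F (a s y)\<bar>" by (simp add: algebra_simps)
      finally show ?thesis .
    qed
    then show "AE s in lborel. 0 < s \<and> s < T \<longrightarrow> \<bar>b s - vel y s\<bar> \<le> (LV * \<kappa> * vu + 1) * \<bar>F (\<eta> s) - F (a s y)\<bar>"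
      by (intro AE_I2) auto
  qed
  moreover have "F (\<eta> t) = F (a t y)" using F\<eta>[OF t] by (simp add: y_def)
  ultimately have "F (\<eta> \<tau>) = F (a \<tau> y)" by simp
  then show ?thesis unfolding xi_def y_def by (metis GF)
qed

lemma w_Linfty_W1infty: "w \<in> Linfty_W1infty T"
proof -
  have m: "case_prod w \<in> borel_measurable borel" by (rule borel_measurable_continuous_onI) (use w_continuous in simp)
  have 1: "w \<in> Linfty_Linfty T"
    unfolding Linfty_Linfty_def Linfty_def using borel_pair_lebesgue_on[OF m] w_bound by (auto intro!: exI[of _ R])
  have 2: "continuous_on UNIV (w t) \<and> (\<forall>x. \<bar>w t x\<bar> \<le> max R \<kappa>) \<and>
       (\<exists>g. is_weak_derivative (w t) g \<and> (AE x in lebesgue. \<bar>g x\<bar> \<le> max R \<kappa>))" for t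
  proof (intro conjI allI)
    show "continuous_on UNIV (w t)" by (rule w_compose_continuous) (auto intro: continuous_intros)
    show "\<bar>w t x\<bar> \<le> max R \<kappa>" for x using w_bound[of t x] by (simp add: le_max_iff_disj)
    obtain g where "is_weak_derivative (w t) g" "\<And>x. \<bar>g x\<bar> \<le> \<kappa>"
      using lipschitz_weak_derivative[of "w t" \<kappa>, OF w_lip_space w_bound] by blast
    then show "\<exists>g. is_weak_derivative (w t) g \<and> (AE x in lebesgue. \<bar>g x\<bar> \<le> max R \<kappa>)"
      by (intro exI[of _ g]) (auto simp: le_max_iff_disj)
  qed
  show ?thesis unfolding Linfty_W1infty_def using 1 2 by (auto intro!: exI[of _ "max R \<kappa>"])
qed

lemma w_fixed_point: "is_fixed_point qo go V vo T w xi"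
  unfolding is_fixed_point_def
proof (intro conjI w_Linfty_W1infty xi_characteristics)
  have "w t x = (LINT y|lebesgue. go (x - xi 0 y t) * qo y)" for t x
    using lebesgue_W[OF a_bilip] by (simp add: w_def xi_def)
  then show "AE (t, x) in lebesgue_on ({0<..<T} \<times> UNIV). w t x = (LINT y|lebesgue. go (x - xi 0 y t) * qo y)"
    by (intro AE_I2) auto
qed

text \<open>A competing pair satisfies its equation only almost everywhere, and \<open>w'\<close> is
  not known to be continuous in time. Its characteristics still form a bi-Lipschitz flow, thanks to
  the Lipschitz bound on \<open>w'\<close> in space; for almost every time \<open>w'\<close> is
  therefore the field \<open>W q0\<close> generated by that flow, and \<open>flow_unique\<close>
  identifies it with \<open>a\<close>.\<close>

lemma fixed_point_unique:
  assumes fp: "is_fixed_point qo go V vo T w' \<xi>'"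
  shows "AE (t, x) in lebesgue_on ({0<..<T} \<times> UNIV). w' t x = w t x"
proof -
  have W1: "w' \<in> Linfty_W1infty T" and ch: "is_characteristics V vo T w' \<xi>'"
    and eq: "AE (t, x) in lebesgue_on ({0<..<T} \<times> UNIV). w' t x = (LINT y|lebesgue. go (x - \<xi>' 0 y t) * qo y)"
    using fp by (auto simp: is_fixed_point_def)
  have meas: "case_prod w' \<in> borel_measurable (lebesgue_on ({0<..<T} \<times> UNIV))"
    using W1 by (auto simp: Linfty_W1infty_def Linfty_Linfty_def Linfty_def)
  obtain C where "AE t in lebesgue_on {0<..<T}.
       continuous_on UNIV (w' t) \<and> (\<forall>x. \<bar>w' t x\<bar> \<le> C) \<and>
       (\<exists>g. is_weak_derivative (w' t) g \<and> (AE x in lebesgue. \<bar>g x\<bar> \<le> C))"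
    using W1 by (auto simp: Linfty_W1infty_def)
  note C0 = this
  \<comment> \<open>At almost every time the bound on the weak derivative becomes a Lipschitz bound
    on the continuous representative.\<close>
  have good: "AE t in lborel. 0 < t \<and> t < T \<longrightarrow> continuous_on UNIV (w' t) \<and> (\<forall>x. \<bar>w' t x\<bar> \<le> C) \<and>
      (\<forall>x z. \<bar>w' t x - w' t z\<bar> \<le> C * \<bar>x - z\<bar>)"
    using C0[unfolded AE_lebesgue_on_iff[OF borel_open[OF open_greaterThanLessThan]]]
  proof eventually_elim
    case (elim t)
    show ?case
    proof
      assume "0 < t \<and> t < T"
      then obtain g where g: "continuous_on UNIV (w' t)" "\<And>x. \<bar>w' t x\<bar> \<le> C" "is_weak_derivative (w' t) g" "AE x in lebesgue. \<bar>g x\<bar> \<le> C"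
        using elim by auto
      have C: "0 \<le> C" using g(2)[of 0] by linarith
      have gC: "AE x in lborel. \<bar>g x\<bar> \<le> C" using g(4) by (simp add: AE_lebesgue_lborel)
      have *: "\<bar>w' t z - w' t x\<bar> \<le> C * (z - x)" if "x < z" for x z
        by (rule weak_derivative_lipschitz[OF g(1,3) that _ C]) (use gC in eventually_elim, auto)
      have "\<bar>w' t x - w' t z\<bar> \<le> C * \<bar>x - z\<bar>" for x z
        using *[of x z] *[of z x] by (cases x z rule: linorder_cases) (auto simp: abs_minus_commute)
      then show "continuous_on UNIV (w' t) \<and> (\<forall>x. \<bar>w' t x\<bar> \<le> C) \<and> (\<forall>x z. \<bar>w' t x - w' t z\<bar> \<le> C * \<bar>x - z\<bar>)"
        using g by blast
    qed
  qed
  define D where "D = max 0 C"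
  have D0: "0 \<le> D" by (simp add: D_def)
  define b where "b t y = \<xi>' 0 y t" for t y
  have chy: "is_characteristic V vo T w' 0 y (\<lambda>t. b t y)" for y
    using ch T by (simp add: is_characteristics_def b_def)
  have "\<exists>\<beta>. \<beta> \<in> borel_measurable borel \<and> (AE s in lborel. 0 < s \<and> s < T \<longrightarrow> w' s (b s y) = \<beta> s)" for y
  proof -
    have cy: "continuous_on {0..T} (\<lambda>t. b t y)" using chy by (simp add: is_characteristic_def)
    have cw: "AE t in lebesgue_on {0<..<T}. continuous_on UNIV (w' t)" using C0 by eventually_elim blast
    show ?thesis by (rule caratheodory_measurable[OF meas cw cy T]) blast
  qed
  then obtain \<beta>0 where \<beta>0: "\<And>y. \<beta>0 y \<in> borel_measurable borel" "\<And>y. AE s in lborel. 0 < s \<and> s < T \<longrightarrow> w' s (b s y) = \<beta>0 y s"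
    by metis
  \<comment> \<open>Along the curve clipping is inactive at almost every time, where
    \<open>w'\<close> is bounded by \<open>D\<close>; it makes the velocity bounded
    everywhere.\<close>
  define \<beta> where "\<beta> y s = V (max (-D) (min D (\<beta>0 y s)))" for y s
  have \<beta>m: "\<beta> y \<in> borel_measurable borel" for y unfolding \<beta>_def using \<beta>0(1)[of y] by measurable
  obtain M where M: "M \<ge> 0" "\<And>p. p \<in> {-D..D} \<Longrightarrow> \<bar>V p\<bar> \<le> M" using V_bounded[of D] by blast
  have \<beta>M: "\<bar>\<beta> y s\<bar> \<le> M" for y s unfolding \<beta>_def by (rule M(2)) (use D0 in auto)
  have \<beta>loc_int: "loc_int (\<beta> y)" for y by (rule loc_int_bounded[OF \<beta>m \<beta>M])
  have \<beta>eq: "AE s in lborel. 0 < s \<and> s < T \<longrightarrow> V (w' s (b s y)) = \<beta> y s" for y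
    using \<beta>0(2)[of y] good
  proof eventually_elim
    case (elim s)
    show ?case
    proof
      assume s: "0 < s \<and> s < T"
      then have "\<bar>w' s (b s y)\<bar> \<le> D" using elim(2) by (simp add: D_def le_max_iff_disj)
      then show "V (w' s (b s y)) = \<beta> y s" using elim(1) s by (auto simp: \<beta>_def abs_le_iff)
    qed
  qed
  have T0: "0 \<in> {0..T}" using T by simp
  have Fb: "F (b t y) - F y = oint (\<beta> y) 0 t" if "t \<in> {0..T}" for t y
    using characteristic_iff[where \<beta>="\<beta> y" and w=w' and \<eta>="\<lambda>t. b t y" and x=y, OF \<beta>m \<beta>eq T0] chy[of y] that by blast
  have b0: "b 0 y = y" for y using Fb[OF T0, of y] by (simp add: F_eq_0)
  obtain LV where LV: "LV \<ge> 0" "\<And>p q. p \<in> {-D..D} \<Longrightarrow> q \<in> {-D..D} \<Longrightarrow> \<bar>V q - V p\<bar> \<le> LV * \<bar>q - p\<bar>"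
    using V_lip[of D] by blast
  define \<Lambda> where "\<Lambda> = LV * D * vu + 1"
  have Lam: "0 < \<Lambda>" using LV D0 vu by (simp add: \<Lambda>_def add_nonneg_pos)
  have blip: "AE s in lborel. 0 < s \<and> s < T \<longrightarrow> \<bar>\<beta> y s - \<beta> z s\<bar> \<le> \<Lambda> * \<bar>F (b s y) - F (b s z)\<bar>" for y z
    using \<beta>eq[of y] \<beta>eq[of z] good
  proof eventually_elim
    case (elim s)
    show ?case
    proof
      assume s: "0 < s \<and> s < T"
      have wD: "w' s x \<in> {-D..D}" for x
      proof -
        have "\<bar>w' s x\<bar> \<le> C" using elim(3) s by blast
        moreover have "C \<le> D" by (simp add: D_def)
        ultimately show ?thesis by auto
      qed
      have "\<bar>\<beta> y s - \<beta> z s\<bar> = \<bar>V (w' s (b s y)) - V (w' s (b s z))\<bar>" using elim(1,2) s by simp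
      also have "\<dots> \<le> LV * \<bar>w' s (b s y) - w' s (b s z)\<bar>" by (rule LV(2)[OF wD wD])
      also have "\<dots> \<le> LV * (D * \<bar>b s y - b s z\<bar>)"
      proof (rule mult_left_mono[OF _ LV(1)])
        have "\<bar>w' s (b s y) - w' s (b s z)\<bar> \<le> C * \<bar>b s y - b s z\<bar>" using elim(3) s by blast
        also have "\<dots> \<le> D * \<bar>b s y - b s z\<bar>" by (rule mult_right_mono) (auto simp: D_def)
        finally show "\<bar>w' s (b s y) - w' s (b s z)\<bar> \<le> D * \<bar>b s y - b s z\<bar>" .
      qed
      also have "\<dots> \<le> LV * (D * (vu * \<bar>F (b s y) - F (b s z)\<bar>))"
        using LV D0 le_F_diff by (intro mult_left_mono) auto
      also have "\<dots> \<le> \<Lambda> * \<bar>F (b s y) - F (b s z)\<bar>" by (simp add: \<Lambda>_def algebra_simps)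
      finally show "\<bar>\<beta> y s - \<beta> z s\<bar> \<le> \<Lambda> * \<bar>F (b s y) - F (b s z)\<bar>" .
    qed
  qed
  define c1 L1 where "c1 = vl / (2 * exp (2 * \<Lambda> * T) * vu)" and "L1 = 2 * exp (2 * \<Lambda> * T) * vu / vl"
  have bb: "bilip c1 L1 (b t)" if "t \<in> {0..T}" for t
    unfolding c1_def L1_def
  proof (rule flow_bilip[OF Lam \<beta>loc_int \<beta>M _ b0 blip that])
    show "F (b t y) - F (b s y) = oint (\<beta> y) s t" if "s \<in> {0..T}" "t \<in> {0..T}" for s t y
      using Fb[OF that(1), of y] Fb[OF that(2), of y] oint_add[OF \<beta>loc_int[of y], of 0 s t] by simp
  qed
  have eqW: "AE z in lborel. z \<in> {0<..<T} \<times> UNIV \<longrightarrow> w' (fst z) (snd z) = W q0 (b (fst z)) (snd z)"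
    using eq[unfolded AE_lebesgue_on_iff[OF strip_borel]]
  proof eventually_elim
    case (elim z)
    obtain t x where z: "z = (t, x)" by (cases z)
    show ?case using elim lebesgue_W[OF bb, of t x] by (auto simp: z b_def)
  qed
  \<comment> \<open>At almost every time both sides are continuous in \<open>x\<close>, so equality
    for almost every \<open>x\<close> improves to every \<open>x\<close>. Evaluation along a
    characteristic requires this.\<close>
  have all: "AE t in lborel. 0 < t \<and> t < T \<longrightarrow> (\<forall>x. w' t x = W q0 (b t) x)"
    using AE_prodD(1)[OF eqW] good
  proof eventually_elim
    case (elim t)
    show ?case
    proof (intro impI allI)
      fix x assume t: "0 < t \<and> t < T"
      show "w' t x = W q0 (b t) x"
      proof (rule continuous_AE_eq[where f="w' t" and g="W q0 (b t)"])
        show "continuous_on UNIV (w' t)" using elim(2) t by blast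
        show "continuous_on UNIV (W q0 (b t))"
          by (rule lipschitz_real_continuous) (rule W_lip[OF bb q0_meas q0_bound], use t in auto)
        show "AE x in lborel. w' t x = W q0 (b t) x" using elim(1) by eventually_elim (use t in auto)
      qed
    qed
  qed
  \<comment> \<open>\<open>flow_unique\<close> asks for one class containing both flows.\<close>
  define c2 L2 where "c2 = min c c1" and "L2 = max L L1"
  have c2: "0 < c2" using c0 bilip_pos(1)[OF bb[OF T0]] by (simp add: c2_def)
  have ab: "a t y = b t y" if "t \<in> {0..T}" for t y
  proof (rule flow_unique[where T=T and a=a and b=b and c=c2 and L=L2 and \<alpha>=vel and \<beta>=\<beta>])
    show "bilip c2 L2 (a t)" for t by (rule bilip_weaken[OF a_bilip c2]) (auto simp: c2_def L2_def)
    show "bilip c2 L2 (b t)" if "t \<in> {0..T}" for t by (rule bilip_weaken[OF bb[OF that] c2]) (auto simp: c2_def L2_def)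
    show "F (a t y) = F y + oint (vel y) 0 t" if "t \<in> {0..T}" for t y by (rule a_flow_vel[OF that])
    show "F (b t y) = F y + oint (\<beta> y) 0 t" if "t \<in> {0..T}" for t y using Fb[OF that, of y] by simp
    show "AE s in lborel. 0 < s \<and> s < T \<longrightarrow> vel y s = V (W q0 (a s) (a s y))" for y by (simp add: vel_def w_def)
    show "AE s in lborel. 0 < s \<and> s < T \<longrightarrow> \<beta> y s = V (W q0 (b s) (b s y))" for y
      using \<beta>eq[of y] all by eventually_elim auto
  qed (use T that vel_loc_int \<beta>loc_int in auto)
  show ?thesis
    unfolding AE_lebesgue_on_iff[OF strip_borel]
    using eqW
  proof eventually_elim
    case (elim z)
    obtain t x where z: "z = (t, x)" by (cases z)
    have "b t = a t" if "t \<in> {0..T}" using ab[OF that] by auto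
    then show ?case using elim by (auto simp: z w_def)
  qed
qed

end

section \<open>The solution transported by the flow\<close>

lemma AE_snd:
  fixes P :: "real \<Rightarrow> bool"
  assumes "AE x in lborel. P x"
  shows "AE z in (lborel :: (real \<times> real) measure). P (snd z)"
proof -
  obtain M where M: "{x \<in> space lborel. \<not> P x} \<subseteq> M" "emeasure lborel M = 0" "M \<in> sets lborel"
    by (rule AE_E[OF assms]) (rule that)
  have [measurable]: "M \<in> sets borel" using M by simp
  have "AE z in (lborel :: (real \<times> real) measure). snd z \<notin> M"
  proof (rule AE_prodI)
    have "{z :: real \<times> real. snd z \<notin> M} = UNIV \<times> (- M)" by auto
    also have "\<dots> \<in> sets borel" using \<open>M \<in> sets borel\<close> by (intro borel_Times) auto
    finally show "{z :: real \<times> real. snd z \<notin> M} \<in> sets borel" .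
    have "AE x in lborel. x \<notin> M" using M by (intro AE_not_in) (auto simp: null_sets_def)
    then show "AE t in lborel. AE x in lborel. snd (t :: real, x) \<notin> M" by simp
  qed
  then show ?thesis by eventually_elim (use M in auto)
qed

lemma L1_loc_bounded:
  assumes "u \<in> borel_measurable borel" "\<And>x. \<bar>u x\<bar> \<le> C"
  shows "u \<in> L1_loc"
  unfolding L1_loc_def set_integrable_def
proof (intro CollectI allI impI)
  fix K :: "real set" assume "compact K"
  then have K: "emeasure lborel K < \<infinity>" "K \<in> sets borel"
    using emeasure_compact_finite[OF \<open>compact K\<close>] borel_compact[OF \<open>compact K\<close>] by auto
  have "integrable lborel (\<lambda>x. indicator K x *\<^sub>R u x)"
    by (rule integrableI_bounded_set[where A=K and B=C]) (use K assms in \<open>auto simp: indicator_def\<close>)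
  then show "integrable lebesgue (\<lambda>x. indicator K x *\<^sub>R u x)"
    by (subst integrable_completion) auto
qed

text \<open>Continuous functions approximate \<open>g\<close> in L1 on a larger interval. Composing
  the error with \<open>\<theta> s\<close> costs at most the factor \<open>1 / c\<close>, uniformly
  in \<open>s\<close>, and for the continuous approximant it suffices that \<open>\<theta> s\<close>
  tends uniformly to the identity.\<close>

lemma L1_composition_limit:
  fixes g :: "real \<Rightarrow> real" and \<theta> :: "real \<Rightarrow> real \<Rightarrow> real"
  assumes g[measurable]: "g \<in> borel_measurable borel" and gC: "\<And>x. \<bar>g x\<bar> \<le> C"
    and \<theta>: "\<And>s. s \<in> S \<Longrightarrow> bilip c L (\<theta> s)" and d: "\<And>s x. s \<in> S \<Longrightarrow> \<bar>\<theta> s x - x\<bar> \<le> D * \<bar>s - t\<bar>"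
    and c: "0 < c" and D: "0 \<le> D"
  shows "((\<lambda>s. LBINT x:{-r..r}. \<bar>g (\<theta> s x) - g x\<bar>) \<longlongrightarrow> 0) (at t within S)"
proof -
  \<comment> \<open>For \<open>\<bar>s - t\<bar> \<le> 1\<close> the map \<open>\<theta> s\<close>
    moves points by at most \<open>D\<close>, so it takes \<open>[-r, r]\<close> into
    \<open>[-r', r']\<close>.\<close>
  define r' where "r' = \<bar>r\<bar> + D"
  have r': "0 \<le> r'" using D by (simp add: r'_def)
  obtain h where h: "\<And>n. continuous_on UNIV (h n)" "\<And>n x. \<bar>h n x\<bar> \<le> C" "AE x in lborel. (\<lambda>n. h n x) \<longlonglongrightarrow> g x"
    using continuous_approx_AE[OF g gC] by metis
  have [measurable]: "h n \<in> borel_measurable borel" for n by (rule borel_measurable_continuous_onI[OF h(1)])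
  have lim: "(\<lambda>n. LINT x|lborel. indicator {-r'..r'} x * \<bar>g x - h n x\<bar>) \<longlonglongrightarrow> (LINT x|lborel. indicator {-r'..r'} x * \<bar>g x - g x\<bar>)"
  proof (rule integral_dominated_convergence[where w="\<lambda>x. indicator {-r'..r'} x * (2 * C)"])
    show "integrable lborel (\<lambda>x. indicator {-r'..r'} x * (2 * C))"
      by (intro integrable_mult_left) (auto simp: integrable_indicator_iff emeasure_lborel_Icc_eq)
    show "AE x in lborel. (\<lambda>n. indicator {-r'..r'} x * \<bar>g x - h n x\<bar>) \<longlonglongrightarrow> indicator {-r'..r'} x * \<bar>g x - g x\<bar>"
      using h(3) by eventually_elim (intro tendsto_intros)
    show "AE x in lborel. norm (indicator {-r'..r'} x * \<bar>g x - h n x\<bar>) \<le> indicator {-r'..r'} x * (2 * C)" for n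
    proof (rule AE_I2)
      fix x
      have "\<bar>g x - h n x\<bar> \<le> 2 * C" using gC[of x] h(2)[of n x] by linarith
      then show "norm (indicator {-r'..r'} x * \<bar>g x - h n x\<bar>) \<le> indicator {-r'..r'} x * (2 * C)" by (simp add: indicator_def)
    qed
  qed measurable
  show ?thesis
    unfolding tendsto_iff
  proof (intro allI impI)
    fix e :: real assume e: "0 < e"
    \<comment> \<open>The approximation error occurs once composed with \<open>\<theta> s\<close>
      and once plain, together less than \<open>e / 2\<close>; the other half is left to the
      continuous part.\<close>
    define e1 where "e1 = min (e / 8 * c) (e / 8)"
    have "e1 / c \<le> e / 8" using c by (simp add: e1_def divide_le_eq)
    moreover have "e1 \<le> e / 8" by (simp add: e1_def)
    ultimately have e1: "0 < e1" "e1 / c + e1 < e / 2" using e c by (auto simp: e1_def)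
    have "eventually (\<lambda>n. \<bar>LINT x|lborel. indicator {-r'..r'} x * \<bar>g x - h n x\<bar>\<bar> < e1) sequentially"
      using order_tendstoD(2)[OF tendsto_rabs[OF lim], of e1] e1 by simp
    then obtain n where n: "(LINT x|lborel. indicator {-r'..r'} x * \<bar>g x - h n x\<bar>) < e1"
      using eventually_happens[of _ sequentially] by fastforce
    have "uniformly_continuous_on {-r'..r'} (h n)"
      by (rule compact_uniformly_continuous) (auto intro: continuous_on_subset[OF h(1)])
    moreover define e2 where "e2 = e / (4 * (\<bar>r\<bar> + 1))"
    have e2: "0 < e2" using e by (simp add: e2_def add_nonneg_pos)
    ultimately obtain \<delta> where \<delta>: "0 < \<delta>" "\<And>x y. x \<in> {-r'..r'} \<Longrightarrow> y \<in> {-r'..r'} \<Longrightarrow> \<bar>y - x\<bar> < \<delta> \<Longrightarrow> \<bar>h n y - h n x\<bar> < e2"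
      unfolding uniformly_continuous_on_def by (metis dist_real_def)
    define \<delta>' where "\<delta>' = min 1 (\<delta> / (D + 1))"
    have \<delta>': "0 < \<delta>'" using \<delta> D by (simp add: \<delta>'_def)
    have "\<bar>LBINT x:{-r..r}. \<bar>g (\<theta> s x) - g x\<bar>\<bar> < e" if s: "s \<in> S" "\<bar>s - t\<bar> < \<delta>'" for s
    proof -
      have [measurable]: "\<theta> s \<in> borel_measurable borel" by (rule bilip_borel[OF \<theta>[OF s(1)]])
      have dd: "\<bar>\<theta> s x - x\<bar> \<le> D" "\<bar>\<theta> s x - x\<bar> < \<delta>" for x
      proof -
        have "D * \<bar>s - t\<bar> \<le> D * 1" using s D by (intro mult_left_mono) (auto simp: \<delta>'_def)
        then show "\<bar>\<theta> s x - x\<bar> \<le> D" using d[OF s(1), of x] by linarith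
        have "D * \<bar>s - t\<bar> \<le> D * (\<delta> / (D + 1))" using s D by (intro mult_left_mono) (auto simp: \<delta>'_def)
        also have "\<dots> < \<delta>" using D \<delta>(1) by (simp add: field_simps)
        finally show "\<bar>\<theta> s x - x\<bar> < \<delta>" using d[OF s(1), of x] by linarith
      qed
      have ig: "integrable lborel (\<lambda>x. indicator {-r'..r'} x * \<bar>g x - h n x\<bar>)"
      proof -
        have "loc_int (\<lambda>x. \<bar>g x - h n x\<bar>)"
          by (intro loc_int_abs loc_int_diff loc_int_bounded[OF g gC] loc_int_continuous[OF h(1)])
        then show ?thesis by (auto dest!: loc_intD simp: set_integrable_def)
      qed
      note ig' = bilip_integrable[OF \<theta>[OF s(1)] ig]
      have ir: "integrable lborel (\<lambda>x. indicator {-r..r} x * e2)"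
        by (intro integrable_mult_left) (auto simp: integrable_indicator_iff emeasure_lborel_Icc_eq)
      have "(LBINT x:{-r..r}. \<bar>g (\<theta> s x) - g x\<bar>) \<le>
        (LINT x|lborel. indicator {-r'..r'} (\<theta> s x) * \<bar>g (\<theta> s x) - h n (\<theta> s x)\<bar> + indicator {-r..r} x * e2
          + indicator {-r'..r'} x * \<bar>g x - h n x\<bar>)"
        unfolding set_lebesgue_integral_def
      proof (rule integral_mono_AE')
        show "integrable lborel (\<lambda>x. indicator {-r'..r'} (\<theta> s x) * \<bar>g (\<theta> s x) - h n (\<theta> s x)\<bar> + indicator {-r..r} x * e2
          + indicator {-r'..r'} x * \<bar>g x - h n x\<bar>)"
          by (intro Bochner_Integration.integrable_add ig ig'(1) ir)
        have "indicator {-r..r} x *\<^sub>R \<bar>g (\<theta> s x) - g x\<bar> \<le>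
          indicator {-r'..r'} (\<theta> s x) * \<bar>g (\<theta> s x) - h n (\<theta> s x)\<bar> + indicator {-r..r} x * e2 + indicator {-r'..r'} x * \<bar>g x - h n x\<bar>" for x
        proof (cases "x \<in> {-r..r}")
          case True
          then have x: "x \<in> {-r'..r'}" "\<theta> s x \<in> {-r'..r'}" using dd(1)[of x] D by (auto simp: r'_def)
          have "\<bar>h n (\<theta> s x) - h n x\<bar> < e2" by (rule \<delta>(2)[OF x dd(2)])
          then show ?thesis using x True by simp
        qed simp
        then show "AE x in lborel. indicator {-r..r} x *\<^sub>R \<bar>g (\<theta> s x) - g x\<bar> \<le>
          indicator {-r'..r'} (\<theta> s x) * \<bar>g (\<theta> s x) - h n (\<theta> s x)\<bar> + indicator {-r..r} x * e2 + indicator {-r'..r'} x * \<bar>g x - h n x\<bar>"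
          by simp
      qed (use e2 in \<open>auto intro!: AE_I2 add_nonneg_nonneg\<close>)
      also have "\<dots> = (LINT x|lborel. indicator {-r'..r'} (\<theta> s x) * \<bar>g (\<theta> s x) - h n (\<theta> s x)\<bar>)
        + (LINT x|lborel. indicator {-r..r} x * e2) + (LINT x|lborel. indicator {-r'..r'} x * \<bar>g x - h n x\<bar>)"
        using ig ig'(1) ir by simp
      also have "\<dots> \<le> e1 / c + e / 2 + e1"
      proof (intro add_mono)
        have "(LINT x|lborel. indicator {-r'..r'} (\<theta> s x) * \<bar>g (\<theta> s x) - h n (\<theta> s x)\<bar>) \<le> (LINT x|lborel. indicator {-r'..r'} x * \<bar>g x - h n x\<bar>) / c"
          using ig'(2) by (simp add: abs_mult)
        also have "\<dots> \<le> e1 / c" using n c by (intro divide_right_mono) auto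
        finally show "(LINT x|lborel. indicator {-r'..r'} (\<theta> s x) * \<bar>g (\<theta> s x) - h n (\<theta> s x)\<bar>) \<le> e1 / c" .
        have "(LINT x|lborel. indicator {-r..r} x * e2) = measure lborel {-r..r} * e2" by simp
        also have "\<dots> \<le> (2 * \<bar>r\<bar>) * e2" using e2 by (intro mult_right_mono) (cases "0 \<le> r", auto)
        also have "\<dots> \<le> e / 2" using e by (simp add: e2_def field_simps)
        finally show "(LINT x|lborel. indicator {-r..r} x * e2) \<le> e / 2" .
      qed (use n in auto)
      also have "\<dots> < e" using e1 by linarith
      finally have "(LBINT x:{-r..r}. \<bar>g (\<theta> s x) - g x\<bar>) < e" .
      moreover have "0 \<le> (LBINT x:{-r..r}. \<bar>g (\<theta> s x) - g x\<bar>)" by (auto simp: set_lebesgue_integral_def)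
      ultimately show ?thesis by simp
    qed
    then show "\<forall>\<^sub>F s in at t within S. dist (LBINT x:{-r..r}. \<bar>g (\<theta> s x) - g x\<bar>) 0 < e"
      unfolding eventually_at using \<delta>' by (auto simp: dist_real_def intro!: exI[of _ \<delta>'])
  qed
qed

section \<open>Joint measurability, continuity in time and weak form of the transported
  solution\<close>

context nonlocal_flow
begin

text \<open>The derivative of \<open>k t\<close> in space, as a sequential limit of difference
  quotients clipped to its a priori range. Being an explicit limit it is jointly Borel in
  \<open>(t, x)\<close>; \<open>dens (a t)\<close>, chosen separately for each \<open>t\<close>, is
  not known to be.\<close>

definition Dk :: "real \<Rightarrow> real \<Rightarrow> real" where
  "Dk t x = max 0 (min (1 / c) (lim (\<lambda>n. (k t (x + inverse (real (Suc n))) - k t x) / inverse (real (Suc n)))))"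

definition sol :: "real \<Rightarrow> real \<Rightarrow> real" where "sol t x = q0 (k t x) * Dk t x"

lemma a_continuous: "continuous_on UNIV (\<lambda>(t, x). a t x)"
proof (rule lipschitz_on_continuous_on[of "B + L"], rule lipschitz_onI)
  have L: "0 < L" by (rule bilip_pos[OF a_bilip])
  then show "0 \<le> B + L" using B0 by simp
  fix p q :: "real \<times> real"
  obtain t x s z where p: "p = (t, x)" and q: "q = (s, z)" by (cases p, cases q)
  have "\<bar>a t x - a s z\<bar> \<le> \<bar>a t x - a s x\<bar> + \<bar>a s x - a s z\<bar>" by simp
  also have "\<dots> \<le> B * \<bar>t - s\<bar> + L * \<bar>x - z\<bar>" by (intro add_mono a_time bilip_abs(2)[OF a_bilip])
  also have "\<dots> \<le> B * dist p q + L * dist p q"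
    using dist_fst_le[of p q] dist_snd_le[of p q] B0 L
    by (intro mult_left_mono add_mono) (auto simp: p q dist_real_def)
  finally show "dist (case p of (t, x) \<Rightarrow> a t x) (case q of (t, x) \<Rightarrow> a t x) \<le> (B + L) * dist p q"
    by (simp add: p q dist_real_def algebra_simps)
qed

lemma k_lip: "\<bar>k t x - k s z\<bar> \<le> 1 / c * (\<bar>x - z\<bar> + B * \<bar>t - s\<bar>)"
proof -
  have "c * \<bar>k t x - k s z\<bar> \<le> \<bar>a t (k t x) - a t (k s z)\<bar>" by (rule bilip_abs(1)[OF a_bilip])
  also have "\<dots> = \<bar>(x - z) + (a s (k s z) - a t (k s z))\<bar>" by simp
  also have "\<dots> \<le> \<bar>x - z\<bar> + \<bar>a s (k s z) - a t (k s z)\<bar>" by (rule abs_triangle_ineq)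
  also have "\<dots> \<le> \<bar>x - z\<bar> + B * \<bar>s - t\<bar>" by (rule add_left_mono[OF a_time])
  finally show ?thesis using c0 by (simp add: field_simps abs_minus_commute)
qed

lemma k_continuous: "continuous_on UNIV (\<lambda>(t, x). k t x)"
proof (rule lipschitz_on_continuous_on[of "1 / c * (1 + B)"], rule lipschitz_onI)
  show "0 \<le> 1 / c * (1 + B)" using B0 c0 by simp
  fix p q :: "real \<times> real"
  obtain t x s z where p: "p = (t, x)" and q: "q = (s, z)" by (cases p, cases q)
  have "\<bar>k t x - k s z\<bar> \<le> 1 / c * (\<bar>x - z\<bar> + B * \<bar>t - s\<bar>)" by (rule k_lip)
  also have "\<dots> \<le> 1 / c * (dist p q + B * dist p q)"
    using dist_fst_le[of p q] dist_snd_le[of p q] B0 c0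
    by (intro mult_left_mono add_mono) (auto simp: p q dist_real_def)
  finally show "dist (case p of (t, x) \<Rightarrow> k t x) (case q of (t, x) \<Rightarrow> k t x) \<le> 1 / c * (1 + B) * dist p q"
    by (simp add: p q dist_real_def algebra_simps add_divide_distrib)
qed

lemma k_meas2[measurable]: "case_prod k \<in> borel_measurable (borel \<Otimes>\<^sub>M borel)"
  unfolding borel_prod by (rule borel_measurable_continuous_onI[OF k_continuous])
lemma a_meas2[measurable]: "case_prod a \<in> borel_measurable (borel \<Otimes>\<^sub>M borel)"
  unfolding borel_prod by (rule borel_measurable_continuous_onI[OF a_continuous])
lemma w_meas2[measurable]: "case_prod w \<in> borel_measurable (borel \<Otimes>\<^sub>M borel)"
  unfolding borel_prod by (rule borel_measurable_continuous_onI[OF w_continuous])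

lemma Dk_meas2[measurable]: "case_prod Dk \<in> borel_measurable (borel \<Otimes>\<^sub>M borel)"
  unfolding Dk_def by measurable
lemma sol_meas2[measurable]: "case_prod sol \<in> borel_measurable (borel \<Otimes>\<^sub>M borel)"
  unfolding sol_def by measurable

lemma slice_meas: "case_prod f \<in> borel_measurable (borel \<Otimes>\<^sub>M borel) \<Longrightarrow> f t \<in> borel_measurable borel"
  for f :: "real \<Rightarrow> real \<Rightarrow> real"
  using measurable_compose_Pair1[of t borel "case_prod f"] by simp

lemma k_meas[measurable]: "k t \<in> borel_measurable borel" by (rule slice_meas) measurable
lemma a_meas[measurable]: "a t \<in> borel_measurable borel" by (rule slice_meas) measurable
lemma Dk_meas[measurable]: "Dk t \<in> borel_measurable borel" by (rule slice_meas) measurable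
lemma sol_meas[measurable]: "sol t \<in> borel_measurable borel" by (rule slice_meas) measurable

lemma Dk_bounds: "0 \<le> Dk t x" "Dk t x \<le> 1 / c" using c0 by (auto simp: Dk_def)

text \<open>Where \<open>k t\<close> has derivative \<open>dens (a t) x\<close>, the difference
  quotients converge to it and already lie in \<open>[0, 1 / c]\<close>, so that the clipping is
  inactive.\<close>

lemma Dk_dens: "AE x in lborel. (k t has_real_derivative Dk t x) (at x) \<and> Dk t x = dens (a t) x"
  using dens_deriv[OF a_bilip, of t]
proof eventually_elim
  case (elim x)
  define u where "u n = (k t (x + inverse (real (Suc n))) - k t x) / inverse (real (Suc n))" for n
  have "((\<lambda>h. (k t (x + h) - k t x) / h) \<longlongrightarrow> dens (a t) x) (at 0)"
    using elim by (simp add: DERIV_def k_def)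
  moreover have "filterlim (\<lambda>n. inverse (real (Suc n))) (at 0) sequentially"
    unfolding filterlim_at using LIMSEQ_inverse_real_of_nat by auto
  ultimately have lim: "u \<longlonglongrightarrow> dens (a t) x" unfolding u_def by (rule filterlim_compose)
  have ub: "0 \<le> u n" "u n \<le> 1 / c" for n
  proof -
    define e where "e = inverse (real (Suc n))"
    have e: "0 < e" by (simp add: e_def)
    have "k t (x + e) - k t x \<le> 1 / c * (x + e - x)"
      using k_bilip[of t] e unfolding bilip_def by (smt (verit))
    moreover have "k t x \<le> k t (x + e)" using bilip_leq[OF k_bilip, of t x "x + e"] e by simp
    ultimately show "0 \<le> u n" "u n \<le> 1 / c" using e unfolding u_def e_def[symmetric] by (auto simp: divide_le_eq)
  qed
  have "0 \<le> dens (a t) x" "dens (a t) x \<le> 1 / c"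
    using LIMSEQ_le_const[OF lim] LIMSEQ_le_const2[OF lim] ub by blast+
  moreover have "Dk t x = max 0 (min (1 / c) (lim u))" unfolding Dk_def u_def ..
  ultimately have "Dk t x = dens (a t) x" using limI[OF lim] by simp
  then show ?case using elim by (simp add: k_def)
qed

lemma Dk_cov:
  assumes [measurable]: "f \<in> borel_measurable borel"
  shows "(LINT y|lborel. f (a t y)) = (LINT x|lborel. Dk t x * f x)"
proof -
  have [measurable]: "dens (a t) \<in> borel_measurable borel" by (rule dens_measurable[OF a_bilip])
  have "(LINT y|lborel. f (a t y)) = (LINT x|lborel. dens (a t) x * f x)" by (rule dens_cov[OF a_bilip]) simp
  also have "\<dots> = (LINT x|lborel. Dk t x * f x)"
    by (rule integral_cong_AE) (use Dk_dens[of t] in \<open>auto\<close>)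
  finally show ?thesis .
qed

lemma sol_bound: "\<bar>sol t x\<bar> \<le> N * (1 / c)"
  unfolding sol_def abs_mult by (rule mult_mono) (use q0_bound Dk_bounds N0 in auto)

lemma sol_formula:
  "AE x in lebesgue. (\<lambda>y. xi t y 0) differentiable (at x) \<and> sol t x = qo (xi t x 0) * deriv (\<lambda>y. xi t y 0) x"
proof -
  have "AE x in lborel. qo (k t x) = q0 (k t x)" by (rule AE_bilip[OF k_bilip qo])
  then have "AE x in lborel. (k t) differentiable (at x) \<and> sol t x = qo (k t x) * deriv (k t) x"
    using Dk_dens[of t]
  proof eventually_elim
    case (elim x)
    have "deriv (k t) x = Dk t x" by (rule DERIV_imp_deriv[OF conjunct1[OF elim(2)]])
    moreover have "(k t) differentiable (at x)" using elim(2) real_differentiable_def by blast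
    ultimately show ?case using elim(1) by (simp add: sol_def)
  qed
  then show ?thesis by (simp add: xi_def AE_lebesgue_lborel)
qed

text \<open>The substitution \<open>z = a t y\<close> turns the convolution with the transported
  density into \<open>W q0 (a t)\<close>: the solution generates the very field that transports
  it.\<close>

lemma sol_convolution: "convolution go (sol t) x = w t x"
proof -
  have "AE y in lborel. go (x - y) = \<gamma> (x - y)"
    by (rule AE_expanding[where c=1 and a="\<lambda>y. x - y" and P="\<lambda>z. go z = \<gamma> z", OF _ _ go]) auto
  then have "convolution go (sol t) x = (LINT y|lborel. \<gamma> (x - y) * sol t y)"
    unfolding convolution_def by (intro LINT_lebesgue_rep(1)) auto
  also have "\<dots> = (LINT z|lborel. Dk t z * (\<gamma> (x - z) * q0 (k t z)))" by (simp add: sol_def ac_simps)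
  also have "\<dots> = (LINT y|lborel. \<gamma> (x - a t y) * q0 (k t (a t y)))" by (rule Dk_cov[symmetric]) measurable
  finally show ?thesis by (simp add: w_def W_def)
qed

lemma sol_Linfty: "sol \<in> Linfty_Linfty T"
proof -
  have "case_prod sol \<in> borel_measurable borel" using sol_meas2 by (simp add: borel_prod)
  then show ?thesis unfolding Linfty_Linfty_def Linfty_def using sol_bound
    by (auto intro!: exI[of _ "N * (1 / c)"] borel_pair_lebesgue_on)
qed

lemma vel_lip: "\<exists>\<Lambda>\<ge>0. \<forall>y z s. \<bar>vel y s - vel z s\<bar> \<le> \<Lambda> * \<bar>y - z\<bar>"
proof -
  obtain LV where LV: "LV \<ge> 0" "\<And>p q. p \<in> {-R..R} \<Longrightarrow> q \<in> {-R..R} \<Longrightarrow> \<bar>V q - V p\<bar> \<le> LV * \<bar>q - p\<bar>"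
    using V_lip[of R] by blast
  have L: "0 < L" by (rule bilip_pos[OF a_bilip])
  have "\<bar>vel y s - vel z s\<bar> \<le> (LV * \<kappa> * L) * \<bar>y - z\<bar>" for y z s
  proof -
    have "\<bar>vel y s - vel z s\<bar> \<le> LV * \<bar>w s (a s y) - w s (a s z)\<bar>"
      unfolding vel_def by (rule LV(2)[OF w_bound' w_bound'])
    also have "\<dots> \<le> LV * (\<kappa> * \<bar>a s y - a s z\<bar>)" by (rule mult_left_mono[OF w_lip_space LV(1)])
    also have "\<dots> \<le> LV * (\<kappa> * (L * \<bar>y - z\<bar>))"
      using LV kappa0 bilip_abs(2)[OF a_bilip] by (intro mult_left_mono) auto
    finally show ?thesis by (simp add: mult.assoc)
  qed
  then show ?thesis using LV kappa0 L by (intro exI[of _ "LV * \<kappa> * L"]) auto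
qed

text \<open>\<open>\<theta>\<close> carries positions at time \<open>s\<close> along characteristics
  to positions at time \<open>t\<close>, and \<open>\<theta>\<close> is \<open>G\<close> applied to
  \<open>F + E\<close>, where the slope of \<open>E\<close> is of order
  \<open>\<bar>s - t\<bar>\<close>. Differentiating \<open>k s = k t \<circ> \<theta>\<close> gives
  \<open>sol s x\<close> as the product \<open>sol t * v\<close> at \<open>\<theta> x\<close> times
  \<open>1 / v x + e x\<close>. Thus it is \<open>sol * v\<close>, not \<open>sol\<close>, that is
  constant along characteristics up to an error linear in \<open>\<bar>s - t\<bar>\<close>.\<close>

lemma sol_difference:
  assumes \<Lambda>: "0 \<le> \<Lambda>" "\<And>y z s. \<bar>vel y s - vel z s\<bar> \<le> \<Lambda> * \<bar>y - z\<bar>"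
    and st: "s \<in> {0..T}" "t \<in> {0..T}"
  shows "AE x in lborel. \<bar>sol s x - sol t x\<bar> \<le>
    1 / vl * \<bar>sol t (a t (k s x)) * v (a t (k s x)) - sol t x * v x\<bar> + N * (1 / c) * vu * (\<Lambda> * (1 / c)) * \<bar>s - t\<bar>"
proof -
  define \<theta> where "\<theta> x = a t (k s x)" for x
  have b\<theta>: "bilip (c * (1 / L)) (L * (1 / c)) \<theta>" unfolding \<theta>_def[abs_def] by (rule bilip_comp[OF a_bilip k_bilip])
  define E where "E x = F (\<theta> x) - F x" for x
  have E: "E x = oint (vel (k s x)) s t" for x
    using a_flow_diff[OF st, of "k s x"] by (simp add: E_def \<theta>_def)
  have Elip: "\<bar>E x - E z\<bar> \<le> (\<Lambda> * (1 / c) * \<bar>t - s\<bar>) * \<bar>x - z\<bar>" for x z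
  proof -
    have kk: "\<bar>k s x - k s z\<bar> \<le> 1 / c * \<bar>x - z\<bar>"
      using k_lip[of s x s z] unfolding diff_self abs_zero mult_zero_right add_0_right .
    have Exz: "E x - E z = oint (\<lambda>r. vel (k s x) r - vel (k s z) r) s t" by (simp add: E oint_diff vel_loc_int)
    have "\<bar>E x - E z\<bar> \<le> (\<Lambda> * \<bar>k s x - k s z\<bar>) * \<bar>t - s\<bar>"
      unfolding Exz by (rule oint_bound[OF loc_int_diff[OF vel_loc_int vel_loc_int]]) (rule AE_I2, rule impI, rule \<Lambda>(2))
    also have "\<dots> \<le> (\<Lambda> * (1 / c * \<bar>x - z\<bar>)) * \<bar>t - s\<bar>"
      by (rule mult_right_mono[OF mult_left_mono[OF kk \<Lambda>(1)] abs_ge_zero])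
    also have "\<dots> = (\<Lambda> * (1 / c) * \<bar>t - s\<bar>) * \<bar>x - z\<bar>" by (simp only: ac_simps)
    finally show ?thesis .
  qed
  obtain e where "e \<in> borel_measurable borel" and e1: "\<And>x. \<bar>e x\<bar> \<le> \<Lambda> * (1 / c) * \<bar>t - s\<bar>"
    and "\<And>a b. E b - E a = oint e a b" and e2: "AE x in lborel. (E has_real_derivative e x) (at x)"
    by (rule lipschitz_density[OF Elip]) (rule that)
  note e = e1 e2
  \<comment> \<open>Exceptional points of \<open>G\<close> are pulled back by the bi-Lipschitz map
    \<open>F \<circ> \<theta>\<close>, exceptional points of \<open>k t\<close> by
    \<open>\<theta>\<close>.\<close>
  have G\<theta>: "AE x in lborel. (G has_real_derivative v (G (F (\<theta> x)))) (at (F (\<theta> x)))"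
    by (rule AE_bilip[OF bilip_comp[OF F_bilip b\<theta>] G_deriv])
  have K\<theta>: "AE x in lborel. (k t has_real_derivative Dk t (\<theta> x)) (at (\<theta> x)) \<and> Dk t (\<theta> x) = dens (a t) (\<theta> x)"
    by (rule AE_bilip[OF b\<theta> Dk_dens])
  define g where "g z = sol t z * v z" for z
  have gB: "\<bar>g z\<bar> \<le> N * (1 / c) * vu" for z
    unfolding g_def abs_mult
    by (intro mult_mono sol_bound) (use v_lower[of z] v_upper[of z] vl N0 c0 in auto)
  show ?thesis
    using F_deriv e(2) G\<theta> K\<theta> Dk_dens[of s]
  proof eventually_elim
    case (elim x)
    \<comment> \<open>Chain rule for \<open>\<theta>\<close>: the factor
      \<open>v (\<theta> x)\<close> will come from \<open>G\<close>, the summand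
      \<open>1 / v x\<close> from \<open>F\<close>.\<close>
    have FE: "((\<lambda>x. F x + E x) has_real_derivative 1 / v x + e x) (at x)" by (rule DERIV_add[OF elim(1,2)])
    have "F x + E x = F (\<theta> x)" by (simp add: E_def)
    with elim(3) have "(G has_real_derivative v (\<theta> x)) (at (F x + E x))" by simp
    from DERIV_chain2[OF this FE] have "((\<lambda>x. G (F x + E x)) has_real_derivative v (\<theta> x) * (1 / v x + e x)) (at x)" .
    moreover have "(\<lambda>x. G (F x + E x)) = \<theta>" by (auto simp: E_def)
    ultimately have "(\<theta> has_real_derivative v (\<theta> x) * (1 / v x + e x)) (at x)" by simp
    from DERIV_chain2[OF conjunct1[OF elim(4)] this]
    have "((\<lambda>x. k t (\<theta> x)) has_real_derivative Dk t (\<theta> x) * (v (\<theta> x) * (1 / v x + e x))) (at x)" .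
    moreover have "(\<lambda>x. k t (\<theta> x)) = k s" by (auto simp: \<theta>_def)
    ultimately have "Dk s x = Dk t (\<theta> x) * (v (\<theta> x) * (1 / v x + e x))"
      using DERIV_unique[OF conjunct1[OF elim(5)]] by simp
    then have ss: "sol s x = g (\<theta> x) * (1 / v x + e x)" by (simp add: sol_def g_def \<theta>_def)
    have vx: "0 < v x" "1 / v x \<le> 1 / vl" using v_lower[of x] vl by (auto intro!: frac_le)
    have "sol s x - sol t x = 1 / v x * (g (\<theta> x) - g x) + g (\<theta> x) * e x"
      unfolding ss using vx by (simp add: g_def field_simps)
    then have "\<bar>sol s x - sol t x\<bar> \<le> \<bar>1 / v x * (g (\<theta> x) - g x)\<bar> + \<bar>g (\<theta> x) * e x\<bar>" by (simp only: abs_triangle_ineq)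
    also have "\<dots> \<le> 1 / vl * \<bar>g (\<theta> x) - g x\<bar> + N * (1 / c) * vu * (\<Lambda> * (1 / c) * \<bar>t - s\<bar>)"
      unfolding abs_mult
      by (intro add_mono mult_mono gB e(1)) (use vx vl N0 c0 vu in auto)
    finally show ?case by (simp add: g_def \<theta>_def abs_minus_commute mult.assoc)
  qed
qed

text \<open>By \<open>sol_difference\<close> continuity in time reduces to L1 continuity of the
  compositions of \<open>sol t * v\<close> with \<open>\<theta> s\<close>; this product is only
  bounded and measurable, which is what \<open>L1_composition_limit\<close> can handle.\<close>

lemma sol_C_L1_loc: "sol \<in> C_L1_loc T"
  unfolding C_L1_loc_def
proof (intro CollectI conjI ballI allI impI)
  show "sol t \<in> L1_loc" for t by (rule L1_loc_bounded[OF sol_meas sol_bound])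
next
  fix K :: "real set" and t assume K: "compact K" and t: "t \<in> {0..T}"
  obtain r where r: "K \<subseteq> {-r..r}"
    using compact_imp_bounded[OF K] by (auto simp: bounded_iff abs_le_iff minus_le_iff subset_iff)
  have Kb[measurable]: "K \<in> sets borel" using K by (rule borel_compact)
  obtain \<Lambda> where \<Lambda>: "0 \<le> \<Lambda>" "\<And>y z s. \<bar>vel y s - vel z s\<bar> \<le> \<Lambda> * \<bar>y - z\<bar>" using vel_lip by blast
  define g where "g z = sol t z * v z" for z
  have gm[measurable]: "g \<in> borel_measurable borel" unfolding g_def by measurable
  have gB: "\<bar>g z\<bar> \<le> N * (1 / c) * vu" for z
    unfolding g_def abs_mult
    by (intro mult_mono sol_bound) (use v_lower[of z] v_upper[of z] vl N0 c0 in auto)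
  define \<theta> where "\<theta> s x = a t (k s x)" for s x
  have b\<theta>: "bilip (c * (1 / L)) (L * (1 / c)) (\<theta> s)" for s unfolding \<theta>_def[abs_def] by (rule bilip_comp[OF a_bilip k_bilip])
  have \<theta>m[measurable]: "\<theta> s \<in> borel_measurable borel" for s by (rule bilip_borel[OF b\<theta>])
  have \<theta>d: "\<bar>\<theta> s x - x\<bar> \<le> B * \<bar>s - t\<bar>" for s x
    using a_time[of t "k s x" s] by (simp add: \<theta>_def abs_minus_commute)
  define J where "J s = (LBINT x:{-r..r}. \<bar>g (\<theta> s x) - g x\<bar>)" for s
  have J: "(J \<longlongrightarrow> 0) (at t within {0..T})"
    unfolding J_def
    by (rule L1_composition_limit[OF gm gB b\<theta> \<theta>d bilip_pos(1)[OF b\<theta>] B0])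
  define M where "M = N * (1 / c) * vu * (\<Lambda> * (1 / c))"
  have M0: "0 \<le> M" using N0 c0 vu \<Lambda>(1) by (simp add: M_def)
  have le: "(LINT x:K|lebesgue. \<bar>sol s x - sol t x\<bar>) \<le> 1 / vl * J s + M * \<bar>s - t\<bar> * (2 * \<bar>r\<bar>)" if s: "s \<in> {0..T}" for s
  proof -
    have i1: "integrable lborel (\<lambda>x. indicator {-r..r} x *\<^sub>R \<bar>g (\<theta> s x) - g x\<bar>)"
    proof -
      have "loc_int (\<lambda>x. \<bar>g (\<theta> s x) - g x\<bar>)"
      proof (intro loc_int_abs loc_int_diff loc_int_bounded[OF gm gB])
        show "loc_int (\<lambda>x. g (\<theta> s x))" by (rule loc_int_bounded[where C="N * (1 / c) * vu"]) (measurable, rule gB)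
      qed
      then show ?thesis by (auto dest!: loc_intD simp: set_integrable_def)
    qed
    have i2: "integrable lborel (\<lambda>x. indicator {-r..r} x * (M * \<bar>s - t\<bar>))"
      by (intro integrable_mult_left) (auto simp: integrable_indicator_iff emeasure_lborel_Icc_eq)
    have "(LINT x:K|lebesgue. \<bar>sol s x - sol t x\<bar>) = (LINT x|lborel. indicator K x *\<^sub>R \<bar>sol s x - sol t x\<bar>)"
      unfolding set_lebesgue_integral_def by (rule integral_completion) measurable
    also have "\<dots> \<le> (LINT x|lborel. 1 / vl * (indicator {-r..r} x *\<^sub>R \<bar>g (\<theta> s x) - g x\<bar>) + indicator {-r..r} x * (M * \<bar>s - t\<bar>))"
    proof (rule integral_mono_AE')
      show "integrable lborel (\<lambda>x. 1 / vl * (indicator {-r..r} x *\<^sub>R \<bar>g (\<theta> s x) - g x\<bar>) + indicator {-r..r} x * (M * \<bar>s - t\<bar>))"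
        by (intro Bochner_Integration.integrable_add integrable_mult_right i1 i2)
      show "AE x in lborel. indicator K x *\<^sub>R \<bar>sol s x - sol t x\<bar> \<le> 1 / vl * (indicator {-r..r} x *\<^sub>R \<bar>g (\<theta> s x) - g x\<bar>) + indicator {-r..r} x * (M * \<bar>s - t\<bar>)"
        using sol_difference[OF \<Lambda> s t]
      proof eventually_elim
        case (elim x)
        show ?case
        proof (cases "x \<in> K")
          case True
          then have "x \<in> {-r..r}" using r by blast
          then show ?thesis using elim True by (simp add: g_def \<theta>_def M_def)
        next
          case False
          then show ?thesis using vl M0 by (simp add: indicator_def)
        qed
      qed
    qed (use vl M0 in \<open>auto intro!: AE_I2 add_nonneg_nonneg\<close>)
    also have "\<dots> = 1 / vl * J s + (M * \<bar>s - t\<bar>) * measure lborel {-r..r}"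
      using i1 i2 by (subst Bochner_Integration.integral_add) (auto simp: J_def set_lebesgue_integral_def)
    also have "\<dots> \<le> 1 / vl * J s + (M * \<bar>s - t\<bar>) * (2 * \<bar>r\<bar>)"
      by (intro add_left_mono mult_left_mono) (use M0 in \<open>cases "0 \<le> r"; simp\<close>)+
    finally show ?thesis by simp
  qed
  show "((\<lambda>s. LINT x:K|lebesgue. \<bar>sol s x - sol t x\<bar>) \<longlongrightarrow> 0) (at t within {0..T})"
  proof (rule tendsto_sandwich)
    show "\<forall>\<^sub>F s in at t within {0..T}. 0 \<le> (LINT x:K|lebesgue. \<bar>sol s x - sol t x\<bar>)"
      by (auto simp: set_lebesgue_integral_def intro!: always_eventually)
    show "\<forall>\<^sub>F s in at t within {0..T}. (LINT x:K|lebesgue. \<bar>sol s x - sol t x\<bar>) \<le> 1 / vl * J s + M * \<bar>s - t\<bar> * (2 * \<bar>r\<bar>)"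
      unfolding eventually_at_filter using le by (auto intro!: always_eventually)
    have "((\<lambda>s. 1 / vl * J s + M * \<bar>s - t\<bar> * (2 * \<bar>r\<bar>)) \<longlongrightarrow> 1 / vl * 0 + M * \<bar>t - t\<bar> * (2 * \<bar>r\<bar>)) (at t within {0..T})"
      by (intro tendsto_intros J)
    then show "((\<lambda>s. 1 / vl * J s + M * \<bar>s - t\<bar> * (2 * \<bar>r\<bar>)) \<longlongrightarrow> 0) (at t within {0..T})" by simp
  qed auto
qed

text \<open>A single characteristic may stay at a point where \<open>G\<close> is not
  differentiable. At each fixed time only a null set of starting points is mapped to such points, so
  Fubini excludes them along almost every characteristic at almost every time.\<close>

lemma char_AE_deriv:
  "AE y in lborel. AE t in lborel. 0 < t \<and> t < T \<longrightarrow> ((\<lambda>t. a t y) has_real_derivative v (a t y) * vel y t) (at t)"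
proof -
  \<comment> \<open>A Borel null set covering the exceptional one, so that its preimage in the plane
    is measurable.\<close>
  obtain M where M: "{z \<in> space lborel. \<not> (G has_real_derivative v (G z)) (at z)} \<subseteq> M" "emeasure lborel M = 0" "M \<in> sets lborel"
    by (rule AE_E[OF G_deriv]) (rule that)
  have [measurable]: "M \<in> sets borel" using M by simp
  have nM: "AE z in lborel. z \<notin> M" using M by (intro AE_not_in) (auto simp: null_sets_def)
  have "AE z in lborel. F (case_prod a z) \<notin> M"
  proof (rule AE_prodI)
    have "(\<lambda>z. F (case_prod a z)) \<in> borel_measurable borel"
      unfolding borel_prod[symmetric] by measurable
    from measurable_sets[OF this, of "- M"] show "{z. F (case_prod a z) \<notin> M} \<in> sets borel" by (simp add: vimage_def)
    show "AE t in lborel. AE x in lborel. F (case (t, x) of (t, x) \<Rightarrow> a t x) \<notin> M"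
      using AE_bilip[OF bilip_comp[OF F_bilip a_bilip] nM] by simp
  qed
  from AE_prodD(2)[OF this] show ?thesis
  proof eventually_elim
    case (elim y)
    then show ?case
    proof eventually_elim
      case (elim t)
      show ?case
      proof
        assume t: "0 < t \<and> t < T"
        have G: "(G has_real_derivative v (a t y)) (at (F (a t y)))"
        proof -
          have "F (a t y) \<notin> {z \<in> space lborel. \<not> (G has_real_derivative v (G z)) (at z)}"
          proof
            assume "F (a t y) \<in> {z \<in> space lborel. \<not> (G has_real_derivative v (G z)) (at z)}"
            then have "F (a t y) \<in> M" by (rule subsetD[OF M(1)])
            then show False using elim by simp
          qed
          then show ?thesis by simp
        qed
        have "((\<lambda>t. F y + oint (vel y) 0 t) has_real_derivative 0 + vel y t) (at t)"
          by (intro DERIV_add DERIV_const oint_deriv vel_continuous)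
        then have "((\<lambda>t. F (a t y)) has_real_derivative 0 + vel y t) (at t)"
          by (rule has_field_derivative_transform_within_open[where S="{0<..<T}"]) (use t a_flow_vel in auto)
        from DERIV_chain2[OF G this] show "((\<lambda>t. a t y) has_real_derivative v (a t y) * vel y t) (at t)" by simp
      qed
    qed
  qed
qed

text \<open>The substitution \<open>x = a t y\<close> turns the integrand into \<open>q0 y\<close>
  times the time derivative of \<open>\<phi> (t, a t y)\<close>. Integrating in time for fixed
  \<open>y\<close> leaves only the value at time 0, since \<open>\<phi>\<close> vanishes at time
  \<open>T\<close>.\<close>

lemma sol_weak_formulation:
  assumes \<phi>: "\<phi> \<in> C1_compact_support ({-42<..<T} \<times> UNIV)"
  shows "(LINT z:{0<..<T} \<times> UNIV|lebesgue.
           (case z of (t, x) \<Rightarrow>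
              sol t x * (deriv (\<lambda>s. \<phi> (s, x)) t
                       + vo x * V (convolution go (sol t) x) * deriv (\<lambda>y. \<phi> (t, y)) x)))
        + (LINT x|lebesgue. \<phi> (0, x) * qo x) = 0"
proof -
  obtain pt px R' C where p: "\<And>t x. (\<phi> has_derivative (\<lambda>(s, y). pt (t, x) * s + px (t, x) * y)) (at (t, x))"
    "continuous_on UNIV pt" "continuous_on UNIV px"
    "\<And>t x. \<not> (t < T \<and> \<bar>x\<bar> \<le> R') \<Longrightarrow> \<phi> (t, x) = 0 \<and> pt (t, x) = 0 \<and> px (t, x) = 0"
    "\<And>z. \<bar>\<phi> z\<bar> \<le> C \<and> \<bar>pt z\<bar> \<le> C \<and> \<bar>px z\<bar> \<le> C"
    by (rule C1_compact_support_prodE[OF \<phi>]) (rule that)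
  have C0: "0 \<le> C" using p(5)[of 0] by linarith
  have pC: "\<bar>pt z\<bar> \<le> C" "\<bar>px z\<bar> \<le> C" for z using p(5)[of z] by auto
  note partial = prod_partial_derivs[OF p(1)]
  have d1: "deriv (\<lambda>s. \<phi> (s, x)) t = pt (t, x)" for t x by (rule DERIV_imp_deriv[OF partial(1)])
  have d2: "deriv (\<lambda>y. \<phi> (t, y)) x = px (t, x)" for t x by (rule DERIV_imp_deriv[OF partial(2)])
  have c\<phi>: "continuous_on UNIV \<phi>"
    by (intro continuous_at_imp_continuous_on ballI) (use has_derivative_continuous[OF p(1)] in auto)
  have m[measurable]: "\<phi> \<in> borel_measurable (borel \<Otimes>\<^sub>M borel)" "pt \<in> borel_measurable (borel \<Otimes>\<^sub>M borel)" "px \<in> borel_measurable (borel \<Otimes>\<^sub>M borel)"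
    unfolding borel_prod by (intro borel_measurable_continuous_onI c\<phi> p(2,3))+
  obtain MV where MV: "MV \<ge> 0" "\<And>p. p \<in> {-R..R} \<Longrightarrow> \<bar>V p\<bar> \<le> MV" using V_bounded[of R] by blast
  \<comment> \<open>The derivative of \<open>\<phi>\<close> along the characteristic through
    \<open>(t, x)\<close>.\<close>
  define H where "H t x = pt (t, x) + v x * V (w t x) * px (t, x)" for t x
  have Hm[measurable]: "case_prod H \<in> borel_measurable (borel \<Otimes>\<^sub>M borel)" unfolding H_def by measurable
  have H0: "H t x = 0" if "R' < \<bar>x\<bar>" for t x using p(4)[of t x] that by (simp add: H_def)
  define CH where "CH = C + vu * MV * C"
  have CH0: "0 \<le> CH" using C0 vu MV by (simp add: CH_def)
  have HB: "\<bar>H t x\<bar> \<le> CH" for t x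
  proof -
    have "\<bar>H t x\<bar> \<le> \<bar>pt (t, x)\<bar> + \<bar>v x * V (w t x) * px (t, x)\<bar>" unfolding H_def by (rule abs_triangle_ineq)
    also have "\<dots> \<le> C + vu * MV * C"
      unfolding abs_mult by (intro add_mono mult_mono pC MV(2) w_bound')
        (use v_lower[of x] v_upper[of x] vl vu MV C0 in auto)
    finally show ?thesis by (simp add: CH_def)
  qed
  define I where "I z = (case z of (t, x) \<Rightarrow> indicator {0<..<T} t * (sol t x * H t x))" for z :: "real \<times> real"
  have Im[measurable]: "I \<in> borel_measurable (borel \<Otimes>\<^sub>M borel)" unfolding I_def by measurable
  have Im': "I \<in> borel_measurable borel" using Im by (simp add: borel_prod)
  have eq1: "(LINT z:{0<..<T} \<times> UNIV|lebesgue.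
           (case z of (t, x) \<Rightarrow>
              sol t x * (deriv (\<lambda>s. \<phi> (s, x)) t
                       + vo x * V (convolution go (sol t) x) * deriv (\<lambda>y. \<phi> (t, y)) x))) = (LINT z|lborel. I z)"
    unfolding set_lebesgue_integral_def
  proof (rule LINT_lebesgue_rep(1)[OF Im'])
    show "AE z in lborel. indicat_real ({0<..<T} \<times> UNIV) z *\<^sub>R
       (case z of (t, x) \<Rightarrow> sol t x * (deriv (\<lambda>s. \<phi> (s, x)) t + vo x * V (convolution go (sol t) x) * deriv (\<lambda>y. \<phi> (t, y)) x)) = I z"
      using AE_snd[OF vo]
      by eventually_elim (auto simp: I_def H_def d1 d2 sol_convolution indicator_def split: prod.splits)
  qed
  have Iint: "integrable lborel I"
  proof (rule integrableI_bounded_set[where A="{0..T} \<times> {-\<bar>R'\<bar>..\<bar>R'\<bar>}" and B="N * (1 / c) * CH"])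
    have "emeasure lborel ({0..T} \<times> {-\<bar>R'\<bar>..\<bar>R'\<bar>}) < \<infinity>" by (intro emeasure_compact_finite compact_Times) auto
    then show "emeasure lborel ({0..T} \<times> {-\<bar>R'\<bar>..\<bar>R'\<bar>}) < \<infinity>" .
    show "AE z in lborel. z \<in> {0..T} \<times> {-\<bar>R'\<bar>..\<bar>R'\<bar>} \<longrightarrow> norm (I z) \<le> N * (1 / c) * CH"
    proof (rule AE_I2, rule impI)
      fix z :: "real \<times> real"
      obtain t x where z: "z = (t, x)" by (cases z)
      have "\<bar>sol t x\<bar> * \<bar>H t x\<bar> \<le> N * (1 / c) * CH" by (intro mult_mono sol_bound HB) (use N0 c0 in auto)
      moreover have "0 \<le> N * (1 / c) * CH" using N0 c0 CH0 by simp
      ultimately show "norm (I z) \<le> N * (1 / c) * CH" by (auto simp: z I_def indicator_def abs_mult)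
    qed
    show "AE z in lborel. z \<notin> {0..T} \<times> {-\<bar>R'\<bar>..\<bar>R'\<bar>} \<longrightarrow> I z = 0"
    proof (rule AE_I2, rule impI)
      fix z :: "real \<times> real" assume n: "z \<notin> {0..T} \<times> {-\<bar>R'\<bar>..\<bar>R'\<bar>}"
      obtain t x where z: "z = (t, x)" by (cases z)
      have "t \<notin> {0..T} \<or> R' < \<bar>x\<bar>" using n z by auto
      then show "I z = 0" using H0[of x t] by (auto simp: z I_def indicator_def)
    qed
  qed (use Im' in \<open>auto intro!: borel_closed closed_Times\<close>)
  \<comment> \<open>\<open>I\<close> is the integrand in the position \<open>x\<close>,
    \<open>J\<close> the same integrand in the starting point \<open>y\<close>.\<close>
  define J where "J z = (case z of (t, y) \<Rightarrow> indicator {0<..<T} t * (q0 y * H t (a t y)))" for z :: "real \<times> real"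
  have Jm[measurable]: "J \<in> borel_measurable (borel \<Otimes>\<^sub>M borel)" unfolding J_def by measurable
  have Jm': "J \<in> borel_measurable borel" using Jm by (simp add: borel_prod)
  \<comment> \<open>Starting points whose characteristic meets \<open>[-R', R']\<close> before
    \<open>T\<close> lie in \<open>[-R2, R2]\<close>: the flow moves 0 by at most
    \<open>B * T\<close> and shrinks distances by no more than the factor \<open>c\<close>.\<close>
  define R2 where "R2 = (\<bar>R'\<bar> + B * T) / c"
  have Jint: "integrable lborel J"
  proof (rule integrableI_bounded_set[where A="{0..T} \<times> {-R2..R2}" and B="N * CH"])
    have "emeasure lborel ({0..T} \<times> {-R2..R2}) < \<infinity>" by (intro emeasure_compact_finite compact_Times) auto
    then show "emeasure lborel ({0..T} \<times> {-R2..R2}) < \<infinity>" .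
    show "AE z in lborel. z \<in> {0..T} \<times> {-R2..R2} \<longrightarrow> norm (J z) \<le> N * CH"
    proof (rule AE_I2, rule impI)
      fix z :: "real \<times> real"
      obtain t x where z: "z = (t, x)" by (cases z)
      have "\<bar>q0 x\<bar> * \<bar>H t (a t x)\<bar> \<le> N * CH" by (intro mult_mono q0_bound HB) (use N0 in auto)
      moreover have "0 \<le> N * CH" using N0 CH0 by simp
      ultimately show "norm (J z) \<le> N * CH" by (auto simp: z J_def indicator_def abs_mult)
    qed
    show "AE z in lborel. z \<notin> {0..T} \<times> {-R2..R2} \<longrightarrow> J z = 0"
    proof (rule AE_I2, rule impI)
      fix z :: "real \<times> real" assume n: "z \<notin> {0..T} \<times> {-R2..R2}"
      obtain t y where z: "z = (t, y)" by (cases z)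
      show "J z = 0"
      proof (cases "t \<in> {0<..<T}")
        case True
        then have "R2 < \<bar>y\<bar>" using n z by auto
        then have "\<bar>R'\<bar> + B * T < c * \<bar>y\<bar>" using c0 by (simp add: R2_def field_simps)
        moreover have "c * \<bar>y\<bar> \<le> \<bar>a t y - a t 0\<bar>" using bilip_abs(1)[OF a_bilip, of y 0 t] by simp
        moreover have "\<bar>a t 0\<bar> \<le> B * \<bar>t\<bar>" using a_time[of t 0 0] by simp
        moreover have "B * \<bar>t\<bar> \<le> B * T" using True B0 by (intro mult_left_mono) auto
        ultimately have "R' < \<bar>a t y\<bar>" by linarith
        then show ?thesis using H0 by (simp add: z J_def)
      qed (auto simp: z J_def)
    qed
  qed (use Jm' in \<open>auto intro!: borel_closed closed_Times\<close>)
  have "(LINT z|lborel. I z) = (LINT t|lborel. LINT x|lborel. I (t, x))" by (rule fubini_lborel(1)[OF Iint])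
  also have "\<dots> = (LINT t|lborel. LINT y|lborel. J (t, y))"
  proof (rule Bochner_Integration.integral_cong)
    fix t
    have [measurable]: "H t \<in> borel_measurable borel" by (rule slice_meas) measurable
    have "(LINT x|lborel. I (t, x)) = (LINT x|lborel. Dk t x * (indicator {0<..<T} t * (q0 (k t x) * H t x)))"
      by (simp add: I_def sol_def ac_simps)
    also have "\<dots> = (LINT y|lborel. indicator {0<..<T} t * (q0 (k t (a t y)) * H t (a t y)))"
      by (rule Dk_cov[symmetric]) measurable
    finally show "(LINT x|lborel. I (t, x)) = (LINT y|lborel. J (t, y))" by (simp add: J_def)
  qed simp
  also have "\<dots> = (LINT z|lborel. J z)" by (rule fubini_lborel(1)[OF Jint, symmetric])
  also have "\<dots> = (LINT y|lborel. LINT t|lborel. J (t, y))" by (rule fubini_lborel(2)[OF Jint])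
  also have "\<dots> = (LINT y|lborel. - (\<phi> (0, y) * q0 y))"
  proof (rule integral_cong_AE)
    show "AE y in lborel. (LINT t|lborel. J (t, y)) = - (\<phi> (0, y) * q0 y)"
      using char_AE_deriv
    proof eventually_elim
      case (elim y)
      \<comment> \<open>A test function along a Lipschitz curve is Lipschitz, hence the integral of
        its almost everywhere derivative.\<close>
      define P where "P t = \<phi> (t, a t y)" for t
      have Plip: "\<bar>P t - P s\<bar> \<le> (C + C * B) * \<bar>t - s\<bar>" for s t
      proof -
        have "\<bar>\<phi> (t, a t y) - \<phi> (s, a t y)\<bar> \<le> C * \<bar>t - s\<bar>"
          by (rule lipschitz_from_deriv[OF partial(1)]) (rule pC)
        moreover have "\<bar>\<phi> (s, a t y) - \<phi> (s, a s y)\<bar> \<le> C * \<bar>a t y - a s y\<bar>"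
          by (rule lipschitz_from_deriv[OF partial(2)]) (rule pC)
        moreover have "C * \<bar>a t y - a s y\<bar> \<le> C * (B * \<bar>t - s\<bar>)" by (rule mult_left_mono[OF a_time C0])
        ultimately show ?thesis by (simp add: P_def algebra_simps)
      qed
      obtain h where h: "h \<in> borel_measurable borel" "\<And>x. \<bar>h x\<bar> \<le> C + C * B"
        "\<And>a b. P b - P a = oint h a b" "AE x in lborel. (P has_real_derivative h x) (at x)"
        by (rule lipschitz_density[OF Plip]) (rule that)
      have hJ: "AE t in lborel. 0 < t \<and> t < T \<longrightarrow> h t = H t (a t y)"
        using h(4) elim
      proof eventually_elim
        case (elim t)
        show ?case
        proof
          assume t: "0 < t \<and> t < T"
          have "((\<lambda>t. a t y) has_derivative (\<lambda>h. v (a t y) * vel y t * h)) (at t)"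
            using elim(2) t by (simp add: has_field_derivative_def)
          then have "((\<lambda>t. (t, a t y)) has_derivative (\<lambda>h. (h, v (a t y) * vel y t * h))) (at t)"
            by (intro has_derivative_Pair has_derivative_ident)
          from has_derivative_compose[OF this p(1)]
          have "(P has_derivative (\<lambda>h. pt (t, a t y) * h + px (t, a t y) * (v (a t y) * vel y t * h))) (at t)"
            by (simp add: P_def[abs_def])
          moreover have "(\<lambda>h. pt (t, a t y) * h + px (t, a t y) * (v (a t y) * vel y t * h)) = (*) (H t (a t y))"
            by (auto simp: H_def vel_def algebra_simps)
          ultimately have "(P has_real_derivative H t (a t y)) (at t)" by (simp add: has_field_derivative_def)
          then show "h t = H t (a t y)" using elim(1) DERIV_unique by blast
        qed
      qed
      have "(LINT t|lborel. J (t, y)) = (LINT t|lborel. indicator {0..T} t *\<^sub>R h t) * q0 y"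
      proof -
        have hm: "h \<in> borel_measurable borel" by fact
        have "(LINT t|lborel. J (t, y)) = (LINT t|lborel. (indicator {0..T} t *\<^sub>R h t) * q0 y)"
        proof (rule integral_cong_AE)
          have "AE t in lborel. t \<noteq> 0 \<and> t \<noteq> T" using AE_lborel_singleton[of 0] AE_lborel_singleton[of T] by eventually_elim auto
          then show "AE t in lborel. J (t, y) = (indicator {0..T} t *\<^sub>R h t) * q0 y"
            using hJ by eventually_elim (auto simp: J_def indicator_def)
          show "(\<lambda>t. J (t, y)) \<in> borel_measurable lborel" by measurable
        qed (use hm in measurable)
        then show ?thesis by simp
      qed
      also have "(LINT t|lborel. indicator {0..T} t *\<^sub>R h t) = P T - P 0"
        using T by (simp add: h(3) oint_le set_lebesgue_integral_def)
      also have "P T - P 0 = - \<phi> (0, y)" using p(4)[of T "a T y"] by (simp add: P_def)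
      finally show ?case by simp
    qed
    show "(\<lambda>y. LINT t|lborel. J (t, y)) \<in> borel_measurable lborel" by measurable
    show "(\<lambda>y. - (\<phi> (0, y) * q0 y)) \<in> borel_measurable lborel" by measurable
  qed
  also have "\<dots> = - (LINT y|lborel. \<phi> (0, y) * q0 y)" by simp
  also have "(LINT y|lborel. \<phi> (0, y) * q0 y) = (LINT x|lebesgue. \<phi> (0, x) * qo x)"
    by (rule LINT_lebesgue_rep(1)[symmetric]) (measurable, use qo in auto)
  finally show ?thesis unfolding eq1 by simp
qed

lemma sol_is_weak_solution: "is_weak_solution qo go V vo T sol"
  unfolding is_weak_solution_def using sol_C_L1_loc sol_Linfty sol_weak_formulation by blast

end

section \<open>Weak solutions are transported by their own flow\<close>

lemma AE_interval_witness:
  fixes a b :: real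
  assumes "AE s in lborel. P s" "a < b"
  obtains s where "a < s" "s < b" "P s"
proof -
  have "\<not> negligible {a<..<b}" using assms(2) by (intro open_not_negligible) auto
  moreover have "negligible {s. \<not> P s}" using assms(1) negligible_AE by blast
  ultimately have "\<not> {a<..<b} \<subseteq> {s. \<not> P s}" using negligible_subset by blast
  then show ?thesis using that by auto
qed

text \<open>Continuity in \<open>t\<close> for each \<open>x\<close> becomes joint because the
  modulus in \<open>x\<close> is uniform in \<open>t\<close>.\<close>

lemma joint_continuity:
  fixes f :: "real \<Rightarrow> real \<Rightarrow> real"
  assumes c: "\<And>x. continuous_on UNIV (\<lambda>t. f t x)" and lip: "\<And>t x z. \<bar>f t x - f t z\<bar> \<le> C * \<bar>x - z\<bar>"
  shows "continuous_on UNIV (\<lambda>(t, x). f t x)"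
  unfolding continuous_on_def
proof
  fix p :: "real \<times> real"
  obtain t x where p: "p = (t, x)" by (cases p)
  have s: "((\<lambda>q. snd q) \<longlongrightarrow> x) (at p within UNIV)" "((\<lambda>q. fst q) \<longlongrightarrow> t) (at p within UNIV)"
    using tendsto_snd[OF tendsto_ident_at[of p UNIV]] tendsto_fst[OF tendsto_ident_at[of p UNIV]] by (simp_all add: p)
  have "((\<lambda>q. f (fst q) (snd q) - f (fst q) x) \<longlongrightarrow> 0) (at p within UNIV)"
  proof (rule Lim_null_comparison)
    show "\<forall>\<^sub>F q in at p within UNIV. norm (f (fst q) (snd q) - f (fst q) x) \<le> C * \<bar>snd q - x\<bar>"
      using lip by (auto intro!: always_eventually)
    have "((\<lambda>q. C * \<bar>snd q - x\<bar>) \<longlongrightarrow> C * \<bar>x - x\<bar>) (at p within UNIV)" by (intro tendsto_intros s)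
    then show "((\<lambda>q. C * \<bar>snd q - x\<bar>) \<longlongrightarrow> 0) (at p within UNIV)" by simp
  qed
  moreover have "((\<lambda>q. f (fst q) x) \<longlongrightarrow> f t x) (at p within UNIV)"
    by (rule continuous_on_tendsto_compose[OF c s(2)]) auto
  ultimately have "((\<lambda>q. (f (fst q) (snd q) - f (fst q) x) + f (fst q) x) \<longlongrightarrow> 0 + f t x) (at p within UNIV)" by (rule tendsto_add)
  moreover have "(\<lambda>(t, x). f t x) = (\<lambda>q. f (fst q) (snd q))" by auto
  ultimately show "((\<lambda>(t, x). f t x) \<longlongrightarrow> (case p of (t, x) \<Rightarrow> f t x)) (at p within UNIV)" by (simp add: p)
qed

text \<open>Picard iteration on the whole interval. Writing the unknown as
  \<open>z0 + exp (2 * \<Lambda> * t) * u\<close> builds the exponential weight into it, so the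
  iteration contracts by 1/2 in the plain supremum norm for every \<open>T\<close>.\<close>

lemma ode_exists:
  fixes f :: "real \<Rightarrow> real \<Rightarrow> real"
  assumes c: "continuous_on UNIV (\<lambda>(t, z). f t z)" and M: "\<And>t z. \<bar>f t z\<bar> \<le> M"
    and lip: "\<And>t z z'. \<bar>f t z - f t z'\<bar> \<le> \<Lambda> * \<bar>z - z'\<bar>" and Lam: "0 < \<Lambda>" and T: "0 \<le> T"
  obtains e where "continuous_on UNIV e" "\<And>t. t \<in> {0..T} \<Longrightarrow> e t = z0 + oint (\<lambda>s. f s (e s)) 0 t"
proof -
  define cl where "cl t = max 0 (min T t)" for t
  have cl: "cl t \<in> {0..T}" "t \<in> {0..T} \<Longrightarrow> cl t = t" for t using T by (auto simp: cl_def)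
  have ccl: "continuous_on UNIV cl" unfolding cl_def by (intro continuous_intros)
  define E where "E u s = z0 + exp (2 * \<Lambda> * cl s) * u s" for u :: "real \<Rightarrow> real" and s
  define g where "g u s = f s (E u s)" for u s
  have cE: "continuous_on UNIV (E (apply_bcontfun u))" for u
    unfolding E_def by (intro continuous_intros ccl) auto
  have cg: "continuous_on UNIV (g (apply_bcontfun u))" for u
  proof -
    have "continuous_on UNIV (\<lambda>s. (s, E u s))" by (intro continuous_on_Pair continuous_on_id cE)
    from continuous_on_compose2[OF c this] show ?thesis by (simp add: g_def[abs_def])
  qed
  have lig: "loc_int (g (apply_bcontfun u))" for u by (rule loc_int_continuous[OF cg])
  define Q0 where "Q0 u t = exp (- (2 * \<Lambda> * cl t)) * oint (g u) 0 (cl t)" for u t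
  have ex1: "exp (- (2 * \<Lambda> * cl t)) \<le> 1" for t using cl(1)[of t] Lam by simp
  have Q0b: "Q0 (apply_bcontfun u) \<in> bcontfun" for u
  proof (rule bcontfun_normI[where b="M * T"])
    have "continuous_on UNIV (\<lambda>x. oint (g u) 0 x)"
      using oint_deriv[OF cg] by (meson DERIV_continuous_on has_field_derivative_at_within)
    then have "continuous_on UNIV (\<lambda>t. oint (g u) 0 (cl t))" by (rule continuous_on_compose2[OF _ ccl]) auto
    then show "continuous_on UNIV (Q0 u)" unfolding Q0_def by (intro continuous_intros ccl)
    fix t
    have M0: "0 \<le> M" using M[of 0 0] by linarith
    have "\<bar>oint (g u) 0 (cl t)\<bar> \<le> M * \<bar>cl t - 0\<bar>" by (rule oint_bound[OF lig]) (use M in \<open>auto simp: g_def\<close>)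
    also have "\<dots> \<le> M * T" using cl(1)[of t] M0 by (intro mult_left_mono) auto
    finally have "\<bar>oint (g u) 0 (cl t)\<bar> \<le> M * T" .
    then have "exp (- (2 * \<Lambda> * cl t)) * \<bar>oint (g u) 0 (cl t)\<bar> \<le> 1 * (M * T)" by (intro mult_mono ex1) (use M0 T in auto)
    then show "norm (Q0 u t) \<le> M * T" by (simp add: Q0_def abs_mult)
  qed
  define Q where "Q u = Bcontfun (Q0 (apply_bcontfun u))" for u
  have Qa: "apply_bcontfun (Q u) = Q0 (apply_bcontfun u)" for u unfolding Q_def by (rule Bcontfun_inverse[OF Q0b])
  have "dist (Q u) (Q u') \<le> 1 / 2 * dist u u'" for u u'
  proof (rule dist_bound)
    fix t
    define d where "d = dist u u'"
    have d0: "0 \<le> d" by (simp add: d_def)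
    have gd: "\<bar>g u s - g u' s\<bar> \<le> \<Lambda> * d * exp (2 * \<Lambda> * \<bar>s - 0\<bar>)" if "0 < s" "s < cl t" for s
    proof -
      have cls: "cl s = s" using that cl(1)[of t] by (intro cl(2)) auto
      have "\<bar>g u s - g u' s\<bar> \<le> \<Lambda> * \<bar>E u s - E u' s\<bar>" unfolding g_def by (rule lip)
      also have "E u s - E u' s = exp (2 * \<Lambda> * s) * (u s - u' s)" by (simp add: E_def cls algebra_simps)
      also have "\<Lambda> * \<bar>exp (2 * \<Lambda> * s) * (u s - u' s)\<bar> \<le> \<Lambda> * (exp (2 * \<Lambda> * s) * d)"
        using dist_bounded[of u s u'] Lam by (intro mult_left_mono) (auto simp: abs_mult d_def dist_real_def)
      finally show ?thesis using that by (simp add: ac_simps)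
    qed
    have liE: "loc_int (\<lambda>s. \<Lambda> * d * exp (2 * \<Lambda> * \<bar>s - 0\<bar>))" by (intro loc_int_continuous continuous_intros)
    have "\<bar>oint (g u) 0 (cl t) - oint (g u') 0 (cl t)\<bar> = \<bar>oint (\<lambda>s. g u s - g u' s) 0 (cl t)\<bar>" by (simp add: oint_diff lig)
    also have "\<dots> \<le> oint (\<lambda>s. \<Lambda> * d * exp (2 * \<Lambda> * \<bar>s - 0\<bar>)) 0 (cl t)"
    proof (rule oint_abs_mono[OF loc_int_diff[OF lig lig] liE])
      show "AE s in lborel. 0 < s \<and> s < cl t \<longrightarrow> \<bar>g u s - g u' s\<bar> \<le> \<Lambda> * d * exp (2 * \<Lambda> * \<bar>s - 0\<bar>)"
        by (rule AE_I2) (use gd in blast)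
    qed (use cl(1)[of t] in auto)
    also have "\<dots> = \<Lambda> * d * oint (\<lambda>s. exp (2 * \<Lambda> * \<bar>s - 0\<bar>)) 0 (cl t)" by (rule oint_cmult)
    also have "\<dots> \<le> \<Lambda> * d * (exp (2 * \<Lambda> * \<bar>cl t - 0\<bar>) / (2 * \<Lambda>))"
      using Lam d0 oint_exp[of "2 * \<Lambda>" 0 "cl t"] by (intro mult_left_mono) auto
    also have "\<dots> = d / 2 * exp (2 * \<Lambda> * cl t)" using Lam cl(1)[of t] by simp
    finally have *: "\<bar>oint (g u) 0 (cl t) - oint (g u') 0 (cl t)\<bar> \<le> d / 2 * exp (2 * \<Lambda> * cl t)" .
    have "\<bar>Q0 u t - Q0 u' t\<bar> = exp (- (2 * \<Lambda> * cl t)) * \<bar>oint (g u) 0 (cl t) - oint (g u') 0 (cl t)\<bar>"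
      by (simp add: Q0_def right_diff_distrib[symmetric] abs_mult)
    also have "\<dots> \<le> exp (- (2 * \<Lambda> * cl t)) * (d / 2 * exp (2 * \<Lambda> * cl t))" by (rule mult_left_mono[OF *]) simp
    also have "\<dots> = d / 2" by (simp add: exp_minus)
    finally show "dist (Q u t) (Q u' t) \<le> 1 / 2 * dist u u'" by (simp add: Qa dist_real_def d_def)
  qed
  then have "\<exists>!u. Q u = u" by (intro banach_fix_type[where c="1 / 2"]) auto
  then obtain u where u: "Q u = u" by blast
  define e where "e = E (apply_bcontfun u)"
  show ?thesis
  proof (rule that[of e])
    show "continuous_on UNIV e" unfolding e_def by (rule cE)
    fix t assume t: "t \<in> {0..T}"
    have "u t = Q0 u t" using u Qa[of u] by simp
    then show "e t = z0 + oint (\<lambda>s. f s (e s)) 0 t"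
      by (simp add: e_def E_def[of _ t] Q0_def g_def[abs_def] cl(2)[OF t] exp_minus)
  qed
qed

text \<open>The bound is given at almost every time only. At such a time \<open>s\<close> the excess
  of \<open>\<bar>q t\<bar>\<close> over \<open>B\<close> is at most
  \<open>\<bar>q s - q t\<bar>\<close>, whose integral over a compact set tends to 0 as
  \<open>s\<close> approaches \<open>t\<close>.\<close>

lemma Linfty_uniform_bound:
  assumes T: "0 < T" and L1: "q \<in> C_L1_loc T"
    and bd: "AE s in lborel. 0 < s \<and> s < T \<longrightarrow> (AE x in lborel. \<bar>q s x\<bar> \<le> B)" and t: "t \<in> {0..T}"
  shows "AE x in lborel. \<bar>q t x\<bar> \<le> B"
proof -
  have int: "set_integrable lebesgue K (q s)" if "s \<in> {0..T}" "compact K" for s K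
    using L1 that by (simp add: C_L1_loc_def L1_loc_def)
  have "AE x in lborel. \<bar>x\<bar> \<le> real n \<longrightarrow> \<bar>q t x\<bar> \<le> B" for n :: nat
  proof -
    define K where "K = {-real n..real n}"
    have K: "compact K" by (simp add: K_def)
    define f where "f x = indicator K x * max 0 (\<bar>q t x\<bar> - B)" for x
    have mono: "integrable lebesgue f"
    proof -
      have i: "integrable lebesgue (\<lambda>x. \<bar>indicator K x *\<^sub>R q t x\<bar> + indicator K x * \<bar>B\<bar>)"
      proof (intro Bochner_Integration.integrable_add integrable_abs integrable_mult_left)
        show "integrable lebesgue (\<lambda>x. indicator K x *\<^sub>R q t x)" using int[OF t K] by (simp add: set_integrable_def)
        show "integrable lebesgue (indicat_real K)"
          by (auto simp: integrable_indicator_iff K_def emeasure_lborel_Icc_eq)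
      qed
      have m: "(\<lambda>x. indicator K x *\<^sub>R q t x) \<in> borel_measurable lebesgue"
        using int[OF t K] by (auto simp: set_integrable_def)
      have "f = (\<lambda>x. indicator K x * max 0 (\<bar>indicator K x *\<^sub>R q t x\<bar> - B))" by (auto simp: f_def indicator_def)
      moreover have "indicat_real K \<in> borel_measurable lebesgue" by (rule borel_measurable_indicator) (simp add: K_def)
      ultimately have fm: "f \<in> borel_measurable lebesgue" using m by simp
      show ?thesis
        by (rule Bochner_Integration.integrable_bound[OF i fm]) (auto simp: f_def indicator_def)
    qed
    have le: "(LINT x|lebesgue. f x) \<le> (LINT x:K|lebesgue. \<bar>q s x - q t x\<bar>)" if s: "s \<in> {0..T}" "AE x in lborel. \<bar>q s x\<bar> \<le> B" for s
      unfolding set_lebesgue_integral_def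
    proof (rule integral_mono_AE[OF mono])
      show "integrable lebesgue (\<lambda>x. indicator K x *\<^sub>R \<bar>q s x - q t x\<bar>)"
        using set_integrable_abs[OF set_integral_diff(1)[OF int[OF s(1) K] int[OF t K]]] by (simp add: set_integrable_def)
      have "AE x in lebesgue. \<bar>q s x\<bar> \<le> B" using s(2) by (simp add: AE_lebesgue_lborel)
      then show "AE x in lebesgue. f x \<le> indicator K x *\<^sub>R \<bar>q s x - q t x\<bar>"
        by eventually_elim (auto simp: f_def indicator_def)
    qed
    have lim: "((\<lambda>s. LINT x:K|lebesgue. \<bar>q s x - q t x\<bar>) \<longlongrightarrow> 0) (at t within {0..T})"
      using L1 K t by (simp add: C_L1_loc_def)
    have small: "(LINT x|lebesgue. f x) \<le> e" if e: "0 < e" for e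
    proof -
      have "\<forall>\<^sub>F s in at t within {0..T}. (LINT x:K|lebesgue. \<bar>q s x - q t x\<bar>) < e"
        by (rule order_tendstoD(2)[OF lim e])
      then obtain d where d: "0 < d" "\<And>s. s \<in> {0..T} \<Longrightarrow> s \<noteq> t \<Longrightarrow> dist s t < d \<Longrightarrow> (LINT x:K|lebesgue. \<bar>q s x - q t x\<bar>) < e"
        unfolding eventually_at by blast
      \<comment> \<open>A one-sided interval next to \<open>t\<close> inside \<open>[0, T]\<close>,
        to the right unless \<open>t = T\<close>; having positive measure it contains a good
        time.\<close>
      define l where "l = (if t < T then t else max 0 (t - d))"
      define u where "u = (if t < T then min T (t + d) else t)"
      have "l < u" "0 \<le> l" "u \<le> T" using d(1) t T by (auto simp: l_def u_def)
      obtain s where s: "l < s" "s < u" "0 < s \<and> s < T \<longrightarrow> (AE x in lborel. \<bar>q s x\<bar> \<le> B)"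
        by (rule AE_interval_witness[OF bd \<open>l < u\<close>]) (rule that)
      have s': "0 < s" "s < T" using s \<open>0 \<le> l\<close> \<open>u \<le> T\<close> by auto
      have "dist s t < d" "s \<noteq> t" using s t by (auto simp: l_def u_def dist_real_def split: if_splits)
      then have "(LINT x:K|lebesgue. \<bar>q s x - q t x\<bar>) < e" using s' by (intro d(2)) auto
      moreover have "(LINT x|lebesgue. f x) \<le> (LINT x:K|lebesgue. \<bar>q s x - q t x\<bar>)" by (rule le) (use s s' in auto)
      ultimately show ?thesis by linarith
    qed
    have "(LINT x|lebesgue. f x) \<le> 0" by (rule field_le_epsilon) (simp add: small)
    moreover have "0 \<le> (LINT x|lebesgue. f x)" by (rule Bochner_Integration.integral_nonneg) (auto simp: f_def)
    ultimately have "(LINT x|lebesgue. f x) = 0" by simp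
    then have "AE x in lebesgue. f x = 0"
      by (subst (asm) integral_nonneg_eq_0_iff_AE[OF mono]) (auto simp: f_def)
    then have "AE x in lborel. f x = 0" by (simp add: AE_lebesgue_lborel)
    then show ?thesis by eventually_elim (auto simp: f_def K_def indicator_def abs_le_iff split: if_splits)
  qed
  then have "AE x in lborel. \<forall>n::nat. \<bar>x\<bar> \<le> real n \<longrightarrow> \<bar>q t x\<bar> \<le> B" by (subst AE_all_countable) blast
  then show ?thesis
  proof eventually_elim
    case (elim x)
    obtain n :: nat where "\<bar>x\<bar> \<le> real n" using real_arch_simple by blast
    then show ?case using elim by blast
  qed
qed

lemma L1_loc_measurable:
  assumes "u \<in> L1_loc" shows "u \<in> borel_measurable lebesgue"
proof -
  have m: "(\<lambda>x. indicator {-real n..real n} x *\<^sub>R u x) \<in> borel_measurable lebesgue" for n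
    using assms by (auto simp: L1_loc_def set_integrable_def)
  show ?thesis
  proof (rule borel_measurable_LIMSEQ_real[OF _ m])
    fix x :: real
    obtain n0 :: nat where n0: "\<bar>x\<bar> \<le> real n0" using real_arch_simple by blast
    show "(\<lambda>n. indicator {-real n..real n} x *\<^sub>R u x) \<longlonglongrightarrow> u x"
    proof (rule tendsto_eventually)
      show "\<forall>\<^sub>F n in sequentially. indicator {-real n..real n} x *\<^sub>R u x = u x"
        using eventually_ge_at_top[of n0]
      proof eventually_elim
        case (elim n)
        then have "real n0 \<le> real n" by simp
        then have "x \<in> {-real n..real n}" using n0 by auto
        then show ?case by simp
      qed
    qed
  qed
qed

lemma bounded_rep:
  fixes u :: "'a::euclidean_space \<Rightarrow> real"
  assumes u: "u \<in> borel_measurable lebesgue" and B: "AE x in lborel. x \<in> S \<longrightarrow> \<bar>u x\<bar> \<le> B" and B0: "0 \<le> B"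
  obtains g where "g \<in> borel_measurable borel" "\<And>x. \<bar>g x\<bar> \<le> B" "AE x in lborel. x \<in> S \<longrightarrow> u x = g x"
proof -
  obtain g where g: "g \<in> borel_measurable borel" "AE x in lborel. u x = g x" by (rule lebesgue_rep[OF u])
  show ?thesis
  proof (rule that[of "\<lambda>x. max (-B) (min B (g x))"])
    show "(\<lambda>x. max (-B) (min B (g x))) \<in> borel_measurable borel" using g(1) by measurable
    show "\<bar>max (-B) (min B (g x))\<bar> \<le> B" for x using B0 by auto
    show "AE x in lborel. x \<in> S \<longrightarrow> u x = max (-B) (min B (g x))"
      using g(2) B by eventually_elim (auto simp: abs_le_iff)
  qed
qed

text \<open>A weak solution \<open>q\<close> is controlled through two kinds of representatives: \<open>qr t\<close> of the time slices, with no
  measurability in \<open>t\<close>, and the jointly Borel \<open>qh\<close>, which says nothing about a fixed time.\<close>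

locale nonlocal_weak = nonlocal_data +
  fixes T Bq :: real and q qr :: "real \<Rightarrow> real \<Rightarrow> real" and qh :: "real \<times> real \<Rightarrow> real"
  assumes T: "0 < T" and weak: "is_weak_solution qo go V vo T q"
    and qr_meas[measurable]: "\<And>t. qr t \<in> borel_measurable borel" and qr_bound: "\<And>t x. \<bar>qr t x\<bar> \<le> Bq"
    and q_qr: "\<And>t. t \<in> {0..T} \<Longrightarrow> AE x in lborel. q t x = qr t x"
    and qh_meas[measurable]: "qh \<in> borel_measurable (borel \<Otimes>\<^sub>M borel)" and qh_bound: "\<And>z. \<bar>qh z\<bar> \<le> Bq"
    and q_qh: "AE z in lborel. z \<in> {0<..<T} \<times> UNIV \<longrightarrow> case_prod q z = qh z"
begin

definition cl :: "real \<Rightarrow> real" where "cl t = max 0 (min T t)"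
definition wq :: "real \<Rightarrow> real \<Rightarrow> real" where "wq t = W (qr t) (\<lambda>y. y)"
text \<open>Clamped in time, so that the field is continuous on the whole plane and characteristics
  exist at negative times too.\<close>

definition wc :: "real \<Rightarrow> real \<Rightarrow> real" where "wc t x = wq (cl t) x"
definition R where "R = Bq * \<Gamma>"
definition \<kappa> where "\<kappa> = Bq * (2 * K)"

lemma cl: "cl t \<in> {0..T}" "t \<in> {0..T} \<Longrightarrow> cl t = t" using T by (auto simp: cl_def)
lemma cl_continuous: "continuous_on UNIV cl" unfolding cl_def by (intro continuous_intros)

lemma Bq0: "0 \<le> Bq" using qr_bound[of 0 0] by linarith

lemma kappa0: "0 \<le> \<kappa>" using Bq0 K0 by (simp add: \<kappa>_def)

lemma wq_bound: "\<bar>wq t x\<bar> \<le> R"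
  unfolding wq_def R_def using W_integrable(2)[OF bilip_id qr_meas qr_bound, of t x] by simp

lemma wq_lip: "\<bar>wq t x - wq t z\<bar> \<le> \<kappa> * \<bar>x - z\<bar>"
  unfolding wq_def \<kappa>_def using W_lip[OF bilip_id qr_meas qr_bound, of t x z] by simp

lemma wc_bound: "wc t x \<in> {-R..R}" using wq_bound[of "cl t" x] by (auto simp: wc_def)

lemma convolution_wq: assumes t: "t \<in> {0..T}" shows "convolution go (q t) x = wq t x"
  unfolding convolution_def wq_def W_def
proof (rule LINT_lebesgue_rep(1))
  have "AE y in lborel. go (x - y) = \<gamma> (x - y)"
    by (rule AE_expanding[where c=1 and a="\<lambda>y. x - y" and P="\<lambda>z. go z = \<gamma> z", OF _ _ go]) auto
  then show "AE y in lborel. go (x - y) * q t y = \<gamma> (x - y) * qr t y"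
    using q_qr[OF t] by eventually_elim simp
qed measurable

lemma qr_L1:
  assumes t: "t \<in> {0..T}"
  shows "((\<lambda>s. LBINT x:{-r..r}. \<bar>qr s x - qr t x\<bar>) \<longlongrightarrow> 0) (at t within {0..T})"
proof -
  have "((\<lambda>s. LINT x:{-r..r}|lebesgue. \<bar>q s x - q t x\<bar>) \<longlongrightarrow> 0) (at t within {0..T})"
    using weak t by (simp add: is_weak_solution_def C_L1_loc_def)
  moreover have "\<forall>\<^sub>F s in at t within {0..T}. (LINT x:{-r..r}|lebesgue. \<bar>q s x - q t x\<bar>) = (LBINT x:{-r..r}. \<bar>qr s x - qr t x\<bar>)"
    unfolding eventually_at_filter
  proof (rule always_eventually, intro allI impI)
    fix s assume "s \<in> {0..T}"
    then have "AE x in lborel. q s x = qr s x" by (rule q_qr)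
    then show "(LINT x:{-r..r}|lebesgue. \<bar>q s x - q t x\<bar>) = (LBINT x:{-r..r}. \<bar>qr s x - qr t x\<bar>)"
      unfolding set_lebesgue_integral_def using q_qr[OF t]
      by (intro LINT_lebesgue_rep(1)) (auto elim: eventually_elim2)
  qed
  ultimately show ?thesis by (rule Lim_transform_eventually)
qed

text \<open>\<open>\<gamma>\<close> is only integrable and \<open>qr\<close> is continuous in time
  only in local L1. Truncating the kernel in support and height leaves a part controlled by local L1
  differences of \<open>qr\<close>; the remainder is uniformly small because \<open>qr\<close> is
  bounded.\<close>

lemma wq_continuous: "continuous_on {0..T} (\<lambda>t. wq t x)"
  unfolding continuous_on_def
proof
  fix t assume t: "t \<in> {0..T}"
  have ig: "integrable lborel (\<lambda>y. \<gamma> (x - y))" using gamma_comp_integrable(1)[OF bilip_id] by simp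
  define gn where "gn n y = (if \<bar>y\<bar> \<le> real n \<and> \<bar>\<gamma> (x - y)\<bar> \<le> real n then \<gamma> (x - y) else 0)" for n :: nat and y
  have gnm[measurable]: "gn n \<in> borel_measurable borel" for n unfolding gn_def by measurable
  have lim: "(\<lambda>n. LINT y|lborel. \<bar>\<gamma> (x - y) - gn n y\<bar>) \<longlonglongrightarrow> (LINT y|lborel. \<bar>\<gamma> (x - y) - \<gamma> (x - y)\<bar>)"
  proof (rule integral_dominated_convergence[where w="\<lambda>y. \<bar>\<gamma> (x - y)\<bar>"])
    show "AE y in lborel. (\<lambda>n. \<bar>\<gamma> (x - y) - gn n y\<bar>) \<longlonglongrightarrow> \<bar>\<gamma> (x - y) - \<gamma> (x - y)\<bar>"
    proof (rule AE_I2, intro tendsto_intros tendsto_eventually)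
      fix y
      obtain n0 :: nat where n0: "max \<bar>y\<bar> \<bar>\<gamma> (x - y)\<bar> \<le> real n0" using real_arch_simple by blast
      show "\<forall>\<^sub>F n in sequentially. gn n y = \<gamma> (x - y)"
        using eventually_ge_at_top[of n0]
      proof eventually_elim
        case (elim n)
        then have "real n0 \<le> real n" by simp
        then show ?case using n0 by (simp add: gn_def)
      qed
    qed
  qed (use ig in \<open>auto simp: gn_def\<close>)
  have "((\<lambda>s. wq s x - wq t x) \<longlongrightarrow> 0) (at t within {0..T})"
    unfolding tendsto_iff
  proof (intro allI impI)
    fix e :: real assume e: "0 < e"
    define e1 where "e1 = e / (4 * (Bq + 1))"
    have e1: "0 < e1" using e Bq0 by (simp add: e1_def add_nonneg_pos)
    have e1B: "2 * Bq * e1 \<le> e / 2" using e Bq0 by (simp add: e1_def field_simps)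
    have "\<forall>\<^sub>F n in sequentially. (LINT y|lborel. \<bar>\<gamma> (x - y) - gn n y\<bar>) < e1"
      by (rule order_tendstoD(2)[OF lim]) (use e1 in simp)
    then obtain n where n: "(LINT y|lborel. \<bar>\<gamma> (x - y) - gn n y\<bar>) < e1"
      using eventually_happens[of _ sequentially] by fastforce
    have ign: "integrable lborel (\<lambda>y. \<bar>\<gamma> (x - y) - gn n y\<bar>)"
      by (rule Bochner_Integration.integrable_bound[OF ig]) (auto simp: gn_def)
    have bd: "\<bar>wq s x - wq t x\<bar> \<le> 2 * Bq * e1 + real n * (LBINT y:{-real n..real n}. \<bar>qr s y - qr t y\<bar>)" for s
    proof -
      have i: "integrable lborel (\<lambda>y. \<gamma> (x - y) * qr s y)" for s
        using W_integrable(1)[OF bilip_id qr_meas qr_bound, of x s] by simp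
      have il: "integrable lborel (\<lambda>y. indicator {-real n..real n} y *\<^sub>R \<bar>qr s y - qr t y\<bar>)"
        using loc_intD[OF loc_int_abs[OF loc_int_diff[OF loc_int_bounded[OF qr_meas qr_bound] loc_int_bounded[OF qr_meas qr_bound]]]]
        by (simp add: set_integrable_def)
      have "wq s x - wq t x = (LINT y|lborel. \<gamma> (x - y) * qr s y - \<gamma> (x - y) * qr t y)"
        unfolding wq_def W_def using i by simp
      then have "\<bar>wq s x - wq t x\<bar> \<le> (LINT y|lborel. \<bar>\<gamma> (x - y) * qr s y - \<gamma> (x - y) * qr t y\<bar>)" by (simp only: integral_abs_bound)
      also have "\<dots> \<le> (LINT y|lborel. 2 * Bq * \<bar>\<gamma> (x - y) - gn n y\<bar> + real n * (indicator {-real n..real n} y *\<^sub>R \<bar>qr s y - qr t y\<bar>))"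
      proof (rule integral_mono)
        show "integrable lborel (\<lambda>y. \<bar>\<gamma> (x - y) * qr s y - \<gamma> (x - y) * qr t y\<bar>)"
          using i by (intro integrable_abs Bochner_Integration.integrable_diff)
        show "integrable lborel (\<lambda>y. 2 * Bq * \<bar>\<gamma> (x - y) - gn n y\<bar> + real n * (indicator {-real n..real n} y *\<^sub>R \<bar>qr s y - qr t y\<bar>))"
          by (intro Bochner_Integration.integrable_add integrable_mult_right ign il)
        fix y
        define d where "d = \<bar>qr s y - qr t y\<bar>"
        have d: "0 \<le> d" "d \<le> 2 * Bq" using qr_bound[of s y] qr_bound[of t y] by (auto simp: d_def)
        have eq: "\<bar>\<gamma> (x - y) * qr s y - \<gamma> (x - y) * qr t y\<bar> = \<bar>\<gamma> (x - y)\<bar> * d"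
          by (simp add: d_def abs_mult[symmetric] right_diff_distrib)
        show "\<bar>\<gamma> (x - y) * qr s y - \<gamma> (x - y) * qr t y\<bar> \<le> 2 * Bq * \<bar>\<gamma> (x - y) - gn n y\<bar> + real n * (indicator {-real n..real n} y *\<^sub>R \<bar>qr s y - qr t y\<bar>)"
          unfolding eq d_def[symmetric]
        proof (cases "\<bar>y\<bar> \<le> real n \<and> \<bar>\<gamma> (x - y)\<bar> \<le> real n")
          case True
          then have "\<bar>\<gamma> (x - y)\<bar> * d \<le> real n * d" using d by (intro mult_right_mono) auto
          moreover have "y \<in> {-real n..real n}" "gn n y = \<gamma> (x - y)" using True by (auto simp: gn_def)
          ultimately show "\<bar>\<gamma> (x - y)\<bar> * d \<le> 2 * Bq * \<bar>\<gamma> (x - y) - gn n y\<bar> + real n * (indicator {-real n..real n} y *\<^sub>R d)" by simp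
        next
          case False
          then have g0: "gn n y = 0" by (auto simp: gn_def)
          have "\<bar>\<gamma> (x - y)\<bar> * d \<le> \<bar>\<gamma> (x - y)\<bar> * (2 * Bq)" by (rule mult_left_mono[OF d(2)]) simp
          moreover have "0 \<le> real n * (indicator {-real n..real n} y *\<^sub>R d)" using d by simp
          ultimately show "\<bar>\<gamma> (x - y)\<bar> * d \<le> 2 * Bq * \<bar>\<gamma> (x - y) - gn n y\<bar> + real n * (indicator {-real n..real n} y *\<^sub>R d)"
            unfolding g0 by (simp add: mult.commute)
        qed
      qed
      also have "\<dots> = 2 * Bq * (LINT y|lborel. \<bar>\<gamma> (x - y) - gn n y\<bar>) + real n * (LBINT y:{-real n..real n}. \<bar>qr s y - qr t y\<bar>)"
        unfolding set_lebesgue_integral_def using ign il by (subst Bochner_Integration.integral_add) auto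
      also have "\<dots> \<le> 2 * Bq * e1 + real n * (LBINT y:{-real n..real n}. \<bar>qr s y - qr t y\<bar>)"
        using n Bq0 by (intro add_right_mono mult_left_mono) auto
      finally show ?thesis .
    qed
    have "((\<lambda>s. real n * (LBINT y:{-real n..real n}. \<bar>qr s y - qr t y\<bar>)) \<longlongrightarrow> real n * 0) (at t within {0..T})"
      by (intro tendsto_intros qr_L1 t)
    then have "\<forall>\<^sub>F s in at t within {0..T}. real n * (LBINT y:{-real n..real n}. \<bar>qr s y - qr t y\<bar>) < e / 2"
      by (rule order_tendstoD(2)) (use e in simp)
    then show "\<forall>\<^sub>F s in at t within {0..T}. dist (wq s x - wq t x) 0 < e"
    proof eventually_elim
      case (elim s)
      then show ?case using bd[of s] e1B by (simp add: dist_real_def)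
    qed
  qed
  then show "((\<lambda>t. wq t x) \<longlongrightarrow> wq t x) (at t within {0..T})" by (simp add: LIM_zero_iff)
qed

lemma wc_continuous: "continuous_on UNIV (\<lambda>(t, x). wc t x)"
proof (rule joint_continuity)
  show "continuous_on UNIV (\<lambda>t. wc t x)" for x
    unfolding wc_def by (rule continuous_on_compose2[OF wq_continuous cl_continuous]) (use cl in auto)
  show "\<bar>wc t x - wc t z\<bar> \<le> \<kappa> * \<bar>x - z\<bar>" for t x z unfolding wc_def by (rule wq_lip)
qed

text \<open>In the coordinate \<open>F\<close> the field \<open>V (wc t (G z))\<close> is continuous
  and Lipschitz in \<open>z\<close>, so \<open>ode_exists\<close> produces its characteristics and
  \<open>flow_bilip\<close> makes them a flow.\<close>

lemma flow_of_weak: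
  obtains c L M b \<beta> where
    "\<And>t. t \<in> {0..T} \<Longrightarrow> bilip c L (b t)" "\<And>y. continuous_on UNIV (\<beta> y)"
    "\<And>t y. t \<in> {0..T} \<Longrightarrow> F (b t y) = F y + oint (\<beta> y) 0 t"
    "\<And>s y. \<beta> y s = V (wc s (b s y))" "\<And>s y. \<bar>\<beta> y s\<bar> \<le> M"
proof -
  obtain LV where LV: "LV \<ge> 0" "\<And>p q. p \<in> {-R..R} \<Longrightarrow> q \<in> {-R..R} \<Longrightarrow> \<bar>V q - V p\<bar> \<le> LV * \<bar>q - p\<bar>"
    using V_lip[of R] by blast
  obtain M where M: "M \<ge> 0" "\<And>p. p \<in> {-R..R} \<Longrightarrow> \<bar>V p\<bar> \<le> M" using V_bounded[of R] by blast
  define \<Lambda> where "\<Lambda> = LV * \<kappa> * vu + 1"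
  have Lam: "0 < \<Lambda>" using LV kappa0 vu by (simp add: \<Lambda>_def add_nonneg_pos)
  define f where "f t z = V (wc t (G z))" for t z
  have fM: "\<bar>f t z\<bar> \<le> M" for t z unfolding f_def by (rule M(2)[OF wc_bound])
  have flip: "\<bar>f t z - f t z'\<bar> \<le> \<Lambda> * \<bar>z - z'\<bar>" for t z z'
  proof -
    have "\<bar>f t z - f t z'\<bar> \<le> LV * \<bar>wc t (G z) - wc t (G z')\<bar>" unfolding f_def by (rule LV(2)[OF wc_bound wc_bound])
    also have "\<dots> \<le> LV * (\<kappa> * \<bar>G z - G z'\<bar>)" unfolding wc_def by (rule mult_left_mono[OF wq_lip LV(1)])
    also have "\<dots> \<le> LV * (\<kappa> * (vu * \<bar>z - z'\<bar>))" using LV kappa0 G_diff_abs(1) by (intro mult_left_mono) auto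
    also have "\<dots> \<le> \<Lambda> * \<bar>z - z'\<bar>" by (simp add: \<Lambda>_def algebra_simps)
    finally show ?thesis .
  qed
  have fc: "continuous_on UNIV (\<lambda>(t, z). f t z)"
  proof -
    have "continuous_on UNIV (\<lambda>p :: real \<times> real. (fst p, G (snd p)))"
      by (intro continuous_intros continuous_on_compose2[OF bilip_continuous[OF G_bilip]]) auto
    from continuous_on_compose2[OF wc_continuous this]
    have "continuous_on UNIV (\<lambda>p. wc (fst p) (G (snd p)))" by simp
    from continuous_on_compose2[OF V_cont this] show ?thesis by (simp add: f_def case_prod_beta)
  qed
  have "\<exists>e. continuous_on UNIV e \<and> (\<forall>t\<in>{0..T}. e t = F y + oint (\<lambda>s. f s (e s)) 0 t)" for y
    by (rule ode_exists[OF fc fM flip Lam, of T "F y"]) (use T in auto)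
  then obtain e where e: "\<And>y. continuous_on UNIV (e y)" "\<And>y t. t \<in> {0..T} \<Longrightarrow> e y t = F y + oint (\<lambda>s. f s (e y s)) 0 t"
    by metis
  define b where "b t y = G (e y t)" for t y
  define \<beta> where "\<beta> y s = f s (e y s)" for y s
  have \<beta>c: "continuous_on UNIV (\<beta> y)" for y
  proof -
    have "continuous_on UNIV (\<lambda>s. (s, e y s))" by (intro continuous_on_Pair continuous_on_id e(1))
    from continuous_on_compose2[OF fc this] show ?thesis by (simp add: \<beta>_def[abs_def])
  qed
  have loc_int: "loc_int (\<beta> y)" for y by (rule loc_int_continuous[OF \<beta>c])
  have Fb: "F (b t y) = F y + oint (\<beta> y) 0 t" if "t \<in> {0..T}" for t y
    using e(2)[OF that, of y] by (simp add: b_def \<beta>_def[abs_def])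
  have T0: "0 \<in> {0..T}" using T by simp
  have b0: "b 0 y = y" for y using Fb[OF T0, of y] by (simp add: b_def)
  have bl: "bilip (vl / (2 * exp (2 * \<Lambda> * T) * vu)) (2 * exp (2 * \<Lambda> * T) * vu / vl) (b t)" if "t \<in> {0..T}" for t
  proof (rule flow_bilip[where \<beta>=\<beta> and a=b and B=M, OF Lam loc_int _ _ b0 _ that])
    show "\<bar>\<beta> y s\<bar> \<le> M" for y s unfolding \<beta>_def by (rule fM)
    show "F (b t y) - F (b s y) = oint (\<beta> y) s t" if "s \<in> {0..T}" "t \<in> {0..T}" for s t y
      using Fb[OF that(1), of y] Fb[OF that(2), of y] oint_add[OF loc_int[of y], of 0 s t] by simp
    show "AE s in lborel. 0 < s \<and> s < T \<longrightarrow> \<bar>\<beta> y s - \<beta> z s\<bar> \<le> \<Lambda> * \<bar>F (b s y) - F (b s z)\<bar>" for y z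
      using flip by (intro AE_I2) (simp add: \<beta>_def b_def)
  qed
  show ?thesis
    by (rule that[OF bl \<beta>c Fb, of M]) (auto simp: \<beta>_def b_def f_def intro: M(2) wc_bound)
qed

end

section \<open>Smoothed indicators along characteristics\<close>

lemma smoothstep_has_derivative:
  assumes A: "(A has_real_derivative A') (at x)" and e: "(e has_real_derivative e') (at t)" and eps: "\<epsilon> \<noteq> 0"
  shows "((\<lambda>z. smoothstep ((A (snd z) - e (fst z)) / \<epsilon>)) has_derivative
    (\<lambda>(s, y). (- e' * bump ((A x - e t) / \<epsilon>) / \<epsilon>) * s + (A' * bump ((A x - e t) / \<epsilon>) / \<epsilon>) * y)) (at (t, x))"
proof -
  have 1: "((\<lambda>z. A (snd z)) has_derivative (\<lambda>z. snd z * A')) (at (t, x))"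
    by (rule DERIV_compose_FDERIV[where g=snd]) (use A in \<open>auto intro!: derivative_eq_intros\<close>)
  have 2: "((\<lambda>z. e (fst z)) has_derivative (\<lambda>z. fst z * e')) (at (t, x))"
    by (rule DERIV_compose_FDERIV[where g=fst]) (use e in \<open>auto intro!: derivative_eq_intros\<close>)
  have 3: "((\<lambda>z. (A (snd z) - e (fst z)) * inverse \<epsilon>) has_derivative (\<lambda>z. (snd z * A' - fst z * e') * inverse \<epsilon>)) (at (t, x))"
    by (intro has_derivative_mult_left has_derivative_diff 1 2)
  have "((\<lambda>z. smoothstep ((A (snd z) - e (fst z)) * inverse \<epsilon>)) has_derivative
    (\<lambda>z. ((snd z * A' - fst z * e') * inverse \<epsilon>) * bump ((A (snd (t, x)) - e (fst (t, x))) * inverse \<epsilon>))) (at (t, x))"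
    by (rule DERIV_compose_FDERIV[OF smoothstep_deriv 3])
  moreover have "(\<lambda>z. ((snd z * A' - fst z * e') * inverse \<epsilon>) * bump ((A (snd (t, x)) - e (fst (t, x))) * inverse \<epsilon>)) =
    (\<lambda>(s, y). (- e' * bump ((A x - e t) / \<epsilon>) / \<epsilon>) * s + (A' * bump ((A x - e t) / \<epsilon>) / \<epsilon>) * y)"
    by (auto simp: fun_eq_iff divide_inverse algebra_simps)
  ultimately show ?thesis by (simp add: divide_inverse)
qed

lemma continuous_on_fst_comp: "continuous_on UNIV f \<Longrightarrow> continuous_on UNIV (\<lambda>z. f (fst z))"
  by (rule continuous_on_compose2[of UNIV f UNIV fst]) (auto intro: continuous_intros)

lemma continuous_on_snd_comp: "continuous_on UNIV f \<Longrightarrow> continuous_on UNIV (\<lambda>z. f (snd z))"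
  by (rule continuous_on_compose2[of UNIV f UNIV snd]) (auto intro: continuous_intros)

lemma small_step_eventually:
  assumes "d > (0::real)"
  shows "\<forall>\<^sub>F m in sequentially. 1 \<le> d / inverse (real (Suc m))"
proof -
  obtain m0 :: nat where m0: "1 / d \<le> real m0" using real_arch_simple by blast
  show ?thesis
    using eventually_ge_at_top[of m0]
  proof eventually_elim
    case (elim m)
    then have "real m0 \<le> real (Suc m)" by simp
    then have "1 / d \<le> real (Suc m)" using m0 by linarith
    then have "1 \<le> d * real (Suc m)" using assms by (simp add: field_simps)
    then show ?case by (simp add: divide_inverse)
  qed
qed

text \<open>For fixed \<open>d\<close> the sequence is eventually constant. The value at
  \<open>d = 0\<close> is 0, which later yields intervals open on the left and closed on the
  right.\<close>

lemma smoothstep_limit: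
  "(\<lambda>m. smoothstep (d / inverse (real (Suc m)))) \<longlonglongrightarrow> (if 0 < d then 1 else 0)"
proof (rule tendsto_eventually, cases "0 < d")
  case True
  then show "\<forall>\<^sub>F m in sequentially. smoothstep (d / inverse (real (Suc m))) = (if 0 < d then 1 else 0)"
    using small_step_eventually[OF True] by (auto elim: eventually_mono simp: smoothstep_1)
next
  case False
  then have "d / inverse (real (Suc m)) \<le> 0" for m by (intro divide_nonpos_pos) auto
  then show "\<forall>\<^sub>F m in sequentially. smoothstep (d / inverse (real (Suc m))) = (if 0 < d then 1 else 0)"
    using False by (auto simp: smoothstep_0 intro!: always_eventually)
qed

text \<open>The support of the rescaled bump contracts to 0 from the right and leaves every fixed
  point, 0 included. The layer terms thus vanish pointwise, and a uniform bound is all that is left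
  to show.\<close>

lemma bump_limit: "\<forall>\<^sub>F m in sequentially. bump (d / inverse (real (Suc m))) = 0"
proof (cases "0 < d")
  case True
  then show ?thesis using small_step_eventually[OF True] by (auto elim: eventually_mono simp: bump_zero)
next
  case False
  then have "d / inverse (real (Suc m)) \<le> 0" for m by (intro divide_nonpos_pos) auto
  then show ?thesis by (auto simp: bump_zero intro!: always_eventually)
qed

context nonlocal_data
begin

text \<open>\<open>F\<close> is merely Lipschitz; test functions are built from its continuously differentiable
  Steklov averages \<open>Fn n\<close>.\<close>

definition Fn :: "nat \<Rightarrow> real \<Rightarrow> real" where
  "Fn n x = (oint F 0 (x + inverse (real (Suc n))) - oint F 0 x) / inverse (real (Suc n))"
definition dFn :: "nat \<Rightarrow> real \<Rightarrow> real" where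
  "dFn n x = (F (x + inverse (real (Suc n))) - F x) / inverse (real (Suc n))"

lemma F_continuous: "continuous_on UNIV F" by (rule bilip_continuous[OF F_bilip])

lemma Fn_deriv: "(Fn n has_real_derivative dFn n x) (at x)"
proof -
  define d where "d = inverse (real (Suc n))"
  have "((\<lambda>x. oint F 0 (x + d)) has_real_derivative F (x + d)) (at x)"
    using oint_deriv[OF F_continuous, of 0 "x + d"] by (simp add: DERIV_shift)
  then show ?thesis
    unfolding Fn_def[abs_def] dFn_def d_def[symmetric]
    by (intro DERIV_cdivide DERIV_diff oint_deriv F_continuous)
qed

lemma dFn_continuous: "continuous_on UNIV (dFn n)"
proof -
  have "continuous_on UNIV (\<lambda>x. F (x + inverse (real (Suc n))))"
    by (rule continuous_on_compose2[OF F_continuous]) (auto intro!: continuous_intros)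
  then show ?thesis unfolding dFn_def[abs_def] by (intro continuous_intros F_continuous) auto
qed

lemma Fn_continuous: "continuous_on UNIV (Fn n)"
  using Fn_deriv by (meson DERIV_continuous_on has_field_derivative_at_within)

lemma dFn_bounds: "0 \<le> dFn n x" "dFn n x \<le> 1 / vl"
proof -
  define d where "d = inverse (real (Suc n))"
  have d: "0 < d" by (simp add: d_def)
  have "x \<le> x + d" using d by simp
  then have "F (x + d) - F x \<le> 1 / vl * (x + d - x)" "F x \<le> F (x + d)"
    using F_bilip bilip_leq[OF F_bilip] unfolding bilip_def by blast+
  then show "0 \<le> dFn n x" "dFn n x \<le> 1 / vl"
    using d unfolding dFn_def d_def[symmetric] by (auto simp: divide_le_eq)
qed

lemma Fn_F: "\<bar>Fn n x - F x\<bar> \<le> inverse (real (Suc n)) / vl"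
proof -
  define d where "d = inverse (real (Suc n))"
  have d: "0 < d" by (simp add: d_def)
  have loc_int: "loc_int F" by (rule loc_int_continuous[OF F_continuous])
  have lic: "loc_int (\<lambda>_. F x)" by (rule loc_int_continuous) auto
  have "Fn n x - F x = oint (\<lambda>s. F s - F x) x (x + d) / d"
    unfolding oint_diff[OF loc_int lic] oint_const Fn_def d_def[symmetric] using d by (simp add: oint_minus[OF loc_int] field_simps)
  moreover have "\<bar>oint (\<lambda>s. F s - F x) x (x + d)\<bar> \<le> d / vl * \<bar>x + d - x\<bar>"
  proof (rule oint_bound[OF loc_int_diff[OF loc_int lic]], rule AE_I2, rule impI)
    fix s assume "min x (x + d) < s \<and> s < max x (x + d)"
    then have "\<bar>s - x\<bar> \<le> d" using d by (auto simp: min_def max_def split: if_splits)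
    then have "\<bar>s - x\<bar> / vl \<le> d / vl" using vl by (intro divide_right_mono) auto
    then show "\<bar>F s - F x\<bar> \<le> d / vl" using F_diff_abs(2)[of s x] by simp
  qed
  then have "\<bar>oint (\<lambda>s. F s - F x) x (x + d)\<bar> / d \<le> (d / vl * \<bar>x + d - x\<bar>) / d" using d by (intro divide_right_mono) auto
  ultimately have "\<bar>Fn n x - F x\<bar> \<le> d / vl" using d by simp
  then show ?thesis unfolding d_def .
qed

lemma Fn_limit: "(\<lambda>n. Fn n x) \<longlonglongrightarrow> F x"
proof -
  have "(\<lambda>n. Fn n x - F x) \<longlonglongrightarrow> 0"
  proof (rule Lim_null_comparison)
    show "\<forall>\<^sub>F n in sequentially. norm (Fn n x - F x) \<le> inverse (real (Suc n)) / vl"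
      unfolding real_norm_def by (rule always_eventually) (rule allI, rule Fn_F)
    show "(\<lambda>n. inverse (real (Suc n)) / vl) \<longlonglongrightarrow> 0"
      using tendsto_divide[OF LIMSEQ_inverse_real_of_nat tendsto_const[of vl]] vl by simp
  qed
  then show ?thesis by (rule LIM_zero_cancel)
qed

lemma dFn_limit: "AE x in lborel. (\<lambda>n. dFn n x) \<longlonglongrightarrow> 1 / v x"
  using F_deriv
proof eventually_elim
  case (elim x)
  then have "((\<lambda>h. (F (x + h) - F x) / h) \<longlongrightarrow> 1 / v x) (at 0)" by (simp add: DERIV_def)
  moreover have "filterlim (\<lambda>n. inverse (real (Suc n))) (at 0) sequentially"
    unfolding filterlim_at using LIMSEQ_inverse_real_of_nat by auto
  ultimately show ?case unfolding dFn_def by (rule filterlim_compose)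
qed

lemma F_zero[simp]: "F 0 = 0" by (simp add: F_def)

end

context nonlocal_weak
begin

lemma wc_meas2[measurable]: "case_prod wc \<in> borel_measurable (borel \<Otimes>\<^sub>M borel)"
  unfolding borel_prod by (rule borel_measurable_continuous_onI[OF wc_continuous])

text \<open>The convolution is replaced by \<open>wc\<close> at every time in \<open>(0, T)\<close>,
  \<open>q\<close> by \<open>qh\<close> at almost every point of the strip; the result is an
  identity between Borel integrals, open to Fubini and dominated convergence.\<close>

lemma weak_form_borel:
  assumes d: "\<And>t x. (\<phi> has_derivative (\<lambda>(s, y). pt (t, x) * s + px (t, x) * y)) (at (t, x))"
    and c: "continuous_on UNIV pt" "continuous_on UNIV px" and \<phi>: "\<phi> \<in> C1_compact_support ({-42<..<T} \<times> UNIV)"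
  shows "(LINT z|lborel. indicator {0<..<T} (fst z) * (qh z * (pt z + v (snd z) * V (wc (fst z) (snd z)) * px z)))
    + (LINT x|lborel. \<phi> (0, x) * q0 x) = 0"
proof -
  note partial = prod_partial_derivs[OF d]
  have d1: "deriv (\<lambda>s. \<phi> (s, x)) t = pt (t, x)" for t x by (rule DERIV_imp_deriv[OF partial(1)])
  have d2: "deriv (\<lambda>y. \<phi> (t, y)) x = px (t, x)" for t x by (rule DERIV_imp_deriv[OF partial(2)])
  have c\<phi>: "continuous_on UNIV \<phi>"
    by (intro continuous_at_imp_continuous_on ballI) (use has_derivative_continuous[OF d] in auto)
  have m[measurable]: "\<phi> \<in> borel_measurable (borel \<Otimes>\<^sub>M borel)" "pt \<in> borel_measurable (borel \<Otimes>\<^sub>M borel)" "px \<in> borel_measurable (borel \<Otimes>\<^sub>M borel)"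
    unfolding borel_prod by (intro borel_measurable_continuous_onI c\<phi> c)+
  have 1: "(LINT z:{0<..<T} \<times> UNIV|lebesgue.
           (case z of (t, x) \<Rightarrow>
              q t x * (deriv (\<lambda>s. \<phi> (s, x)) t
                       + vo x * V (convolution go (q t) x) * deriv (\<lambda>y. \<phi> (t, y)) x)))
    = (LINT z|lborel. indicator {0<..<T} (fst z) * (qh z * (pt z + v (snd z) * V (wc (fst z) (snd z)) * px z)))"
    unfolding set_lebesgue_integral_def
  proof (rule LINT_lebesgue_rep(1))
    have "(\<lambda>z. indicator {0<..<T} (fst z) * (qh z * (pt z + v (snd z) * V (wc (fst z) (snd z)) * px z))) \<in> borel_measurable (borel \<Otimes>\<^sub>M borel)"
      by measurable
    then show "(\<lambda>z. indicator {0<..<T} (fst z) * (qh z * (pt z + v (snd z) * V (wc (fst z) (snd z)) * px z))) \<in> borel_measurable borel"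
      by (simp add: borel_prod)
    show "AE z in lborel. indicat_real ({0<..<T} \<times> UNIV) z *\<^sub>R
       (case z of (t, x) \<Rightarrow> q t x * (deriv (\<lambda>s. \<phi> (s, x)) t + vo x * V (convolution go (q t) x) * deriv (\<lambda>y. \<phi> (t, y)) x))
       = indicator {0<..<T} (fst z) * (qh z * (pt z + v (snd z) * V (wc (fst z) (snd z)) * px z))"
      using AE_snd[OF vo] q_qh
    proof eventually_elim
      case (elim z)
      obtain t x where z: "z = (t, x)" by (cases z)
      show ?case
      proof (cases "t \<in> {0<..<T}")
        case True
        then have "t \<in> {0..T}" by auto
        then have "convolution go (q t) x = wc t x" using convolution_wq cl(2) by (simp add: wc_def)
        then show ?thesis using elim True by (simp add: z d1 d2)
      qed (simp add: z)
    qed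
  qed
  have 2: "(LINT x|lebesgue. \<phi> (0, x) * qo x) = (LINT x|lborel. \<phi> (0, x) * q0 x)"
    by (rule LINT_lebesgue_rep(1)) (measurable, use qo in auto)
  show ?thesis using weak \<phi> unfolding is_weak_solution_def 1[symmetric] 2[symmetric] by blast
qed

end

locale nonlocal_weak_flow = nonlocal_weak +
  fixes c L M :: real and b \<beta> :: "real \<Rightarrow> real \<Rightarrow> real"
  assumes bl: "\<And>t. t \<in> {0..T} \<Longrightarrow> bilip c L (b t)" and \<beta>c: "\<And>y. continuous_on UNIV (\<beta> y)"
    and Fb: "\<And>t y. t \<in> {0..T} \<Longrightarrow> F (b t y) = F y + oint (\<beta> y) 0 t"
    and \<beta>V: "\<And>s y. \<beta> y s = V (wc s (b s y))" and \<beta>M: "\<And>s y. \<bar>\<beta> y s\<bar> \<le> M"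
begin

text \<open>The characteristic in the coordinate \<open>F\<close>, extended to all real times
  because test functions also live at negative times.\<close>

definition e :: "real \<Rightarrow> real \<Rightarrow> real" where "e y t = F y + oint (\<beta> y) 0 t"

lemma e_deriv: "(e y has_real_derivative \<beta> y t) (at t)"
proof -
  have "((\<lambda>t. F y + oint (\<beta> y) 0 t) has_real_derivative 0 + \<beta> y t) (at t)"
    by (intro DERIV_add DERIV_const oint_deriv \<beta>c)
  then show ?thesis unfolding e_def[abs_def] by simp
qed

lemma e_continuous: "continuous_on UNIV (e y)"
  using e_deriv by (meson DERIV_continuous_on has_field_derivative_at_within)

lemma e_meas[measurable]: "e y \<in> borel_measurable borel"
  by (rule borel_measurable_continuous_onI[OF e_continuous])
lemma \<beta>_meas[measurable]: "\<beta> y \<in> borel_measurable borel"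
  by (rule borel_measurable_continuous_onI[OF \<beta>c])

lemma e_F: "t \<in> {0..T} \<Longrightarrow> e y t = F (b t y)" by (simp add: e_def Fb)

lemma M0: "0 \<le> M" using \<beta>M[of 0 0] by linarith

text \<open>The test function is \<open>\<psi>\<close> times the difference of two smoothed steps
  along the characteristics of \<open>y1\<close> and \<open>y2\<close>, with \<open>Fn n\<close> in
  place of \<open>F\<close>. As \<open>n\<close> grows, \<open>v * dFn n\<close> tends to 1 almost
  everywhere; \<open>v\<close> drops out, and only the gap between the velocity at \<open>x\<close>
  and that of the characteristic remains. Beyond \<open>R3\<close> both steps take the same value:
  the summands next to \<open>E\<close> pay for the layer width, at most 1, and for
  \<open>\<bar>Fn n - F\<bar> \<le> 1 / vl\<close>.\<close>

lemma regularised_identity: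
  fixes \<psi> \<psi>' :: "real \<Rightarrow> real"
  assumes \<psi>: "\<And>t. (\<psi> has_real_derivative \<psi>' t) (at t)" and \<psi>c: "continuous_on UNIV \<psi>'"
    and \<psi>B: "\<And>t. \<bar>\<psi> t\<bar> \<le> C" "\<And>t. \<bar>\<psi>' t\<bar> \<le> C" and \<psi>s: "\<And>t. \<psi> t \<noteq> 0 \<Longrightarrow> -2 \<le> t \<and> t \<le> t2" and t2: "t2 < T"
    and eps: "0 < \<epsilon>" "\<epsilon> \<le> 1" and E: "\<And>t. t \<in> {-2..T} \<Longrightarrow> \<bar>e y1 t\<bar> \<le> E \<and> \<bar>e y2 t\<bar> \<le> E"
    and R3: "R3 = vu * (E + 1 + 1 / vl)"
  shows "(LINT z|lborel. indicator {0<..<T} (fst z) * (qh z *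
      (\<psi>' (fst z) * (smoothstep ((F (snd z) - e y1 (fst z)) / \<epsilon>) - smoothstep ((F (snd z) - e y2 (fst z)) / \<epsilon>))
      + \<psi> (fst z) * (bump ((F (snd z) - e y1 (fst z)) / \<epsilon>) / \<epsilon> * (V (wc (fst z) (snd z)) - \<beta> y1 (fst z))
        - bump ((F (snd z) - e y2 (fst z)) / \<epsilon>) / \<epsilon> * (V (wc (fst z) (snd z)) - \<beta> y2 (fst z))))))
    + (LINT x|lborel. \<psi> 0 * (smoothstep ((F x - F y1) / \<epsilon>) - smoothstep ((F x - F y2) / \<epsilon>)) * q0 x) = 0"
    (is "integral\<^sup>L lborel ?G + integral\<^sup>L lborel ?H = 0")
proof -
  have C0: "0 \<le> C" using \<psi>B(1)[of 0] by linarith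
  have c\<psi>: "continuous_on UNIV \<psi>" using \<psi> by (meson DERIV_continuous_on has_field_derivative_at_within)
  have [measurable]: "\<psi> \<in> borel_measurable borel" "\<psi>' \<in> borel_measurable borel"
    by (auto intro: borel_measurable_continuous_onI c\<psi> \<psi>c)
  have [measurable]: "Fn n \<in> borel_measurable borel" "dFn n \<in> borel_measurable borel" for n
    by (auto intro: borel_measurable_continuous_onI Fn_continuous dFn_continuous)
  define u where "u n y z = (Fn n (snd z) - e y (fst z)) / \<epsilon>" for n y and z :: "real \<times> real"
  define \<phi> where "\<phi> n z = \<psi> (fst z) * (smoothstep (u n y1 z) - smoothstep (u n y2 z))" for n z
  define pt where "pt n z = \<psi>' (fst z) * (smoothstep (u n y1 z) - smoothstep (u n y2 z))
    + \<psi> (fst z) * (- \<beta> y1 (fst z) * bump (u n y1 z) / \<epsilon> - (- \<beta> y2 (fst z) * bump (u n y2 z) / \<epsilon>))" for n z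
  define px where "px n z = \<psi> (fst z) * (dFn n (snd z) * bump (u n y1 z) / \<epsilon> - dFn n (snd z) * bump (u n y2 z) / \<epsilon>)" for n z
  have der: "(\<phi> n has_derivative (\<lambda>(s, y). pt n (t, x) * s + px n (t, x) * y)) (at (t, x))" for n t x
  proof -
    have 1: "((\<lambda>z. \<psi> (fst z)) has_derivative (\<lambda>z. fst z * \<psi>' t)) (at (t, x))"
      by (rule DERIV_compose_FDERIV[where g=fst]) (use \<psi> in \<open>auto intro!: derivative_eq_intros\<close>)
    note s = smoothstep_has_derivative[OF Fn_deriv e_deriv, where \<epsilon>=\<epsilon> and x=x and t=t]
    have "(\<phi> n has_derivative (\<lambda>h. \<psi> (fst (t, x)) *
      ((case h of (s, y) \<Rightarrow> (- \<beta> y1 t * bump ((Fn n x - e y1 t) / \<epsilon>) / \<epsilon>) * s + (dFn n x * bump ((Fn n x - e y1 t) / \<epsilon>) / \<epsilon>) * y)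
       - (case h of (s, y) \<Rightarrow> (- \<beta> y2 t * bump ((Fn n x - e y2 t) / \<epsilon>) / \<epsilon>) * s + (dFn n x * bump ((Fn n x - e y2 t) / \<epsilon>) / \<epsilon>) * y))
      + (fst h * \<psi>' t) * (smoothstep (u n y1 (t, x)) - smoothstep (u n y2 (t, x))))) (at (t, x))"
      unfolding \<phi>_def[abs_def] u_def
      using has_derivative_mult[OF 1 has_derivative_diff[OF s s]] eps by simp
    moreover have "(\<lambda>h. \<psi> (fst (t, x)) *
      ((case h of (s, y) \<Rightarrow> (- \<beta> y1 t * bump ((Fn n x - e y1 t) / \<epsilon>) / \<epsilon>) * s + (dFn n x * bump ((Fn n x - e y1 t) / \<epsilon>) / \<epsilon>) * y)
       - (case h of (s, y) \<Rightarrow> (- \<beta> y2 t * bump ((Fn n x - e y2 t) / \<epsilon>) / \<epsilon>) * s + (dFn n x * bump ((Fn n x - e y2 t) / \<epsilon>) / \<epsilon>) * y))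
      + (fst h * \<psi>' t) * (smoothstep (u n y1 (t, x)) - smoothstep (u n y2 (t, x)))) = (\<lambda>(s, y). pt n (t, x) * s + px n (t, x) * y)"
      by (auto simp: fun_eq_iff pt_def px_def u_def algebra_simps)
    ultimately show ?thesis by simp
  qed
  have cu: "continuous_on UNIV (u n y)" for n y
    unfolding u_def using eps
    by (intro continuous_intros continuous_on_snd_comp[OF Fn_continuous] continuous_on_fst_comp[OF e_continuous]) auto
  have cpt: "continuous_on UNIV (pt n)" and cpx: "continuous_on UNIV (px n)" for n
    unfolding pt_def px_def using eps
    by (intro continuous_intros continuous_on_fst_comp[OF \<psi>c] continuous_on_fst_comp[OF c\<psi>]
        continuous_on_compose2[OF smoothstep_continuous cu subset_UNIV] continuous_on_compose2[OF bump_continuous cu subset_UNIV]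
        continuous_on_fst_comp[OF \<beta>c] continuous_on_snd_comp[OF dFn_continuous]; simp)+
  have uout: "u n y1 (t, x) \<le> 0 \<and> u n y2 (t, x) \<le> 0 \<or> 1 \<le> u n y1 (t, x) \<and> 1 \<le> u n y2 (t, x)"
    if "t \<in> {-2..T}" "R3 < \<bar>x\<bar>" for n t x
  proof -
    have "E + 1 + 1 / vl < \<bar>x\<bar> / vu" using that(2) vu unfolding R3 by (simp add: field_simps)
    also have "\<dots> \<le> \<bar>F x\<bar>" using F_diff_abs(1)[of x 0] by simp
    finally have "E + 1 + 1 / vl < \<bar>F x\<bar>" .
    moreover have "\<bar>Fn n x - F x\<bar> \<le> 1 / vl"
    proof -
      have "inverse (real (Suc n)) \<le> 1" by (simp add: inverse_le_1_iff)
      then have "inverse (real (Suc n)) / vl \<le> 1 / vl" using vl by (intro divide_right_mono) auto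
      then show ?thesis using Fn_F[of n x] by linarith
    qed
    ultimately have "E + 1 < \<bar>Fn n x\<bar>" by linarith
    moreover have "\<bar>e y1 t\<bar> \<le> E" "\<bar>e y2 t\<bar> \<le> E" using E[OF that(1)] by auto
    ultimately have "Fn n x - e y1 t \<le> 0 \<and> Fn n x - e y2 t \<le> 0 \<or> \<epsilon> \<le> Fn n x - e y1 t \<and> \<epsilon> \<le> Fn n x - e y2 t"
      using eps by linarith
    then show ?thesis using eps by (auto simp: u_def divide_le_0_iff)
  qed
  have out: "smoothstep (u n y1 (t, x)) = smoothstep (u n y2 (t, x))" "bump (u n y1 (t, x)) = 0" "bump (u n y2 (t, x)) = 0"
    if "t \<in> {-2..T}" "R3 < \<bar>x\<bar>" for n t x
    using uout[OF that, of n] by (auto simp: smoothstep_0 smoothstep_1 bump_zero)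
  have E0: "0 \<le> E" using E[of 0] T by auto
  have R30: "0 \<le> R3" using E0 vu vl by (simp add: R3)
  have \<phi>C1: "\<phi> n \<in> C1_compact_support ({-42<..<T} \<times> UNIV)" for n
  proof (rule C1_compact_support_prodI[OF der cpt cpx])
    show "-2 \<le> t \<and> t \<le> t2 \<and> -R3 \<le> x \<and> x \<le> R3" if "\<phi> n (t, x) \<noteq> 0" for t x
    proof -
      have t: "-2 \<le> t" "t \<le> t2" using that \<psi>s[of t] by (auto simp: \<phi>_def)
      have "\<not> R3 < \<bar>x\<bar>"
      proof
        assume "R3 < \<bar>x\<bar>"
        then have "smoothstep (u n y1 (t, x)) = smoothstep (u n y2 (t, x))" using t t2 by (intro out) auto
        then show False using that by (simp add: \<phi>_def)
      qed
      then show ?thesis using t by auto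
    qed
  qed (use t2 in auto)
  define G where "G n z = indicator {0<..<T} (fst z) * (qh z * (pt n z + v (snd z) * V (wc (fst z) (snd z)) * px n z))" for n z
  define H where "H n x = \<phi> n (0, x) * q0 x" for n x
  have id: "integral\<^sup>L lborel (G n) + integral\<^sup>L lborel (H n) = 0" for n
    unfolding G_def H_def by (rule weak_form_borel[OF der cpt cpx \<phi>C1])
  obtain MV where MV: "MV \<ge> 0" "\<And>p. p \<in> {-R..R} \<Longrightarrow> \<bar>V p\<bar> \<le> MV" using V_bounded[of R] by blast
  have um[measurable]: "u n y \<in> borel_measurable (borel \<Otimes>\<^sub>M borel)" for n y unfolding u_def by measurable
  have Gm: "G n \<in> borel_measurable borel" for n
    unfolding borel_prod[symmetric] G_def pt_def px_def by measurable
  have Gm': "?G \<in> borel_measurable borel"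
    unfolding borel_prod[symmetric] by measurable
  \<comment> \<open>Uniform in \<open>n\<close> for the fixed width \<open>\<epsilon>\<close>; 3/2
    is the maximum of \<open>bump\<close>.\<close>
  define D where "D = Bq * (C + C * (M * (3/2) / \<epsilon> + M * (3/2) / \<epsilon>) + vu * MV * (C * (1 / vl * (3/2) / \<epsilon> + 1 / vl * (3/2) / \<epsilon>)))"
  have tri: "\<bar>p - r\<bar> \<le> k + l" if "\<bar>p\<bar> \<le> k" "\<bar>r\<bar> \<le> l" for p r k l :: real using that by linarith
  have ss: "\<bar>smoothstep p - smoothstep r\<bar> \<le> 1" for p r
    using smoothstep_bounds[of p] smoothstep_bounds[of r] by linarith
  have bb: "\<bar>k * bump p / \<epsilon>\<bar> \<le> l * (3/2) / \<epsilon>" if "\<bar>k\<bar> \<le> l" for k l p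
  proof -
    have "\<bar>k\<bar> * bump p \<le> l * (3/2)" by (rule mult_mono) (use that bump_bounds[of p] in auto)
    then have "\<bar>k\<bar> * bump p / \<epsilon> \<le> l * (3/2) / \<epsilon>" using eps by (intro divide_right_mono) auto
    then show ?thesis using eps bump_bounds(1)[of p] by (simp add: abs_mult)
  qed
  have ptB: "\<bar>pt n z\<bar> \<le> C + C * (M * (3/2) / \<epsilon> + M * (3/2) / \<epsilon>)" for n z
  proof -
    have "\<bar>\<psi>' (fst z) * (smoothstep (u n y1 z) - smoothstep (u n y2 z))\<bar> \<le> C * 1"
      unfolding abs_mult by (intro mult_mono \<psi>B ss) (use C0 in auto)
    moreover have "\<bar>\<psi> (fst z) * (- \<beta> y1 (fst z) * bump (u n y1 z) / \<epsilon> - (- \<beta> y2 (fst z) * bump (u n y2 z) / \<epsilon>))\<bar> \<le> C * (M * (3/2) / \<epsilon> + M * (3/2) / \<epsilon>)"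
      unfolding abs_mult by (intro mult_mono \<psi>B tri bb) (use C0 \<beta>M in auto)
    ultimately show ?thesis unfolding pt_def by linarith
  qed
  have pxB: "\<bar>px n z\<bar> \<le> C * (1 / vl * (3/2) / \<epsilon> + 1 / vl * (3/2) / \<epsilon>)" for n z
    unfolding px_def abs_mult by (intro mult_mono \<psi>B tri bb) (use C0 dFn_bounds in \<open>auto simp: abs_of_nonneg\<close>)
  have GB: "\<bar>G n z\<bar> \<le> indicator ({0..T} \<times> {-R3..R3}) z * D" for n z
  proof -
    obtain t x where z: "z = (t, x)" by (cases z)
    have CC: "0 \<le> C * (1 / vl * (3/2) / \<epsilon> + 1 / vl * (3/2) / \<epsilon>)" using pxB[of n z] by linarith
    have "\<bar>v x * V (wc t x) * px n z\<bar> \<le> vu * MV * (C * (1 / vl * (3/2) / \<epsilon> + 1 / vl * (3/2) / \<epsilon>))"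
      unfolding abs_mult
      by (intro mult_mono MV(2) wc_bound pxB) (use v_lower[of x] v_upper[of x] vl vu MV(1) in auto)
    then have "\<bar>pt n z + v x * V (wc t x) * px n z\<bar> \<le> C + C * (M * (3/2) / \<epsilon> + M * (3/2) / \<epsilon>) + vu * MV * (C * (1 / vl * (3/2) / \<epsilon> + 1 / vl * (3/2) / \<epsilon>))"
      using ptB[of n z] by linarith
    then have "\<bar>qh z\<bar> * \<bar>pt n z + v x * V (wc t x) * px n z\<bar> \<le> D"
      unfolding D_def by (intro mult_mono qh_bound) (use Bq0 in auto)
    moreover from this have D0: "0 \<le> D" by (meson abs_ge_zero mult_nonneg_nonneg order_trans)
    moreover have "\<bar>G n z\<bar> = indicator {0<..<T} t * (\<bar>qh z\<bar> * \<bar>pt n z + v x * V (wc t x) * px n z\<bar>)"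
      by (simp add: G_def z abs_mult)
    moreover have "pt n z = 0 \<and> px n z = 0" if "t \<in> {0<..<T}" "x \<notin> {-R3..R3}"
      using out[of t x n] that by (auto simp: z pt_def px_def)
    ultimately show ?thesis by (cases "t \<in> {0<..<T}"; cases "x \<in> {-R3..R3}") (auto simp: z indicator_def)
  qed
  have box: "integrable lborel (\<lambda>z. indicator ({0..T} \<times> {-R3..R3}) z * D)"
  proof (intro integrable_mult_left)
    have "compact ({0..T} \<times> {-R3..R3})" by (intro compact_Times) auto
    then show "integrable lborel (indicat_real ({0..T} \<times> {-R3..R3}))"
      using emeasure_compact_finite borel_compact by (subst integrable_indicator_iff) auto
  qed
  have Glim: "AE z in lborel. (\<lambda>n. G n z) \<longlonglongrightarrow> ?G z"
    using AE_snd[OF dFn_limit]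
  proof eventually_elim
    case (elim z)
    obtain t x where z: "z = (t, x)" by (cases z)
    have vx: "v x \<noteq> 0" using v_lower[of x] vl by simp
    have ul: "(\<lambda>n. u n y (t, x)) \<longlonglongrightarrow> (F x - e y t) / \<epsilon>" for y
      unfolding u_def fst_conv snd_conv by (intro tendsto_intros Fn_limit) (use eps in auto)
    have sl: "(\<lambda>n. smoothstep (u n y (t, x))) \<longlonglongrightarrow> smoothstep ((F x - e y t) / \<epsilon>)" for y
      by (rule continuous_on_tendsto_compose[OF smoothstep_continuous ul]) auto
    have bl: "(\<lambda>n. bump (u n y (t, x))) \<longlonglongrightarrow> bump ((F x - e y t) / \<epsilon>)" for y
      by (rule continuous_on_tendsto_compose[OF bump_continuous ul]) auto
    have dl: "(\<lambda>n. dFn n x) \<longlonglongrightarrow> 1 / v x" using elim by (simp add: z)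
    define lim where "lim = indicator {0<..<T} t * (qh (t, x) *
       ((\<psi>' t * (smoothstep ((F x - e y1 t) / \<epsilon>) - smoothstep ((F x - e y2 t) / \<epsilon>))
        + \<psi> t * (- \<beta> y1 t * bump ((F x - e y1 t) / \<epsilon>) / \<epsilon> - (- \<beta> y2 t * bump ((F x - e y2 t) / \<epsilon>) / \<epsilon>)))
       + v x * V (wc t x) * (\<psi> t * (1 / v x * bump ((F x - e y1 t) / \<epsilon>) / \<epsilon> - 1 / v x * bump ((F x - e y2 t) / \<epsilon>) / \<epsilon>))))"
    have "(\<lambda>n. G n (t, x)) \<longlonglongrightarrow> lim"
      unfolding lim_def G_def pt_def px_def fst_conv snd_conv
      by (intro tendsto_intros sl bl dl) (use eps in auto)
    \<comment> \<open>Here \<open>v x\<close> cancels against \<open>1 / v x\<close>, which leaves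
      the velocity gap in each layer.\<close>
    moreover have "lim = ?G (t, x)" using vx eps by (simp add: lim_def field_simps)
    ultimately show ?case by (simp add: z)
  qed
  have 1: "(\<lambda>n. integral\<^sup>L lborel (G n)) \<longlonglongrightarrow> integral\<^sup>L lborel ?G"
    by (rule integral_dominated_convergence[OF _ _ box Glim]) (use Gm Gm' GB in auto)
  have Hb: "\<bar>H n x\<bar> \<le> indicator {-R3..R3} x * (C * 1 * N)" for n x
  proof -
    have "\<bar>H n x\<bar> \<le> C * 1 * N"
      unfolding H_def \<phi>_def abs_mult by (intro mult_mono \<psi>B ss q0_bound) (use C0 in auto)
    moreover have "H n x = 0" if "x \<notin> {-R3..R3}"
      using out(1)[of 0 x n] that T by (auto simp: H_def \<phi>_def)
    ultimately show ?thesis by (cases "x \<in> {-R3..R3}") auto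
  qed
  have 2: "(\<lambda>n. integral\<^sup>L lborel (H n)) \<longlonglongrightarrow> integral\<^sup>L lborel ?H"
  proof (rule integral_dominated_convergence[where w="\<lambda>x. indicator {-R3..R3} x * (C * 1 * N)"])
    show "integrable lborel (\<lambda>x. indicator {-R3..R3} x * (C * 1 * N))"
      by (intro integrable_mult_left) (auto simp: integrable_indicator_iff emeasure_lborel_Icc_eq)
    show "AE x in lborel. (\<lambda>n. H n x) \<longlonglongrightarrow> ?H x"
    proof (rule AE_I2)
      fix x
      have "(\<lambda>n. (Fn n x - e y 0) / \<epsilon>) \<longlonglongrightarrow> (F x - F y) / \<epsilon>" for y
        using tendsto_divide[OF tendsto_diff[OF Fn_limit[of x] tendsto_const[of "e y 0"]] tendsto_const[of \<epsilon>]] eps by (simp add: e_def)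
      then have "(\<lambda>n. smoothstep ((Fn n x - e y 0) / \<epsilon>)) \<longlonglongrightarrow> smoothstep ((F x - F y) / \<epsilon>)" for y
        by (rule continuous_on_tendsto_compose[OF smoothstep_continuous]) auto
      then show "(\<lambda>n. H n x) \<longlonglongrightarrow> ?H x" unfolding H_def \<phi>_def u_def fst_conv snd_conv by (intro tendsto_intros)
    qed
    show "H n \<in> borel_measurable lborel" for n unfolding H_def \<phi>_def u_def fst_conv snd_conv by measurable
  qed (use Hb in auto)
  have "(\<lambda>n. integral\<^sup>L lborel (G n) + integral\<^sup>L lborel (H n)) \<longlonglongrightarrow> integral\<^sup>L lborel ?G + integral\<^sup>L lborel ?H"
    by (rule tendsto_add[OF 1 2])
  then show ?thesis unfolding id by (simp add: LIMSEQ_const_iff)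
qed

text \<open>The width-\<open>\<epsilon>\<close> layer contributes a bounded integrand, since the velocity field is Lipschitz in the
  coordinate \<open>F\<close>; this is what lets \<open>\<epsilon>\<close> tend to \<open>0\<close> in \<open>regularised_identity\<close>.\<close>

lemma field_gap:
  "\<exists>\<Lambda>\<ge>0. \<forall>t\<in>{0..T}. \<forall>x y \<epsilon>. 0 < \<epsilon> \<longrightarrow> \<bar>bump ((F x - e y t) / \<epsilon>) / \<epsilon> * (V (wc t x) - \<beta> y t)\<bar> \<le> \<Lambda>"
proof -
  obtain LV where LV: "LV \<ge> 0" "\<And>p q. p \<in> {-R..R} \<Longrightarrow> q \<in> {-R..R} \<Longrightarrow> \<bar>V q - V p\<bar> \<le> LV * \<bar>q - p\<bar>"
    using V_lip[of R] by blast
  define A where "A = LV * (\<kappa> * vu)"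
  have A0: "0 \<le> A" using LV kappa0 vu by (simp add: A_def)
  have "\<bar>bump ((F x - e y t) / \<epsilon>) / \<epsilon> * (V (wc t x) - \<beta> y t)\<bar> \<le> 3/2 * A" if t: "t \<in> {0..T}" and eps: "0 < \<epsilon>" for t x y \<epsilon>
  proof (cases "0 < F x - e y t \<and> F x - e y t < \<epsilon>")
    case True
    have "\<bar>V (wc t x) - \<beta> y t\<bar> \<le> LV * \<bar>wc t x - wc t (b t y)\<bar>" unfolding \<beta>V by (rule LV(2)[OF wc_bound wc_bound])
    also have "\<dots> \<le> LV * (\<kappa> * \<bar>x - b t y\<bar>)" unfolding wc_def by (rule mult_left_mono[OF wq_lip LV(1)])
    also have "\<dots> \<le> LV * (\<kappa> * (vu * \<bar>F x - F (b t y)\<bar>))"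
      using LV kappa0 le_F_diff by (intro mult_left_mono) auto
    also have "\<dots> = A * \<bar>F x - e y t\<bar>" by (simp add: A_def e_F[OF t])
    also have "\<dots> \<le> A * \<epsilon>" using True A0 by (intro mult_left_mono) auto
    finally have "bump ((F x - e y t) / \<epsilon>) / \<epsilon> * \<bar>V (wc t x) - \<beta> y t\<bar> \<le> (3/2) / \<epsilon> * (A * \<epsilon>)"
      by (intro mult_mono divide_right_mono bump_bounds) (use eps A0 in auto)
    then show ?thesis using eps bump_bounds(1)[of "(F x - e y t) / \<epsilon>"] by (simp add: abs_mult)
  next
    case False
    then have "(F x - e y t) / \<epsilon> \<le> 0 \<or> 1 \<le> (F x - e y t) / \<epsilon>" using eps by (auto simp: divide_le_0_iff)
    then show ?thesis using A0 by (simp add: bump_zero)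
  qed
  then show ?thesis using A0 by (intro exI[of _ "3/2 * A"]) auto
qed

lemma b0: "b 0 y = y"
proof -
  have "F (b 0 y) = F y" using Fb[of 0 y] T by simp
  then show ?thesis by (metis GF)
qed

lemma b_time: assumes s: "s \<in> {0..T}" and t: "t \<in> {0..T}" shows "\<bar>b s y - b t y\<bar> \<le> vu * M * \<bar>s - t\<bar>"
proof -
  have loc_int: "loc_int (\<beta> y)" by (rule loc_int_continuous[OF \<beta>c])
  have "\<bar>oint (\<beta> y) t s\<bar> \<le> M * \<bar>s - t\<bar>" by (rule oint_bound[OF loc_int]) (use \<beta>M in auto)
  then have "\<bar>F (b s y) - F (b t y)\<bar> \<le> M * \<bar>s - t\<bar>"
    using oint_minus[OF loc_int, of 0 s t] by (simp add: Fb[OF s] Fb[OF t])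
  then have "vu * \<bar>F (b s y) - F (b t y)\<bar> \<le> vu * (M * \<bar>s - t\<bar>)" using vu by (intro mult_left_mono) auto
  then show ?thesis using le_F_diff[of "b s y" "b t y"] by simp
qed

section \<open>Mass between two characteristics\<close>

definition mass :: "real \<Rightarrow> real \<Rightarrow> real \<Rightarrow> real" where
  "mass y1 y2 t = oint (qr t) (b t y1) (b t y2)"

lemma loc_int_qr: "loc_int (qr t)" by (rule loc_int_bounded[OF qr_meas qr_bound])

text \<open>The endpoints move at bounded speed through a bounded density, and the density is
  continuous in local L1; \<open>r\<close> is chosen to enclose both endpoints at all times.\<close>

lemma mass_continuous:
  assumes y12: "y1 \<le> y2"
  shows "continuous_on {0..T} (mass y1 y2)"
  unfolding continuous_on_def
proof
  fix t assume t: "t \<in> {0..T}"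
  define r where "r = \<bar>b t y1\<bar> + \<bar>b t y2\<bar> + vu * M * T"
  define g where "g s = (LBINT x:{-r..r}. \<bar>qr s x - qr t x\<bar>) + 2 * (Bq * (vu * M * \<bar>s - t\<bar>))" for s
  have "(g \<longlongrightarrow> 0 + 2 * (Bq * (vu * M * \<bar>t - t\<bar>))) (at t within {0..T})"
    unfolding g_def by (intro tendsto_intros qr_L1 t)
  then have g0: "(g \<longlongrightarrow> 0) (at t within {0..T})" by simp
  have bd: "\<bar>mass y1 y2 s - mass y1 y2 t\<bar> \<le> g s" if s: "s \<in> {0..T}" for s
  proof -
    have le: "b s y1 \<le> b s y2" using y12 bilip_leq[OF bl[OF s]] by simp
    have "\<bar>s - t\<bar> \<le> T" using s t by auto
    then have "vu * M * \<bar>s - t\<bar> \<le> vu * M * T" using vu M0 by (intro mult_left_mono) auto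
    then have r: "-r \<le> b s y1" "b s y2 \<le> r"
      using b_time[OF s t, of y1] b_time[OF s t, of y2] by (auto simp: r_def)
    define f where "f x = qr s x - qr t x" for x
    have lif: "loc_int f" unfolding f_def by (intro loc_int_diff loc_int_qr)
    note lia = loc_int_abs[OF lif]
    have nn: "0 \<le> oint (\<lambda>x. \<bar>f x\<bar>) p p'" if "p \<le> p'" for p p'
      using oint_abs_mono[OF lif lia that] by (force intro: order_trans[OF abs_ge_zero])
    have "\<bar>oint f (b s y1) (b s y2)\<bar> \<le> oint (\<lambda>x. \<bar>f x\<bar>) (b s y1) (b s y2)"
      by (rule oint_abs_mono[OF lif lia le]) simp
    also have "\<dots> \<le> oint (\<lambda>x. \<bar>f x\<bar>) (-r) r"
      using nn[OF r(1)] nn[OF r(2)] oint_add[OF lia, of "-r" "b s y1" "b s y2"] oint_add[OF lia, of "-r" "b s y2" r] by linarith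
    also have "\<dots> = (LBINT x:{-r..r}. \<bar>qr s x - qr t x\<bar>)"
      unfolding f_def by (rule oint_le) (use r le in linarith)
    finally have 1: "\<bar>oint f (b s y1) (b s y2)\<bar> \<le> (LBINT x:{-r..r}. \<bar>qr s x - qr t x\<bar>)" .
    have 2: "\<bar>oint (qr t) (b t y) (b s y)\<bar> \<le> Bq * (vu * M * \<bar>s - t\<bar>)" for y
    proof -
      have "\<bar>oint (qr t) (b t y) (b s y)\<bar> \<le> Bq * \<bar>b s y - b t y\<bar>" by (rule oint_bound[OF loc_int_qr]) (use qr_bound in auto)
      also have "\<dots> \<le> Bq * (vu * M * \<bar>s - t\<bar>)" using Bq0 b_time[OF s t] by (intro mult_left_mono) auto
      finally show ?thesis .
    qed
    have "mass y1 y2 s - mass y1 y2 t = oint f (b s y1) (b s y2) - oint (qr t) (b t y1) (b s y1) + oint (qr t) (b t y2) (b s y2)"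
      using oint_diff[OF loc_int_qr[of s] loc_int_qr[of t], of "b s y1" "b s y2"]
        oint_add[OF loc_int_qr[of t], of "b t y1" "b s y1" "b s y2"] oint_add[OF loc_int_qr[of t], of "b t y1" "b t y2" "b s y2"]
      by (simp add: mass_def f_def[abs_def])
    then show ?thesis using 1 2[of y1] 2[of y2] by (simp add: g_def)
  qed
  have "((\<lambda>s. mass y1 y2 s - mass y1 y2 t) \<longlongrightarrow> 0) (at t within {0..T})"
    by (rule Lim_null_comparison[OF _ g0]) (use bd in \<open>auto simp: eventually_at_filter\<close>)
  then show "((mass y1 y2) \<longlongrightarrow> mass y1 y2 t) (at t within {0..T})" by (simp add: LIM_zero_iff)
qed

lemma mass_cl_continuous: "y1 \<le> y2 \<Longrightarrow> continuous_on UNIV (\<lambda>t. mass y1 y2 (cl t))"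
  by (rule continuous_on_compose2[OF mass_continuous cl_continuous]) (use cl in auto)

text \<open>Width 0 in \<open>regularised_identity\<close>: the steps become the indicator of the
  region between the characteristics, and the layer terms, bounded by \<open>field_gap\<close>,
  vanish pointwise. After integration in \<open>x\<close> the identity says that the mass has weak
  time derivative 0 and the initial value given by \<open>q0\<close>.\<close>

lemma sharp_identity:
  fixes \<psi> \<psi>' :: "real \<Rightarrow> real"
  assumes \<psi>: "\<And>t. (\<psi> has_real_derivative \<psi>' t) (at t)" and \<psi>c: "continuous_on UNIV \<psi>'"
    and \<psi>B: "\<And>t. \<bar>\<psi> t\<bar> \<le> C" "\<And>t. \<bar>\<psi>' t\<bar> \<le> C" and \<psi>s: "\<And>t. \<psi> t \<noteq> 0 \<Longrightarrow> -2 \<le> t \<and> t \<le> t2" and t2: "t2 < T"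
    and y12: "y1 \<le> y2"
  shows "(LINT t|lborel. indicator {0<..<T} t * \<psi>' t * mass y1 y2 (cl t)) + \<psi> 0 * oint q0 y1 y2 = 0"
proof -
  have C0: "0 \<le> C" using \<psi>B(1)[of 0] by linarith
  have c\<psi>: "continuous_on UNIV \<psi>" using \<psi> by (meson DERIV_continuous_on has_field_derivative_at_within)
  have [measurable]: "\<psi> \<in> borel_measurable borel" "\<psi>' \<in> borel_measurable borel"
    by (auto intro: borel_measurable_continuous_onI c\<psi> \<psi>c)
  obtain E1 where E1: "0 \<le> E1" "\<And>t. -2 \<le> t \<Longrightarrow> t \<le> T \<Longrightarrow> \<bar>e y1 t\<bar> \<le> E1"
    using continuous_interval_bounded[OF e_continuous, of "-2" T y1] by blast
  obtain E2 where E2: "0 \<le> E2" "\<And>t. -2 \<le> t \<Longrightarrow> t \<le> T \<Longrightarrow> \<bar>e y2 t\<bar> \<le> E2"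
    using continuous_interval_bounded[OF e_continuous, of "-2" T y2] by blast
  define E where "E = max E1 E2"
  have E0: "0 \<le> E" using E1(1) by (simp add: E_def)
  have E: "\<bar>e y1 t\<bar> \<le> E \<and> \<bar>e y2 t\<bar> \<le> E" if "t \<in> {-2..T}" for t
    using E1(2)[of t] E2(2)[of t] that by (simp add: E_def le_max_iff_disj)
  define R3 where "R3 = vu * (E + 1 + 1 / vl)"
  obtain \<Lambda> where \<Lambda>: "0 \<le> \<Lambda>" "\<And>t x y \<epsilon>. t \<in> {0..T} \<Longrightarrow> 0 < \<epsilon> \<Longrightarrow> \<bar>bump ((F x - e y t) / \<epsilon>) / \<epsilon> * (V (wc t x) - \<beta> y t)\<bar> \<le> \<Lambda>"
    using field_gap by blast
  define \<epsilon> where "\<epsilon> m = inverse (real (Suc m))" for m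
  have eps: "0 < \<epsilon> m" "\<epsilon> m \<le> 1" for m by (auto simp: \<epsilon>_def inverse_le_1_iff)
  define S where "S m y t x = smoothstep ((F x - e y t) / \<epsilon> m)" for m y t x
  define Q where "Q m y t x = bump ((F x - e y t) / \<epsilon> m) / \<epsilon> m * (V (wc t x) - \<beta> y t)" for m y t x
  define J where "J y t x = (if 0 < F x - e y t then 1 else 0 :: real)" for y t x
  define G where "G m z = indicator {0<..<T} (fst z) * (qh z * (\<psi>' (fst z) * (S m y1 (fst z) (snd z) - S m y2 (fst z) (snd z))
      + \<psi> (fst z) * (Q m y1 (fst z) (snd z) - Q m y2 (fst z) (snd z))))" for m z
  define H where "H m x = \<psi> 0 * (S m y1 0 x - S m y2 0 x) * q0 x" for m x
  define G' where "G' z = indicator {0<..<T} (fst z) * (qh z * (\<psi>' (fst z) * (J y1 (fst z) (snd z) - J y2 (fst z) (snd z))))" for z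
  define H' where "H' x = \<psi> 0 * (J y1 0 x - J y2 0 x) * q0 x" for x
  have id: "integral\<^sup>L lborel (G m) + integral\<^sup>L lborel (H m) = 0" for m
    using regularised_identity[OF \<psi> \<psi>c \<psi>B \<psi>s t2 eps[of m] E R3_def]
    unfolding G_def H_def S_def Q_def by (simp add: e_def)
  have Gm: "G m \<in> borel_measurable borel" for m
    unfolding borel_prod[symmetric] G_def S_def Q_def by measurable
  have Gm': "G' \<in> borel_measurable borel"
    unfolding borel_prod[symmetric] G'_def J_def by measurable
  have far: "(F x - e y1 t \<le> 0 \<and> F x - e y2 t \<le> 0) \<or> (1 \<le> F x - e y1 t \<and> 1 \<le> F x - e y2 t)"
    if "t \<in> {-2..T}" "x \<notin> {-R3..R3}" for t x
  proof -
    have "R3 < \<bar>x\<bar>" using that(2) by auto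
    then have "E + 1 + 1 / vl < \<bar>x\<bar> / vu" using vu unfolding R3_def by (simp add: field_simps)
    also have "\<dots> \<le> \<bar>F x\<bar>" using F_diff_abs(1)[of x 0] by simp
    finally have "E + 1 + 1 / vl < \<bar>F x\<bar>" .
    moreover have "0 < 1 / vl" using vl by simp
    ultimately show ?thesis using E[OF that(1)] by linarith
  qed
  have Sfar: "S m y1 t x = S m y2 t x \<and> Q m y1 t x = 0 \<and> Q m y2 t x = 0" if "t \<in> {-2..T}" "x \<notin> {-R3..R3}" for m t x
    using far[OF that]
  proof
    assume "F x - e y1 t \<le> 0 \<and> F x - e y2 t \<le> 0"
    then have "(F x - e y1 t) / \<epsilon> m \<le> 0" "(F x - e y2 t) / \<epsilon> m \<le> 0" using eps[of m] by (auto simp: divide_le_0_iff)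
    then show ?thesis by (simp add: S_def Q_def smoothstep_0 bump_zero)
  next
    assume "1 \<le> F x - e y1 t \<and> 1 \<le> F x - e y2 t"
    then have "1 \<le> (F x - e y1 t) / \<epsilon> m" "1 \<le> (F x - e y2 t) / \<epsilon> m" using eps[of m] by (auto simp: le_divide_eq)
    then show ?thesis by (simp add: S_def Q_def smoothstep_1 bump_zero)
  qed
  have ss: "\<bar>smoothstep p - smoothstep r\<bar> \<le> 1" for p r
    using smoothstep_bounds[of p] smoothstep_bounds[of r] by linarith
  define D where "D = Bq * (C * 1 + C * (\<Lambda> + \<Lambda>))"
  have D0: "0 \<le> D" using Bq0 C0 \<Lambda>(1) by (simp add: D_def)
  have GB: "\<bar>G m z\<bar> \<le> indicator ({0..T} \<times> {-R3..R3}) z * D" for m z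
  proof -
    obtain t x where z: "z = (t, x)" by (cases z)
    show ?thesis
    proof (cases "t \<in> {0<..<T}")
      case True
      then have t: "t \<in> {0..T}" "t \<in> {-2..T}" by auto
      show ?thesis
      proof (cases "x \<in> {-R3..R3}")
        case x: True
        have "\<bar>Q m y1 t x\<bar> \<le> \<Lambda>" "\<bar>Q m y2 t x\<bar> \<le> \<Lambda>" unfolding Q_def by (rule \<Lambda>(2)[OF t(1) eps(1)])+
        then have "\<bar>Q m y1 t x - Q m y2 t x\<bar> \<le> \<Lambda> + \<Lambda>" by linarith
        then have 1: "\<bar>\<psi> t * (Q m y1 t x - Q m y2 t x)\<bar> \<le> C * (\<Lambda> + \<Lambda>)"
          unfolding abs_mult by (intro mult_mono \<psi>B) (use C0 in auto)
        have 2: "\<bar>\<psi>' t * (S m y1 t x - S m y2 t x)\<bar> \<le> C * 1"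
          unfolding abs_mult S_def by (intro mult_mono \<psi>B ss) (use C0 in auto)
        have "\<bar>qh z\<bar> * \<bar>\<psi>' t * (S m y1 t x - S m y2 t x) + \<psi> t * (Q m y1 t x - Q m y2 t x)\<bar> \<le> D"
          unfolding D_def by (intro mult_mono qh_bound order_trans[OF abs_triangle_ineq add_mono] 1 2) (use Bq0 in auto)
        then show ?thesis using True x by (simp add: z G_def abs_mult)
      next
        case False
        then show ?thesis using Sfar[OF t(2) False, of m] by (simp add: z G_def)
      qed
    next
      case False
      then show ?thesis using D0 by (simp add: z G_def)
    qed
  qed
  have box: "integrable lborel (\<lambda>z. indicator ({0..T} \<times> {-R3..R3}) z * D)"
  proof (intro integrable_mult_left)
    have "compact ({0..T} \<times> {-R3..R3})" by (intro compact_Times) auto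
    then show "integrable lborel (indicat_real ({0..T} \<times> {-R3..R3}))"
      using emeasure_compact_finite borel_compact by (subst integrable_indicator_iff) auto
  qed
  have Slim: "(\<lambda>m. S m y t x) \<longlonglongrightarrow> J y t x" for y t x
    unfolding S_def \<epsilon>_def J_def by (rule smoothstep_limit)
  have Qlim: "(\<lambda>m. Q m y t x) \<longlonglongrightarrow> 0" for y t x
  proof (rule tendsto_eventually)
    show "\<forall>\<^sub>F m in sequentially. Q m y t x = 0"
      using bump_limit[of "F x - e y t"] by eventually_elim (simp add: Q_def \<epsilon>_def)
  qed
  have Glim: "(\<lambda>m. G m z) \<longlonglongrightarrow> G' z" for z
  proof -
    have "(\<lambda>m. G m z) \<longlonglongrightarrow> indicator {0<..<T} (fst z) * (qh z * (\<psi>' (fst z) * (J y1 (fst z) (snd z) - J y2 (fst z) (snd z))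
      + \<psi> (fst z) * (0 - 0)))"
      unfolding G_def by (intro tendsto_intros Slim Qlim)
    then show ?thesis by (simp add: G'_def)
  qed
  have 1: "(\<lambda>m. integral\<^sup>L lborel (G m)) \<longlonglongrightarrow> integral\<^sup>L lborel G'"
    by (rule integral_dominated_convergence[OF _ _ box]) (use Gm Gm' GB Glim in auto)
  have Gi: "integrable lborel G'"
    by (rule integrable_dominated_convergence[OF _ _ box, where s=G]) (use Gm Gm' GB Glim in auto)
  have Hb: "\<bar>H m x\<bar> \<le> indicator {-R3..R3} x * (C * 1 * N)" for m x
  proof -
    have "\<bar>H m x\<bar> \<le> C * 1 * N"
      unfolding H_def S_def abs_mult by (intro mult_mono \<psi>B ss q0_bound) (use C0 in auto)
    moreover have "H m x = 0" if "x \<notin> {-R3..R3}"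
      using Sfar[of 0 x m] that T by (auto simp: H_def)
    ultimately show ?thesis by (cases "x \<in> {-R3..R3}") auto
  qed
  have 2: "(\<lambda>m. integral\<^sup>L lborel (H m)) \<longlonglongrightarrow> integral\<^sup>L lborel H'"
  proof (rule integral_dominated_convergence[where w="\<lambda>x. indicator {-R3..R3} x * (C * 1 * N)"])
    show "integrable lborel (\<lambda>x. indicator {-R3..R3} x * (C * 1 * N))"
      by (intro integrable_mult_left) (auto simp: integrable_indicator_iff emeasure_lborel_Icc_eq)
    show "AE x in lborel. (\<lambda>m. H m x) \<longlonglongrightarrow> H' x"
      unfolding H_def H'_def by (intro AE_I2 tendsto_intros Slim)
    show "H m \<in> borel_measurable lborel" for m unfolding H_def S_def by measurable
    show "H' \<in> borel_measurable lborel" unfolding H'_def J_def by measurable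
  qed (use Hb in auto)
  have "(\<lambda>m. integral\<^sup>L lborel (G m) + integral\<^sup>L lborel (H m)) \<longlonglongrightarrow> integral\<^sup>L lborel G' + integral\<^sup>L lborel H'"
    by (rule tendsto_add[OF 1 2])
  then have sum0: "integral\<^sup>L lborel G' + integral\<^sup>L lborel H' = 0" unfolding id by (simp add: LIMSEQ_const_iff)
  have Jdiff: "J y1 t x - J y2 t x = indicator {b t y1<..b t y2} x" if "t \<in> {0..T}" for t x
  proof -
    have "0 < F x - e y t \<longleftrightarrow> b t y < x" for y using bilip_less[OF F_bilip] by (simp add: e_F[OF that])
    moreover have "b t y1 \<le> b t y2" using y12 bilip_leq[OF bl[OF that]] by simp
    ultimately show ?thesis by (auto simp: J_def indicator_def)
  qed
  have half_open: "(LINT x|lborel. indicator {p<..r} x * f x) = oint f p r" if "p \<le> r" for p r and f :: "real \<Rightarrow> real"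
    using interval_integral_Ioc[of p r f] that
    by (simp add: oint_def set_lebesgue_integral_def)
  have H'eq: "integral\<^sup>L lborel H' = \<psi> 0 * oint q0 y1 y2"
  proof -
    have "integral\<^sup>L lborel H' = (LINT x|lborel. \<psi> 0 * (indicator {y1<..y2} x * q0 x))"
      using Jdiff[of 0] T by (intro Bochner_Integration.integral_cong) (auto simp: H'_def b0)
    then show ?thesis using half_open[OF y12, of q0] by simp
  qed
  have "integral\<^sup>L lborel G' = (LINT t|lborel. LINT x|lborel. G' (t, x))" by (rule fubini_lborel(1)[OF Gi])
  also have "\<dots> = (LINT t|lborel. indicator {0<..<T} t * \<psi>' t * mass y1 y2 (cl t))"
  proof (rule integral_cong_AE)
    have [measurable]: "(\<lambda>t. mass y1 y2 (cl t)) \<in> borel_measurable borel"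
      by (rule borel_measurable_continuous_onI[OF mass_cl_continuous[OF y12]])
    show "(\<lambda>t. indicator {0<..<T} t * \<psi>' t * mass y1 y2 (cl t)) \<in> borel_measurable lborel" by measurable
    have [measurable]: "G' \<in> borel_measurable (borel \<Otimes>\<^sub>M lborel)" using Gm' by (simp add: borel_prod[symmetric] cong: measurable_cong_sets)
    show "(\<lambda>t. LINT x|lborel. G' (t, x)) \<in> borel_measurable lborel" by measurable
    show "AE t in lborel. (LINT x|lborel. G' (t, x)) = indicator {0<..<T} t * \<psi>' t * mass y1 y2 (cl t)"
      using AE_prodD(1)[OF q_qh]
    proof eventually_elim
      case (elim t)
      show ?case
      proof (cases "t \<in> {0<..<T}")
        case True
        then have t: "t \<in> {0..T}" by auto
        have [measurable]: "(\<lambda>x. qh (t, x)) \<in> borel_measurable borel" by measurable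
        \<comment> \<open>At almost every time \<open>qh\<close> restricted to that time and
          \<open>qr t\<close> both represent \<open>q t\<close>; this exchange brings in
          \<open>mass\<close>, which is defined at every time.\<close>
        have "(LINT x|lborel. G' (t, x)) = (LINT x|lborel. \<psi>' t * (indicator {b t y1<..b t y2} x * qr t x))"
        proof (rule integral_cong_AE)
          show "AE x in lborel. G' (t, x) = \<psi>' t * (indicator {b t y1<..b t y2} x * qr t x)"
            using elim q_qr[OF t] by eventually_elim (use True Jdiff[OF t] in \<open>simp add: G'_def\<close>)
          show "(\<lambda>x. G' (t, x)) \<in> borel_measurable lborel" unfolding G'_def J_def by measurable
        qed measurable
        also have "\<dots> = \<psi>' t * oint (qr t) (b t y1) (b t y2)"
          using half_open[of "b t y1" "b t y2" "qr t"] y12 bilip_leq[OF bl[OF t]] by simp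
        finally show ?thesis using True by (simp add: mass_def cl(2)[OF t])
      qed (simp add: G'_def)
    qed
  qed
  finally show ?thesis using sum0 H'eq by simp
qed

end

context nonlocal_weak_flow
begin

text \<open>On \<open>(0, T)\<close> the derivative of the cut-off is minus a unit bump to the right
  of \<open>t\<close>, so \<open>sharp_identity\<close> states that a right-sided average of the
  mass equals the initial mass; continuity of the mass lets the width tend to 0.\<close>

lemma mass_conserved_interior:
  assumes y12: "y1 \<le> y2" and t: "0 \<le> t" "t < T"
  shows "mass y1 y2 t = oint q0 y1 y2"
proof -
  define f where "f s = mass y1 y2 (cl s)" for s
  have cf: "continuous_on UNIV f" unfolding f_def by (rule mass_cl_continuous[OF y12])
  define \<delta> where "\<delta> n = inverse (real (Suc n))" for n
  have \<delta>: "0 < \<delta> n" for n by (simp add: \<delta>_def)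
  have id: "(LINT s|lborel. f s * (bump ((s - t) / \<delta> n) / \<delta> n)) = oint q0 y1 y2" if n: "t + \<delta> n < T" for n
  proof -
    \<comment> \<open>The rise takes place on \<open>[-2, -1]\<close>, within the time range of test
      functions and before 0: hence \<open>\<psi> 0 = 1\<close>, and only the fall after
      \<open>t\<close> is visible on \<open>(0, T)\<close>.\<close>
    define \<psi> where "\<psi> s = smoothstep ((s - (-2)) / 1) - smoothstep ((s - t) / \<delta> n)" for s
    define \<psi>' where "\<psi>' s = bump ((s - (-2)) / 1) / 1 - bump ((s - t) / \<delta> n) / \<delta> n" for s
    define C where "C = 1 + 3/2 + (3/2) / \<delta> n"
    have "0 \<le> (3/2) / \<delta> n" using \<delta>[of n] by simp
    then have C: "1 \<le> C" unfolding C_def by linarith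
    have "(LINT s|lborel. indicator {0<..<T} s * \<psi>' s * f s) + \<psi> 0 * oint q0 y1 y2 = 0"
      unfolding f_def
    proof (rule sharp_identity[where C=C and ?t2.0="t + \<delta> n", OF _ _ _ _ _ n y12])
      show "(\<psi> has_real_derivative \<psi>' s) (at s)" for s
        unfolding \<psi>_def[abs_def] \<psi>'_def using \<delta>[of n]
        by (intro DERIV_diff smoothstep_scaled_deriv) auto
      show "continuous_on UNIV \<psi>'"
        unfolding \<psi>'_def using \<delta>[of n]
        by (intro continuous_intros continuous_on_compose2[OF bump_continuous _ subset_UNIV]) auto
      show "\<bar>\<psi> s\<bar> \<le> C" for s
        using smoothstep_bounds[of "(s - (-2)) / 1"] smoothstep_bounds[of "(s - t) / \<delta> n"] C
        unfolding \<psi>_def by linarith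
      show "\<bar>\<psi>' s\<bar> \<le> C" for s
      proof -
        have "0 \<le> bump ((s - t) / \<delta> n) / \<delta> n" "bump ((s - t) / \<delta> n) / \<delta> n \<le> (3/2) / \<delta> n"
          by (rule divide_nonneg_pos divide_right_mono bump_bounds \<delta> less_imp_le)+
        then show ?thesis using bump_bounds[of "(s - (-2)) / 1"] unfolding \<psi>'_def C_def by linarith
      qed
      show "-2 \<le> s \<and> s \<le> t + \<delta> n" if "\<psi> s \<noteq> 0" for s
      proof (rule ccontr)
        assume "\<not> (-2 \<le> s \<and> s \<le> t + \<delta> n)"
        then consider "s < -2" | "t + \<delta> n < s" by linarith
        then have "\<psi> s = 0"
        proof cases
          case 1
          then have "(s - (-2)) / 1 \<le> 0" "(s - t) / \<delta> n \<le> 0" using t \<delta>[of n] by (auto intro!: divide_nonpos_pos)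
          then show ?thesis by (simp only: \<psi>_def smoothstep_0)
        next
          case 2
          then have "1 \<le> (s - (-2)) / 1" "1 \<le> (s - t) / \<delta> n" using t \<delta>[of n] by (auto simp: le_divide_eq)
          then show ?thesis by (simp only: \<psi>_def smoothstep_1)
        qed
        then show False using that by simp
      qed
    qed
    moreover have "\<psi> 0 = 1"
      using t \<delta>[of n] by (simp add: \<psi>_def smoothstep_1 smoothstep_0 divide_nonpos_pos)
    moreover have "indicator {0<..<T} s * \<psi>' s * f s = - (f s * (bump ((s - t) / \<delta> n) / \<delta> n))" for s
    proof (cases "s \<in> {0<..<T}")
      case True
      then have "bump ((s - (-2)) / 1) = 0" by (intro bump_zero) auto
      then show ?thesis using True by (simp add: \<psi>'_def)
    next
      case False
      then have "s \<le> t \<or> t + \<delta> n \<le> s" using t n by auto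
      then have "(s - t) / \<delta> n \<le> 0 \<or> 1 \<le> (s - t) / \<delta> n" using \<delta>[of n] by (auto simp: le_divide_eq divide_le_0_iff)
      then show ?thesis using False by (simp add: bump_zero)
    qed
    ultimately show ?thesis by simp
  qed
  obtain B where B: "\<And>s. t \<le> s \<Longrightarrow> s \<le> t + 1 \<Longrightarrow> \<bar>f s\<bar> \<le> B"
    using continuous_interval_bounded[OF cf, of t "t + 1"] by blast
  have "(\<lambda>n. LINT s|lborel. f s * (bump ((s - t) / \<delta> n) / \<delta> n)) \<longlonglongrightarrow> f t"
    unfolding \<delta>_def
  proof (rule bump_average_limit[OF _ _ B])
    show "f \<in> borel_measurable borel" by (rule borel_measurable_continuous_onI[OF cf])
    have "(f \<longlongrightarrow> f t) (at t)" using cf by (simp add: continuous_on_def)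
    then show "(f \<longlongrightarrow> f t) (at_right t)" by (rule filterlim_mono) (auto simp: at_le)
  qed
  moreover have "(\<lambda>n. LINT s|lborel. f s * (bump ((s - t) / \<delta> n) / \<delta> n)) \<longlonglongrightarrow> oint q0 y1 y2"
  proof (rule tendsto_eventually)
    have "\<forall>\<^sub>F n in sequentially. \<delta> n < T - t"
      unfolding \<delta>_def by (rule order_tendstoD(2)[OF LIMSEQ_inverse_real_of_nat]) (use t in simp)
    then show "\<forall>\<^sub>F n in sequentially. (LINT s|lborel. f s * (bump ((s - t) / \<delta> n) / \<delta> n)) = oint q0 y1 y2"
      by eventually_elim (rule id, simp)
  qed
  ultimately have "f t = oint q0 y1 y2" by (rule LIMSEQ_unique)
  then show ?thesis using t by (simp add: f_def cl(2))
qed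

text \<open>Test functions vanish near \<open>T\<close>, so the final time is reached by
  continuity.\<close>

lemma mass_conserved:
  assumes y12: "y1 \<le> y2" and t: "t \<in> {0..T}"
  shows "mass y1 y2 t = oint q0 y1 y2"
proof -
  have cl: "closure {0..<T} = {0..T}" using T by simp
  show ?thesis
    by (rule continuous_constant_on_closure[of "{0..<T}"])
      (use mass_continuous[OF y12] mass_conserved_interior[OF y12] t cl in auto)
qed

text \<open>Every interval at time \<open>t\<close> lies between two characteristics. Conservation
  of mass and the change of variables by \<open>b t\<close> therefore give equal integrals over all
  intervals.\<close>

lemma density_formula:
  assumes t: "t \<in> {0..T}"
  shows "AE x in lborel. qr t x = dens (b t) x * q0 (inv (b t) x)"
proof -
  note bt = bl[OF t]
  note ib = bilip_inv_simps[OF bt]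
  have [measurable]: "inv (b t) \<in> borel_measurable borel" by (rule bilip_borel[OF bilip_inv[OF bt]])
  have [measurable]: "dens (b t) \<in> borel_measurable borel" by (rule dens_measurable[OF bt])
  obtain D where D: "\<And>x. 0 \<le> dens (b t) x" "\<And>x. dens (b t) x \<le> D" using dens_bounded[OF bt] by blast
  show ?thesis
  proof (rule oint_eq_AE_eq[OF qr_meas qr_bound])
    show "(\<lambda>x. dens (b t) x * q0 (inv (b t) x)) \<in> borel_measurable borel" by measurable
    show "\<bar>dens (b t) x * q0 (inv (b t) x)\<bar> \<le> D * N" for x
      unfolding abs_mult using D[of x] by (intro mult_mono q0_bound) auto
    fix p r :: real assume pr: "p \<le> r"
    define y1 where "y1 = inv (b t) p"
    define y2 where "y2 = inv (b t) r"
    have y: "b t y1 = p" "b t y2 = r" by (simp_all add: y1_def y2_def ib)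
    have y12: "y1 \<le> y2" using bilip_leq[OF bt, of y1 y2] pr y by simp
    have "oint (qr t) p r = oint q0 y1 y2" using mass_conserved[OF y12 t] by (simp add: mass_def y)
    also have "\<dots> = (LINT y|lborel. indicator {p..r} (b t y) * q0 (inv (b t) (b t y)))"
      unfolding oint_le[OF y12] set_lebesgue_integral_def real_scaleR_def
      using bilip_leq[OF bt, of y1] bilip_leq[OF bt, of _ y2]
      by (intro Bochner_Integration.integral_cong) (auto simp: ib y indicator_def)
    also have "\<dots> = (LINT x|lborel. dens (b t) x * (indicator {p..r} x * q0 (inv (b t) x)))"
      by (rule dens_cov[OF bt, of "\<lambda>x. indicator {p..r} x * q0 (inv (b t) x)"]) measurable
    also have "\<dots> = oint (\<lambda>x. dens (b t) x * q0 (inv (b t) x)) p r"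
      unfolding oint_le[OF pr] set_lebesgue_integral_def real_scaleR_def by (simp add: ac_simps)
    finally show "oint (qr t) p r = oint (\<lambda>x. dens (b t) x * q0 (inv (b t) x)) p r" .
  qed
qed

text \<open>With the density known, the change of variables turns the convolution of
  \<open>\<gamma>\<close> with \<open>qr s\<close> into \<open>W q0 (b s)\<close>. The flow of an
  arbitrary weak solution thus obeys a closed equation that no longer mentions the solution.\<close>

lemma velocity_formula:
  assumes s: "s \<in> {0..T}"
  shows "\<beta> y s = V (W q0 (b s) (b s y))"
proof -
  note bs = bl[OF s]
  have [measurable]: "inv (b s) \<in> borel_measurable borel" by (rule bilip_borel[OF bilip_inv[OF bs]])
  have [measurable]: "dens (b s) \<in> borel_measurable borel" by (rule dens_measurable[OF bs])
  have "W (qr s) (\<lambda>y. y) x = W q0 (b s) x" for x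
  proof -
    have "W q0 (b s) x = (LINT y|lborel. \<gamma> (x - b s y) * q0 (inv (b s) (b s y)))"
      by (simp add: W_def bilip_inv_simps[OF bs])
    also have "\<dots> = (LINT z|lborel. dens (b s) z * (\<gamma> (x - z) * q0 (inv (b s) z)))"
      by (rule dens_cov[OF bs, of "\<lambda>z. \<gamma> (x - z) * q0 (inv (b s) z)"]) measurable
    also have "\<dots> = W (qr s) (\<lambda>y. y) x"
      unfolding W_def
      by (rule integral_cong_AE) (measurable, use density_formula[OF s] in eventually_elim, simp)
    finally show ?thesis by simp
  qed
  then show ?thesis by (simp add: \<beta>V wc_def wq_def cl(2)[OF s])
qed

end

section \<open>Uniqueness of weak solutions\<close>

context nonlocal_data
begin

text \<open>Chooses the representatives \<open>qr\<close> and \<open>qh\<close> of an arbitrary weak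
  solution under one common bound, and passes on only what a comparison of two solutions uses: the
  flow, its closed equation and the density.\<close>

lemma weak_solution_flow:
  assumes T: "0 < T" and weak: "is_weak_solution qo go V vo T q"
  obtains c L b \<beta> where "\<And>t. t \<in> {0..T} \<Longrightarrow> bilip c L (b t)" "\<And>y. loc_int (\<beta> y)"
    "\<And>t y. t \<in> {0..T} \<Longrightarrow> F (b t y) = F y + oint (\<beta> y) 0 t"
    "\<And>y. AE s in lborel. 0 < s \<and> s < T \<longrightarrow> \<beta> y s = V (W q0 (b s) (b s y))"
    "\<And>t. t \<in> {0..T} \<Longrightarrow> AE x in lborel. q t x = dens (b t) x * q0 (inv (b t) x)"
proof -
  let ?S = "{0<..<T} \<times> (UNIV :: real set)"
  have L1: "q \<in> C_L1_loc T" and Li: "case_prod q \<in> Linfty ?S"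
    using weak by (auto simp: is_weak_solution_def Linfty_Linfty_def)
  from Li obtain C where C: "AE z in lebesgue_on ?S. \<bar>case_prod q z\<bar> \<le> C"
    and qm: "case_prod q \<in> borel_measurable (lebesgue_on ?S)" by (auto simp: Linfty_def)
  define B where "B = max 0 C"
  have B0: "0 \<le> B" by (simp add: B_def)
  have B: "AE z in lborel. z \<in> ?S \<longrightarrow> \<bar>case_prod q z\<bar> \<le> B"
    using C unfolding AE_lebesgue_on_iff[OF strip_borel] by eventually_elim (auto simp: B_def)
  have "AE t in lborel. AE x in lborel. (t, x) \<in> ?S \<longrightarrow> \<bar>case_prod q (t, x)\<bar> \<le> B" by (rule AE_prodD(1)[OF B])
  then have Bs: "AE s in lborel. 0 < s \<and> s < T \<longrightarrow> (AE x in lborel. \<bar>q s x\<bar> \<le> B)"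
  proof eventually_elim
    case (elim s)
    then show ?case by (cases "0 < s \<and> s < T") auto
  qed
  have "\<exists>g. g \<in> borel_measurable borel \<and> (\<forall>x. \<bar>g x\<bar> \<le> B) \<and> (t \<in> {0..T} \<longrightarrow> (AE x in lborel. q t x = g x))" for t
  proof (cases "t \<in> {0..T}")
    case True
    have m: "q t \<in> borel_measurable lebesgue" by (rule L1_loc_measurable) (use L1 True in \<open>simp add: C_L1_loc_def\<close>)
    have b: "AE x in lborel. x \<in> UNIV \<longrightarrow> \<bar>q t x\<bar> \<le> B" using Linfty_uniform_bound[OF T L1 Bs True] by simp
    obtain g where "g \<in> borel_measurable borel" "\<And>x. \<bar>g x\<bar> \<le> B" "AE x in lborel. x \<in> UNIV \<longrightarrow> q t x = g x"
      by (rule bounded_rep[OF m b B0]) (rule that)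
    then show ?thesis by auto
  next
    case False
    \<comment> \<open>A default slice outside \<open>[0, T]\<close>, so that \<open>qr\<close> is
      Borel and bounded at all times.\<close>
    then show ?thesis using B0 by (intro exI[of _ "\<lambda>_. 0"]) auto
  qed
  then obtain qr where qr: "\<And>t. qr t \<in> borel_measurable borel" "\<And>t x. \<bar>qr t x\<bar> \<le> B"
    "\<And>t. t \<in> {0..T} \<Longrightarrow> AE x in lborel. q t x = qr t x" by metis
  have m: "(\<lambda>z. indicator ?S z *\<^sub>R case_prod q z) \<in> borel_measurable lebesgue"
    using qm strip_borel[of T] by (subst (asm) borel_measurable_restrict_space_iff) auto
  have b: "AE z in lborel. z \<in> ?S \<longrightarrow> \<bar>indicator ?S z *\<^sub>R case_prod q z\<bar> \<le> B"
    using B by eventually_elim auto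
  obtain qh where qh: "qh \<in> borel_measurable borel" "\<And>z. \<bar>qh z\<bar> \<le> B"
    "AE z in lborel. z \<in> ?S \<longrightarrow> indicator ?S z *\<^sub>R case_prod q z = qh z"
    by (rule bounded_rep[OF m b B0]) (rule that)
  have qqh: "AE z in lborel. z \<in> ?S \<longrightarrow> case_prod q z = qh z" using qh(3) by eventually_elim auto
  interpret nonlocal_weak vl vu N K q0 \<gamma> V v qo go vo T B q qr qh
    by unfold_locales (use T weak qr qh(1,2) qqh in \<open>simp_all add: borel_prod\<close>)
  obtain c L M b' \<beta> where fl: "\<And>t. t \<in> {0..T} \<Longrightarrow> bilip c L (b' t)" "\<And>y. continuous_on UNIV (\<beta> y)"
    "\<And>t y. t \<in> {0..T} \<Longrightarrow> F (b' t y) = F y + oint (\<beta> y) 0 t"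
    "\<And>s y. \<beta> y s = V (wc s (b' s y))" "\<And>s y. \<bar>\<beta> y s\<bar> \<le> M"
    by (rule flow_of_weak) (rule that)
  interpret nonlocal_weak_flow vl vu N K q0 \<gamma> V v qo go vo T B q qr qh c L M b' \<beta>
    by unfold_locales (rule fl; assumption?)+
  show thesis
  proof (rule that[of c L b' \<beta>, OF fl(1) loc_int_continuous[OF fl(2)] fl(3)])
    show "AE s in lborel. 0 < s \<and> s < T \<longrightarrow> \<beta> y s = V (W q0 (b' s) (b' s y))" for y
      using velocity_formula[of _ y] by (intro AE_I2) auto
    show "AE x in lborel. q t x = dens (b' t) x * q0 (inv (b' t) x)" if "t \<in> {0..T}" for t
      using qr(3)[OF that] density_formula[OF that] by eventually_elim simp
  qed
qed

text \<open>Both flows solve the same closed equation. Merged constants put them into one class,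
  \<open>flow_unique\<close> identifies them, and the density formula determines the solution from
  the flow at every time.\<close>

lemma weak_solution_unique:
  assumes T: "0 < T" and q: "is_weak_solution qo go V vo T q" and q': "is_weak_solution qo go V vo T q'"
    and t: "t \<in> {0..T}"
  shows "AE x in lborel. q' t x = q t x"
proof -
  obtain c L b \<beta> where b: "\<And>t. t \<in> {0..T} \<Longrightarrow> bilip c L (b t)" "\<And>y. loc_int (\<beta> y)"
    "\<And>t y. t \<in> {0..T} \<Longrightarrow> F (b t y) = F y + oint (\<beta> y) 0 t"
    "\<And>y. AE s in lborel. 0 < s \<and> s < T \<longrightarrow> \<beta> y s = V (W q0 (b s) (b s y))"
    "\<And>t. t \<in> {0..T} \<Longrightarrow> AE x in lborel. q t x = dens (b t) x * q0 (inv (b t) x)"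
    by (rule weak_solution_flow[OF T q]) (rule that)
  obtain c' L' b' \<beta>' where b': "\<And>t. t \<in> {0..T} \<Longrightarrow> bilip c' L' (b' t)" "\<And>y. loc_int (\<beta>' y)"
    "\<And>t y. t \<in> {0..T} \<Longrightarrow> F (b' t y) = F y + oint (\<beta>' y) 0 t"
    "\<And>y. AE s in lborel. 0 < s \<and> s < T \<longrightarrow> \<beta>' y s = V (W q0 (b' s) (b' s y))"
    "\<And>t. t \<in> {0..T} \<Longrightarrow> AE x in lborel. q' t x = dens (b' t) x * q0 (inv (b' t) x)"
    by (rule weak_solution_flow[OF T q']) (rule that)
  have "0 < c" "0 < c'" using b(1)[OF t] b'(1)[OF t] by (auto dest: bilip_pos(1))
  then have m: "0 < min c c'" by simp
  have bb: "bilip (min c c') (max L L') (b s)" "bilip (min c c') (max L L') (b' s)" if "s \<in> {0..T}" for s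
    using bilip_weaken[OF b(1)[OF that] m] bilip_weaken[OF b'(1)[OF that] m] by auto
  have "b t y = b' t y" for y
    by (rule flow_unique[OF less_imp_le[OF T] bb b(2) b'(2) b(3) b'(3) b(4) b'(4) t])
  then have bb': "b t = b' t" by (rule ext)
  show ?thesis using b(5)[OF t] b'(5)[OF t] by eventually_elim (simp add: bb')
qed

end

section \<open>Existence and uniqueness\<close>

text \<open>Converts the distributional variation into the translation form required of the kernel;
  the constant is the total variation itself.\<close>

lemma total_variation_translation:
  assumes f: "f \<in> BV_nonneg" and g: "g \<in> borel_measurable borel" "AE x in lborel. f x = g x"
  obtains K where "\<And>h. h > 0 \<Longrightarrow> (LINT x|lborel. \<bar>g (x + h) - g x\<bar>) \<le> K * h"
proof -
  have gi: "integrable lborel g" using f LINT_lebesgue_rep(2)[OF g] by (simp add: BV_nonneg_def)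
  have fin: "total_variation f < \<infinity>" using f by (simp add: BV_nonneg_def)
  define K where "K = real_of_ereal (total_variation f)"
  have "(LINT x|lborel. g x * deriv \<phi> x) \<le> K" if \<phi>: "\<phi> \<in> C1_compact_support UNIV" "\<And>x. \<bar>\<phi> x\<bar> \<le> 1" for \<phi>
  proof -
    obtain \<phi>' where d: "\<And>z. (\<phi> has_derivative blinfun_apply (\<phi>' z)) (at z)" and c: "continuous_on UNIV \<phi>'"
      using \<phi>(1) unfolding C1_compact_support_def by blast
    have "deriv \<phi> x = blinfun_apply (\<phi>' x) 1" for x
      using has_derivative_imp_has_field_derivative[OF d[of x], of "blinfun_apply (\<phi>' x) 1"]
      by (intro DERIV_imp_deriv) (metis blinfun.bounded_linear_right linear_simps(5) mult.commute mult.right_neutral real_scaleR_def)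
    then have "continuous_on UNIV (deriv \<phi>)" using c by (simp add: continuous_intros cong: continuous_on_cong)
    then have [measurable]: "deriv \<phi> \<in> borel_measurable borel" by (rule borel_measurable_continuous_onI)
    have "(LINT x|lebesgue. f x * deriv \<phi> x) = (LINT x|lborel. g x * deriv \<phi> x)"
      by (rule LINT_lebesgue_rep(1)) (use g in \<open>auto elim: eventually_mono\<close>)
    moreover have "ereal (LINT x|lebesgue. f x * deriv \<phi> x) \<le> total_variation f"
      unfolding total_variation_def by (rule SUP_upper) (use \<phi> in auto)
    ultimately have le: "ereal (LINT x|lborel. g x * deriv \<phi> x) \<le> total_variation f" by simp
    \<comment> \<open>The remaining infinite value has to be excluded for
      \<open>real_of_ereal\<close> to be faithful.\<close>
    then have "total_variation f \<noteq> - \<infinity>" by auto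
    then have "total_variation f = ereal K" using fin by (cases "total_variation f") (auto simp: K_def)
    then show ?thesis using le by simp
  qed
  from translation_estimate[OF gi _ this] show ?thesis by (intro that) auto
qed

theorem theorem3p1:
  fixes v_low :: real and q\<^sub>0 \<gamma> V v :: "real \<Rightarrow> real"
  assumes "v_low > 0"
    and "q\<^sub>0 \<in> Linfty UNIV"
    and "\<gamma> \<in> BV_nonneg"
    and "V \<in> W1infty_loc"
    and "v \<in> Linfty UNIV" and "AE x in lebesgue. v_low \<le> v x"
  shows "\<exists>T>0. \<exists>q w \<xi>.
    is_weak_solution q\<^sub>0 \<gamma> V v T q \<and>
    (\<forall>q'. is_weak_solution q\<^sub>0 \<gamma> V v T q' \<longrightarrow>
       (\<forall>t\<in>{0..T}. AE x in lebesgue. q' t x = q t x)) \<and>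
    is_fixed_point q\<^sub>0 \<gamma> V v T w \<xi> \<and>
    (\<forall>w' \<xi>'. is_fixed_point q\<^sub>0 \<gamma> V v T w' \<xi>' \<longrightarrow>
       (AE (t, x) in lebesgue_on ({0<..<T} \<times> UNIV). w' t x = w t x)) \<and>
    (\<forall>t\<in>{0..T}. \<forall>x \<eta>. is_characteristic V v T w t x \<eta> \<longrightarrow>
       (\<forall>\<tau>\<in>{0..T}. \<eta> \<tau> = \<xi> t x \<tau>)) \<and>
    (\<forall>t\<in>{0<..<T}. AE x in lebesgue.
       (\<lambda>y. \<xi> t y 0) differentiable (at x) \<and>
       q t x = q\<^sub>0 (\<xi> t x 0) * deriv (\<lambda>y. \<xi> t y 0) x)"
proof -
  have rep: "\<exists>g B. g \<in> borel_measurable borel \<and> (\<forall>x. \<bar>g x\<bar> \<le> B) \<and> (AE x in lborel. f x = g x)"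
    if "f \<in> Linfty UNIV" for f :: "real \<Rightarrow> real"
  proof -
    from that obtain C where m: "f \<in> borel_measurable lebesgue" and C: "AE x in lborel. \<bar>f x\<bar> \<le> C"
      unfolding Linfty_def lebesgue_on_UNIV_eq AE_lebesgue_lborel by blast
    have b: "AE x in lborel. x \<in> UNIV \<longrightarrow> \<bar>f x\<bar> \<le> max 0 C" using C by eventually_elim auto
    obtain g where "g \<in> borel_measurable borel" "\<And>x. \<bar>g x\<bar> \<le> max 0 C" "AE x in lborel. x \<in> UNIV \<longrightarrow> f x = g x"
      by (rule bounded_rep[OF m b]) (auto intro: that)
    then show ?thesis by (intro exI[of _ g] exI[of _ "max 0 C"]) auto
  qed
  obtain Q N where Q: "Q \<in> borel_measurable borel" "\<And>x. \<bar>Q x\<bar> \<le> N" "AE x in lborel. q\<^sub>0 x = Q x"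
    using rep[OF assms(2)] by blast
  obtain u B where u: "u \<in> borel_measurable borel" "\<And>x. \<bar>u x\<bar> \<le> B" "AE x in lborel. v x = u x"
    using rep[OF assms(5)] by blast
  \<comment> \<open>The maximum makes the lower bound hold at every point while altering
    \<open>v\<close> on a null set only.\<close>
  define v' where "v' x = max v_low (u x)" for x
  have v': "v' \<in> borel_measurable borel" "\<And>x. v_low \<le> v' x" "\<And>x. v' x \<le> max v_low B"
    using u(1) u(2) unfolding v'_def[abs_def] by (auto simp: abs_le_iff intro: max.coboundedI2 order_trans)
  have vv': "AE x in lborel. v x = v' x"
    using u(3) assms(6)[unfolded AE_lebesgue_lborel] by eventually_elim (simp add: v'_def)
  have \<gamma>i: "integrable lebesgue \<gamma>" using assms(3) by (simp add: BV_nonneg_def)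
  obtain g where g: "g \<in> borel_measurable borel" "AE x in lborel. \<gamma> x = g x"
    by (rule lebesgue_rep[OF borel_measurable_integrable[OF \<gamma>i]])
  have gi: "integrable lborel g" using \<gamma>i LINT_lebesgue_rep(2)[OF g] by simp
  obtain K where K: "\<And>h. h > 0 \<Longrightarrow> (LINT x|lborel. \<bar>g (x + h) - g x\<bar>) \<le> K * h"
    by (rule total_variation_translation[OF assms(3) g]) (rule that)
  interpret nonlocal_data v_low "max v_low B" N K Q g V v' q\<^sub>0 \<gamma> v
    by unfold_locales (use assms(1) v' Q gi K W1infty_loc_lipschitz[OF assms(4)] g(2) vv' in auto)
  obtain T c L B' a where fl: "0 < T" "\<And>t. bilip c L (a t)" "\<And>s t y. \<bar>a t y - a s y\<bar> \<le> B' * \<bar>t - s\<bar>"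
    "\<And>t y. t \<in> {0..T} \<Longrightarrow> F (a t y) = F y + oint (\<lambda>s. V (W Q (a s) (a s y))) 0 t"
    by (rule flow_exists) (rule that)
  interpret nonlocal_flow v_low "max v_low B" N K Q g V v' q\<^sub>0 \<gamma> v T c L B' a
    by unfold_locales (rule fl; assumption?)+
  show ?thesis
  proof (rule exI[of _ T], rule conjI[OF fl(1)], rule exI[of _ sol], rule exI[of _ w], rule exI[of _ xi],
      intro conjI sol_is_weak_solution w_fixed_point)
    show "\<forall>q'. is_weak_solution q\<^sub>0 \<gamma> V v T q' \<longrightarrow> (\<forall>t\<in>{0..T}. AE x in lebesgue. q' t x = sol t x)"
      using weak_solution_unique[OF fl(1) sol_is_weak_solution] by (simp add: AE_lebesgue_lborel)
    show "\<forall>w' \<xi>'. is_fixed_point q\<^sub>0 \<gamma> V v T w' \<xi>' \<longrightarrow> (AE (t, x) in lebesgue_on ({0<..<T} \<times> UNIV). w' t x = w t x)"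
      using fixed_point_unique by blast
    show "\<forall>t\<in>{0..T}. \<forall>x \<eta>. is_characteristic V v T w t x \<eta> \<longrightarrow> (\<forall>\<tau>\<in>{0..T}. \<eta> \<tau> = xi t x \<tau>)"
      using xi_unique by blast
    show "\<forall>t\<in>{0<..<T}. AE x in lebesgue. (\<lambda>y. xi t y 0) differentiable (at x) \<and>
       sol t x = q\<^sub>0 (xi t x 0) * deriv (\<lambda>y. xi t y 0) x"
      using sol_formula by blast
  qed
qed

end
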